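(* Assume that $\mathcal A(\cdot)\in\mathscr L^1_{\mathbb F}(L^2(\Omega;\mathbb R^n))$, $\mathcal B(\cdot)\in\mathscr L^2_{\mathbb F}(L^2(\Omega;\mathbb R^m);L^2(\Omega;\mathbb R^n))$, $\mathcal C(\cdot)\in\mathscr L^2_{\mathbb F}(L^2(\Omega;\mathbb R^n))$, $\mathcal D(\cdot)\in\mathscr L^\infty_{\mathbb F}(L^2(\Omega;\mathbb R^m);L^2(\Omega;\mathbb R^n))$, $b(\cdot)\in L^2_{\mathbb F}(\Omega;L^1(0,T;\mathbb R^n))$ and $\sigma(\cdot)\in L^2_{\mathbb F}(0,T;\mathbb R^n)$. Then for any $t\in[0,T]$, any $x\in L^2_{\mathcal F_t}(\Omega;\mathbb R^n)$ and any $u(\cdot)\in\mathcal U[t,T]$, there exists a unique solution $X(\cdot)\in L^2_{\mathbb F}(\Omega;C([t,T];\mathbb R^n))$ to $$\begin{cases} dX(s)=\big[\mathcal A(s)X(s)+\mathcal B(s)u(s)+b(s)\big]ds+\big[\mathcal C(s)X(s)+\mathcal D(s)u(s)+\sigma(s)\big]dW(s),\quad s\in[t,T],\\ X(t)=x,\end{cases}$$ and $$\mathbb E\Big[\sup_{s\in[t,T]}|X(s)|^2\Big]\le K\Big[\|x\|_2^2+\big(\|\mathcal B(\cdot)\|_2^2+\|\mathcal D(\cdot)\|_\infty^2\big)\int_t^T\|u(r)\|_2^2dr+\Big\|\int_t^T|b(r)|dr\Big\|_2^2+\int_t^T\|\sigma(r)\|_2^2dr\Big]$$ for some constant $K>0$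 depending on $\|\mathcal A(\cdot)\|_1$ and $\|\mathcal C(\cdot)\|_2$.
   Context: $(\Omega,\mathcal F,\mathbb F,\mathbb P)$ is a complete filtered probability space carrying a standard one-dimensional Brownian motion $W$; $\mathbb F=\{\mathcal F_t\}_{t\ge0}$ is the natural filtration of $W$ augmented by all $\mathbb P$-null sets; $T>0$ is fixed. For a random vector $\xi$, $\|\xi\|_2=(\mathbb E|\xi|^2)^{1/2}$. Spaces: $L^2_{\mathcal F_t}(\Omega;\mathbb R^n)$ is the space of $\mathcal F_t$-measurable $\xi:\Omega\to\mathbb R^n$ with $\|\xi\|_2<\infty$; $L^2(\Omega;\mathbb R^n)=L^2_{\mathcal F_T}(\Omega;\mathbb R^n)$. $L^2_{\mathbb F}(t,T;\mathbb R^n)$: $\mathbb F$-progressively measurable $\varphi$ on $[t,T]\times\Omega$ with $\mathbb E\int_t^T|\varphi(s)|^2ds<\infty$. $L^2_{\mathbb F}(\Omega;L^1(t,T;\mathbb R^n))$: $\mathbb F$-progressively measurable $\varphi$ with $\|\int_t^T|\varphi(r)|dr\|_2<\infty$. $L^2_{\mathbb F}(\Omega;C([t,T];\mathbb R^n))$: $\mathbb F$-progressively measurable, a.s. continuous $\varphi$ with $\mathbb E[\sup_{s\in[t,T]}|\varphi(s)|^2]<\infty$. $\mathcal U[t,T]=L^2_{\mathbb F}(t,T;\mathbb R^m)$. Operator-valued processes: $\mathcal B:[0,T]\to\mathscr L(L^2(\Omega;\mathbb R^m);L^2(\Omega;\mathbb R^n))$ (bounded linear operators) is strongly $\mathbb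 F$-progressively measurable if $\mathcal B(s)\in\mathscr L(L^2_{\mathcal F_s}(\Omega;\mathbb R^m);L^2_{\mathcal F_s}(\Omega;\mathbb R^n))$ for all $s\in[0,T]$ and $\mathcal B(\cdot)\eta(\cdot)$ is $\mathbb F$-progressively measurable for every $\eta(\cdot)\in L^2_{\mathbb F}(0,T;\mathbb R^m)$. Let $\|\mathcal B(s)\|$ be the operator norm of $\mathcal B(s)$ on $L^2_{\mathcal F_s}(\Omega;\mathbb R^m)$, and $\|\mathcal B(\cdot)\|_p=(\int_0^T\|\mathcal B(s)\|^pds)^{1/p}$ for $p\in[1,\infty)$, $\|\mathcal B(\cdot)\|_\infty=\operatorname{esssup}_{s\in[0,T]}\|\mathcal B(s)\|$. $\mathscr L^p_{\mathbb F}(L^2(\Omega;\mathbb R^m);L^2(\Omega;\mathbb R^n))$ is the set of strongly $\mathbb F$-progressively measurable $\mathcal B(\cdot)$ with $\|\mathcal B(\cdot)\|_p<\infty$; $\mathscr L^p_{\mathbb F}(L^2(\Omega;\mathbb R^n))$ is the case of equal domain and target. *)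

theory Defs
  imports "HOL-Probability.Probability"
begin

section \<open>Brownian motion and its augmented filtration\<close>

definition standard_brownian_motion :: "'a measure \<Rightarrow> (real \<Rightarrow> 'a \<Rightarrow> real) \<Rightarrow> bool" where
  "standard_brownian_motion M W \<longleftrightarrow>
     (\<forall>t\<ge>0. W t \<in> borel_measurable M) \<and>
     (AE \<omega> in M. W 0 \<omega> = 0) \<and>
     (\<forall>s t. 0 \<le> s \<and> s < t \<longrightarrow>
        distributed M lborel (\<lambda>\<omega>. W t \<omega> - W s \<omega>) (\<lambda>y. ennreal (normal_density 0 (sqrt (t - s)) y))) \<and>
     (\<forall>\<tau> :: nat \<Rightarrow> real. 0 \<le> \<tau> 0 \<and> incseq \<tau> \<longrightarrow>
        prob_space.indep_vars M (\<lambda>_. borel) (\<lambda>i \<omega>. W (\<tau> (Suc i)) \<omega> - W (\<tau> i) \<omega>) UNIV) \<and>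
     (AE \<omega> in M. continuous_on {0..} (\<lambda>t. W t \<omega>))"

text \<open>Only the sigma-algebras of the filtration are used; the measure carried by \<^term>\<open>sigma\<close> is
  irrelevant, and all expectations are taken with respect to \<open>M\<close>.\<close>

definition augmented_filtration :: "'a measure \<Rightarrow> (real \<Rightarrow> 'a \<Rightarrow> real) \<Rightarrow> real \<Rightarrow> 'a measure" where
  "augmented_filtration M W t =
     sigma (space M)
       ({W s -` S \<inter> space M | s S. 0 \<le> s \<and> s \<le> t \<and> S \<in> sets borel} \<union> null_sets M)"

definition brownian_setting ::
  "'a measure \<Rightarrow> (real \<Rightarrow> 'a measure) \<Rightarrow> (real \<Rightarrow> 'a \<Rightarrow> real) \<Rightarrow> bool" where
  "brownian_setting M F W \<longleftrightarrow>
     prob_space M \<and> complete_measure M \<and> standard_brownian_motion M W \<and> F = augmented_filtration M W"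


section \<open>Spaces of random vectors and processes\<close>

text \<open>Elements of the spaces below are functions, not equivalence classes. Integrals that occur in
  membership conditions are taken in \<^typ>\<open>ennreal\<close>, because the Bochner integral of a non-integrable
  function is 0. For the same reason, \<open>norm2 M \<xi>\<close> is meaningful only for square-integrable \<open>\<xi>\<close>.\<close>

definition norm2 :: "'a measure \<Rightarrow> ('a \<Rightarrow> 'b::euclidean_space) \<Rightarrow> real" where
  "norm2 M \<xi> = sqrt (\<integral>\<omega>. (norm (\<xi> \<omega>))\<^sup>2 \<partial>M)"

definition L2 :: "'a measure \<Rightarrow> 'a measure \<Rightarrow> ('a \<Rightarrow> 'b::euclidean_space) set" where
  "L2 M G = {\<xi> \<in> borel_measurable G. integrable M (\<lambda>\<omega>. (norm (\<xi> \<omega>))\<^sup>2)}"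

definition progressive ::
  "(real \<Rightarrow> 'a measure) \<Rightarrow> real \<Rightarrow> real \<Rightarrow> (real \<Rightarrow> 'a \<Rightarrow> 'b::euclidean_space) \<Rightarrow> bool" where
  "progressive F t T \<phi> \<longleftrightarrow>
     (\<forall>r\<in>{t..T}. (\<lambda>(s, \<omega>). \<phi> s \<omega>) \<in> borel_measurable (restrict_space borel {t..r} \<Otimes>\<^sub>M F r))"

definition L2_proc ::
  "'a measure \<Rightarrow> (real \<Rightarrow> 'a measure) \<Rightarrow> real \<Rightarrow> real \<Rightarrow> (real \<Rightarrow> 'a \<Rightarrow> 'b::euclidean_space) set" where
  "L2_proc M F t T = {\<phi>. progressive F t T \<phi> \<and>
     (\<integral>\<^sup>+\<omega>. (\<integral>\<^sup>+s\<in>{t..T}. ennreal ((norm (\<phi> s \<omega>))\<^sup>2) \<partial>lborel) \<partial>M) < \<infinity>}"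

definition L2_L1_proc ::
  "'a measure \<Rightarrow> (real \<Rightarrow> 'a measure) \<Rightarrow> real \<Rightarrow> real \<Rightarrow> (real \<Rightarrow> 'a \<Rightarrow> 'b::euclidean_space) set" where
  "L2_L1_proc M F t T = {\<phi>. progressive F t T \<phi> \<and>
     (\<integral>\<^sup>+\<omega>. (\<integral>\<^sup>+s\<in>{t..T}. ennreal (norm (\<phi> s \<omega>)) \<partial>lborel)\<^sup>2 \<partial>M) < \<infinity>}"

definition sup_sq_expectation ::
  "'a measure \<Rightarrow> real \<Rightarrow> real \<Rightarrow> (real \<Rightarrow> 'a \<Rightarrow> 'b::euclidean_space) \<Rightarrow> ennreal" where
  "sup_sq_expectation M t T \<phi> = (\<integral>\<^sup>+\<omega>. (SUP s\<in>{t..T}. ennreal ((norm (\<phi> s \<omega>))\<^sup>2)) \<partial>M)"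

definition L2_C_proc ::
  "'a measure \<Rightarrow> (real \<Rightarrow> 'a measure) \<Rightarrow> real \<Rightarrow> real \<Rightarrow> (real \<Rightarrow> 'a \<Rightarrow> 'b::euclidean_space) set" where
  "L2_C_proc M F t T = {\<phi>. progressive F t T \<phi> \<and>
     (AE \<omega> in M. continuous_on {t..T} (\<lambda>s. \<phi> s \<omega>)) \<and> sup_sq_expectation M t T \<phi> < \<infinity>}"


section \<open>Operator-valued processes\<close>

text \<open>A bounded linear operator between the spaces of equivalence classes is represented by a
  function on representatives which respects almost sure equality and has the defining properties
  almost surely. Its values outside \<open>L2 M G\<close> are irrelevant.\<close>

definition L2_operator ::
  "'a measure \<Rightarrow> 'a measure \<Rightarrow> (('a \<Rightarrow> 'b::euclidean_space) \<Rightarrow> 'a \<Rightarrow> 'c::euclidean_space) \<Rightarrow> bool" where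
  "L2_operator M G L \<longleftrightarrow>
     (\<forall>\<xi>\<in>L2 M G. L \<xi> \<in> L2 M G) \<and>
     (\<forall>\<xi>\<in>L2 M G. \<forall>\<eta>\<in>L2 M G. (AE \<omega> in M. \<xi> \<omega> = \<eta> \<omega>) \<longrightarrow> (AE \<omega> in M. L \<xi> \<omega> = L \<eta> \<omega>)) \<and>
     (\<forall>\<xi>\<in>L2 M G. \<forall>\<eta>\<in>L2 M G. AE \<omega> in M. L (\<lambda>\<omega>. \<xi> \<omega> + \<eta> \<omega>) \<omega> = L \<xi> \<omega> + L \<eta> \<omega>) \<and>
     (\<forall>\<xi>\<in>L2 M G. \<forall>c::real. AE \<omega> in M. L (\<lambda>\<omega>. c *\<^sub>R \<xi> \<omega>) \<omega> = c *\<^sub>R L \<xi> \<omega>) \<and>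
     (\<exists>K. \<forall>\<xi>\<in>L2 M G. norm2 M (L \<xi>) \<le> K * norm2 M \<xi>)"

definition L2_onorm ::
  "'a measure \<Rightarrow> 'a measure \<Rightarrow> (('a \<Rightarrow> 'b::euclidean_space) \<Rightarrow> 'a \<Rightarrow> 'c::euclidean_space) \<Rightarrow> real" where
  "L2_onorm M G L = (SUP \<xi>\<in>{\<xi> \<in> L2 M G. norm2 M \<xi> \<le> 1}. norm2 M (L \<xi>))"

text \<open>As \<open>\<B> s (\<eta> s)\<close> is determined only up to almost sure equality, and only for those (almost all)
  \<open>s\<close> at which \<open>\<eta> s\<close> is square integrable, progressive measurability of \<open>s \<mapsto> \<B> s (\<eta> s)\<close> means
  that it has a progressively measurable version.\<close>

definition strongly_progressive ::
  "'a measure \<Rightarrow> (real \<Rightarrow> 'a measure) \<Rightarrow> real \<Rightarrow>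
   (real \<Rightarrow> ('a \<Rightarrow> 'b::euclidean_space) \<Rightarrow> 'a \<Rightarrow> 'c::euclidean_space) \<Rightarrow> bool" where
  "strongly_progressive M F T \<B> \<longleftrightarrow>
     (\<forall>s\<in>{0..T}. L2_operator M (F T) (\<B> s) \<and> L2_operator M (F s) (\<B> s)) \<and>
     (\<forall>\<eta>\<in>L2_proc M F 0 T. \<exists>\<zeta>. progressive F 0 T \<zeta> \<and>
        (AE s in lborel. s \<in> {0..T} \<longrightarrow> (AE \<omega> in M. \<zeta> s \<omega> = \<B> s (\<eta> s) \<omega>)))"

definition op_norm_p ::
  "'a measure \<Rightarrow> (real \<Rightarrow> 'a measure) \<Rightarrow> real \<Rightarrow> real \<Rightarrow>
   (real \<Rightarrow> ('a \<Rightarrow> 'b::euclidean_space) \<Rightarrow> 'a \<Rightarrow> 'c::euclidean_space) \<Rightarrow> real" where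
  "op_norm_p M F T p \<B> =
     (\<integral>s. L2_onorm M (F s) (\<B> s) powr p \<partial>lebesgue_on {0..T}) powr (1 / p)"

definition op_esssup ::
  "'a measure \<Rightarrow> (real \<Rightarrow> 'a measure) \<Rightarrow> real \<Rightarrow>
   (real \<Rightarrow> ('a \<Rightarrow> 'b::euclidean_space) \<Rightarrow> 'a \<Rightarrow> 'c::euclidean_space) \<Rightarrow> ereal" where
  "op_esssup M F T \<B> = esssup (lebesgue_on {0..T}) (\<lambda>s. ereal (L2_onorm M (F s) (\<B> s)))"

definition op_norm_inf ::
  "'a measure \<Rightarrow> (real \<Rightarrow> 'a measure) \<Rightarrow> real \<Rightarrow>
   (real \<Rightarrow> ('a \<Rightarrow> 'b::euclidean_space) \<Rightarrow> 'a \<Rightarrow> 'c::euclidean_space) \<Rightarrow> real" where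
  "op_norm_inf M F T \<B> = real_of_ereal (op_esssup M F T \<B>)"

definition op_Lp ::
  "'a measure \<Rightarrow> (real \<Rightarrow> 'a measure) \<Rightarrow> real \<Rightarrow> real \<Rightarrow>
   (real \<Rightarrow> ('a \<Rightarrow> 'b::euclidean_space) \<Rightarrow> 'a \<Rightarrow> 'c::euclidean_space) set" where
  "op_Lp M F T p = {\<B>. strongly_progressive M F T \<B> \<and>
     integrable (lebesgue_on {0..T}) (\<lambda>s. L2_onorm M (F s) (\<B> s) powr p)}"

definition op_Linf ::
  "'a measure \<Rightarrow> (real \<Rightarrow> 'a measure) \<Rightarrow> real \<Rightarrow>
   (real \<Rightarrow> ('a \<Rightarrow> 'b::euclidean_space) \<Rightarrow> 'a \<Rightarrow> 'c::euclidean_space) set" where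
  "op_Linf M F T = {\<B>. strongly_progressive M F T \<B> \<and> op_esssup M F T \<B> < \<infinity>}"


section \<open>The Ito integral\<close>

text \<open>A list of triples \<open>(p, q, \<xi>)\<close> represents the elementary integrand that is the sum of the
  processes \<open>\<xi> 1\<^bsub>(p, q]\<^esub>\<close>. The intervals may overlap, so that elementary integrands are closed
  under addition.\<close>

definition elementary ::
  "'a measure \<Rightarrow> (real \<Rightarrow> 'a measure) \<Rightarrow> real \<Rightarrow> real \<Rightarrow>
   (real \<times> real \<times> ('a \<Rightarrow> 'b::euclidean_space)) list \<Rightarrow> bool" where
  "elementary M F t s es \<longleftrightarrow>
     (\<forall>(p, q, \<xi>) \<in> set es. t \<le> p \<and> p \<le> q \<and> q \<le> s \<and>
        \<xi> \<in> borel_measurable (F p) \<and> (\<exists>c. \<forall>\<omega>\<in>space M. norm (\<xi> \<omega>) \<le> c))"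

definition elementary_process ::
  "(real \<times> real \<times> ('a \<Rightarrow> 'b::euclidean_space)) list \<Rightarrow> real \<Rightarrow> 'a \<Rightarrow> 'b" where
  "elementary_process es r \<omega> = (\<Sum>(p, q, \<xi>)\<leftarrow>es. indicat_real {p<..q} r *\<^sub>R \<xi> \<omega>)"

definition elementary_integral ::
  "(real \<Rightarrow> 'a \<Rightarrow> real) \<Rightarrow> (real \<times> real \<times> ('a \<Rightarrow> 'b::euclidean_space)) list \<Rightarrow> 'a \<Rightarrow> 'b" where
  "elementary_integral W es \<omega> = (\<Sum>(p, q, \<xi>)\<leftarrow>es. (W q \<omega> - W p \<omega>) *\<^sub>R \<xi> \<omega>)"

text \<open>\<open>J\<close> is (a version of) the Ito integral of \<open>\<phi>\<close> over \<open>[t, s]\<close>. By the Ito isometry, the limit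
  \<open>J\<close> exists, is almost surely unique, and does not depend on the approximating sequence.\<close>

definition has_ito_integral ::
  "'a measure \<Rightarrow> (real \<Rightarrow> 'a measure) \<Rightarrow> (real \<Rightarrow> 'a \<Rightarrow> real) \<Rightarrow> real \<Rightarrow> real \<Rightarrow>
   (real \<Rightarrow> 'a \<Rightarrow> 'b::euclidean_space) \<Rightarrow> ('a \<Rightarrow> 'b) \<Rightarrow> bool" where
  "has_ito_integral M F W t s \<phi> J \<longleftrightarrow>
     \<phi> \<in> L2_proc M F t s \<and> J \<in> L2 M (F s) \<and>
     (\<exists>es. (\<forall>k::nat. elementary M F t s (es k)) \<and>
        (\<lambda>k. \<integral>\<^sup>+\<omega>. (\<integral>\<^sup>+r\<in>{t..s}. ennreal ((norm (elementary_process (es k) r \<omega> - \<phi> r \<omega>))\<^sup>2)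
               \<partial>lborel) \<partial>M) \<longlonglongrightarrow> 0 \<and>
        (\<lambda>k. \<integral>\<^sup>+\<omega>. ennreal ((norm (elementary_integral W (es k) \<omega> - J \<omega>))\<^sup>2) \<partial>M) \<longlonglongrightarrow> 0)"

definition ito_integral_process ::
  "'a measure \<Rightarrow> (real \<Rightarrow> 'a measure) \<Rightarrow> (real \<Rightarrow> 'a \<Rightarrow> real) \<Rightarrow> real \<Rightarrow> real \<Rightarrow>
   (real \<Rightarrow> 'a \<Rightarrow> 'b::euclidean_space) \<Rightarrow> (real \<Rightarrow> 'a \<Rightarrow> 'b) \<Rightarrow> bool" where
  "ito_integral_process M F W t T \<phi> I \<longleftrightarrow>
     progressive F t T I \<and> (AE \<omega> in M. continuous_on {t..T} (\<lambda>s. I s \<omega>)) \<and>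
     (\<forall>s\<in>{t..T}. has_ito_integral M F W t s \<phi> (I s))"


section \<open>Solutions of the state equation\<close>

text \<open>\<open>f\<close> and \<open>g\<close> are progressively measurable versions of the drift and of the diffusion
  coefficient along \<open>X\<close>. They are unique up to null sets for the product of Lebesgue measure and
  \<open>M\<close>, and the integrability required of them is automatic for \<open>X\<close> in \<open>L2_C_proc\<close> under the standing
  assumptions on the coefficients and on \<open>u\<close>.\<close>

definition sde_solution ::
  "'a measure \<Rightarrow> (real \<Rightarrow> 'a measure) \<Rightarrow> (real \<Rightarrow> 'a \<Rightarrow> real) \<Rightarrow> real \<Rightarrow>
   (real \<Rightarrow> ('a \<Rightarrow> real^'n) \<Rightarrow> 'a \<Rightarrow> real^'n) \<Rightarrow> (real \<Rightarrow> ('a \<Rightarrow> real^'m) \<Rightarrow> 'a \<Rightarrow> real^'n) \<Rightarrow>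
   (real \<Rightarrow> ('a \<Rightarrow> real^'n) \<Rightarrow> 'a \<Rightarrow> real^'n) \<Rightarrow> (real \<Rightarrow> ('a \<Rightarrow> real^'m) \<Rightarrow> 'a \<Rightarrow> real^'n) \<Rightarrow>
   (real \<Rightarrow> 'a \<Rightarrow> real^'n) \<Rightarrow> (real \<Rightarrow> 'a \<Rightarrow> real^'n) \<Rightarrow>
   real \<Rightarrow> ('a \<Rightarrow> real^'n) \<Rightarrow> (real \<Rightarrow> 'a \<Rightarrow> real^'m) \<Rightarrow> (real \<Rightarrow> 'a \<Rightarrow> real^'n) \<Rightarrow> bool" where
  "sde_solution M F W T \<A> \<B> \<C> \<D> b \<sigma> t x u X \<longleftrightarrow>
     X \<in> L2_C_proc M F t T \<and>
     (\<exists>f g I. f \<in> L2_L1_proc M F t T \<and> g \<in> L2_proc M F t T \<and>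
        (AE s in lborel. s \<in> {t..T} \<longrightarrow>
           (AE \<omega> in M. f s \<omega> = \<A> s (X s) \<omega> + \<B> s (u s) \<omega> + b s \<omega>)) \<and>
        (AE s in lborel. s \<in> {t..T} \<longrightarrow>
           (AE \<omega> in M. g s \<omega> = \<C> s (X s) \<omega> + \<D> s (u s) \<omega> + \<sigma> s \<omega>)) \<and>
        ito_integral_process M F W t T g I \<and>
        (AE \<omega> in M. \<forall>s\<in>{t..T}. X s \<omega> = x \<omega> + (LINT r:{t..s}|lborel. f r \<omega>) + I s \<omega>))"

definition indistinguishable_on ::
  "'a measure \<Rightarrow> real set \<Rightarrow> (real \<Rightarrow> 'a \<Rightarrow> 'b) \<Rightarrow> (real \<Rightarrow> 'a \<Rightarrow> 'b) \<Rightarrow> bool" where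
  "indistinguishable_on M S X Y \<longleftrightarrow> (AE \<omega> in M. \<forall>s\<in>S. X s \<omega> = Y s \<omega>)"

end

theory Submission
  imports Defs
begin

text \<open>The stochastic integral is built from the isometry for elementary integrands. These are dense in
  \<open>L\<^sup>2\<close>: a bounded progressive integrand is approximated by its averages over the preceding block of a
  uniform grid. Doob's inequality, needed only for elementary integrals, gives a continuous version and
  \<open>E sup \<bar>I\<bar>\<^sup>2 \<le> 16 E \<integral> \<bar>g\<bar>\<^sup>2\<close>. For the drift, Cauchy-Schwarz with the weight \<open>a = \<parallel>\<A>\<parallel>\<close> gives
  \<open>E (\<integral> \<bar>\<A> X\<bar>)\<^sup>2 \<le> (\<integral> a) \<integral> a E \<bar>X\<bar>\<^sup>2\<close>. Hence two images \<open>Y, Y'\<close> of \<open>X, X'\<close> under the Picard map satisfy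
  \<open>E sup\<^bsub>[t,s]\<^esub> \<bar>Y - Y'\<bar>\<^sup>2 \<le> \<integral>\<^bsub>[t,s]\<^esub> h(r) E \<bar>X\<^sub>r - X'\<^sub>r\<bar>\<^sup>2 dr\<close> with
  \<open>h = 2 \<parallel>\<A>\<parallel>\<^sub>1 a + 32 \<parallel>\<C>\<parallel>\<^sup>2\<close>, a contraction in a norm whose weight grows exponentially in
  \<open>\<integral> h \<le> 2 \<parallel>\<A>\<parallel>\<^sub>1\<^sup>2 + 32 \<parallel>\<C>\<parallel>\<^sub>2\<^sup>2\<close>. The constant \<open>K\<close> is the supremum of that weight times the constant of the
  first Picard step, which involves only the data.\<close>

section \<open>The augmented Brownian filtration\<close>

text \<open>The operators act on whole random variables, so the value of \<open>\<A> s (X s)\<close>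
  at one outcome depends on all of \<open>X s\<close>. There is no pathwise Lipschitz bound and
  nothing to localise by stopping times. What can be estimated is the mean square of
  \<open>X r - X' r\<close> at each single time, and a supremum over time is bounded by a time
  integral of such mean squares. The norms of \<open>\<A>\<close> and \<open>\<C>\<close> are merely
  integrable in time. The length of an interval on which one step contracts depends on how h is
  distributed; a weight that measures time by the mass of h treats the whole interval at once and
  leaves a constant that depends on the norms alone. Squared distances shrink by 1/4 per step, which
  beats the factors \<open>2 ^ Suc i\<close> that squaring a telescoping sum costs. In
  \<open>K\<close>, 512 is 4 * 128: 128 bounds the first Picard step, and 4 is the sum of the
  geometric losses. Second moments are mostly computed in \<open>ennreal\<close>, so that finiteness
  comes out of the estimates. No conditional expectation occurs: the martingale property is
  orthogonality to all square integrable \<open>F s\<close>-measurable vectors.\<close>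

abbreviation msq :: "'a measure \<Rightarrow> ('a \<Rightarrow> 'b::real_normed_vector) \<Rightarrow> ennreal" where
  "msq M f \<equiv> \<integral>\<^sup>+\<omega>. ennreal ((norm (f \<omega>))\<^sup>2) \<partial>M"

lemma has_bochner_integral_sum_list:
  fixes g :: "'x \<Rightarrow> 'a \<Rightarrow> 'b::{banach, second_countable_topology}"
  assumes "\<And>x. x \<in> set xs \<Longrightarrow> has_bochner_integral M (g x) (v x)"
  shows "has_bochner_integral M (\<lambda>\<omega>. \<Sum>x\<leftarrow>xs. g x \<omega>) (\<Sum>x\<leftarrow>xs. v x)"
  using assms by (induction xs) (auto intro!: has_bochner_integral_add)

lemma inner_sum_list_sum_list:
  fixes f :: "'x \<Rightarrow> 'b::real_inner"
  shows "inner (\<Sum>x\<leftarrow>xs. f x) (\<Sum>y\<leftarrow>ys. g y) = (\<Sum>x\<leftarrow>xs. \<Sum>y\<leftarrow>ys. inner (f x) (g y))"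
proof -
  have "inner z (\<Sum>y\<leftarrow>ys. g y) = (\<Sum>y\<leftarrow>ys. inner z (g y))" for z
    by (induction ys) (auto simp: inner_add_right)
  then show ?thesis
    by (induction xs) (auto simp: inner_add_left sum_list_addf)
qed

locale brownian = prob_space M + complete_measure M for M :: "'a measure" +
  fixes W F
  assumes bm: "standard_brownian_motion M W" and filt: "F = augmented_filtration M W"
begin

lemma AE_null_set: assumes "AE \<omega> in M. P \<omega>" shows "{\<omega>\<in>space M. \<not> P \<omega>} \<in> null_sets M"
  using assms complete2 by (auto simp: eventually_ae_filter)

lemma W_measurable[measurable]: "0 \<le> t \<Longrightarrow> W t \<in> borel_measurable M"
  using bm by (auto simp: standard_brownian_motion_def)

lemma W_0: "AE \<omega> in M. W 0 \<omega> = 0"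
  using bm by (auto simp: standard_brownian_motion_def)

lemma W_continuous: "AE \<omega> in M. continuous_on {0..} (\<lambda>t. W t \<omega>)"
  using bm by (auto simp: standard_brownian_motion_def)

abbreviation gen :: "real \<Rightarrow> 'a set set" where
  "gen t \<equiv> {W s -` S \<inter> space M | s S. 0 \<le> s \<and> s \<le> t \<and> S \<in> sets borel} \<union> null_sets M"

lemma gen_sets: "gen t \<subseteq> sets M"
  by (auto intro!: measurable_sets)

lemma gen_Pow: "gen t \<subseteq> Pow (space M)"
  using gen_sets[of t] sets.space_closed by blast

lemma space_F[simp]: "space (F t) = space M"
  using gen_Pow[of t] by (subst filt) (simp add: augmented_filtration_def space_measure_of)

lemma sets_F: "sets (F t) = sigma_sets (space M) (gen t)"
  using gen_Pow[of t] by (subst filt) (simp add: augmented_filtration_def sets_measure_of)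

lemma sets_F_subset: "sets (F t) \<subseteq> sets M"
  unfolding sets_F using gen_sets[of t] by (rule sets.sigma_sets_subset)

lemma sets_F_mono: "s \<le> t \<Longrightarrow> sets (F s) \<subseteq> sets (F t)"
  unfolding sets_F by (rule sigma_sets_mono') (blast intro: order_trans)

lemma measurable_F: "f \<in> measurable (F t) N \<Longrightarrow> f \<in> measurable M N"
  using sets_F_subset[of t] by (auto simp: measurable_def)

lemma measurable_F_mono: "f \<in> measurable (F s) N \<Longrightarrow> s \<le> t \<Longrightarrow> f \<in> measurable (F t) N"
  using sets_F_mono[of s t] by (auto simp: measurable_def)

lemma W_adapted: "0 \<le> s \<Longrightarrow> s \<le> t \<Longrightarrow> W s \<in> borel_measurable (F t)"
  unfolding measurable_def by (auto simp: sets_F intro!: sigma_sets.Basic)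

text \<open>By completeness every subset of the exceptional null set is measurable. A supremum over
  an interval agrees with a countable supremum only almost surely, and this carries measurability
  over.\<close>

lemma measurable_M_AE_cong:
  fixes g :: "'a \<Rightarrow> 'c::topological_space"
  assumes f: "f \<in> borel_measurable M" and ae: "AE \<omega> in M. f \<omega> = g \<omega>"
  shows "g \<in> borel_measurable M"
proof (rule measurableI)
  fix S :: "'c set" assume S: "S \<in> sets borel"
  define N where "N = {\<omega>\<in>space M. f \<omega> \<noteq> g \<omega>}"
  have N: "N \<in> null_sets M" using AE_null_set[OF ae] by (simp add: N_def)
  have "g -` S \<inter> space M = (f -` S \<inter> space M - N) \<union> (g -` S \<inter> N)"
    by (auto simp: N_def)
  moreover have "g -` S \<inter> N \<in> null_sets M" by (rule complete2[OF _ N]) auto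
  ultimately show "g -` S \<inter> space M \<in> sets M"
    using measurable_sets[OF f S] N by (auto intro!: sets.Diff sets.Un)
qed simp

text \<open>Finite-dimensional cylinders are an intersection-stable generator. Events that constrain
  a single time, as in \<open>gen s\<close>, are not closed under intersection, and the passage from
  a generator to its sigma-algebra needs that closure.\<close>

definition cyl :: "real \<Rightarrow> 'a set set" where
  "cyl s = {{\<omega>\<in>space M. \<forall>i\<in>I. W i \<omega> \<in> S i} | I S. finite I \<and> I \<subseteq> {0..s} \<and> (\<forall>i\<in>I. S i \<in> sets (borel::real measure))}"

lemma cyl_sets: "C \<in> cyl s \<Longrightarrow> C \<in> sets M"
proof -
  assume "C \<in> cyl s"
  then obtain I and S :: "real \<Rightarrow> real set" where C: "C = {\<omega>\<in>space M. \<forall>i\<in>I. W i \<omega> \<in> S i}"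
    and IS: "finite I" "I \<subseteq> {0..s}" "\<And>i. i \<in> I \<Longrightarrow> S i \<in> sets borel"
    unfolding cyl_def by auto
  have "{\<omega>\<in>space M. W i \<omega> \<in> S i} \<in> sets M" if "i \<in> I" for i
    using that IS by (intro predE pred_sets1[where N = borel] W_measurable) auto
  then show ?thesis unfolding C using IS by (intro sets.sets_Collect_finite_All) auto
qed

lemma cyl_Int: assumes "A \<in> cyl s" "B \<in> cyl s" shows "A \<inter> B \<in> cyl s"
proof -
  obtain I S where A: "A = {\<omega>\<in>space M. \<forall>i\<in>I. W i \<omega> \<in> S i}" and I: "finite I" "I \<subseteq> {0..s}"
    "\<forall>i\<in>I. S i \<in> sets (borel::real measure)" using assms(1) unfolding cyl_def by auto
  obtain J R where B: "B = {\<omega>\<in>space M. \<forall>i\<in>J. W i \<omega> \<in> R i}" and J: "finite J" "J \<subseteq> {0..s}"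
    "\<forall>i\<in>J. R i \<in> sets (borel::real measure)" using assms(2) unfolding cyl_def by auto
  define Q where "Q i = (if i \<in> I then S i else UNIV) \<inter> (if i \<in> J then R i else UNIV)" for i
  have "A \<inter> B = {\<omega>\<in>space M. \<forall>i\<in>I \<union> J. W i \<omega> \<in> Q i}" unfolding A B Q_def by auto
  moreover have "\<forall>i\<in>I \<union> J. Q i \<in> sets borel" using I J by (auto simp: Q_def)
  ultimately show ?thesis using I J unfolding cyl_def
    by (intro CollectI exI[of _ "I \<union> J"] exI[of _ Q]) auto
qed

text \<open>Independence is given only for increments along increasing sequences of times. Sorting
  the times of the cylinder together with 0 and \<open>s\<close> writes each \<open>W i\<close> as a
  sum of increments before \<open>s\<close>; the increment from \<open>s\<close> to \<open>t\<close>
  is the next one in the sequence.\<close>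

lemma cyl_indep:
  assumes C: "C \<in> cyl s" and st: "0 \<le> s" "s \<le> t" and B: "B \<in> sets (borel::real measure)"
  defines "D \<equiv> (\<lambda>\<omega>. W t \<omega> - W s \<omega>) -` B \<inter> space M"
  shows "prob (C \<inter> D) = prob C * prob D"
proof -
  obtain I S where C: "C = {\<omega>\<in>space M. \<forall>i\<in>I. W i \<omega> \<in> S i}" and I: "finite I" "I \<subseteq> {0..s}"
    "\<forall>i\<in>I. S i \<in> sets (borel::real measure)" using C unfolding cyl_def by auto
  define S' where "S' i = (if i \<in> I then S i else UNIV)" for i
  have S'[measurable]: "S' i \<in> sets borel" for i using I by (auto simp: S'_def)
  define xs where "xs = sorted_list_of_set (insert 0 (insert s I))"
  have set_xs: "set xs = insert 0 (insert s I)" and sorted: "sorted xs" using I(1)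
    by (simp_all only: xs_def finite_insert set_sorted_list_of_set sorted_list_of_set.sorted_sorted_key_list_of_set
       sorted_sorted_list_of_set simp_thms)
  have xs0: "xs \<noteq> []" using set_xs by auto
  define n where "n = length xs - 1"
  have len: "length xs = Suc n" using xs0 by (simp add: n_def)
  \<comment> \<open>After the list, whose last entry is \<open>s\<close>, the sequence stays at
    \<open>t\<close>: increment number \<open>n\<close> runs from \<open>s\<close> to
    \<open>t\<close>, and all later ones vanish.\<close>
  define \<tau> where "\<tau> i = (if i \<le> n then xs ! i else t)" for i
  have in_xs: "xs ! i \<in> {0..s}" if "i \<le> n" for i
  proof -
    have "xs ! i \<in> set xs" using that len by auto
    then show ?thesis using set_xs I st by auto
  qed
  have \<tau>0: "\<tau> 0 = 0"
  proof -
    obtain j where "j \<le> n" "xs ! j = 0" using set_xs len by (metis in_set_conv_nth insertI1 less_Suc_eq_le)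
    then have "xs ! 0 \<le> 0" using sorted len by (metis le0 less_Suc_eq_le sorted_nth_mono)
    then show ?thesis using in_xs[of 0] by (auto simp: \<tau>_def)
  qed
  have \<tau>n: "\<tau> n = s"
  proof -
    have "s \<in> set xs" using set_xs by auto
    then obtain j where "j \<le> n" "xs ! j = s" using len by (metis in_set_conv_nth less_Suc_eq_le)
    then have "s \<le> xs ! n" using sorted len by (metis lessI sorted_nth_mono)
    then show ?thesis using in_xs[of n] by (auto simp: \<tau>_def)
  qed
  have \<tau>Sn: "\<tau> (Suc n) = t" by (simp add: \<tau>_def)
  have inc: "incseq \<tau>"
  proof (rule incseq_SucI)
    fix i show "\<tau> i \<le> \<tau> (Suc i)"
      using sorted_nth_mono[OF sorted, of i "Suc i"] in_xs[of i] st len by (auto simp: \<tau>_def)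
  qed
  define d where "d i \<omega> = W (\<tau> (Suc i)) \<omega> - W (\<tau> i) \<omega>" for i \<omega>
  have "indep_vars (\<lambda>_. borel) d UNIV"
    using bm inc \<tau>0 unfolding standard_brownian_motion_def d_def by auto
  from indep_var_restrict[OF this, of "{..<n}" "{n}"]
  have ind: "indep_var (PiM {..<n} (\<lambda>_. borel)) (\<lambda>\<omega>. restrict (\<lambda>i. d i \<omega>) {..<n})
        (PiM {n} (\<lambda>_. borel)) (\<lambda>\<omega>. restrict (\<lambda>i. d i \<omega>) {n})" by auto
  \<comment> \<open>The cylinder in terms of increments: the value of \<open>W\<close> at
    \<open>\<tau> k\<close> is the sum of the first \<open>k\<close> of them.\<close>
  define X where "X = {f \<in> space (PiM {..<n} (\<lambda>_. borel::real measure)). \<forall>k\<in>{..n}. (\<Sum>i<k. f i) \<in> S' (\<tau> k)}"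
  define Y where "Y = {f \<in> space (PiM {n} (\<lambda>_. borel::real measure)). f n \<in> B}"
  have X: "X \<in> sets (PiM {..<n} (\<lambda>_. borel))"
    unfolding X_def
  proof (intro sets.sets_Collect_finite_All predE pred_sets2[OF S'] borel_measurable_sum)
    fix k i assume "k \<in> {..n}" "i \<in> {..<k}"
    then show "(\<lambda>f. f i) \<in> borel_measurable (PiM {..<n} (\<lambda>_. borel))"
      by (intro measurable_component_singleton) auto
  qed auto
  have Y: "Y \<in> sets (PiM {n} (\<lambda>_. borel))"
    unfolding Y_def by (intro predE pred_sets2[OF B] measurable_component_singleton) auto
  define C' where "C' = (\<lambda>\<omega>. restrict (\<lambda>i. d i \<omega>) {..<n}) -` X \<inter> space M"
  have D: "D = (\<lambda>\<omega>. restrict (\<lambda>i. d i \<omega>) {n}) -` Y \<inter> space M"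
    by (auto simp: D_def Y_def space_PiM d_def \<tau>n \<tau>Sn)
  have CX: "C' \<in> sets M" using ind X unfolding C'_def indep_var_eq by (auto intro: measurable_sets)
  have DY: "D \<in> sets M" using st B unfolding D_def by (auto intro!: measurable_sets)
  have CM: "C \<in> sets M" using assms(1) by (rule cyl_sets)
  have tel: "(\<Sum>i<k. d i \<omega>) = W (\<tau> k) \<omega> - W 0 \<omega>" for k \<omega>
    unfolding d_def by (subst sum_lessThan_telescope) (simp add: \<tau>0)
  \<comment> \<open>The two events agree only almost surely, because \<open>W 0\<close> vanishes
    only almost surely.\<close>
  have ae: "AE \<omega> in M. \<omega> \<in> C \<longleftrightarrow> \<omega> \<in> C'"
    using W_0
  proof eventually_elim
    case (elim \<omega>)
    have "(\<forall>i\<in>I. W i \<omega> \<in> S i) \<longleftrightarrow> (\<forall>k\<in>{..n}. W (\<tau> k) \<omega> \<in> S' (\<tau> k))"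
    proof safe
      fix i assume *: "i \<in> I" "\<forall>k\<in>{..n}. W (\<tau> k) \<omega> \<in> S' (\<tau> k)"
      then obtain k where "k \<le> n" "xs ! k = i" using set_xs len by (metis in_set_conv_nth insertCI less_Suc_eq_le)
      then show "W i \<omega> \<in> S i" using * by (auto simp: \<tau>_def S'_def dest: bspec[of _ _ k])
    qed (auto simp: S'_def)
    also have "\<dots> \<longleftrightarrow> (\<forall>k\<in>{..n}. (\<Sum>i<k. restrict (\<lambda>i. d i \<omega>) {..<n} i) \<in> S' (\<tau> k))"
    proof (intro ball_cong refl)
      fix k assume k: "k \<in> {..n}"
      have "(\<Sum>i<k. restrict (\<lambda>i. d i \<omega>) {..<n} i) = (\<Sum>i<k. d i \<omega>)"
        using k by (intro sum.cong) auto
      then show "W (\<tau> k) \<omega> \<in> S' (\<tau> k) \<longleftrightarrow> (\<Sum>i<k. restrict (\<lambda>i. d i \<omega>) {..<n} i) \<in> S' (\<tau> k)"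
        unfolding tel using elim by auto
    qed
    finally show ?case unfolding C C'_def X_def by (auto simp: space_PiM)
  qed
  have "prob (C' \<inter> D) = prob C' * prob D"
    using indep_varD[OF ind X Y] unfolding D C'_def by (simp add: vimage_Int[symmetric] vimage_def Int_def conj_ac)
  moreover have "prob C = prob C'"
    using ae CX CM by (intro measure_eq_AE) auto
  moreover have "prob (C \<inter> D) = prob (C' \<inter> D)"
    using ae CX CM DY by (intro measure_eq_AE) auto
  ultimately show ?thesis by simp
qed

text \<open>Adding the null sets to the cylinders keeps the generator intersection-stable, since by
  completeness an intersection with a null set is null; and a null set is independent of every
  event. Hence the augmented filtration inherits the independence.\<close>

lemma indep_set_F_increment:
  assumes st: "0 \<le> s" "s \<le> t"
  shows "indep_set (sets (F s)) (sigma_sets (space M) {(\<lambda>\<omega>. W t \<omega> - W s \<omega>) -` B \<inter> space M | B. B \<in> sets borel})"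
proof -
  let ?E = "cyl s \<union> null_sets M" and ?D = "{(\<lambda>\<omega>. W t \<omega> - W s \<omega>) -` B \<inter> space M | B. B \<in> sets borel}"
  have ev: "?E \<subseteq> events" "?D \<subseteq> events" using cyl_sets st by (auto intro!: measurable_sets)
  have "indep_set ?E ?D"
  proof (rule indep_setI[OF ev])
    fix a b assume a: "a \<in> ?E" and b: "b \<in> ?D"
    then obtain B where B: "B \<in> sets borel" "b = (\<lambda>\<omega>. W t \<omega> - W s \<omega>) -` B \<inter> space M" by auto
    from a show "prob (a \<inter> b) = prob a * prob b"
    proof
      assume "a \<in> cyl s" then show ?thesis using cyl_indep[OF _ st B(1)] B by simp
    next
      assume a: "a \<in> null_sets M"
      then have "a \<inter> b \<in> null_sets M" by (rule complete2[rotated]) auto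
      then show ?thesis using a by (simp add: measure_eq_0_null_sets)
    qed
  qed
  moreover have "Int_stable ?E"
    unfolding Int_stable_def
  proof (intro ballI)
    fix a b assume "a \<in> ?E" "b \<in> ?E"
    moreover have "a \<inter> b \<in> null_sets M" if "a \<in> null_sets M \<or> b \<in> null_sets M"
      using that complete2[of "a \<inter> b" a] complete2[of "a \<inter> b" b] by auto
    ultimately show "a \<inter> b \<in> ?E" using cyl_Int by blast
  qed
  moreover have "Int_stable ?D"
    unfolding Int_stable_def
  proof (intro ballI)
    fix a b assume "a \<in> ?D" "b \<in> ?D"
    then obtain A B where "A \<in> sets borel" "B \<in> sets borel"
      "a = (\<lambda>\<omega>. W t \<omega> - W s \<omega>) -` A \<inter> space M" "b = (\<lambda>\<omega>. W t \<omega> - W s \<omega>) -` B \<inter> space M" by auto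
    then have "a \<inter> b = (\<lambda>\<omega>. W t \<omega> - W s \<omega>) -` (A \<inter> B) \<inter> space M" "A \<inter> B \<in> sets borel" by auto
    then show "a \<inter> b \<in> ?D" by blast
  qed
  ultimately have ind: "indep_set (sigma_sets (space M) ?E) (sigma_sets (space M) ?D)"
    by (rule indep_set_sigma_sets)
  have "gen s \<subseteq> ?E"
  proof safe
    fix r and S :: "real set" assume *: "0 \<le> r" "r \<le> s" "S \<in> sets borel" "W r -` S \<inter> space M \<notin> null_sets M"
    have "W r -` S \<inter> space M = {\<omega> \<in> space M. \<forall>i\<in>{r}. W i \<omega> \<in> (\<lambda>_. S) i}" by auto
    then show "W r -` S \<inter> space M \<in> cyl s" using * unfolding cyl_def
      by (intro CollectI exI[of _ "{r}"] exI[of _ "\<lambda>_. S"]) auto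
  qed
  then have "sets (F s) \<subseteq> sigma_sets (space M) ?E" unfolding sets_F by (rule sigma_sets_mono')
  then show ?thesis using ind unfolding indep_sets2_eq by blast
qed

lemma indep_var_F_increment:
  fixes Z :: "'a \<Rightarrow> real"
  assumes st: "0 \<le> s" "s \<le> t" and Z: "Z \<in> borel_measurable (F s)"
  shows "indep_var borel Z borel (\<lambda>\<omega>. W t \<omega> - W s \<omega>)"
proof -
  have "sigma_sets (space M) {Z -` A \<inter> space M | A. A \<in> sets borel} \<subseteq> sets (F s)"
    using measurable_sets[OF Z] sets.sigma_sets_subset[of "{Z -` A \<inter> space M | A. A \<in> sets borel}" "F s"] by auto
  moreover have "sets (F s) \<subseteq> events" by (rule sets_F_subset)
  ultimately have "indep_set (sigma_sets (space M) {Z -` A \<inter> space M | A. A \<in> sets borel})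
      (sigma_sets (space M) {(\<lambda>\<omega>. W t \<omega> - W s \<omega>) -` B \<inter> space M | B. B \<in> sets borel})"
    using indep_set_F_increment[OF st, unfolded indep_sets2_eq]
    by (intro indep_setI) (meson subset_trans subsetD)+
  moreover have "random_variable borel (\<lambda>\<omega>. W t \<omega> - W s \<omega>)" using st by simp
  ultimately show ?thesis unfolding indep_var_eq using measurable_F[OF Z] by blast
qed

section \<open>Moments of Brownian increments\<close>

lemma increment_moments:
  assumes st: "0 \<le> s" "s \<le> t"
  shows "has_bochner_integral M (\<lambda>\<omega>. W t \<omega> - W s \<omega>) 0"
    and "has_bochner_integral M (\<lambda>\<omega>. (W t \<omega> - W s \<omega>)\<^sup>2) (t - s)"
proof -
  have "has_bochner_integral M (\<lambda>\<omega>. W t \<omega> - W s \<omega>) 0 \<and> has_bochner_integral M (\<lambda>\<omega>. (W t \<omega> - W s \<omega>)\<^sup>2) (t - s)"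
  proof (cases "s = t")
    \<comment> \<open>The zero increment has no normal density and is treated apart.\<close>
    case True then show ?thesis by (simp add: has_bochner_integral_zero)
  next
    case False
    then have lt: "s < t" using st by auto
    have dist: "distributed M lborel (\<lambda>\<omega>. W t \<omega> - W s \<omega>) (\<lambda>y. ennreal (normal_density 0 (sqrt (t - s)) y))"
      using bm lt st unfolding standard_brownian_motion_def by auto
    have pos: "sqrt (t - s) > 0" using lt by simp
    have 1: "integrable M (\<lambda>\<omega>. (W t \<omega> - W s \<omega>) ^ k)" for k :: nat
      using integrable_normal_moment[OF pos, of 0 k]
      by (subst distributed_integrable[OF dist, symmetric]) (auto simp: normal_density_nonneg)
    have 2: "(\<integral>\<omega>. (W t \<omega> - W s \<omega>) ^ k \<partial>M) = (\<integral>x. normal_density 0 (sqrt (t - s)) x * x ^ k \<partial>lborel)" for k :: nat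
      by (subst distributed_integral[OF dist, symmetric]) (auto simp: normal_density_nonneg)
    show ?thesis using 1[of 1] 1[of 2] 2[of 1] 2[of 2] integral_normal_moment_odd[OF pos, of 0 0]
       integral_normal_moment_even[OF pos, of 0 1] lt
      by (auto simp: has_bochner_integral_iff)
  qed
  then show "has_bochner_integral M (\<lambda>\<omega>. W t \<omega> - W s \<omega>) 0"
     "has_bochner_integral M (\<lambda>\<omega>. (W t \<omega> - W s \<omega>)\<^sup>2) (t - s)" by auto
qed

text \<open>Independence factors the expectations. These two identities are the source of the
  martingale property and of the isometry.\<close>

lemma increment_mult:
  fixes Z :: "'a \<Rightarrow> real"
  assumes st: "0 \<le> s" "s \<le> t" and Z: "Z \<in> borel_measurable (F s)" "integrable M Z"
  shows "has_bochner_integral M (\<lambda>\<omega>. Z \<omega> * (W t \<omega> - W s \<omega>)) 0"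
    and "has_bochner_integral M (\<lambda>\<omega>. Z \<omega> * (W t \<omega> - W s \<omega>)\<^sup>2) ((t - s) * (\<integral>\<omega>. Z \<omega> \<partial>M))"
proof -
  note ind = indep_var_F_increment[OF st Z(1)]
  note m = increment_moments[OF st, THEN has_bochner_integral_integral_eq]
  note i = increment_moments[OF st, THEN integrable.intros]
  show "has_bochner_integral M (\<lambda>\<omega>. Z \<omega> * (W t \<omega> - W s \<omega>)) 0"
    using indep_var_integrable[OF ind Z(2) i(1)] indep_var_lebesgue_integral[OF ind Z(2) i(1)] m(1)
    by (auto simp: has_bochner_integral_iff)
  have ind2: "indep_var borel Z borel (\<lambda>\<omega>. (W t \<omega> - W s \<omega>)\<^sup>2)"
    using indep_var_compose[OF ind, of "\<lambda>x. x" borel "\<lambda>x. x\<^sup>2" borel] by (simp add: comp_def)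
  show "has_bochner_integral M (\<lambda>\<omega>. Z \<omega> * (W t \<omega> - W s \<omega>)\<^sup>2) ((t - s) * (\<integral>\<omega>. Z \<omega> \<partial>M))"
    using indep_var_integrable[OF ind2 Z(2) i(2)] indep_var_lebesgue_integral[OF ind2 Z(2) i(2)] m(2)
    by (auto simp: has_bochner_integral_iff)
qed

end

section \<open>Elementary integrals\<close>

text \<open>The value is the length of the intersection of the two intervals, with
  \<open>max 0\<close> for an empty one. The same number comes out of
  \<open>increment_overlap\<close>, and the isometry rests on this match.\<close>

lemma has_bochner_integral_overlap:
  assumes "p \<le> q" "p' \<le> q'"
  shows "has_bochner_integral lborel (\<lambda>r. indicat_real {p<..q} r * indicat_real {p'<..q'} r) (max 0 (min q q' - max p p'))"
proof -
  have "emeasure lborel {max p p'<..min q q'} < \<infinity>"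
  proof (cases "max p p' \<le> min q q'")
    case True then show ?thesis by (subst emeasure_lborel_Ioc) auto
  next
    case False
    then have e: "{max p p'<..min q q'} = {}" by (simp only: greaterThanAtMost_empty_iff)
    show ?thesis unfolding e by simp
  qed
  then have "has_bochner_integral lborel (indicat_real {max p p'<..min q q'}) (measure lborel {max p p'<..min q q'})"
    by (intro has_bochner_integral_real_indicator) auto
  moreover have "measure lborel {max p p'<..min q q'} = max 0 (min q q' - max p p')"
    by (cases "max p p' \<le> min q q'") (auto simp: max_def)
  moreover have "indicat_real {p<..q} r * indicat_real {p'<..q'} r = indicat_real {max p p'<..min q q'} r" for r
    by (auto simp: indicator_def)
  ultimately show ?thesis by simp
qed

text \<open>Since intervals in a list may overlap, concatenation suffices and no common refinement
  of the two partitions has to be formed.\<close>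

definition elementary_diff :: "(real \<times> real \<times> ('a \<Rightarrow> 'b::euclidean_space)) list \<Rightarrow> _ \<Rightarrow> _" where
  "elementary_diff es es' = es @ map (\<lambda>(p, q, \<xi>). (p, q, \<lambda>\<omega>. - \<xi> \<omega>)) es'"

lemma elementary_elementary_diff:
  assumes "elementary M F t s es" "elementary M F t s es'"
  shows "elementary M F t s (elementary_diff es es')"
  using assms unfolding elementary_def elementary_diff_def
  by (auto split: prod.splits intro!: borel_measurable_uminus)

lemma elementary_process_diff:
  "elementary_process (elementary_diff es es') r \<omega> = elementary_process es r \<omega> - elementary_process es' r \<omega>"
proof -
  have "(\<Sum>(p, q, \<xi>)\<leftarrow>map (\<lambda>(p, q, \<xi>). (p, q, \<lambda>\<omega>. - \<xi> \<omega>)) es'. indicat_real {p<..q} r *\<^sub>R \<xi> \<omega>)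
      = - (\<Sum>(p, q, \<xi>)\<leftarrow>es'. indicat_real {p<..q} r *\<^sub>R \<xi> \<omega>)"
    by (induction es') auto
  then show ?thesis by (simp add: elementary_process_def elementary_diff_def)
qed

lemma elementary_integral_diff:
  "elementary_integral W (elementary_diff es es') \<omega> = elementary_integral W es \<omega> - elementary_integral W es' \<omega>"
proof -
  have "(\<Sum>(p, q, \<xi>)\<leftarrow>map (\<lambda>(p, q, \<xi>). (p, q, \<lambda>\<omega>. - \<xi> \<omega>)) es'. (W q \<omega> - W p \<omega>) *\<^sub>R \<xi> \<omega>)
      = - (\<Sum>(p, q, \<xi>)\<leftarrow>es'. (W q \<omega> - W p \<omega>) *\<^sub>R \<xi> \<omega>)"
    by (induction es') auto
  then show ?thesis by (simp add: elementary_integral_def elementary_diff_def)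
qed

text \<open>Entries that start after \<open>s\<close> are dropped, because cutting them at
  \<open>s\<close> would reverse the order of their end points.\<close>

definition elementary_restrict :: "real \<Rightarrow> (real \<times> real \<times> ('a \<Rightarrow> 'b::euclidean_space)) list \<Rightarrow> _" where
  "elementary_restrict s es = map (\<lambda>(p, q, \<xi>). (p, min q s, \<xi>)) (filter (\<lambda>(p, q, \<xi>). p \<le> s) es)"

lemma elementary_elementary_restrict:
  "elementary M F t T es \<Longrightarrow> elementary M F t s (elementary_restrict s es)"
  by (auto simp: elementary_def elementary_restrict_def split: prod.splits)

lemma elementary_process_restrict:
  "r \<le> s \<Longrightarrow> elementary_process (elementary_restrict s es) r \<omega> = elementary_process es r \<omega>"
  by (induction es) (auto simp: elementary_process_def elementary_restrict_def indicator_def)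

text \<open>The integral as a process in its upper limit. With \<open>min\<close> at both end points
  one formula covers entries before, across and after \<open>s\<close>, and continuity in
  \<open>s\<close> is visible.\<close>

definition elementary_integral_at ::
  "(real \<Rightarrow> 'a \<Rightarrow> real) \<Rightarrow> (real \<times> real \<times> ('a \<Rightarrow> 'b::euclidean_space)) list \<Rightarrow> real \<Rightarrow> 'a \<Rightarrow> 'b" where
  "elementary_integral_at W es s \<omega> = (\<Sum>(p, q, \<xi>)\<leftarrow>es. (W (min q s) \<omega> - W (min p s) \<omega>) *\<^sub>R \<xi> \<omega>)"

lemma elementary_integral_restrict:
  "elementary M F t T es \<Longrightarrow> elementary_integral W (elementary_restrict s es) \<omega> = elementary_integral_at W es s \<omega>"
  by (induction es) (auto simp: elementary_integral_def elementary_restrict_def elementary_integral_at_def elementary_def)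

lemma elementary_integral_at_diff:
  "elementary_integral_at W (elementary_diff es es') s \<omega>
     = elementary_integral_at W es s \<omega> - elementary_integral_at W es' s \<omega>"
proof -
  have "(\<Sum>(p, q, \<xi>)\<leftarrow>map (\<lambda>(p, q, \<xi>). (p, q, \<lambda>\<omega>. - \<xi> \<omega>)) es'. (W (min q s) \<omega> - W (min p s) \<omega>) *\<^sub>R \<xi> \<omega>)
      = - (\<Sum>(p, q, \<xi>)\<leftarrow>es'. (W (min q s) \<omega> - W (min p s) \<omega>) *\<^sub>R \<xi> \<omega>)"
    by (induction es') auto
  then show ?thesis by (simp add: elementary_integral_at_def elementary_diff_def)
qed

section \<open>A pathwise maximal inequality and suprema over dyadic grids\<close>

primrec running_max :: "(nat \<Rightarrow> real) \<Rightarrow> nat \<Rightarrow> real" where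
  "running_max a 0 = a 0"
| "running_max a (Suc k) = max (running_max a k) (a (Suc k))"

lemma running_max_ge: "j \<le> k \<Longrightarrow> a j \<le> running_max a k"
  by (induction k) (auto simp: le_Suc_eq max.coboundedI1)

lemma running_max_eq: "\<exists>j\<le>k. running_max a k = a j"
  by (induction k) (auto simp: max_def le_Suc_eq)

text \<open>Summation by parts, for arbitrary reals. In the induction the right side stays put
  unless the new value b exceeds the old maximum m, and then it grows by (b - m)^2 / 2.\<close>

lemma running_max_sum_le:
  "(\<Sum>k<n. running_max a k * (a (Suc k) - a k)) \<le> running_max a n * a n - (running_max a n)\<^sup>2 / 2"
proof (induction n)
  case 0 then show ?case by (simp add: power2_eq_square)
next
  case (Suc n)
  let ?m = "running_max a n" and ?b = "a (Suc n)"
  have "(\<Sum>k<Suc n. running_max a k * (a (Suc k) - a k)) \<le> ?m * ?b - ?m\<^sup>2 / 2"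
    using Suc by (simp add: algebra_simps)
  also have "\<dots> \<le> running_max a (Suc n) * ?b - (running_max a (Suc n))\<^sup>2 / 2"
  proof (cases "?b \<le> ?m")
    case False
    have "0 \<le> (?m - ?b)\<^sup>2" by simp
    then show ?thesis using False by (simp add: power2_eq_square algebra_simps)
  qed (simp add: max_def)
  finally show ?case .
qed

lemma running_max_measurable[measurable (raw)]:
  assumes "\<And>j. j \<le> k \<Longrightarrow> f j \<in> borel_measurable M"
  shows "(\<lambda>\<omega>. running_max (\<lambda>j. f j \<omega>) k) \<in> borel_measurable M"
  using assms by (induction k) auto

lemma ennreal_sq_add_le:
  fixes x y :: "'b::real_normed_vector"
  shows "ennreal ((norm (x + y))\<^sup>2) \<le> 2 * ennreal ((norm x)\<^sup>2) + 2 * ennreal ((norm y)\<^sup>2)"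
proof -
  have "(norm (x + y))\<^sup>2 \<le> (norm x + norm y)\<^sup>2" by (intro power_mono norm_triangle_ineq) simp
  also have "\<dots> \<le> 2 * (norm x)\<^sup>2 + 2 * (norm y)\<^sup>2"
    using sum_squares_ge_zero[of "norm x - norm y" 0] by (simp add: power2_eq_square algebra_simps)
  finally have "ennreal ((norm (x + y))\<^sup>2) \<le> ennreal (2 * (norm x)\<^sup>2 + 2 * (norm y)\<^sup>2)" by (rule ennreal_leI)
  then show ?thesis by (simp add: ennreal_plus ennreal_mult)
qed

lemma dyadic_point_in:
  fixes t s :: real
  assumes ts: "t \<le> s" and k: "k \<le> 2^n"
  shows "t + (s - t) * real k / 2^n \<in> {t..s}"
proof -
  have "real k \<le> 2^n" using k by (metis of_nat_le_iff of_nat_numeral of_nat_power)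
  then have "(s - t) * (real k / 2^n) \<le> (s - t) * 1" using ts by (intro mult_left_mono) auto
  then show ?thesis using ts by auto
qed

text \<open>Continuity reduces the supremum over an interval to countably many times, as needed for
  measurability. Each time is the limit of the dyadic points just below it.\<close>

lemma SUP_dyadic_grid:
  fixes f :: "real \<Rightarrow> 'b::euclidean_space"
  assumes c: "continuous_on {t..s} f" and ts: "t \<le> s"
  shows "(SUP r\<in>{t..s}. ennreal ((norm (f r))\<^sup>2))
    = (SUP n. SUP k\<in>{..2^n::nat}. ennreal ((norm (f (t + (s - t) * real k / 2^n)))\<^sup>2))" (is "?L = ?R")
proof (rule antisym)
  have in_grid: "t + (s - t) * real k / 2^n \<in> {t..s}" if "k \<le> 2^n" for k n
    using dyadic_point_in[OF ts] that by simp
  then show "?R \<le> ?L" by (intro SUP_least SUP_upper) auto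
  show "?L \<le> ?R"
  proof (rule SUP_least)
    fix r assume r: "r \<in> {t..s}"
    \<comment> \<open>The relative position of \<open>r\<close> in the interval, with 0 as a
      harmless value when the interval is a point.\<close>
    define \<theta> where "\<theta> = (if s = t then 0 else (r - t) / (s - t))"
    have \<theta>: "0 \<le> \<theta>" "\<theta> \<le> 1" "r = t + (s - t) * \<theta>" using r ts by (auto simp: \<theta>_def field_simps)
    define k where "k n = nat \<lfloor>\<theta> * 2^n\<rfloor>" for n :: nat
    have k: "real (k n) = of_int \<lfloor>\<theta> * 2^n\<rfloor>" for n using \<theta> by (simp add: k_def)
    have kle: "k n \<le> 2^n" for n
    proof -
      have "real (k n) \<le> \<theta> * 2^n" unfolding k by (rule of_int_floor_le)
      also have "\<dots> \<le> 1 * 2^n" using \<theta> by (intro mult_right_mono) auto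
      finally show ?thesis by (metis mult_1 of_nat_le_iff of_nat_numeral of_nat_power)
    qed
    have lim: "(\<lambda>n. real (k n) / 2^n) \<longlonglongrightarrow> \<theta>"
    proof (rule LIMSEQ_I)
      fix e :: real assume "e > 0"
      have z: "(\<lambda>n. (1/2::real)^n) \<longlonglongrightarrow> 0" by (rule LIMSEQ_realpow_zero) auto
      from LIMSEQ_D[OF this \<open>e > 0\<close>] obtain N where N: "\<And>n. n \<ge> N \<Longrightarrow> (1/2::real)^n < e" by auto
      show "\<exists>N. \<forall>n\<ge>N. norm (real (k n) / 2^n - \<theta>) < e"
      proof (intro exI allI impI)
        fix n assume "n \<ge> N"
        have "\<bar>real (k n) - \<theta> * 2^n\<bar> \<le> 1" unfolding k by linarith
        then have "\<bar>real (k n) - \<theta> * 2^n\<bar> / 2^n \<le> 1 / 2^n" by (intro divide_right_mono) auto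
        moreover have "\<bar>real (k n) / 2^n - \<theta>\<bar> = \<bar>real (k n) - \<theta> * 2^n\<bar> / 2^n" 
        proof -
          have "real (k n) / 2^n - \<theta> = (real (k n) - \<theta> * 2^n) / 2^n" by (simp add: diff_divide_distrib)
          then show ?thesis by (simp only: abs_divide) simp
        qed
        ultimately show "norm (real (k n) / 2^n - \<theta>) < e" using N[OF \<open>n \<ge> N\<close>] by (simp add: power_divide)
      qed
    qed
    have "(\<lambda>n. t + (s - t) * (real (k n) / 2^n)) \<longlonglongrightarrow> t + (s - t) * \<theta>" by (intro tendsto_intros lim)
    then have "(\<lambda>n. t + (s - t) * real (k n) / 2^n) \<longlonglongrightarrow> r" using \<theta>(3) by simp
    then have "(\<lambda>n. f (t + (s - t) * real (k n) / 2^n)) \<longlonglongrightarrow> f r"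
      by (intro continuous_on_tendsto_compose[OF c]) (use r in_grid[OF kle] in auto)
    then have L: "(\<lambda>n. ennreal ((norm (f (t + (s - t) * real (k n) / 2^n)))\<^sup>2)) \<longlonglongrightarrow> ennreal ((norm (f r))\<^sup>2)"
      by (intro tendsto_intros)
    have U: "ennreal ((norm (f (t + (s - t) * real (k n) / 2^n)))\<^sup>2) \<le> ?R" for n
      by (rule SUP_upper2[of n], simp, rule SUP_upper) (use kle in auto)
    show "ennreal ((norm (f r))\<^sup>2) \<le> ?R" by (rule LIMSEQ_le_const2[OF L]) (use U in blast)
  qed
qed

text \<open>The grids are nested, point \<open>k\<close> of level \<open>n\<close> being point
  \<open>2 * k\<close> of the next level; monotone convergence can then be applied to the
  suprema.\<close>

lemma dyadic_SUP_mono: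
  "incseq (\<lambda>n. SUP k\<in>{..2^n::nat}. ennreal ((norm (f (t + (s - t) * real k / 2^n)))\<^sup>2))"
proof (rule incseq_SucI, rule SUP_least)
  fix n k assume "k \<in> {..2^n::nat}"
  then have "2 * k \<in> {..2^Suc n}" "t + (s - t) * real k / 2^n = t + (s - t) * real (2 * k) / 2^Suc n" by auto
  then show "ennreal ((norm (f (t + (s - t) * real k / 2^n)))\<^sup>2)
     \<le> (SUP k\<in>{..2^Suc n}. ennreal ((norm (f (t + (s - t) * real k / 2^Suc n)))\<^sup>2))"
    by (intro SUP_upper2[of "2 * k"]) auto
qed

context brownian
begin

section \<open>The isometry for elementary integrands\<close>

lemma L2_integrable_inner:
  fixes X Y :: "'a \<Rightarrow> 'b::euclidean_space"
  assumes X: "X \<in> borel_measurable M" "integrable M (\<lambda>\<omega>. (norm (X \<omega>))\<^sup>2)"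
    and Y: "Y \<in> borel_measurable M" "integrable M (\<lambda>\<omega>. (norm (Y \<omega>))\<^sup>2)"
  shows "integrable M (\<lambda>\<omega>. inner (X \<omega>) (Y \<omega>))"
proof (rule Bochner_Integration.integrable_bound)
  show "integrable M (\<lambda>\<omega>. (norm (X \<omega>))\<^sup>2 + (norm (Y \<omega>))\<^sup>2)" using X Y by auto
  show "(\<lambda>\<omega>. inner (X \<omega>) (Y \<omega>)) \<in> borel_measurable M" using X Y by auto
  have "\<bar>inner x y\<bar> \<le> (norm x)\<^sup>2 + (norm y)\<^sup>2" for x y :: 'b
  proof -
    have "\<bar>inner x y\<bar> \<le> norm x * norm y" by (rule Cauchy_Schwarz_ineq2)
    moreover have "2 * (norm x * norm y) \<le> (norm x)\<^sup>2 + (norm y)\<^sup>2"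
      using sum_squares_ge_zero[of "norm x - norm y" 0] by (simp add: power2_eq_square algebra_simps)
    moreover have "0 \<le> norm x * norm y" by simp
    ultimately show ?thesis by linarith
  qed
  then show "AE \<omega> in M. norm (inner (X \<omega>) (Y \<omega>)) \<le> norm ((norm (X \<omega>))\<^sup>2 + (norm (Y \<omega>))\<^sup>2)" by auto
qed

text \<open>Split the longer increment at \<open>a\<close>. The first piece gives a square; the
  second is independent of \<open>F a\<close>, with respect to which \<open>Z\<close> times the
  shorter increment is measurable, and contributes nothing.\<close>

lemma increment_mult_mult:
  fixes Z :: "'a \<Rightarrow> real"
  assumes p: "0 \<le> p" "p \<le> a" "a \<le> b" and Z: "Z \<in> borel_measurable (F p)" "integrable M Z"
  shows "has_bochner_integral M (\<lambda>\<omega>. Z \<omega> * ((W a \<omega> - W p \<omega>) * (W b \<omega> - W p \<omega>))) ((a - p) * (\<integral>\<omega>. Z \<omega> \<partial>M))"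
proof -
  have 1: "has_bochner_integral M (\<lambda>\<omega>. Z \<omega> * (W a \<omega> - W p \<omega>)\<^sup>2) ((a - p) * (\<integral>\<omega>. Z \<omega> \<partial>M))"
    by (rule increment_mult) (use p Z in auto)
  have "(\<lambda>\<omega>. Z \<omega> * (W a \<omega> - W p \<omega>)) \<in> borel_measurable (F a)"
    using measurable_F_mono[OF Z(1) p(2)] p by (intro borel_measurable_times borel_measurable_diff W_adapted) auto
  moreover have "integrable M (\<lambda>\<omega>. Z \<omega> * (W a \<omega> - W p \<omega>))"
    using increment_mult(1)[OF p(1,2) Z] by (rule integrable.intros)
  ultimately have "has_bochner_integral M (\<lambda>\<omega>. (Z \<omega> * (W a \<omega> - W p \<omega>)) * (W b \<omega> - W a \<omega>)) 0"
    using p by (intro increment_mult) auto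
  from has_bochner_integral_add[OF 1 this] show ?thesis
    by (simp add: algebra_simps power2_eq_square)
qed

text \<open>Split the earlier increment at \<open>p'\<close>. The piece before \<open>p'\<close> is
  known at time \<open>p'\<close> and therefore orthogonal to the later increment; what remains is a
  pair of increments with the common start \<open>p'\<close>. The bound on \<open>Z\<close> keeps
  the products integrable.\<close>

lemma increment_overlap_ordered:
  fixes Z :: "'a \<Rightarrow> real"
  assumes p: "0 \<le> p" "p \<le> q" "p \<le> p'" "p' \<le> q'"
    and Z: "Z \<in> borel_measurable (F p')" "\<And>\<omega>. \<omega> \<in> space M \<Longrightarrow> \<bar>Z \<omega>\<bar> \<le> c"
  shows "has_bochner_integral M (\<lambda>\<omega>. Z \<omega> * ((W q \<omega> - W p \<omega>) * (W q' \<omega> - W p' \<omega>)))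
           (max 0 (min q q' - p') * (\<integral>\<omega>. Z \<omega> \<partial>M))"
proof -
  have ZM: "Z \<in> borel_measurable M" using Z(1) by (rule measurable_F)
  have iZ: "integrable M Z" using Z(2) ZM by (intro integrable_const_bound[of _ c]) auto
  have zero: "has_bochner_integral M (\<lambda>\<omega>. (Z \<omega> * (W a \<omega> - W p \<omega>)) * (W q' \<omega> - W p' \<omega>)) 0"
    if a: "p \<le> a" "a \<le> p'" for a
  proof (rule increment_mult)
    show "(\<lambda>\<omega>. Z \<omega> * (W a \<omega> - W p \<omega>)) \<in> borel_measurable (F p')"
      using Z(1) p a by (intro borel_measurable_times borel_measurable_diff W_adapted) auto
    have i: "integrable M (\<lambda>\<omega>. c * (W a \<omega> - W p \<omega>))"
      using increment_moments(1)[of p a] p a by (auto intro: integrable.intros)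
    show "integrable M (\<lambda>\<omega>. Z \<omega> * (W a \<omega> - W p \<omega>))"
    proof (rule Bochner_Integration.integrable_bound[OF i])
      show "(\<lambda>\<omega>. Z \<omega> * (W a \<omega> - W p \<omega>)) \<in> borel_measurable M"
        using ZM p a by (intro borel_measurable_times borel_measurable_diff W_measurable) auto
      show "AE \<omega> in M. norm (Z \<omega> * (W a \<omega> - W p \<omega>)) \<le> norm (c * (W a \<omega> - W p \<omega>))"
      proof (rule AE_I2)
        fix \<omega> assume "\<omega> \<in> space M"
        from Z(2)[OF this] have "\<bar>Z \<omega>\<bar> \<le> \<bar>c\<bar>" by linarith
        then show "norm (Z \<omega> * (W a \<omega> - W p \<omega>)) \<le> norm (c * (W a \<omega> - W p \<omega>))"
          by (simp add: abs_mult mult_right_mono)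
      qed
    qed
  qed (use p in auto)
  show ?thesis
  proof (cases "q \<le> p'")
    case True
    then have "max 0 (min q q' - p') = 0" by auto
    then show ?thesis using zero[of q] p True by (simp add: mult.assoc)
  next
    case False
    have "has_bochner_integral M (\<lambda>\<omega>. Z \<omega> * ((W q \<omega> - W p' \<omega>) * (W q' \<omega> - W p' \<omega>))) ((min q q' - p') * (\<integral>\<omega>. Z \<omega> \<partial>M))"
    proof (cases "q \<le> q'")
      case True then show ?thesis using increment_mult_mult[of p' q q' Z] False p Z(1) iZ by simp
    next
      case F: False then show ?thesis using increment_mult_mult[of p' q' q Z] False p Z(1) iZ
        by (simp add: mult.commute[of "W q _ - W p' _"])
    qed
    from has_bochner_integral_add[OF zero[of p'] this] show ?thesis using p False by (simp add: algebra_simps)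
  qed
qed

lemma increment_overlap:
  fixes Z :: "'a \<Rightarrow> real"
  assumes p: "0 \<le> p" "p \<le> q" "0 \<le> p'" "p' \<le> q'"
    and Z: "Z \<in> borel_measurable (F (max p p'))" "\<And>\<omega>. \<omega> \<in> space M \<Longrightarrow> \<bar>Z \<omega>\<bar> \<le> c"
  shows "has_bochner_integral M (\<lambda>\<omega>. Z \<omega> * ((W q \<omega> - W p \<omega>) * (W q' \<omega> - W p' \<omega>)))
           (max 0 (min q q' - max p p') * (\<integral>\<omega>. Z \<omega> \<partial>M))"
proof (cases "p \<le> p'")
  case True
  then show ?thesis using increment_overlap_ordered[of p q p' q' Z c] p Z by (simp add: max_def)
next
  case False
  then show ?thesis using increment_overlap_ordered[of p' q' p q Z c] p Z
    by (simp add: max_def min.commute[of q] mult.commute[of "W q _ - W p _"])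
qed

text \<open>Both sides are double sums over pairs of entries, and they agree pair by pair: each
  contributes the length of the overlap times the expected inner product of the two coefficients.
  Overlapping intervals thus need no special care.\<close>

lemma elementary_isometry:
  fixes es :: "(real \<times> real \<times> ('a \<Rightarrow> 'b::euclidean_space)) list"
  assumes t: "0 \<le> t" and es: "elementary M F t s es"
  shows "(msq M (elementary_integral W es))
      = (\<integral>\<^sup>+\<omega>. (\<integral>\<^sup>+r\<in>{t..s}. ennreal ((norm (elementary_process es r \<omega>))\<^sup>2) \<partial>lborel) \<partial>M)"
    and "integrable M (\<lambda>\<omega>. (norm (elementary_integral W es \<omega>))\<^sup>2)"
proof -
  define ov :: "(real \<times> real \<times> ('a \<Rightarrow> 'b)) \<Rightarrow> (real \<times> real \<times> ('a \<Rightarrow> 'b)) \<Rightarrow> real"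
    where "ov x y = max 0 (min (fst (snd x)) (fst (snd y)) - max (fst x) (fst y))" for x y
  define ip :: "(real \<times> real \<times> ('a \<Rightarrow> 'b)) \<Rightarrow> (real \<times> real \<times> ('a \<Rightarrow> 'b)) \<Rightarrow> 'a \<Rightarrow> real"
    where "ip x y \<omega> = inner (snd (snd x) \<omega>) (snd (snd y) \<omega>)" for x y \<omega>
  define Q where "Q \<omega> = (\<Sum>x\<leftarrow>es. \<Sum>y\<leftarrow>es. ov x y * ip x y \<omega>)" for \<omega>
  define V where "V = (\<Sum>x\<leftarrow>es. \<Sum>y\<leftarrow>es. ov x y * (\<integral>\<omega>. ip x y \<omega> \<partial>M))"
  have el: "t \<le> fst x" "fst x \<le> fst (snd x)" "fst (snd x) \<le> s" "snd (snd x) \<in> borel_measurable (F (fst x))"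
    "\<exists>c. \<forall>\<omega>\<in>space M. norm (snd (snd x) \<omega>) \<le> c" if "x \<in> set es" for x
    using es that unfolding elementary_def by (auto simp: split_beta)
  have ipm: "ip x y \<in> borel_measurable (F (max (fst x) (fst y)))" if "x \<in> set es" "y \<in> set es" for x y
    unfolding ip_def using measurable_F_mono[OF el(4)[OF that(1)]] measurable_F_mono[OF el(4)[OF that(2)]]
    by (intro borel_measurable_inner) auto
  have ipb: "\<exists>c. \<forall>\<omega>\<in>space M. \<bar>ip x y \<omega>\<bar> \<le> c" if xy: "x \<in> set es" "y \<in> set es" for x y
  proof -
    obtain c d where cd: "\<And>\<omega>. \<omega> \<in> space M \<Longrightarrow> norm (snd (snd x) \<omega>) \<le> c" "\<And>\<omega>. \<omega> \<in> space M \<Longrightarrow> norm (snd (snd y) \<omega>) \<le> d"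
      using el(5)[OF xy(1)] el(5)[OF xy(2)] by auto
    have "\<bar>ip x y \<omega>\<bar> \<le> c * d" if "\<omega> \<in> space M" for \<omega>
    proof -
      have "\<bar>ip x y \<omega>\<bar> \<le> norm (snd (snd x) \<omega>) * norm (snd (snd y) \<omega>)" unfolding ip_def by (rule Cauchy_Schwarz_ineq2)
      also have "\<dots> \<le> c * d" using cd[OF that] order_trans[OF norm_ge_zero cd(1)[OF that]] by (intro mult_mono) auto
      finally show ?thesis .
    qed
    then show ?thesis by blast
  qed
  have iip: "integrable M (ip x y)" if xy: "x \<in> set es" "y \<in> set es" for x y
  proof -
    obtain c where "\<forall>\<omega>\<in>space M. \<bar>ip x y \<omega>\<bar> \<le> c" using ipb[OF xy] by auto
    then show ?thesis using measurable_F[OF ipm[OF xy]] by (intro integrable_const_bound[of _ c]) auto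
  qed
  have I: "has_bochner_integral M (\<lambda>\<omega>. (norm (elementary_integral W es \<omega>))\<^sup>2) V"
    unfolding elementary_integral_def power2_norm_eq_inner inner_sum_list_sum_list V_def
  proof (intro has_bochner_integral_sum_list)
    fix x y assume xy: "x \<in> set es" "y \<in> set es"
    obtain c where "\<And>\<omega>. \<omega> \<in> space M \<Longrightarrow> \<bar>ip x y \<omega>\<bar> \<le> c" using ipb[OF xy] by auto
    from increment_overlap[OF _ el(2)[OF xy(1)] _ el(2)[OF xy(2)] ipm[OF xy] this] t el(1)[OF xy(1)] el(1)[OF xy(2)]
    have "has_bochner_integral M (\<lambda>\<omega>. ip x y \<omega> * ((W (fst (snd x)) \<omega> - W (fst x) \<omega>) * (W (fst (snd y)) \<omega> - W (fst y) \<omega>)))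
       (ov x y * (\<integral>\<omega>. ip x y \<omega> \<partial>M))" unfolding ov_def by auto
    then show "has_bochner_integral M (\<lambda>\<omega>. inner (case x of (p, q, \<xi>) \<Rightarrow> (W q \<omega> - W p \<omega>) *\<^sub>R \<xi> \<omega>)
          (case y of (p, q, \<xi>) \<Rightarrow> (W q \<omega> - W p \<omega>) *\<^sub>R \<xi> \<omega>)) (ov x y * (\<integral>\<omega>. ip x y \<omega> \<partial>M))"
      by (simp add: split_beta ip_def mult_ac)
  qed
  have P: "has_bochner_integral lborel (\<lambda>r. (norm (elementary_process es r \<omega>))\<^sup>2) (Q \<omega>)" for \<omega>
    unfolding elementary_process_def power2_norm_eq_inner inner_sum_list_sum_list Q_def
  proof (intro has_bochner_integral_sum_list)
    fix x y assume xy: "x \<in> set es" "y \<in> set es"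
    from has_bochner_integral_mult_left[OF has_bochner_integral_overlap[OF el(2)[OF xy(1)] el(2)[OF xy(2)]], of "ip x y \<omega>"]
    show "has_bochner_integral lborel (\<lambda>r. inner (case x of (p, q, \<xi>) \<Rightarrow> indicat_real {p<..q} r *\<^sub>R \<xi> \<omega>)
          (case y of (p, q, \<xi>) \<Rightarrow> indicat_real {p<..q} r *\<^sub>R \<xi> \<omega>)) (ov x y * ip x y \<omega>)"
      by (simp add: split_beta ip_def mult_ac ov_def)
  qed
  have Q: "has_bochner_integral M Q V"
    unfolding Q_def V_def
  proof (intro has_bochner_integral_sum_list)
    fix x y assume "x \<in> set es" "y \<in> set es"
    from has_bochner_integral_integrable[OF iip[OF this]]
    show "has_bochner_integral M (\<lambda>\<omega>. ov x y * ip x y \<omega>) (ov x y * (\<integral>\<omega>. ip x y \<omega> \<partial>M))"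
      by (rule has_bochner_integral_mult_right)
  qed
  have Q0: "0 \<le> Q \<omega>" for \<omega>
    by (subst has_bochner_integral_integral_eq[OF P, symmetric]) simp
  \<comment> \<open>Off \<open>{t..s}\<close> the process vanishes, so integration over that
    interval is integration over the whole line.\<close>
  have zero: "elementary_process es r \<omega> = 0" if "r \<notin> {t..s}" for r \<omega>
  proof -
    have "(case x of (p, q, \<xi>) \<Rightarrow> indicat_real {p<..q} r *\<^sub>R \<xi> \<omega>) = 0" if x: "x \<in> set es" for x
      using el[OF x] \<open>r \<notin> {t..s}\<close> by (auto simp: split_beta indicator_def)
    moreover have "(\<And>x. x \<in> set es \<Longrightarrow> g x = 0) \<Longrightarrow> (\<Sum>x\<leftarrow>es. g x) = 0" for g :: "_ \<Rightarrow> 'b"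
      by (induction es) auto
    ultimately show ?thesis unfolding elementary_process_def by blast
  qed
  have "(\<integral>\<^sup>+r\<in>{t..s}. ennreal ((norm (elementary_process es r \<omega>))\<^sup>2) \<partial>lborel) = ennreal (Q \<omega>)" for \<omega>
  proof -
    have "(\<integral>\<^sup>+r\<in>{t..s}. ennreal ((norm (elementary_process es r \<omega>))\<^sup>2) \<partial>lborel)
       = (\<integral>\<^sup>+r. ennreal ((norm (elementary_process es r \<omega>))\<^sup>2) \<partial>lborel)"
      using zero by (intro nn_integral_cong) (auto simp: indicator_def)
    also have "\<dots> = ennreal (Q \<omega>)"
      using P[of \<omega>] by (subst nn_integral_eq_integral) (auto simp: has_bochner_integral_iff)
    finally show ?thesis .
  qed
  moreover have "(\<integral>\<^sup>+\<omega>. ennreal (Q \<omega>) \<partial>M) = ennreal V"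
    using Q Q0 by (subst nn_integral_eq_integral) (auto simp: has_bochner_integral_iff)
  moreover have "(msq M (elementary_integral W es)) = ennreal V"
    using I by (subst nn_integral_eq_integral) (auto simp: has_bochner_integral_iff)
  ultimately show "(msq M (elementary_integral W es))
      = (\<integral>\<^sup>+\<omega>. (\<integral>\<^sup>+r\<in>{t..s}. ennreal ((norm (elementary_process es r \<omega>))\<^sup>2) \<partial>lborel) \<partial>M)" by simp
  show "integrable M (\<lambda>\<omega>. (norm (elementary_integral W es \<omega>))\<^sup>2)" using I by (rule integrable.intros)
qed

section \<open>Martingale property and Doob's inequality for elementary integrals\<close>

lemma elementary_integral_at_adapted:
  assumes t: "0 \<le> t" "t \<le> s" and es: "elementary M F t T es"
  shows "elementary_integral_at W es s \<in> borel_measurable (F s)"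
proof -
  have "(\<lambda>\<omega>. (W (min q s) \<omega> - W (min p s) \<omega>) *\<^sub>R \<xi> \<omega>) \<in> borel_measurable (F s)"
    if x: "(p, q, \<xi>) \<in> set es" for p q \<xi>
  proof (cases "p \<le> s")
    case True
    then show ?thesis using es x t unfolding elementary_def
      by (intro borel_measurable_scaleR borel_measurable_diff W_adapted) (auto intro: measurable_F_mono)
  next
    case False
    then have "min q s = s" "min p s = s" using es x unfolding elementary_def by auto
    then show ?thesis by simp
  qed
  then have "(\<lambda>\<omega>. \<Sum>x\<leftarrow>es. (case x of (p, q, \<xi>) \<Rightarrow> (W (min q s) \<omega> - W (min p s) \<omega>) *\<^sub>R \<xi> \<omega>)) \<in> borel_measurable (F s)"
    by (induction es) (auto intro!: borel_measurable_add)
  then show ?thesis unfolding elementary_integral_at_def by simp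
qed

lemma elementary_integral_at_L2:
  assumes "0 \<le> t" "t \<le> s" "elementary M F t T es"
  shows "elementary_integral_at W es s \<in> L2 M (F s)"
  using elementary_integral_at_adapted[OF assms]
    elementary_isometry(2)[OF assms(1) elementary_elementary_restrict[OF assms(3), of s]]
  by (simp add: L2_def elementary_integral_restrict[OF assms(3)])

lemma elementary_integral_at_isometry:
  assumes "0 \<le> t" "elementary M F t T es"
  shows "(msq M (elementary_integral_at W es s))
      = (\<integral>\<^sup>+\<omega>. (\<integral>\<^sup>+r\<in>{t..s}. ennreal ((norm (elementary_process es r \<omega>))\<^sup>2) \<partial>lborel) \<partial>M)"
  unfolding elementary_integral_restrict[OF assms(2), symmetric]
    elementary_isometry(1)[OF assms(1) elementary_elementary_restrict[OF assms(2)]]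
  by (intro nn_integral_cong) (auto simp: indicator_def elementary_process_restrict)

lemma elementary_integral_at_continuous:
  assumes t: "0 \<le> t" and es: "elementary M F t T es"
  shows "AE \<omega> in M. continuous_on {t..} (\<lambda>s. elementary_integral_at W es s \<omega>)"
  using W_continuous
proof eventually_elim
  case (elim \<omega>)
  have "continuous_on {t..} (\<lambda>s. (W (min q s) \<omega> - W (min p s) \<omega>) *\<^sub>R \<xi> \<omega>)"
    if x: "(p, q, \<xi>) \<in> set es" for p q and \<xi> :: "'a \<Rightarrow> 'b"
    using es x t unfolding elementary_def
    by (intro continuous_intros continuous_on_compose2[OF elim]) auto
  then have "continuous_on {t..} (\<lambda>s. \<Sum>x\<leftarrow>es. (case x of (p, q, \<xi>) \<Rightarrow> (W (min q s) \<omega> - W (min p s) \<omega>) *\<^sub>R \<xi> \<omega>))"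
    by (induction es) (auto intro!: continuous_on_add)
  then show ?case unfolding elementary_integral_at_def by simp
qed

text \<open>Orthogonality to every square integrable \<open>F s\<close>-measurable \<open>Z\<close>
  replaces the conditional expectation. Each entry contributes
  \<open>inner (Z \<omega>) (\<xi> \<omega>)\<close> times an increment that starts only when both
  factors are known.\<close>

lemma elementary_integral_martingale:
  fixes es :: "(real \<times> real \<times> ('a \<Rightarrow> 'b::euclidean_space)) list"
  assumes t: "0 \<le> t" "t \<le> s" "s \<le> s'" and es: "elementary M F t T es" and Z: "Z \<in> L2 M (F s)"
  shows "has_bochner_integral M
    (\<lambda>\<omega>. inner (Z \<omega>) (elementary_integral_at W es s' \<omega> - elementary_integral_at W es s \<omega>)) 0"
proof -
  have ZF: "Z \<in> borel_measurable (F s)" using Z unfolding L2_def by simp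
  have ZM: "Z \<in> borel_measurable M" using ZF by (rule measurable_F)
  have increment: "has_bochner_integral M (\<lambda>\<omega>. inner (Z \<omega>)
      ((W (min q s') \<omega> - W (min p s') \<omega>) *\<^sub>R \<xi> \<omega> - (W (min q s) \<omega> - W (min p s) \<omega>) *\<^sub>R \<xi> \<omega>)) 0"
    if x: "(p, q, \<xi>) \<in> set es" for p q and \<xi> :: "'a \<Rightarrow> 'b"
  proof -
    have el: "t \<le> p" "p \<le> q" "\<xi> \<in> borel_measurable (F p)" using es x unfolding elementary_def by auto
    obtain c where c: "\<And>\<omega>. \<omega> \<in> space M \<Longrightarrow> norm (\<xi> \<omega>) \<le> c" using es x unfolding elementary_def by fastforce
    have \<xi>M: "\<xi> \<in> borel_measurable M" using el(3) by (rule measurable_F)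
    show ?thesis
    proof (cases "p < s' \<and> s < q")
      \<comment> \<open>The interval of the entry does not meet the open interval from
        \<open>s\<close> to \<open>s'\<close>, and nothing is added between these times.\<close>
      case False
      then have "min q s' = s' \<and> min p s' = s' \<and> min q s = s \<and> min p s = s
          \<or> min q s' = q \<and> min q s = q \<and> min p s' = p \<and> min p s = p" using el t by auto
      then have "(W (min q s') \<omega> - W (min p s') \<omega>) *\<^sub>R \<xi> \<omega> - (W (min q s) \<omega> - W (min p s) \<omega>) *\<^sub>R \<xi> \<omega> = 0" for \<omega>
        by (elim disjE conjE) simp_all
      then show ?thesis by (simp only: inner_zero_right has_bochner_integral_zero)
    next
      case True
      \<comment> \<open>The part of the entry between \<open>s\<close> and \<open>s'\<close> starts
        at \<open>max p s\<close>, where both \<open>Z\<close> and \<open>\<xi>\<close> are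
        measurable.\<close>
      have eq: "(W (min q s') \<omega> - W (min p s') \<omega>) *\<^sub>R \<xi> \<omega> - (W (min q s) \<omega> - W (min p s) \<omega>) *\<^sub>R \<xi> \<omega>
        = (W (min q s') \<omega> - W (max p s) \<omega>) *\<^sub>R \<xi> \<omega>" for \<omega>
        using True el t by (cases "p \<le> s") (auto simp: min_def max_def scaleR_left_diff_distrib)
      have "has_bochner_integral M (\<lambda>\<omega>. inner (Z \<omega>) (\<xi> \<omega>) * (W (min q s') \<omega> - W (max p s) \<omega>)) 0"
      proof (rule increment_mult)
        show "(\<lambda>\<omega>. inner (Z \<omega>) (\<xi> \<omega>)) \<in> borel_measurable (F (max p s))"
          by (rule borel_measurable_inner[OF measurable_F_mono[OF ZF] measurable_F_mono[OF el(3)]]) auto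
        have "(norm (\<xi> \<omega>))\<^sup>2 \<le> c\<^sup>2" if "\<omega> \<in> space M" for \<omega> using c[OF that] by (intro power_mono) auto
        then have i: "integrable M (\<lambda>\<omega>. (norm (\<xi> \<omega>))\<^sup>2)"
          using \<xi>M by (intro integrable_const_bound[of _ "c\<^sup>2"]) (simp_all add: AE_I2)
        have "integrable M (\<lambda>\<omega>. (norm (Z \<omega>))\<^sup>2)" using Z unfolding L2_def by simp
        then show "integrable M (\<lambda>\<omega>. inner (Z \<omega>) (\<xi> \<omega>))"
          by (rule L2_integrable_inner[OF ZM _ \<xi>M i])
      qed (use True t el in auto)
      then show ?thesis unfolding eq by (simp add: mult.commute)
    qed
  qed
  have eq: "elementary_integral_at W es s' \<omega> - elementary_integral_at W es s \<omega>
    = (\<Sum>x\<leftarrow>es. case x of (p, q, \<xi>) \<Rightarrow> (W (min q s') \<omega> - W (min p s') \<omega>) *\<^sub>R \<xi> \<omega>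
        - (W (min q s) \<omega> - W (min p s) \<omega>) *\<^sub>R \<xi> \<omega>)" for \<omega>
    unfolding elementary_integral_at_def by (induction es) auto
  have in_sum: "inner z (\<Sum>x\<leftarrow>es. g x) = (\<Sum>x\<leftarrow>es. inner z (g x))" for z and g :: "_ \<Rightarrow> 'b"
    by (induction es) (auto simp: inner_add_right)
  have "has_bochner_integral M (\<lambda>\<omega>. \<Sum>x\<leftarrow>es. inner (Z \<omega>) (case x of (p, q, \<xi>) \<Rightarrow> (W (min q s') \<omega> - W (min p s') \<omega>) *\<^sub>R \<xi> \<omega>
        - (W (min q s) \<omega> - W (min p s) \<omega>) *\<^sub>R \<xi> \<omega>)) (\<Sum>x\<leftarrow>es. 0)"
  proof (rule has_bochner_integral_sum_list)
    fix x assume x: "x \<in> set es"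
    obtain p q \<xi> where "x = (p, q, \<xi>)" by (cases x)
    then show "has_bochner_integral M (\<lambda>\<omega>. inner (Z \<omega>) (case x of (p, q, \<xi>) \<Rightarrow> (W (min q s') \<omega> - W (min p s') \<omega>) *\<^sub>R \<xi> \<omega>
        - (W (min q s) \<omega> - W (min p s) \<omega>) *\<^sub>R \<xi> \<omega>)) 0" using increment[of p q \<xi>] x by simp
  qed
  then show ?thesis unfolding eq in_sum by simp
qed

text \<open>With \<open>a\<close> the norm of the martingale and \<open>m\<close> its running maximum, integrate the pathwise inequality
  \<open>\<Sum>\<^sub>k m\<^sub>k (a\<^bsub>k+1\<^esub> - a\<^sub>k) \<le> m\<^sub>n a\<^sub>n - m\<^sub>n\<^sup>2 / 2\<close>; its left side has nonnegative expectation.\<close>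

lemma doob_L2_finite:
  fixes N :: "nat \<Rightarrow> 'a \<Rightarrow> 'b::euclidean_space"
  assumes \<tau>: "incseq \<tau>" and N: "\<And>k. k \<le> n \<Longrightarrow> N k \<in> L2 M (F (\<tau> k))"
    and mart: "\<And>k Z. k < n \<Longrightarrow> Z \<in> L2 M (F (\<tau> k)) \<Longrightarrow> has_bochner_integral M (\<lambda>\<omega>. inner (Z \<omega>) (N (Suc k) \<omega> - N k \<omega>)) 0"
  shows "(\<integral>\<^sup>+\<omega>. (SUP k\<in>{..n}. ennreal ((norm (N k \<omega>))\<^sup>2)) \<partial>M) \<le> 4 * (msq M (N n))"
proof -
  define m where "m k \<omega> = running_max (\<lambda>j. norm (N j \<omega>)) k" for k \<omega>
  have m0: "0 \<le> m k \<omega>" for k \<omega>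
    using running_max_ge[of 0 k "\<lambda>j. norm (N j \<omega>)"] norm_ge_zero[of "N 0 \<omega>"] unfolding m_def by linarith
  have NF: "N j \<in> borel_measurable (F (\<tau> k))" if "j \<le> k" "k \<le> n" for j k
    using N[of j] that incseqD[OF \<tau>, of j k] unfolding L2_def by (auto intro: measurable_F_mono)
  have mF: "m k \<in> borel_measurable (F (\<tau> k))" if "k \<le> n" for k
    unfolding m_def using NF that by (intro running_max_measurable borel_measurable_norm) auto
  have NM: "N k \<in> borel_measurable M" if "k \<le> n" for k using measurable_F[OF NF[of k k]] that by auto
  have mM: "m k \<in> borel_measurable M" if "k \<le> n" for k using measurable_F[OF mF] that by auto
  have Ni: "integrable M (\<lambda>\<omega>. (norm (N k \<omega>))\<^sup>2)" if "k \<le> n" for k using N[OF that] unfolding L2_def by auto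
  have mi: "integrable M (\<lambda>\<omega>. (m k \<omega>)\<^sup>2)" if k: "k \<le> n" for k
  proof (rule Bochner_Integration.integrable_bound)
    show "integrable M (\<lambda>\<omega>. \<Sum>j\<le>k. (norm (N j \<omega>))\<^sup>2)" using Ni k by auto
    show "(\<lambda>\<omega>. (m k \<omega>)\<^sup>2) \<in> borel_measurable M" using mM[OF k] by auto
    have "(m k \<omega>)\<^sup>2 \<le> (\<Sum>j\<le>k. (norm (N j \<omega>))\<^sup>2)" for \<omega>
    proof -
      obtain j where j: "j \<le> k" "m k \<omega> = norm (N j \<omega>)"
        using running_max_eq[of k "\<lambda>j. norm (N j \<omega>)"] unfolding m_def by auto
      show ?thesis unfolding j(2) using j(1) by (intro member_le_sum) auto
    qed
    then show "AE \<omega> in M. norm ((m k \<omega>)\<^sup>2) \<le> norm (\<Sum>j\<le>k. (norm (N j \<omega>))\<^sup>2)"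
      by (auto simp: sum_nonneg)
  qed
  \<comment> \<open>The direction \<open>sgn\<close> turns the pathwise inequality for norms into
    one for vectors: by Cauchy-Schwarz, the inner product of \<open>sgn (N k)\<close> with an
    increment is at most the increment of the norm.\<close>
  define Z where "Z k \<omega> = m k \<omega> *\<^sub>R sgn (N k \<omega>)" for k \<omega>
  have Z: "Z k \<in> L2 M (F (\<tau> k))" if k: "k \<le> n" for k
  proof -
    have s: "(\<lambda>\<omega>. sgn (N k \<omega>)) \<in> borel_measurable (F (\<tau> k))"
      unfolding sgn_div_norm using NF[of k k] k
      by (intro borel_measurable_scaleR borel_measurable_inverse borel_measurable_norm) auto
    have ZF: "Z k \<in> borel_measurable (F (\<tau> k))" unfolding Z_def using s mF[OF k] by (intro borel_measurable_scaleR)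
    have "integrable M (\<lambda>\<omega>. (norm (Z k \<omega>))\<^sup>2)"
    proof (rule Bochner_Integration.integrable_bound[OF mi[OF k]])
      show "(\<lambda>\<omega>. (norm (Z k \<omega>))\<^sup>2) \<in> borel_measurable M" using measurable_F[OF ZF] by auto
      show "AE \<omega> in M. norm ((norm (Z k \<omega>))\<^sup>2) \<le> norm ((m k \<omega>)\<^sup>2)"
        by (auto simp: Z_def norm_sgn power_mult_distrib)
    qed
    then show ?thesis using ZF by (simp add: L2_def)
  qed
  have path: "(m n \<omega>)\<^sup>2 / 4 + (\<Sum>k<n. inner (Z k \<omega>) (N (Suc k) \<omega> - N k \<omega>)) \<le> (norm (N n \<omega>))\<^sup>2" for \<omega>
  proof -
    have "inner (Z k \<omega>) (N (Suc k) \<omega> - N k \<omega>) \<le> m k \<omega> * (norm (N (Suc k) \<omega>) - norm (N k \<omega>))" for k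
    proof -
      have "inner (sgn (N k \<omega>)) (N (Suc k) \<omega>) \<le> norm (sgn (N k \<omega>)) * norm (N (Suc k) \<omega>)" by (rule norm_cauchy_schwarz)
      also have "\<dots> \<le> norm (N (Suc k) \<omega>)" by (simp add: norm_sgn)
      finally have "inner (sgn (N k \<omega>)) (N (Suc k) \<omega>) \<le> norm (N (Suc k) \<omega>)" .
      moreover have "inner (sgn (N k \<omega>)) (N k \<omega>) = norm (N k \<omega>)"
        by (cases "N k \<omega> = 0") (simp_all add: sgn_div_norm power2_norm_eq_inner[symmetric] power2_eq_square)
      ultimately have "inner (sgn (N k \<omega>)) (N (Suc k) \<omega> - N k \<omega>) \<le> norm (N (Suc k) \<omega>) - norm (N k \<omega>)"
        by (simp add: inner_diff_right)
      then show ?thesis unfolding Z_def inner_scaleR_left using m0 by (rule mult_left_mono)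
    qed
    then have "(\<Sum>k<n. inner (Z k \<omega>) (N (Suc k) \<omega> - N k \<omega>)) \<le> (\<Sum>k<n. m k \<omega> * (norm (N (Suc k) \<omega>) - norm (N k \<omega>)))"
      by (rule sum_mono)
    also have "\<dots> \<le> m n \<omega> * norm (N n \<omega>) - (m n \<omega>)\<^sup>2 / 2" unfolding m_def by (rule running_max_sum_le)
    \<comment> \<open>The difference of the two sides is the square of m / 2 - a, where a is the
      last norm. The resulting term m^2 / 4 yields the constant 4.\<close>
    also have "\<dots> \<le> (norm (N n \<omega>))\<^sup>2 - (m n \<omega>)\<^sup>2 / 4"
      using zero_le_power2[of "m n \<omega> / 2 - norm (N n \<omega>)"] by (simp add: power2_eq_square algebra_simps)
    finally show ?thesis by simp
  qed
  have zero: "has_bochner_integral M (\<lambda>\<omega>. \<Sum>k<n. inner (Z k \<omega>) (N (Suc k) \<omega> - N k \<omega>)) (\<Sum>k<n. 0)"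
    by (intro has_bochner_integral_sum mart Z) auto
  have "(\<integral>\<omega>. (m n \<omega>)\<^sup>2 / 4 + (\<Sum>k<n. inner (Z k \<omega>) (N (Suc k) \<omega> - N k \<omega>)) \<partial>M) \<le> (\<integral>\<omega>. (norm (N n \<omega>))\<^sup>2 \<partial>M)"
    using zero mi[of n] Ni[of n] path by (intro integral_mono) (auto intro: integrable.intros)
  moreover have "(\<integral>\<omega>. (m n \<omega>)\<^sup>2 / 4 + (\<Sum>k<n. inner (Z k \<omega>) (N (Suc k) \<omega> - N k \<omega>)) \<partial>M) = (\<integral>\<omega>. (m n \<omega>)\<^sup>2 \<partial>M) / 4"
    using zero mi[of n] by (subst Bochner_Integration.integral_add) (auto simp: has_bochner_integral_iff)
  ultimately have le: "(\<integral>\<omega>. (m n \<omega>)\<^sup>2 \<partial>M) \<le> 4 * (\<integral>\<omega>. (norm (N n \<omega>))\<^sup>2 \<partial>M)" by simp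
  have "(\<integral>\<^sup>+\<omega>. (SUP k\<in>{..n}. ennreal ((norm (N k \<omega>))\<^sup>2)) \<partial>M) \<le> (\<integral>\<^sup>+\<omega>. ennreal ((m n \<omega>)\<^sup>2) \<partial>M)"
    unfolding m_def by (intro nn_integral_mono SUP_least ennreal_leI power_mono running_max_ge[of _ n "\<lambda>j. norm (N j _)"]) auto
  also have "\<dots> = ennreal (\<integral>\<omega>. (m n \<omega>)\<^sup>2 \<partial>M)" using mi by (intro nn_integral_eq_integral) auto
  also have "\<dots> \<le> ennreal (4 * (\<integral>\<omega>. (norm (N n \<omega>))\<^sup>2 \<partial>M))" using le by (rule ennreal_leI)
  also have "\<dots> = 4 * (msq M (N n))"
    using Ni[of n] by (simp add: ennreal_mult nn_integral_eq_integral)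
  finally show ?thesis .
qed

text \<open>Almost sure continuity reduces to dyadic times and completeness absorbs the exceptional
  paths. The second claim lets a bound that is uniform over finite grids pass to the full
  supremum.\<close>

lemma sup_sq_measurable:
  fixes X :: "real \<Rightarrow> 'a \<Rightarrow> 'b::euclidean_space"
  assumes ts: "t \<le> s" and X: "\<And>r. r \<in> {t..s} \<Longrightarrow> X r \<in> borel_measurable M"
    and c: "AE \<omega> in M. continuous_on {t..s} (\<lambda>r. X r \<omega>)"
  shows "(\<lambda>\<omega>. SUP r\<in>{t..s}. ennreal ((norm (X r \<omega>))\<^sup>2)) \<in> borel_measurable M"
    and "sup_sq_expectation M t s X
      = (SUP n. \<integral>\<^sup>+\<omega>. (SUP k\<in>{..2^n::nat}. ennreal ((norm (X (t + (s - t) * real k / 2^n) \<omega>))\<^sup>2)) \<partial>M)"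
proof -
  have in_grid: "t + (s - t) * real k / 2^n \<in> {t..s}" if "k \<in> {..2^n}" for k n :: nat
    using dyadic_point_in[OF ts] that by simp
  have m: "(\<lambda>\<omega>. SUP k\<in>{..2^n::nat}. ennreal ((norm (X (t + (s - t) * real k / 2^n) \<omega>))\<^sup>2)) \<in> borel_measurable M" for n
    using X[OF in_grid] by (intro borel_measurable_SUP) auto
  have ae: "AE \<omega> in M. (SUP n. SUP k\<in>{..2^n::nat}. ennreal ((norm (X (t + (s - t) * real k / 2^n) \<omega>))\<^sup>2))
     = (SUP r\<in>{t..s}. ennreal ((norm (X r \<omega>))\<^sup>2))"
    using c by eventually_elim (simp add: SUP_dyadic_grid[OF _ ts])
  show "(\<lambda>\<omega>. SUP r\<in>{t..s}. ennreal ((norm (X r \<omega>))\<^sup>2)) \<in> borel_measurable M"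
    by (rule measurable_M_AE_cong[OF borel_measurable_SUP ae]) (use m in auto)
  have "sup_sq_expectation M t s X
     = (\<integral>\<^sup>+\<omega>. (SUP n. SUP k\<in>{..2^n::nat}. ennreal ((norm (X (t + (s - t) * real k / 2^n) \<omega>))\<^sup>2)) \<partial>M)"
    unfolding sup_sq_expectation_def using ae by (intro nn_integral_cong_AE) auto
  also have "\<dots> = (SUP n. \<integral>\<^sup>+\<omega>. (SUP k\<in>{..2^n::nat}. ennreal ((norm (X (t + (s - t) * real k / 2^n) \<omega>))\<^sup>2)) \<partial>M)"
  proof (rule nn_integral_monotone_convergence_SUP[OF _ m])
    show "incseq (\<lambda>n \<omega>. SUP k\<in>{..2^n::nat}. ennreal ((norm (X (t + (s - t) * real k / 2^n) \<omega>))\<^sup>2))"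
      using dyadic_SUP_mono[of "\<lambda>r. X r _" t s] by (auto simp: incseq_def le_fun_def)
  qed
  finally show "sup_sq_expectation M t s X
      = (SUP n. \<integral>\<^sup>+\<omega>. (SUP k\<in>{..2^n::nat}. ennreal ((norm (X (t + (s - t) * real k / 2^n) \<omega>))\<^sup>2)) \<partial>M)" .
qed

text \<open>Doob's inequality is applied to the integral sampled at each dyadic level. The last
  sample is always the value at \<open>s\<close>, so the isometry gives a bound that does not depend
  on the level.\<close>

lemma elementary_integral_doob:
  assumes t: "0 \<le> t" "t \<le> s" and es: "elementary M F t T es"
  shows "sup_sq_expectation M t s (elementary_integral_at W es)
     \<le> 4 * (\<integral>\<^sup>+\<omega>. (\<integral>\<^sup>+r\<in>{t..s}. ennreal ((norm (elementary_process es r \<omega>))\<^sup>2) \<partial>lborel) \<partial>M)"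
proof -
  have cont: "AE \<omega> in M. continuous_on {t..s} (\<lambda>r. elementary_integral_at W es r \<omega>)"
    using elementary_integral_at_continuous[OF t(1) es] by eventually_elim (auto intro: continuous_on_subset)
  have "(\<integral>\<^sup>+\<omega>. (SUP k\<in>{..2^n::nat}. ennreal ((norm (elementary_integral_at W es (t + (s - t) * real k / 2^n) \<omega>))\<^sup>2)) \<partial>M)
     \<le> 4 * (\<integral>\<^sup>+\<omega>. (\<integral>\<^sup>+r\<in>{t..s}. ennreal ((norm (elementary_process es r \<omega>))\<^sup>2) \<partial>lborel) \<partial>M)" for n
  proof -
    define \<tau> where "\<tau> k = t + (s - t) * real k / 2^n" for k :: nat
    have inc: "incseq \<tau>" unfolding \<tau>_def using t by (intro incseq_SucI add_left_mono divide_right_mono mult_left_mono) auto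
    have t\<tau>: "t \<le> \<tau> k" for k using t unfolding \<tau>_def by auto
    have "\<tau> (2^n) = s" unfolding \<tau>_def by simp
    then show ?thesis
      using doob_L2_finite[of \<tau> "2^n" "\<lambda>k. elementary_integral_at W es (\<tau> k)"] inc
        elementary_integral_at_L2[OF t(1) t\<tau> es] elementary_integral_martingale[OF t(1) t\<tau> incseq_SucD[OF inc] es]
        elementary_integral_at_isometry[OF t(1) es, of s]
      unfolding \<tau>_def[symmetric] by simp
  qed
  moreover have "elementary_integral_at W es r \<in> borel_measurable M" if "r \<in> {t..s}" for r
    using elementary_integral_at_adapted[OF t(1) _ es, of r] that by (auto intro: measurable_F)
  ultimately show ?thesis using sup_sq_measurable(2)[OF t(2) _ cont] by (auto intro!: SUP_least)
qed

end

section \<open>Progressive processes and density of elementary integrands\<close>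

lemma ennreal_tendsto_0I:
  fixes x :: "nat \<Rightarrow> ennreal"
  assumes "\<And>e::real. 0 < e \<Longrightarrow> eventually (\<lambda>n. x n \<le> ennreal e) sequentially"
  shows "x \<longlonglongrightarrow> 0"
proof (rule order_tendstoI)
  fix a :: ennreal assume "0 < a"
  then obtain y where y: "0 < y" "y < a" using dense by blast
  then obtain e where e: "y = ennreal e" "0 \<le> e" by (cases y) auto
  then have "0 < e" using y by (cases "e = 0") auto
  from assms[OF this] show "eventually (\<lambda>n. x n < a) sequentially"
    by eventually_elim (use y e in auto)
qed simp

lemma ennreal_tendsto_0D:
  fixes x :: "nat \<Rightarrow> ennreal"
  assumes "x \<longlonglongrightarrow> 0" "0 < e"
  shows "eventually (\<lambda>n. x n < ennreal e) sequentially"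
  using order_tendstoD(2)[OF assms(1), of "ennreal e"] assms(2) by simp

definition proc_energy :: "'a measure \<Rightarrow> real \<Rightarrow> real \<Rightarrow> (real \<Rightarrow> 'a \<Rightarrow> 'b::euclidean_space) \<Rightarrow> ennreal" where
  "proc_energy M t s \<phi> = (\<integral>\<^sup>+\<omega>. (\<integral>\<^sup>+r\<in>{t..s}. ennreal ((norm (\<phi> r \<omega>))\<^sup>2) \<partial>lborel) \<partial>M)"

section \<open>Closure properties of progressive processes\<close>

lemma progressive_add: "progressive F t T \<phi> \<Longrightarrow> progressive F t T \<psi> \<Longrightarrow> progressive F t T (\<lambda>s \<omega>. \<phi> s \<omega> + \<psi> s \<omega>)"
  unfolding progressive_def split_beta by (auto intro: borel_measurable_add)

lemma progressive_diff: "progressive F t T \<phi> \<Longrightarrow> progressive F t T \<psi> \<Longrightarrow> progressive F t T (\<lambda>s \<omega>. \<phi> s \<omega> - \<psi> s \<omega>)"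
  unfolding progressive_def split_beta by (auto intro: borel_measurable_diff)

text \<open>\<open>lim\<close> has some value even where the sequence diverges, and is measurable
  there too; hence the limit is progressive without removing an exceptional set.\<close>

lemma progressive_lim:
  fixes X :: "nat \<Rightarrow> real \<Rightarrow> 'a \<Rightarrow> 'b::euclidean_space"
  assumes "\<And>n. progressive F t T (X n)" shows "progressive F t T (\<lambda>s \<omega>. lim (\<lambda>n. X n s \<omega>))"
  using assms unfolding progressive_def split_beta by (auto intro: borel_measurable_lim_metric)

lemma progressive_comp:
  assumes "progressive F t T \<phi>" "h \<in> borel_measurable borel" shows "progressive F t T (\<lambda>s \<omega>. h (\<phi> s \<omega>))"
  using assms measurable_compose[OF _ assms(2)] unfolding progressive_def split_beta by auto

lemma progressive_indicator:
  fixes B :: "real set"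
  assumes "progressive F t T \<phi>" "B \<in> sets borel" shows "progressive F t T (\<lambda>s \<omega>. indicator B s *\<^sub>R \<phi> s \<omega>)"
  unfolding progressive_def split_beta
proof
  fix r assume "r \<in> {t..T}"
  then have \<phi>: "(\<lambda>x. \<phi> (fst x) (snd x)) \<in> borel_measurable (restrict_space borel {t..r} \<Otimes>\<^sub>M F r)"
    using assms unfolding progressive_def split_beta by auto
  have f: "fst \<in> borel_measurable (restrict_space borel {t..r} \<Otimes>\<^sub>M F r)"
    by (rule measurable_compose[OF measurable_fst]) (simp add: measurable_restrict_space1)
  have "(\<lambda>x. indicat_real B (fst x)) \<in> borel_measurable (restrict_space borel {t..r} \<Otimes>\<^sub>M F r)"
    by (rule measurable_compose[OF f borel_measurable_indicator]) (use assms in auto)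
  then show "(\<lambda>x. indicat_real B (fst x) *\<^sub>R \<phi> (fst x) (snd x)) \<in> borel_measurable (restrict_space borel {t..r} \<Otimes>\<^sub>M F r)"
    using \<phi> by (rule borel_measurable_scaleR)
qed

text \<open>Replaces the restricted time space by the whole line: it suffices to agree on
  \<open>{t..r}\<close> with a jointly measurable function. Extension by zero in
  \<open>progressive_joint\<close> is the converse.\<close>

lemma progressiveI_joint:
  assumes "\<And>r. r \<in> {t..T} \<Longrightarrow> \<exists>\<psi>\<in>borel_measurable (borel \<Otimes>\<^sub>M F r). \<forall>s\<in>{t..r}. \<forall>\<omega>\<in>space (F r). \<phi> s \<omega> = \<psi> (s, \<omega>)"
  shows "progressive F t T \<phi>"
  unfolding progressive_def
proof
  fix r assume "r \<in> {t..T}"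
  from assms[OF this] obtain \<psi> where \<psi>: "\<psi> \<in> borel_measurable (borel \<Otimes>\<^sub>M F r)"
    and eq: "\<And>s \<omega>. s \<in> {t..r} \<Longrightarrow> \<omega> \<in> space (F r) \<Longrightarrow> \<phi> s \<omega> = \<psi> (s, \<omega>)" by blast
  have "(\<lambda>x. (fst x, snd x)) \<in> measurable (restrict_space borel {t..r} \<Otimes>\<^sub>M F r) (borel \<Otimes>\<^sub>M F r)"
  proof (rule measurable_Pair)
    show "fst \<in> borel_measurable (restrict_space borel {t..r} \<Otimes>\<^sub>M F r)"
      by (rule measurable_compose[OF measurable_fst]) (simp add: measurable_restrict_space1)
  qed (rule measurable_snd)
  from measurable_compose[OF this \<psi>]
  have "(\<lambda>x. \<psi> (fst x, snd x)) \<in> borel_measurable (restrict_space borel {t..r} \<Otimes>\<^sub>M F r)" .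
  then show "(\<lambda>(s, \<omega>). \<phi> s \<omega>) \<in> borel_measurable (restrict_space borel {t..r} \<Otimes>\<^sub>M F r)"
    by (rule measurable_cong[THEN iffD1, rotated]) (auto simp: space_pair_measure space_restrict_space eq)
qed

lemma progressive_joint:
  fixes \<phi> :: "real \<Rightarrow> 'a \<Rightarrow> 'b::euclidean_space"
  assumes \<phi>: "progressive F t T \<phi>" and r: "r \<in> {t..T}"
  shows "(\<lambda>x. indicator {t..r} (fst x) *\<^sub>R \<phi> (fst x) (snd x)) \<in> borel_measurable (borel \<Otimes>\<^sub>M F r)"
proof -
  let ?A = "{t..r} \<times> space (F r)"
  have A: "?A \<in> sets (borel \<Otimes>\<^sub>M F r)" by (intro pair_measureI) auto
  have "(\<lambda>x. (fst x, snd x)) \<in> measurable (restrict_space (borel \<Otimes>\<^sub>M F r) ?A) (restrict_space borel {t..r} \<Otimes>\<^sub>M F r)"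
  proof (rule measurable_Pair)
    have "fst \<in> borel_measurable (restrict_space (borel \<Otimes>\<^sub>M F r) ?A)"
      by (rule measurable_restrict_space1) (rule measurable_fst)
    then show "fst \<in> measurable (restrict_space (borel \<Otimes>\<^sub>M F r) ?A) (restrict_space borel {t..r})"
      by (rule measurable_restrict_space2[rotated]) (simp add: space_restrict_space Pi_iff mem_Times_iff)
    show "snd \<in> measurable (restrict_space (borel \<Otimes>\<^sub>M F r) ?A) (F r)"
      by (rule measurable_restrict_space1) (rule measurable_snd)
  qed
  moreover have "(\<lambda>(s, \<omega>). \<phi> s \<omega>) \<in> borel_measurable (restrict_space borel {t..r} \<Otimes>\<^sub>M F r)"
    using \<phi> r unfolding progressive_def by (rule bspec)
  ultimately have "(\<lambda>x. case (fst x, snd x) of (s, \<omega>) \<Rightarrow> \<phi> s \<omega>) \<in> borel_measurable (restrict_space (borel \<Otimes>\<^sub>M F r) ?A)"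
    by (rule measurable_compose)
  then have "(\<lambda>x. \<phi> (fst x) (snd x)) \<in> borel_measurable (restrict_space (borel \<Otimes>\<^sub>M F r) ?A)"
    by (simp only: prod.case)
  then have "(\<lambda>x. indicator ?A x *\<^sub>R \<phi> (fst x) (snd x)) \<in> borel_measurable (borel \<Otimes>\<^sub>M F r)"
    by (subst (asm) borel_measurable_restrict_space_iff) (rule sets.Int[OF A sets.top])
  then show ?thesis
    by (rule measurable_cong[THEN iffD1, rotated]) (auto simp: space_pair_measure indicator_def)
qed

lemma progressive_section:
  fixes \<phi> :: "real \<Rightarrow> 'a \<Rightarrow> 'b::euclidean_space"
  assumes "progressive F t T \<phi>" "s \<in> {t..T}"
  shows "\<phi> s \<in> borel_measurable (F s)"
  using measurable_compose[OF measurable_Pair1'[of s borel "F s"] progressive_joint[OF assms]] assms(2) by simp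

lemma progressive_subinterval:
  fixes \<phi> :: "real \<Rightarrow> 'a \<Rightarrow> 'b::euclidean_space"
  assumes \<phi>: "progressive F t T \<phi>" and t: "t \<le> t'" "T' \<le> T"
  shows "progressive F t' T' \<phi>"
proof (rule progressiveI_joint)
  fix r assume "r \<in> {t'..T'}"
  then show "\<exists>\<psi>\<in>borel_measurable (borel \<Otimes>\<^sub>M F r). \<forall>s\<in>{t'..r}. \<forall>\<omega>\<in>space (F r). \<phi> s \<omega> = \<psi> (s, \<omega>)"
    using t by (intro bexI[OF _ progressive_joint[OF \<phi>, of r]]) auto
qed

text \<open>For \<open>r\<close> before \<open>t\<close> the extended process is zero on the whole
  interval, so nothing about \<open>\<phi>\<close> is asked there. Processes on
  \<open>{t..T}\<close> become admissible arguments for operators tested on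
  \<open>{0..T}\<close>.\<close>

lemma progressive_extend:
  fixes \<phi> :: "real \<Rightarrow> 'a \<Rightarrow> 'b::euclidean_space"
  assumes \<phi>: "progressive F t T \<phi>"
  shows "progressive F t0 T (\<lambda>s \<omega>. indicator {t..} s *\<^sub>R \<phi> s \<omega>)"
proof (rule progressiveI_joint)
  fix r assume r: "r \<in> {t0..T}"
  show "\<exists>\<psi>\<in>borel_measurable (borel \<Otimes>\<^sub>M F r). \<forall>s\<in>{t0..r}. \<forall>\<omega>\<in>space (F r). indicator {t..} s *\<^sub>R \<phi> s \<omega> = \<psi> (s, \<omega>)"
  proof (cases "t \<le> r")
    case True
    then show ?thesis using r by (intro bexI[OF _ progressive_joint[OF \<phi>, of r]]) (auto simp: indicator_def)
  next
    case False
    then show ?thesis by (intro bexI[of _ "\<lambda>_. 0"]) auto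
  qed
qed

section \<open>Shifted averages over uniform grids\<close>

lemma sum_indicator_Ioc:
  fixes a :: "nat \<Rightarrow> real"
  assumes "incseq a"
  shows "(\<Sum>k<n. indicat_real {a k<..a (Suc k)} s) = indicat_real {a 0<..a n} s"
proof (induction n)
  case (Suc n)
  have "a 0 \<le> a n" "a n \<le> a (Suc n)" using assms by (auto simp: incseq_def)
  then show ?case using Suc by (auto simp: indicator_def)
qed simp

definition block_average :: "(nat \<Rightarrow> real) \<Rightarrow> real \<Rightarrow> (real \<Rightarrow> 'b::euclidean_space) \<Rightarrow> nat \<Rightarrow> 'b" where
  "block_average a \<delta> u k = (1 / \<delta>) *\<^sub>R (LINT s|lborel. indicator {a k<..a (Suc k)} s *\<^sub>R u s)"

text \<open>The delay by one block makes the coefficient known when its interval starts. On the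
  first block there is no predecessor and the value is 0.\<close>

definition shifted_average :: "(nat \<Rightarrow> real) \<Rightarrow> real \<Rightarrow> nat \<Rightarrow> (real \<Rightarrow> 'b::euclidean_space) \<Rightarrow> real \<Rightarrow> 'b" where
  "shifted_average a \<delta> n u r = (\<Sum>k<n. indicator {a (Suc k)<..a (Suc (Suc k))} r *\<^sub>R block_average a \<delta> u k)"

lemma integrable_bounded_Ioc:
  fixes u :: "real \<Rightarrow> 'b::euclidean_space"
  assumes "u \<in> borel_measurable borel" "\<And>s. norm (u s) \<le> c"
  shows "integrable lborel (\<lambda>s. indicator {a<..b} s *\<^sub>R u s)"
proof (rule integrableI_bounded_set_indicator[where B = c])
  show "emeasure lborel {a<..b} < \<infinity>"
  proof (rule le_less_trans[OF emeasure_mono])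
    show "{a<..b} \<subseteq> {a..b}" by auto
    show "emeasure lborel {a..b} < \<infinity>" using emeasure_lborel_cbox_finite[of a b] by (simp only: cbox_interval)
  qed simp
qed (use assms in auto)

lemma block_average_diff:
  fixes u v :: "real \<Rightarrow> 'b::euclidean_space"
  assumes "u \<in> borel_measurable borel" "\<And>s. norm (u s) \<le> c" "v \<in> borel_measurable borel" "\<And>s. norm (v s) \<le> d"
  shows "block_average a \<delta> (\<lambda>s. u s - v s) k = block_average a \<delta> u k - block_average a \<delta> v k"
  unfolding block_average_def
  using Bochner_Integration.integral_diff[OF integrable_bounded_Ioc[OF assms(1,2)] integrable_bounded_Ioc[OF assms(3,4)], of "a k" "a (Suc k)" "a k" "a (Suc k)"]
  by (simp add: scaleR_right_diff_distrib)

lemma shifted_average_diff: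
  fixes u v :: "real \<Rightarrow> 'b::euclidean_space"
  assumes "u \<in> borel_measurable borel" "\<And>s. norm (u s) \<le> c" "v \<in> borel_measurable borel" "\<And>s. norm (v s) \<le> d"
  shows "shifted_average a \<delta> n (\<lambda>s. u s - v s) r = shifted_average a \<delta> n u r - shifted_average a \<delta> n v r"
  unfolding shifted_average_def by (simp add: block_average_diff[OF assms] scaleR_right_diff_distrib sum_subtractf)

lemma shifted_average_measurable[measurable]: "shifted_average a \<delta> n u \<in> borel_measurable borel"
  unfolding shifted_average_def by measurable

text \<open>There are \<open>Suc n\<close> blocks, so that the step is defined for
  \<open>n = 0\<close> and exactly \<open>n\<close> blocks have a predecessor.\<close>

locale uniform_grid =
  fixes t T :: real and a :: "nat \<Rightarrow> real" and \<delta> :: real and n :: nat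
  assumes tT: "t < T" and \<delta>: "\<delta> = (T - t) / real (Suc n)" and a: "\<And>k. a k = t + real k * \<delta>"
begin

lemma \<delta>_pos: "0 < \<delta>" using tT by (simp add: \<delta>)

lemma a_inc: "incseq a" using \<delta>_pos by (intro incseq_SucI) (simp add: a)

lemma a_Suc: "a (Suc k) = a k + \<delta>" by (simp add: a algebra_simps)

lemma a_0: "a 0 = t" by (simp add: a)

lemma a_end: "a (Suc n) = T"
  by (simp add: a \<delta>)

lemma emeasure_block: "emeasure lborel {a k<..a (Suc k)} = ennreal \<delta>"
  using \<delta>_pos by (simp add: a_Suc)

lemma block_const:
  fixes y :: "'b::euclidean_space"
  shows "integrable lborel (\<lambda>s. indicat_real {a k<..a (Suc k)} s *\<^sub>R y)"
    "(LINT s|lborel. indicat_real {a k<..a (Suc k)} s *\<^sub>R y) = \<delta> *\<^sub>R y"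
proof -
  show "integrable lborel (\<lambda>s. indicat_real {a k<..a (Suc k)} s *\<^sub>R y)"
    by (rule integrable_bounded_Ioc[where c = "norm y"]) auto
  show "(LINT s|lborel. indicat_real {a k<..a (Suc k)} s *\<^sub>R y) = \<delta> *\<^sub>R y"
    using emeasure_block[of k] \<delta>_pos by (simp add: measure_def)
qed

text \<open>An average of values within \<open>e\<close> of \<open>z\<close> is within
  \<open>e\<close> of \<open>z\<close>. With \<open>z = 0\<close> this is the uniform bound, with
  \<open>z\<close> a value of \<open>u\<close> the local approximation.\<close>

lemma block_average_bound:
  fixes u :: "real \<Rightarrow> 'b::euclidean_space"
  assumes u: "u \<in> borel_measurable borel" "\<And>s. norm (u s) \<le> c"
    and near: "\<And>s. s \<in> {a k<..a (Suc k)} \<Longrightarrow> norm (u s - z) \<le> e"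
  shows "norm (block_average a \<delta> u k - z) \<le> e"
proof -
  let ?I = "\<lambda>s. indicat_real {a k<..a (Suc k)} s"
  note ic = block_const(1) and c = block_const(2)
  have iu: "integrable lborel (\<lambda>s. ?I s *\<^sub>R u s)" using u by (rule integrable_bounded_Ioc)
  have "(LINT s|lborel. ?I s *\<^sub>R (u s - z)) = (LINT s|lborel. ?I s *\<^sub>R u s) - \<delta> *\<^sub>R z"
    unfolding scaleR_right_diff_distrib by (subst Bochner_Integration.integral_diff[OF iu ic]) (simp only: c)
  then have eq: "block_average a \<delta> u k - z = (1 / \<delta>) *\<^sub>R (LINT s|lborel. ?I s *\<^sub>R (u s - z))"
    using \<delta>_pos by (simp add: block_average_def scaleR_right_diff_distrib)
  have "norm (LINT s|lborel. ?I s *\<^sub>R (u s - z)) \<le> (LINT s|lborel. ?I s *\<^sub>R e)"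
  proof (rule order_trans[OF integral_norm_bound integral_mono])
    show "integrable lborel (\<lambda>s. norm (?I s *\<^sub>R (u s - z)))"
      unfolding scaleR_right_diff_distrib by (intro integrable_norm Bochner_Integration.integrable_diff iu ic)
    show "norm (?I s *\<^sub>R (u s - z)) \<le> ?I s *\<^sub>R e" for s
      using near[of s] by (auto simp: indicator_def)
  qed (rule ic)
  also have "\<dots> = \<delta> * e" unfolding c by simp
  finally show ?thesis unfolding eq using \<delta>_pos by (simp add: field_simps)
qed

lemma shifted_average_norm:
  fixes u :: "real \<Rightarrow> 'b::euclidean_space"
  assumes u: "u \<in> borel_measurable borel" "\<And>s. norm (u s) \<le> c"
  shows "norm (shifted_average a \<delta> n u r) \<le> c"
proof -
  have c0: "0 \<le> c" using order_trans[OF norm_ge_zero u(2)] .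
  have b: "norm (block_average a \<delta> u k) \<le> c" for k using block_average_bound[OF u, of k 0 c] u(2) by simp
  have "norm (shifted_average a \<delta> n u r) \<le> (\<Sum>k<n. indicator {a (Suc k)<..a (Suc (Suc k))} r * c)"
    unfolding shifted_average_def by (rule order_trans[OF norm_sum sum_mono]) (auto simp: indicator_def b)
  also have "\<dots> = indicator {a (Suc 0)<..a (Suc n)} r * c"
    using sum_indicator_Ioc[where a = "\<lambda>k. a (Suc k)" and n = n and s = r] a_inc by (simp add: sum_distrib_right[symmetric] incseq_def)
  also have "\<dots> \<le> c" using c0 by (auto simp: indicator_def)
  finally show ?thesis .
qed

text \<open>On each block the norm of the average times the block length is at most the integral of
  the norm over the preceding block. This contraction, uniform in the grid, carries convergence from
  continuous to measurable functions.\<close>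

lemma shifted_average_L1:
  fixes u :: "real \<Rightarrow> 'b::euclidean_space"
  assumes u: "u \<in> borel_measurable borel" "\<And>s. norm (u s) \<le> c"
  shows "(\<integral>\<^sup>+r. ennreal (norm (shifted_average a \<delta> n u r)) \<partial>lborel) \<le> (\<integral>\<^sup>+r\<in>{t..T}. ennreal (norm (u r)) \<partial>lborel)"
proof -
  have "(\<integral>\<^sup>+r. ennreal (norm (shifted_average a \<delta> n u r)) \<partial>lborel)
     \<le> (\<integral>\<^sup>+r. (\<Sum>k<n. ennreal (norm (block_average a \<delta> u k)) * indicator {a (Suc k)<..a (Suc (Suc k))} r) \<partial>lborel)"
  proof (rule nn_integral_mono)
    fix r
    have "norm (shifted_average a \<delta> n u r) \<le> (\<Sum>k<n. indicator {a (Suc k)<..a (Suc (Suc k))} r * norm (block_average a \<delta> u k))"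
      unfolding shifted_average_def by (rule order_trans[OF norm_sum]) simp
    then have "ennreal (norm (shifted_average a \<delta> n u r)) \<le> ennreal (\<Sum>k<n. indicator {a (Suc k)<..a (Suc (Suc k))} r * norm (block_average a \<delta> u k))"
      by (rule ennreal_leI)
    also have "\<dots> = (\<Sum>k<n. ennreal (norm (block_average a \<delta> u k)) * indicator {a (Suc k)<..a (Suc (Suc k))} r)"
      by (subst sum_ennreal[symmetric]) (auto intro!: sum.cong simp: indicator_def)
    finally show "ennreal (norm (shifted_average a \<delta> n u r)) \<le> (\<Sum>k<n. ennreal (norm (block_average a \<delta> u k)) * indicator {a (Suc k)<..a (Suc (Suc k))} r)" .
  qed
  also have "\<dots> = (\<Sum>k<n. ennreal (norm (block_average a \<delta> u k)) * ennreal \<delta>)"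
    by (subst nn_integral_sum) (auto simp: nn_integral_cmult_indicator emeasure_block simp del: emeasure_lborel_Ioc)
  also have "\<dots> \<le> (\<Sum>k<n. \<integral>\<^sup>+s. ennreal (norm (u s)) * indicator {a k<..a (Suc k)} s \<partial>lborel)"
  proof (rule sum_mono)
    fix k
    have "ennreal (norm (block_average a \<delta> u k)) * ennreal \<delta> = ennreal (norm (LINT s|lborel. indicator {a k<..a (Suc k)} s *\<^sub>R u s))"
      using \<delta>_pos by (simp add: block_average_def ennreal_mult[symmetric])
    also have "\<dots> \<le> (\<integral>\<^sup>+s. norm (indicator {a k<..a (Suc k)} s *\<^sub>R u s) \<partial>lborel)"
      by (rule integral_norm_bound_ennreal[OF integrable_bounded_Ioc[OF u]])
    also have "\<dots> = (\<integral>\<^sup>+s. ennreal (norm (u s)) * indicator {a k<..a (Suc k)} s \<partial>lborel)"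
      by (intro nn_integral_cong) (auto simp: indicator_def)
    finally show "ennreal (norm (block_average a \<delta> u k)) * ennreal \<delta> \<le> (\<integral>\<^sup>+s. ennreal (norm (u s)) * indicator {a k<..a (Suc k)} s \<partial>lborel)" .
  qed
  also have "\<dots> = (\<integral>\<^sup>+s. (\<Sum>k<n. ennreal (norm (u s)) * indicator {a k<..a (Suc k)} s) \<partial>lborel)"
    using u(1) by (subst nn_integral_sum) auto
  also have "\<dots> \<le> (\<integral>\<^sup>+r\<in>{t..T}. ennreal (norm (u r)) \<partial>lborel)"
  proof (rule nn_integral_mono)
    fix s
    have "(\<Sum>k<n. ennreal (norm (u s)) * indicator {a k<..a (Suc k)} s)
       = (\<Sum>k<n. ennreal (norm (u s) * indicat_real {a k<..a (Suc k)} s))"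
      by (rule sum.cong) (auto split: split_indicator)
    also have "\<dots> = ennreal (\<Sum>k<n. norm (u s) * indicat_real {a k<..a (Suc k)} s)"
      by (rule sum_ennreal) simp
    also have "\<dots> = ennreal (norm (u s) * indicat_real {a 0<..a n} s)"
      by (simp only: sum_distrib_left[symmetric] sum_indicator_Ioc[OF a_inc])
    also have "\<dots> \<le> ennreal (norm (u s)) * indicator {t..T} s"
    proof -
      have "a n \<le> T" using a_inc a_end by (metis incseq_SucD)
      then show ?thesis using a_0 by (auto simp: indicator_def)
    qed
    finally show "(\<Sum>k<n. ennreal (norm (u s)) * indicator {a k<..a (Suc k)} s) \<le> ennreal (norm (u s)) * indicator {t..T} s" .
  qed
  finally show ?thesis .
qed

text \<open>A point and the block averaged for it lie in two adjacent blocks, hence at distance at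
  most \<open>2 * \<delta>\<close>. Beyond the first block the indicators sum to 1, so the error is
  a convex combination of block errors.\<close>

lemma shifted_average_near:
  fixes u :: "real \<Rightarrow> 'b::euclidean_space"
  assumes u: "u \<in> borel_measurable borel" "\<And>s. norm (u s) \<le> c" and r: "a 1 < r" "r \<le> T"
    and near: "\<And>s. \<bar>s - r\<bar> \<le> 2 * \<delta> \<Longrightarrow> norm (u s - u r) \<le> e"
  shows "norm (shifted_average a \<delta> n u r - u r) \<le> e"
proof -
  let ?I = "\<lambda>k. indicat_real {a (Suc k)<..a (Suc (Suc k))} r"
  have one: "(\<Sum>k<n. ?I k) = 1"
    using sum_indicator_Ioc[where a = "\<lambda>k. a (Suc k)" and n = n and s = r] a_inc r a_end by (simp add: incseq_def)
  have "shifted_average a \<delta> n u r - u r = (\<Sum>k<n. ?I k *\<^sub>R block_average a \<delta> u k) - (\<Sum>k<n. ?I k) *\<^sub>R u r"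
    by (simp only: shifted_average_def one scaleR_one)
  also have "\<dots> = (\<Sum>k<n. ?I k *\<^sub>R (block_average a \<delta> u k - u r))"
    by (simp only: scaleR_sum_left scaleR_right_diff_distrib sum_subtractf)
  also have "norm \<dots> \<le> (\<Sum>k<n. ?I k * e)"
  proof (rule order_trans[OF norm_sum sum_mono])
    fix k
    show "norm (?I k *\<^sub>R (block_average a \<delta> u k - u r)) \<le> ?I k * e"
    proof (cases "r \<in> {a (Suc k)<..a (Suc (Suc k))}")
      case True
      have "norm (block_average a \<delta> u k - u r) \<le> e"
      proof (rule block_average_bound[OF u])
        fix s assume "s \<in> {a k<..a (Suc k)}"
        then have "\<bar>s - r\<bar> \<le> 2 * \<delta>" using True \<delta>_pos by (auto simp: a_Suc)
        then show "norm (u s - u r) \<le> e" by (rule near)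
      qed
      then show ?thesis using True by simp
    qed simp
  qed
  also have "\<dots> = e" by (simp only: sum_distrib_right[symmetric] one mult_1)
  finally show ?thesis .
qed

end

definition grid_step :: "real \<Rightarrow> real \<Rightarrow> nat \<Rightarrow> real" where "grid_step t T n = (T - t) / real (Suc n)"
definition grid_point :: "real \<Rightarrow> real \<Rightarrow> nat \<Rightarrow> nat \<Rightarrow> real" where "grid_point t T n k = t + real k * grid_step t T n"

lemma uniform_grid_grid_point: "t < T \<Longrightarrow> uniform_grid t T (grid_point t T n) (grid_step t T n) n"
  by unfold_locales (auto simp: grid_point_def grid_step_def)

lemma grid_step_tendsto: "grid_step t T \<longlonglongrightarrow> 0"
  unfolding grid_step_def by (intro tendsto_divide_0[OF tendsto_const] filterlim_compose[OF _ filterlim_Suc] filterlim_at_top_imp_at_infinity filterlim_real_sequentially)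

abbreviation grid_average :: "real \<Rightarrow> real \<Rightarrow> nat \<Rightarrow> (real \<Rightarrow> 'b::euclidean_space) \<Rightarrow> real \<Rightarrow> 'b" where
  "grid_average t T n \<equiv> shifted_average (grid_point t T n) (grid_step t T n) n"

lemma grid_average_tendsto_continuous:
  fixes h :: "real \<Rightarrow> 'b::euclidean_space"
  assumes tT: "t < T" and h: "continuous_on UNIV h" "\<And>s. norm (h s) \<le> c" and r: "t < r" "r \<le> T"
  shows "(\<lambda>n. grid_average t T n h r) \<longlonglongrightarrow> h r"
proof (rule LIMSEQ_I)
  fix e :: real assume e: "0 < e"
  have "isCont h r" using h(1) by (simp add: continuous_on_eq_continuous_at)
  then obtain d where d: "0 < d" "\<And>s. \<bar>s - r\<bar> < d \<Longrightarrow> norm (h s - h r) < e / 2"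
  proof -
    have "0 < e / 2" using e by simp
    from LIM_D[OF isCont_def[THEN iffD1, OF \<open>isCont h r\<close>] this]
    obtain d where "0 < d" "\<And>s. s \<noteq> r \<and> norm (s - r) < d \<Longrightarrow> norm (h s - h r) < e / 2" by blast
    moreover have "norm (h r - h r) < e / 2" using e by simp
    ultimately show thesis using that by (metis real_norm_def)
  qed
  \<comment> \<open>The bound makes two steps shorter than \<open>d\<close> and one step shorter
    than \<open>r - t\<close>, so that \<open>r\<close> lies beyond the first block.\<close>
  have "0 < min d (r - t) / 2" using d r by auto
  from LIMSEQ_D[OF grid_step_tendsto[of t T] this]
  obtain N where N: "\<And>n. n \<ge> N \<Longrightarrow> \<bar>grid_step t T n\<bar> < min d (r - t) / 2" by auto
  show "\<exists>N. \<forall>n\<ge>N. norm (grid_average t T n h r - h r) < e"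
  proof (intro exI allI impI)
    fix n assume n: "n \<ge> N"
    interpret uniform_grid t T "grid_point t T n" "grid_step t T n" n using tT by (rule uniform_grid_grid_point)
    have "norm (grid_average t T n h r - h r) \<le> e / 2"
    proof (rule shifted_average_near)
      show "h \<in> borel_measurable borel" using h(1) by (rule borel_measurable_continuous_onI)
      show "norm (h s) \<le> c" for s by (rule h)
      show "grid_point t T n 1 < r" using N[OF n] \<delta>_pos by (auto simp: grid_point_def)
      show "norm (h s - h r) \<le> e / 2" if "\<bar>s - r\<bar> \<le> 2 * grid_step t T n" for s
        by (rule less_imp_le, rule d) (use that N[OF n] in auto)
    qed (rule r)
    then show "norm (grid_average t T n h r - h r) < e" using e by simp
  qed
qed

lemma nn_integral_tendsto_0_bounded:
  fixes f :: "nat \<Rightarrow> real \<Rightarrow> 'b::euclidean_space"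
  assumes f: "\<And>n. f n \<in> borel_measurable lborel" "\<And>n r. norm (f n r) \<le> c"
    and lim: "AE r in lborel. r \<in> {t..T} \<longrightarrow> (\<lambda>n. f n r) \<longlonglongrightarrow> 0"
  shows "(\<lambda>n. \<integral>\<^sup>+r\<in>{t..T}. ennreal (norm (f n r)) \<partial>lborel) \<longlonglongrightarrow> 0"
proof -
  have "(\<lambda>n. \<integral>\<^sup>+r\<in>{t..T}. ennreal (norm (f n r)) \<partial>lborel) \<longlonglongrightarrow> (\<integral>\<^sup>+(r::real). (0::ennreal) \<partial>lborel)"
  proof (rule nn_integral_dominated_convergence[where w = "\<lambda>r. ennreal c * indicator {t..T} r"
        and u' = "\<lambda>r. 0" and u = "\<lambda>n r. ennreal (norm (f n r)) * indicator {t..T} r"])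
    show "(\<lambda>r. ennreal (norm (f n r)) * indicator {t..T} r) \<in> borel_measurable lborel" for n using f(1)[of n] by simp
    show "AE r in lborel. ennreal (norm (f n r)) * indicator {t..T} r \<le> ennreal c * indicator {t..T} r" for n
      using f(2) by (auto simp: indicator_def ennreal_leI)
    have "emeasure lborel {t..T} < \<infinity>" using emeasure_lborel_cbox_finite[of t T] by simp
    then show "(\<integral>\<^sup>+r. ennreal c * indicator {t..T} r \<partial>lborel) < \<infinity>"
      by (subst nn_integral_cmult_indicator) (auto simp: ennreal_mult_less_top simp del: emeasure_lborel_Icc_eq)
    show "AE r in lborel. (\<lambda>n. ennreal (norm (f n r)) * indicator {t..T} r) \<longlonglongrightarrow> 0"
      using lim
    proof eventually_elim
      case (elim r)
      show ?case
      proof (cases "r \<in> {t..T}")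
        case True
        then have "(\<lambda>n. norm (f n r)) \<longlonglongrightarrow> 0" using elim by (simp add: tendsto_norm_zero)
        then have "(\<lambda>n. ennreal (norm (f n r))) \<longlonglongrightarrow> ennreal 0" by (intro tendsto_ennrealI)
        then show ?thesis using True by simp
      qed simp
    qed
  qed auto
  then show ?thesis by simp
qed

text \<open>A Lebesgue measurable function is an almost everywhere limit of continuous ones.
  Projection onto the closed ball of radius \<open>c\<close> is continuous and fixes the values of
  \<open>u\<close>, so it restores the bound without spoiling the limit.\<close>

lemma bounded_measurable_approx_continuous:
  fixes u :: "real \<Rightarrow> 'b::euclidean_space"
  assumes u: "u \<in> borel_measurable borel" "\<And>s. norm (u s) \<le> c"
  shows "\<exists>h::nat \<Rightarrow> real \<Rightarrow> 'b. (\<forall>m. continuous_on UNIV (h m)) \<and> (\<forall>m s. norm (h m s) \<le> c) \<and>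
    (AE r in lborel. (\<lambda>m. h m r) \<longlonglongrightarrow> u r)"
proof -
  have "u \<in> borel_measurable lebesgue" using u(1) by (simp add: measurable_completion)
  then have "u measurable_on UNIV" by (rule lebesgue_measurable_imp_measurable_on) auto
  then obtain N g where N: "negligible N" and g: "\<And>m. continuous_on UNIV (g m)"
    and lim: "\<And>r. r \<notin> N \<Longrightarrow> (\<lambda>m. g m r) \<longlonglongrightarrow> u r" unfolding measurable_on_def by auto
  have c0: "0 \<le> c" using order_trans[OF norm_ge_zero u(2)] .
  let ?p = "closest_point (cball (0::'b) c)"
  have cp: "continuous_on UNIV ?p" by (rule continuous_on_closest_point) (use c0 in auto)
  have ball: "?p z \<in> cball 0 c" for z by (rule closest_point_in_set) (use c0 in auto)
  have pu: "?p (u r) = u r" for r using u(2)[of r] by (intro closest_point_self) auto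
  show ?thesis
  proof (intro exI[of _ "\<lambda>m s. ?p (g m s)"] conjI allI)
    show "continuous_on UNIV (\<lambda>s. ?p (g m s))" for m
      by (rule continuous_on_compose2[OF cp g]) auto
    show "norm (?p (g m s)) \<le> c" for m s using ball[of "g m s"] by simp
    have "AE r in lebesgue. r \<notin> N" using N by (simp add: AE_not_in negligible_iff_null_sets)
    then have "AE r in lebesgue. (\<lambda>m. ?p (g m r)) \<longlonglongrightarrow> u r"
    proof eventually_elim
      case (elim r)
      have "isCont ?p (u r)" using cp by (simp add: continuous_on_eq_continuous_at)
      from isCont_tendsto_compose[OF this lim[OF elim]] show ?case by (simp only: pu)
    qed
    then show "AE r in lborel. (\<lambda>m. ?p (g m r)) \<longlonglongrightarrow> u r" by (simp add: AE_completion_iff)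
  qed
qed

text \<open>Density argument: with \<open>h m\<close> continuous and close to \<open>u\<close>, the
  error splits into the average of \<open>u - h m\<close>, the averaging error of
  \<open>h m\<close>, and \<open>h m - u\<close>. The first and third are controlled by the same
  distance, because averaging contracts.\<close>

lemma grid_average_tendsto_L1:
  fixes u :: "real \<Rightarrow> 'b::euclidean_space"
  assumes tT: "t < T" and u: "u \<in> borel_measurable borel" "\<And>s. norm (u s) \<le> c"
  shows "(\<lambda>n. \<integral>\<^sup>+r\<in>{t..T}. ennreal (norm (grid_average t T n u r - u r)) \<partial>lborel) \<longlonglongrightarrow> 0"
proof (rule ennreal_tendsto_0I)
  fix e :: real assume e: "0 < e"
  obtain h :: "nat \<Rightarrow> real \<Rightarrow> 'b" where h: "\<And>m. continuous_on UNIV (h m)" "\<And>m s. norm (h m s) \<le> c"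
    "AE r in lborel. (\<lambda>m. h m r) \<longlonglongrightarrow> u r" using bounded_measurable_approx_continuous[OF u] by blast
  have hm[measurable]: "h m \<in> borel_measurable borel" for m using h(1) by (rule borel_measurable_continuous_onI)
  have um[measurable]: "u \<in> borel_measurable borel" by fact
  have b2: "norm (x - y) \<le> 2 * c" if "norm x \<le> c" "norm y \<le> c" for x y :: 'b
    using norm_triangle_ineq4[of x y] that by linarith
  have "(\<lambda>m. \<integral>\<^sup>+r\<in>{t..T}. ennreal (norm (u r - h m r)) \<partial>lborel) \<longlonglongrightarrow> 0"
  proof (rule nn_integral_tendsto_0_bounded)
    show "(\<lambda>r. u r - h m r) \<in> borel_measurable lborel" for m by simp
    show "norm (u r - h m r) \<le> 2 * c" for m r by (rule b2) (rule u h)+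
    show "AE r in lborel. r \<in> {t..T} \<longrightarrow> (\<lambda>m. u r - h m r) \<longlonglongrightarrow> 0"
      using h(3) by eventually_elim (use LIM_zero_cancel in \<open>auto intro!: tendsto_eq_intros\<close>)
  qed
  from ennreal_tendsto_0D[OF this, of "e / 4"] e obtain m where
    m: "(\<integral>\<^sup>+r\<in>{t..T}. ennreal (norm (u r - h m r)) \<partial>lborel) < ennreal (e / 4)"
    unfolding eventually_sequentially by auto
  let ?D = "\<integral>\<^sup>+r\<in>{t..T}. ennreal (norm (u r - h m r)) \<partial>lborel"
  have avg: "norm (grid_average t T n (h m) r) \<le> c" for n r
  proof -
    interpret uniform_grid t T "grid_point t T n" "grid_step t T n" n using tT by (rule uniform_grid_grid_point)
    show ?thesis by (rule shifted_average_norm[OF hm h(2)])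
  qed
  have "(\<lambda>n. \<integral>\<^sup>+r\<in>{t..T}. ennreal (norm (grid_average t T n (h m) r - h m r)) \<partial>lborel) \<longlonglongrightarrow> 0"
  proof (rule nn_integral_tendsto_0_bounded)
    show "(\<lambda>r. grid_average t T n (h m) r - h m r) \<in> borel_measurable lborel" for n by simp
    show "norm (grid_average t T n (h m) r - h m r) \<le> 2 * c" for n r by (rule b2) (rule avg h)+
    have "AE r in lborel. r \<noteq> t" by (rule AE_lborel_singleton)
    then show "AE r in lborel. r \<in> {t..T} \<longrightarrow> (\<lambda>n. grid_average t T n (h m) r - h m r) \<longlonglongrightarrow> 0"
    proof eventually_elim
      case (elim r)
      show ?case
      proof
        assume "r \<in> {t..T}"
        then have "t < r" "r \<le> T" using elim by auto
        from grid_average_tendsto_continuous[OF tT h(1) h(2) this] show "(\<lambda>n. grid_average t T n (h m) r - h m r) \<longlonglongrightarrow> 0"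
          by (rule LIM_zero)
      qed
    qed
  qed
  from ennreal_tendsto_0D[OF this, of "e / 4"] e
  have "eventually (\<lambda>n. (\<integral>\<^sup>+r\<in>{t..T}. ennreal (norm (grid_average t T n (h m) r - h m r)) \<partial>lborel) < ennreal (e / 4)) sequentially" by simp
  then show "eventually (\<lambda>n. (\<integral>\<^sup>+r\<in>{t..T}. ennreal (norm (grid_average t T n u r - u r)) \<partial>lborel) \<le> ennreal e) sequentially"
  proof eventually_elim
    case (elim n)
    interpret uniform_grid t T "grid_point t T n" "grid_step t T n" n using tT by (rule uniform_grid_grid_point)
    let ?A = "\<lambda>v. grid_average t T n v"
    let ?H = "\<integral>\<^sup>+r\<in>{t..T}. ennreal (norm (?A (h m) r - h m r)) \<partial>lborel"
    have "(\<integral>\<^sup>+r\<in>{t..T}. ennreal (norm (?A u r - u r)) \<partial>lborel)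
      \<le> (\<integral>\<^sup>+r. ennreal (norm (?A (\<lambda>s. u s - h m s) r)) + (ennreal (norm (?A (h m) r - h m r)) * indicator {t..T} r
            + ennreal (norm (u r - h m r)) * indicator {t..T} r) \<partial>lborel)"
    proof (rule nn_integral_mono)
      fix r
      have "?A u r - u r = ?A (\<lambda>s. u s - h m s) r + ((?A (h m) r - h m r) + (h m r - u r))"
        using shifted_average_diff[OF u hm h(2)] by simp
      moreover have "norm (x + (y + z)) \<le> norm x + (norm y + norm z)" for x y z :: 'b
        using norm_triangle_ineq[of x "y + z"] norm_triangle_ineq[of y z] by linarith
      ultimately have "norm (?A u r - u r) \<le> norm (?A (\<lambda>s. u s - h m s) r) + (norm (?A (h m) r - h m r) + norm (h m r - u r))"
        by metis
      then have "ennreal (norm (?A u r - u r)) \<le> ennreal (norm (?A (\<lambda>s. u s - h m s) r)) + (ennreal (norm (?A (h m) r - h m r)) + ennreal (norm (u r - h m r)))"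
        by (simp add: ennreal_plus[symmetric] norm_minus_commute ennreal_leI del: ennreal_plus)
      then show "ennreal (norm (?A u r - u r)) * indicator {t..T} r
        \<le> ennreal (norm (?A (\<lambda>s. u s - h m s) r)) + (ennreal (norm (?A (h m) r - h m r)) * indicator {t..T} r
            + ennreal (norm (u r - h m r)) * indicator {t..T} r)"
        by (cases "r \<in> {t..T}") auto
    qed
    also have "\<dots> = (\<integral>\<^sup>+r. ennreal (norm (?A (\<lambda>s. u s - h m s) r)) \<partial>lborel) + (?H + ?D)"
      by (subst nn_integral_add; simp)+
    also have "\<dots> \<le> ?D + (?H + ?D)"
    proof (rule add_right_mono, rule shifted_average_L1)
      show "(\<lambda>s. u s - h m s) \<in> borel_measurable borel" by simp
      show "norm (u s - h m s) \<le> 2 * c" for s by (rule b2) (rule u h)+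
    qed
    also have "\<dots> \<le> ennreal (e / 4) + (ennreal (e / 4) + ennreal (e / 4))"
      using m elim by (intro add_mono) auto
    also have "\<dots> \<le> ennreal e" using e by (simp add: ennreal_plus[symmetric] ennreal_leI del: ennreal_plus)
    finally show ?case .
  qed
qed

text \<open>Measurability of a parametrised integral, with the upper limit moved into an indicator.
  Paths that are not integrable get the value 0, which does no harm to measurability.\<close>

lemma progressive_integral:
  fixes \<phi> :: "real \<Rightarrow> 'a \<Rightarrow> 'b::euclidean_space"
  assumes \<phi>: "progressive F t T \<phi>"
  shows "progressive F t T (\<lambda>s \<omega>. LINT r:{t..s}|lborel. \<phi> r \<omega>)"
proof (rule progressiveI_joint)
  fix r assume r: "r \<in> {t..T}"
  define g where "g x u = indicat_real {t..fst x} u *\<^sub>R (indicator {t..r} u *\<^sub>R \<phi> u (snd x))" for x :: "real \<times> 'a" and u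
  have "(\<lambda>y. (snd y, snd (fst y))) \<in> measurable ((borel \<Otimes>\<^sub>M F r) \<Otimes>\<^sub>M lborel) (borel \<Otimes>\<^sub>M F r)"
    by (intro measurable_Pair measurable_compose[OF measurable_fst measurable_snd]) simp
  from measurable_compose[OF this progressive_joint[OF \<phi> r]]
  have 1: "(\<lambda>y. indicator {t..r} (snd y) *\<^sub>R \<phi> (snd y) (snd (fst y))) \<in> borel_measurable ((borel \<Otimes>\<^sub>M F r) \<Otimes>\<^sub>M lborel)"
    by simp
  have f1: "(\<lambda>y. fst (fst y)) \<in> borel_measurable ((borel \<Otimes>\<^sub>M F r) \<Otimes>\<^sub>M (lborel :: real measure))"
    by (rule measurable_compose[OF measurable_fst measurable_fst])
  have f2: "snd \<in> borel_measurable ((borel \<Otimes>\<^sub>M F r) \<Otimes>\<^sub>M (lborel :: real measure))" by simp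
  have "(\<lambda>y. if t \<le> snd y \<and> snd y \<le> fst (fst y) then 1 else 0 :: real) \<in> borel_measurable ((borel \<Otimes>\<^sub>M F r) \<Otimes>\<^sub>M lborel)"
    using f1 f2 by simp
  moreover have "indicat_real {t..fst (fst y)} (snd y) = (if t \<le> snd y \<and> snd y \<le> fst (fst y) then 1 else 0)" for y :: "(real \<times> 'a) \<times> real"
    by (auto simp: indicator_def)
  ultimately have 2: "(\<lambda>y. indicat_real {t..fst (fst y)} (snd y)) \<in> borel_measurable ((borel \<Otimes>\<^sub>M F r) \<Otimes>\<^sub>M lborel)" by simp
  have "case_prod g \<in> borel_measurable ((borel \<Otimes>\<^sub>M F r) \<Otimes>\<^sub>M lborel)"
    unfolding g_def split_beta by (rule borel_measurable_scaleR[OF 2 1])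
  then have "(\<lambda>x. LINT u|lborel. g x u) \<in> borel_measurable (borel \<Otimes>\<^sub>M F r)"
    by (rule lborel.borel_measurable_lebesgue_integral)
  then show "\<exists>\<psi>\<in>borel_measurable (borel \<Otimes>\<^sub>M F r). \<forall>s\<in>{t..r}. \<forall>\<omega>\<in>space (F r).
      (LINT r:{t..s}|lborel. \<phi> r \<omega>) = \<psi> (s, \<omega>)"
    by (rule bexI[rotated])
       (auto simp: set_lebesgue_integral_def g_def indicator_def intro!: Bochner_Integration.integral_cong)
qed

text \<open>Large values are set to zero and not projected to the sphere, so the error is either 0
  or the vector itself and is dominated by it.\<close>

definition truncate :: "real \<Rightarrow> 'b::real_normed_vector \<Rightarrow> 'b" where
  "truncate m x = (if norm x \<le> m then x else 0)"

lemma truncate_measurable[measurable]: "truncate m \<in> borel_measurable (borel :: 'b::euclidean_space measure)"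
  unfolding truncate_def[abs_def] by measurable

lemma truncate_norm: "0 \<le> m \<Longrightarrow> norm (truncate m x) \<le> m"
  by (simp add: truncate_def)

context brownian
begin

section \<open>Joint measurability and Fubini for progressive processes\<close>

lemma progressive_joint_M:
  fixes \<phi> :: "real \<Rightarrow> 'a \<Rightarrow> 'b::euclidean_space"
  assumes "progressive F t T \<phi>" "t \<le> T"
  shows "(\<lambda>x. indicator {t..T} (fst x) *\<^sub>R \<phi> (fst x) (snd x)) \<in> borel_measurable (lborel \<Otimes>\<^sub>M M)"
proof -
  have i: "(\<lambda>\<omega>. \<omega>) \<in> measurable M (F T)"
  proof (rule measurableI)
    fix A assume "A \<in> sets (F T)"
    then have "A \<in> sets M" using sets_F_subset by blast
    then show "(\<lambda>\<omega>. \<omega>) -` A \<inter> space M \<in> sets M" by simp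
  qed simp
  have "(\<lambda>x. (fst x, snd x)) \<in> measurable (lborel \<Otimes>\<^sub>M M) (borel \<Otimes>\<^sub>M F T)"
    by (intro measurable_Pair measurable_compose[OF measurable_snd i]) simp
  from measurable_compose[OF this progressive_joint[OF assms(1), of T]] assms(2) show ?thesis by simp
qed

text \<open>The deterministic factor \<open>g\<close> is there for the reciprocal weight in the
  weighted Cauchy-Schwarz inequality; energies use \<open>g = 1\<close>.\<close>

lemma progressive_nn_joint:
  fixes \<phi> :: "real \<Rightarrow> 'a \<Rightarrow> 'b::euclidean_space" and h :: "'b \<Rightarrow> ennreal" and g :: "real \<Rightarrow> ennreal"
  assumes \<phi>: "progressive F t T \<phi>" and s: "t \<le> s" "s \<le> T"
    and h: "h \<in> borel_measurable borel" and g: "g \<in> borel_measurable borel"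
  shows "(\<lambda>(r, \<omega>). g r * h (\<phi> r \<omega>) * indicator {t..s} r) \<in> borel_measurable (lborel \<Otimes>\<^sub>M M)"
proof -
  have 1: "(\<lambda>x. h (indicator {t..T} (fst x) *\<^sub>R \<phi> (fst x) (snd x))) \<in> borel_measurable (lborel \<Otimes>\<^sub>M M)"
    by (rule measurable_compose[OF progressive_joint_M[OF \<phi>] h]) (use s in auto)
  have 2: "(\<lambda>x. g (fst x)) \<in> borel_measurable (lborel \<Otimes>\<^sub>M M)"
    by (rule measurable_compose[OF measurable_fst]) (use g in simp)
  have 3: "(\<lambda>x. indicator {t..s} (fst x) :: ennreal) \<in> borel_measurable (lborel \<Otimes>\<^sub>M M)"
    by (rule measurable_compose[OF measurable_fst]) simp
  have "(\<lambda>x. g (fst x) * h (indicator {t..T} (fst x) *\<^sub>R \<phi> (fst x) (snd x)) * indicator {t..s} (fst x)) \<in> borel_measurable (lborel \<Otimes>\<^sub>M M)"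
    by (intro borel_measurable_times_ennreal 1 2 3)
  moreover have "(\<lambda>(r, \<omega>). g r * h (\<phi> r \<omega>) * indicator {t..s} r)
     = (\<lambda>x. g (fst x) * h (indicator {t..T} (fst x) *\<^sub>R \<phi> (fst x) (snd x)) * indicator {t..s} (fst x))"
    using s by (auto simp: fun_eq_iff indicator_def)
  ultimately show ?thesis by simp
qed

lemma progressive_nn_path:
  fixes \<phi> :: "real \<Rightarrow> 'a \<Rightarrow> 'b::euclidean_space" and h :: "'b \<Rightarrow> ennreal" and g :: "real \<Rightarrow> ennreal"
  assumes "progressive F t T \<phi>" "t \<le> s" "s \<le> T" "h \<in> borel_measurable borel" "g \<in> borel_measurable borel"
    "\<omega> \<in> space M"
  shows "(\<lambda>r. g r * h (\<phi> r \<omega>) * indicator {t..s} r) \<in> borel_measurable lborel"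
  using measurable_compose[OF measurable_Pair2'[OF assms(6)] progressive_nn_joint[OF assms(1-5)]] by simp

lemma sigma_finite_lborel_M: "pair_sigma_finite (lborel :: real measure) M"
  by (intro pair_sigma_finite.intro lborel.sigma_finite_measure_axioms sigma_finite_measure_axioms)

lemma progressive_nn_integral_measurable:
  fixes \<phi> :: "real \<Rightarrow> 'a \<Rightarrow> 'b::euclidean_space" and h :: "'b \<Rightarrow> ennreal" and g :: "real \<Rightarrow> ennreal"
  assumes "progressive F t T \<phi>" "t \<le> s" "s \<le> T" "h \<in> borel_measurable borel" "g \<in> borel_measurable borel"
  shows "(\<lambda>\<omega>. \<integral>\<^sup>+r. g r * h (\<phi> r \<omega>) * indicator {t..s} r \<partial>lborel) \<in> borel_measurable M"
proof -
  have "(\<lambda>(\<omega>, r). g r * h (\<phi> r \<omega>) * indicator {t..s} r) \<in> borel_measurable (M \<Otimes>\<^sub>M lborel)"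
    using measurable_pair_swap[OF progressive_nn_joint[OF assms]] by (simp add: split_beta)
  then show ?thesis by (rule lborel.borel_measurable_nn_integral)
qed

lemma progressive_Fubini:
  fixes \<phi> :: "real \<Rightarrow> 'a \<Rightarrow> 'b::euclidean_space" and h :: "'b \<Rightarrow> ennreal" and g :: "real \<Rightarrow> ennreal"
  assumes "progressive F t T \<phi>" "t \<le> s" "s \<le> T" "h \<in> borel_measurable borel" "g \<in> borel_measurable borel"
  shows "(\<integral>\<^sup>+\<omega>. (\<integral>\<^sup>+r. g r * h (\<phi> r \<omega>) * indicator {t..s} r \<partial>lborel) \<partial>M)
    = (\<integral>\<^sup>+r. g r * (\<integral>\<^sup>+\<omega>. h (\<phi> r \<omega>) \<partial>M) * indicator {t..s} r \<partial>lborel)"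
proof -
  have "(\<integral>\<^sup>+\<omega>. (\<integral>\<^sup>+r. g r * h (\<phi> r \<omega>) * indicator {t..s} r \<partial>lborel) \<partial>M)
    = (\<integral>\<^sup>+r. (\<integral>\<^sup>+\<omega>. g r * h (\<phi> r \<omega>) * indicator {t..s} r \<partial>M) \<partial>lborel)"
    by (rule pair_sigma_finite.Fubini'[OF sigma_finite_lborel_M progressive_nn_joint[OF assms]])
  also have "\<dots> = (\<integral>\<^sup>+r. g r * (\<integral>\<^sup>+\<omega>. h (\<phi> r \<omega>) \<partial>M) * indicator {t..s} r \<partial>lborel)"
  proof (rule nn_integral_cong)
    fix r
    show "(\<integral>\<^sup>+\<omega>. g r * h (\<phi> r \<omega>) * indicator {t..s} r \<partial>M) = g r * (\<integral>\<^sup>+\<omega>. h (\<phi> r \<omega>) \<partial>M) * indicator {t..s} r"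
    proof (cases "r \<in> {t..s}")
      case True
      have "(\<lambda>\<omega>. h (\<phi> r \<omega>)) \<in> borel_measurable M"
        by (rule measurable_compose[OF measurable_F[OF progressive_section[OF assms(1)]] assms(4)]) (use True assms in auto)
      then show ?thesis using True by (simp add: nn_integral_cmult)
    qed simp
  qed
  finally show ?thesis .
qed

lemma proc_energy_Fubini:
  assumes "progressive F t T \<phi>" "t \<le> s" "s \<le> T"
  shows "proc_energy M t s \<phi> = (\<integral>\<^sup>+r\<in>{t..s}. (msq M (\<phi> r)) \<partial>lborel)"
  using progressive_Fubini[OF assms, of "\<lambda>x. ennreal ((norm x)\<^sup>2)" "\<lambda>_. 1"] unfolding proc_energy_def by simp

lemma sq_path_measurable:
  fixes \<phi> :: "real \<Rightarrow> 'a \<Rightarrow> 'b::euclidean_space"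
  assumes "progressive F t T \<phi>" "t \<le> s" "s \<le> T" "\<omega> \<in> space M"
  shows "(\<lambda>r. ennreal ((norm (\<phi> r \<omega>))\<^sup>2) * indicator {t..s} r) \<in> borel_measurable lborel"
  using progressive_nn_path[OF assms(1-3) _ _ assms(4), of "\<lambda>x. ennreal ((norm x)\<^sup>2)" "\<lambda>_. 1"] by simp

lemma sq_integral_measurable:
  fixes \<phi> :: "real \<Rightarrow> 'a \<Rightarrow> 'b::euclidean_space"
  assumes "progressive F t T \<phi>" "t \<le> s" "s \<le> T"
  shows "(\<lambda>\<omega>. \<integral>\<^sup>+r\<in>{t..s}. ennreal ((norm (\<phi> r \<omega>))\<^sup>2) \<partial>lborel) \<in> borel_measurable M"
  using progressive_nn_integral_measurable[OF assms(1-3), of "\<lambda>x. ennreal ((norm x)\<^sup>2)" "\<lambda>_. 1"] by simp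

lemma proc_energy_add_le:
  fixes \<phi> \<psi> :: "real \<Rightarrow> 'a \<Rightarrow> 'b::euclidean_space"
  assumes \<phi>: "progressive F t T \<phi>" and \<psi>: "progressive F t T \<psi>" and s: "t \<le> s" "s \<le> T"
  shows "proc_energy M t s (\<lambda>r \<omega>. \<phi> r \<omega> + \<psi> r \<omega>) \<le> 2 * proc_energy M t s \<phi> + 2 * proc_energy M t s \<psi>"
proof -
  have "proc_energy M t s (\<lambda>r \<omega>. \<phi> r \<omega> + \<psi> r \<omega>)
    \<le> (\<integral>\<^sup>+\<omega>. 2 * (\<integral>\<^sup>+r\<in>{t..s}. ennreal ((norm (\<phi> r \<omega>))\<^sup>2) \<partial>lborel)
         + 2 * (\<integral>\<^sup>+r\<in>{t..s}. ennreal ((norm (\<psi> r \<omega>))\<^sup>2) \<partial>lborel) \<partial>M)"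
    unfolding proc_energy_def
  proof (rule nn_integral_mono)
    fix \<omega> assume \<omega>: "\<omega> \<in> space M"
    have "(\<integral>\<^sup>+r\<in>{t..s}. ennreal ((norm (\<phi> r \<omega> + \<psi> r \<omega>))\<^sup>2) \<partial>lborel)
      \<le> (\<integral>\<^sup>+r. 2 * (ennreal ((norm (\<phi> r \<omega>))\<^sup>2) * indicator {t..s} r) + 2 * (ennreal ((norm (\<psi> r \<omega>))\<^sup>2) * indicator {t..s} r) \<partial>lborel)"
    proof (rule nn_integral_mono)
      fix r show "ennreal ((norm (\<phi> r \<omega> + \<psi> r \<omega>))\<^sup>2) * indicator {t..s} r
        \<le> 2 * (ennreal ((norm (\<phi> r \<omega>))\<^sup>2) * indicator {t..s} r) + 2 * (ennreal ((norm (\<psi> r \<omega>))\<^sup>2) * indicator {t..s} r)"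
        using ennreal_sq_add_le[of "\<phi> r \<omega>" "\<psi> r \<omega>"] by (cases "r \<in> {t..s}") auto
    qed
    also have "\<dots> = 2 * (\<integral>\<^sup>+r\<in>{t..s}. ennreal ((norm (\<phi> r \<omega>))\<^sup>2) \<partial>lborel)
         + 2 * (\<integral>\<^sup>+r\<in>{t..s}. ennreal ((norm (\<psi> r \<omega>))\<^sup>2) \<partial>lborel)"
      using sq_path_measurable[OF \<phi> s \<omega>] sq_path_measurable[OF \<psi> s \<omega>]
      by (subst nn_integral_add) (auto simp: nn_integral_cmult)
    finally show "(\<integral>\<^sup>+r\<in>{t..s}. ennreal ((norm (\<phi> r \<omega> + \<psi> r \<omega>))\<^sup>2) \<partial>lborel)
      \<le> 2 * (\<integral>\<^sup>+r\<in>{t..s}. ennreal ((norm (\<phi> r \<omega>))\<^sup>2) \<partial>lborel)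
         + 2 * (\<integral>\<^sup>+r\<in>{t..s}. ennreal ((norm (\<psi> r \<omega>))\<^sup>2) \<partial>lborel)" .
  qed
  also have "\<dots> = 2 * proc_energy M t s \<phi> + 2 * proc_energy M t s \<psi>"
    unfolding proc_energy_def using sq_integral_measurable[OF \<phi> s] sq_integral_measurable[OF \<psi> s]
    by (subst nn_integral_add) (auto simp: nn_integral_cmult)
  finally show ?thesis .
qed

text \<open>An entry starting after \<open>r\<close> is zero up to time \<open>r\<close>, so its
  coefficient need not be measurable for \<open>F r\<close>.\<close>

lemma elementary_progressive:
  fixes es :: "(real \<times> real \<times> ('a \<Rightarrow> 'b::euclidean_space)) list"
  assumes "elementary M F t s es"
  shows "progressive F t0 T (elementary_process es)"
  using assms
proof (induction es)
  case Nil
  show ?case unfolding progressive_def split_beta elementary_process_def by simp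
next
  case (Cons x es)
  obtain p q \<xi> where x: "x = (p, q, \<xi>)" by (cases x)
  have \<xi>: "\<xi> \<in> borel_measurable (F p)" and es: "elementary M F t s es" using Cons.prems unfolding elementary_def x by auto
  have "progressive F t0 T (\<lambda>r \<omega>. indicat_real {p<..q} r *\<^sub>R \<xi> \<omega>)"
  proof (rule progressiveI_joint)
    fix r
    show "\<exists>\<psi>\<in>borel_measurable (borel \<Otimes>\<^sub>M F r). \<forall>s\<in>{t0..r}. \<forall>\<omega>\<in>space (F r). indicat_real {p<..q} s *\<^sub>R \<xi> \<omega> = \<psi> (s, \<omega>)"
    proof (cases "p \<le> r")
      case True
      have "(\<lambda>x. indicat_real {p<..q} (fst x) *\<^sub>R \<xi> (snd x)) \<in> borel_measurable (borel \<Otimes>\<^sub>M F r)"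
        by (intro borel_measurable_scaleR measurable_compose[OF measurable_fst]
              measurable_compose[OF measurable_snd measurable_F_mono[OF \<xi> True]]) simp
      then show ?thesis by (rule bexI[rotated]) auto
    next
      case False
      then show ?thesis by (intro bexI[of _ "\<lambda>_. 0"]) auto
    qed
  qed
  from progressive_add[OF this Cons.IH[OF es]] show ?case by (simp add: elementary_process_def x)
qed

text \<open>For each path the grid averages converge in the mean over time; dominated convergence
  adds the expectation, and the uniform bound upgrades first powers to squares.\<close>

lemma elementary_dense_bounded:
  fixes \<phi> :: "real \<Rightarrow> 'a \<Rightarrow> 'b::euclidean_space"
  assumes t: "0 \<le> t" "t < T" and \<phi>: "progressive F t T \<phi>" and c: "\<And>r \<omega>. norm (\<phi> r \<omega>) \<le> c"
  shows "\<exists>es. (\<forall>n. elementary M F t T (es n)) \<and>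
    (\<lambda>n::nat. proc_energy M t T (\<lambda>r \<omega>. elementary_process (es n) r \<omega> - \<phi> r \<omega>)) \<longlonglongrightarrow> 0"
proof -
  have c0: "0 \<le> c" using order_trans[OF norm_ge_zero c] .
  define \<phi>' where "\<phi>' \<omega> r = indicat_real {t..T} r *\<^sub>R \<phi> r \<omega>" for \<omega> r
  have \<phi>'m: "\<phi>' \<omega> \<in> borel_measurable borel" if "\<omega> \<in> space M" for \<omega>
    using measurable_compose[OF measurable_Pair2'[OF that] progressive_joint_M[OF \<phi>]] t unfolding \<phi>'_def by simp
  have \<phi>'c: "norm (\<phi>' \<omega> r) \<le> c" for \<omega> r using c[of r \<omega>] c0 by (auto simp: \<phi>'_def indicator_def)
  define a where "a = grid_point t T"
  define es where "es n = map (\<lambda>k. (a n (Suc k), a n (Suc (Suc k)), \<lambda>\<omega>. block_average (a n) (grid_step t T n) (\<phi>' \<omega>) k)) [0..<n]" for n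
  have elem: "elementary M F t T (es n)" for n
  proof -
    interpret uniform_grid t T "a n" "grid_step t T n" n unfolding a_def using t by (intro uniform_grid_grid_point)
    have "t \<le> a n (Suc k)" "a n (Suc k) \<le> a n (Suc (Suc k))" "a n (Suc (Suc k)) \<le> T" "t \<le> a n k" "a n k \<le> a n (Suc k)" if "k < n" for k
      using a_inc a_0 a_end that unfolding incseq_def by (metis Suc_leI le0 le_SucI le_refl Suc_mono)+
    note ak = this
    have m: "(\<lambda>\<omega>. block_average (a n) (grid_step t T n) (\<phi>' \<omega>) k) \<in> borel_measurable (F (a n (Suc k)))" if k: "k < n" for k
    proof -
      have in_T: "a n (Suc k) \<in> {t..T}" using ak[OF k] by auto
      \<comment> \<open>The indicator turns the integral over one block into a running integral up
        to \<open>a n (Suc k)\<close>, whose measurability at that time is known.\<close>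
      have "progressive F t T (\<lambda>r \<omega>. indicator {a n k<..} r *\<^sub>R \<phi> r \<omega>)" by (rule progressive_indicator[OF \<phi>]) simp
      from progressive_section[OF progressive_integral[OF this] in_T]
      have "(\<lambda>\<omega>. LINT r:{t..a n (Suc k)}|lborel. indicator {a n k<..} r *\<^sub>R \<phi> r \<omega>) \<in> borel_measurable (F (a n (Suc k)))" .
      then have "(\<lambda>\<omega>. (1 / grid_step t T n) *\<^sub>R (LINT r:{t..a n (Suc k)}|lborel. indicator {a n k<..} r *\<^sub>R \<phi> r \<omega>)) \<in> borel_measurable (F (a n (Suc k)))"
        by (intro borel_measurable_scaleR borel_measurable_const)
      moreover have "block_average (a n) (grid_step t T n) (\<phi>' \<omega>) k = (1 / grid_step t T n) *\<^sub>R (LINT r:{t..a n (Suc k)}|lborel. indicator {a n k<..} r *\<^sub>R \<phi> r \<omega>)" for \<omega>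
      proof -
        have "indicat_real {a n k<..a n (Suc k)} s *\<^sub>R \<phi>' \<omega> s = indicat_real {t..a n (Suc k)} s *\<^sub>R (indicat_real {a n k<..} s *\<^sub>R \<phi> s \<omega>)" for s
          using ak[OF k] by (auto simp: \<phi>'_def indicator_def)
        then show ?thesis unfolding block_average_def set_lebesgue_integral_def by simp
      qed
      ultimately show ?thesis by simp
    qed
    have b: "norm (block_average (a n) (grid_step t T n) (\<phi>' \<omega>) k) \<le> c" if "\<omega> \<in> space M" for \<omega> k
      using block_average_bound[OF \<phi>'m[OF that] \<phi>'c, of k 0 c] \<phi>'c by simp
    show ?thesis unfolding elementary_def es_def using ak m b by (auto intro!: exI[of _ c])
  qed
  have proc: "elementary_process (es n) r \<omega> = grid_average t T n (\<phi>' \<omega>) r" for n r \<omega>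
    unfolding elementary_process_def es_def shifted_average_def a_def
    by (simp add: comp_def interv_sum_list_conv_sum_set_nat atLeast0LessThan)
  define G where "G n \<omega> = (\<integral>\<^sup>+r\<in>{t..T}. ennreal (norm (elementary_process (es n) r \<omega> - \<phi> r \<omega>)) \<partial>lborel)" for n \<omega>
  have Geq: "G n \<omega> = (\<integral>\<^sup>+r\<in>{t..T}. ennreal (norm (grid_average t T n (\<phi>' \<omega>) r - \<phi>' \<omega> r)) \<partial>lborel)" for n \<omega>
    unfolding G_def proc by (intro nn_integral_cong) (auto simp: \<phi>'_def indicator_def)
  have prog: "progressive F t T (\<lambda>r \<omega>. elementary_process (es n) r \<omega> - \<phi> r \<omega>)" for n
    by (rule progressive_diff[OF elementary_progressive[OF elem] \<phi>])
  have Gm: "G n \<in> borel_measurable M" for n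
    using progressive_nn_integral_measurable[OF prog _ order_refl, of "\<lambda>x. ennreal (norm x)" "\<lambda>_. 1" n] t unfolding G_def by simp
  have diff_le: "norm (elementary_process (es n) r \<omega> - \<phi> r \<omega>) \<le> 2 * c" if "\<omega> \<in> space M" for n r \<omega>
  proof -
    interpret uniform_grid t T "grid_point t T n" "grid_step t T n" n using t by (intro uniform_grid_grid_point)
    have "norm (elementary_process (es n) r \<omega>) \<le> c" unfolding proc by (rule shifted_average_norm[OF \<phi>'m[OF that] \<phi>'c])
    then show ?thesis using c[of r \<omega>] norm_triangle_ineq4[of "elementary_process (es n) r \<omega>" "\<phi> r \<omega>"] by linarith
  qed
  have fin: "emeasure lborel {t..T} < \<infinity>" using emeasure_lborel_cbox_finite[of t T] by (simp only: cbox_interval)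
  have lim: "(\<lambda>n. \<integral>\<^sup>+\<omega>. G n \<omega> \<partial>M) \<longlonglongrightarrow> (\<integral>\<^sup>+\<omega>. 0 \<partial>M)"
  proof (rule nn_integral_dominated_convergence[where w = "\<lambda>_. ennreal (2 * c) * emeasure lborel {t..T}" and u = G and u' = "\<lambda>_. 0"])
    show "AE \<omega> in M. G n \<omega> \<le> ennreal (2 * c) * emeasure lborel {t..T}" for n
    proof (rule AE_I2)
      fix \<omega> assume \<omega>: "\<omega> \<in> space M"
      have "G n \<omega> \<le> (\<integral>\<^sup>+r. ennreal (2 * c) * indicator {t..T} r \<partial>lborel)"
        unfolding G_def using diff_le[OF \<omega>] by (intro nn_integral_mono mult_right_mono ennreal_leI) auto
      then show "G n \<omega> \<le> ennreal (2 * c) * emeasure lborel {t..T}" by (subst (asm) nn_integral_cmult_indicator) auto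
    qed
    show "(\<integral>\<^sup>+\<omega>. ennreal (2 * c) * emeasure lborel {t..T} \<partial>M) < \<infinity>"
      using fin emeasure_space_1 by (simp add: ennreal_mult_less_top del: emeasure_lborel_Icc_eq)
    show "AE \<omega> in M. (\<lambda>n. G n \<omega>) \<longlonglongrightarrow> 0"
      by (rule AE_I2) (simp only: Geq, rule grid_average_tendsto_L1[OF t(2) \<phi>'m \<phi>'c])
  qed (use Gm in auto)
  \<comment> \<open>An error of norm at most \<open>2 * c\<close> has a square of at most
    \<open>2 * c\<close> times itself.\<close>
  have le: "proc_energy M t T (\<lambda>r \<omega>. elementary_process (es n) r \<omega> - \<phi> r \<omega>) \<le> ennreal (2 * c) * (\<integral>\<^sup>+\<omega>. G n \<omega> \<partial>M)" for n
  proof -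
    have "proc_energy M t T (\<lambda>r \<omega>. elementary_process (es n) r \<omega> - \<phi> r \<omega>) \<le> (\<integral>\<^sup>+\<omega>. ennreal (2 * c) * G n \<omega> \<partial>M)"
      unfolding proc_energy_def
    proof (rule nn_integral_mono)
      fix \<omega> assume \<omega>: "\<omega> \<in> space M"
      have "(\<integral>\<^sup>+r\<in>{t..T}. ennreal ((norm (elementary_process (es n) r \<omega> - \<phi> r \<omega>))\<^sup>2) \<partial>lborel)
        \<le> (\<integral>\<^sup>+r. ennreal (2 * c) * (ennreal (norm (elementary_process (es n) r \<omega> - \<phi> r \<omega>)) * indicator {t..T} r) \<partial>lborel)"
      proof (rule nn_integral_mono)
        fix r
        let ?d = "norm (elementary_process (es n) r \<omega> - \<phi> r \<omega>)"
        have "?d\<^sup>2 \<le> 2 * c * ?d" using diff_le[OF \<omega>, of n r] by (simp add: power2_eq_square mult_right_mono)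
        then have "ennreal (?d\<^sup>2) \<le> ennreal (2 * c) * ennreal ?d" using c0 by (simp add: ennreal_mult[symmetric] ennreal_leI)
        then show "ennreal (?d\<^sup>2) * indicator {t..T} r \<le> ennreal (2 * c) * (ennreal ?d * indicator {t..T} r)"
          by (cases "r \<in> {t..T}") auto
      qed
      also have "\<dots> = ennreal (2 * c) * G n \<omega>"
        unfolding G_def
        using progressive_nn_path[OF prog _ order_refl _ _ \<omega>, of "\<lambda>x. ennreal (norm x)" "\<lambda>_. 1" n] t
        by (intro nn_integral_cmult) simp
      finally show "(\<integral>\<^sup>+r\<in>{t..T}. ennreal ((norm (elementary_process (es n) r \<omega> - \<phi> r \<omega>))\<^sup>2) \<partial>lborel) \<le> ennreal (2 * c) * G n \<omega>" .
    qed
    then show ?thesis using Gm by (simp add: nn_integral_cmult)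
  qed
  have "(\<lambda>n. ennreal (2 * c) * (\<integral>\<^sup>+\<omega>. G n \<omega> \<partial>M)) \<longlonglongrightarrow> ennreal (2 * c) * 0"
    using lim by (intro ennreal_tendsto_cmult) auto
  then have lim': "(\<lambda>n. ennreal (2 * c) * (\<integral>\<^sup>+\<omega>. G n \<omega> \<partial>M)) \<longlonglongrightarrow> 0" by simp
  have "(\<lambda>n. proc_energy M t T (\<lambda>r \<omega>. elementary_process (es n) r \<omega> - \<phi> r \<omega>)) \<longlonglongrightarrow> 0"
    by (rule tendsto_sandwich[OF _ _ tendsto_const lim']) (simp_all add: le)
  then show ?thesis using elem by blast
qed

text \<open>Dominated convergence twice, in time for a fixed outcome and then over outcomes. The
  integrand \<open>(norm (\<phi> r \<omega>))^2\<close> dominates, and at each point the error is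
  eventually 0.\<close>

lemma truncate_tendsto_energy:
  fixes \<phi> :: "real \<Rightarrow> 'a \<Rightarrow> 'b::euclidean_space"
  assumes tT: "t \<le> T" and \<phi>: "progressive F t T \<phi>" and fin: "proc_energy M t T \<phi> < \<infinity>"
  shows "(\<lambda>n. proc_energy M t T (\<lambda>r \<omega>. truncate (real n) (\<phi> r \<omega>) - \<phi> r \<omega>)) \<longlonglongrightarrow> 0"
proof -
  let ?d = "\<lambda>n r \<omega>. truncate (real n) (\<phi> r \<omega>) - \<phi> r \<omega>"
  let ?E = "\<lambda>\<omega>. \<integral>\<^sup>+r\<in>{t..T}. ennreal ((norm (\<phi> r \<omega>))\<^sup>2) \<partial>lborel"
  let ?D = "\<lambda>n \<omega>. \<integral>\<^sup>+r\<in>{t..T}. ennreal ((norm (?d n r \<omega>))\<^sup>2) \<partial>lborel"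
  have d: "progressive F t T (?d n)" for n
    by (intro progressive_diff progressive_comp[OF \<phi> truncate_measurable] \<phi>)
  have dle: "ennreal ((norm (?d n r \<omega>))\<^sup>2) \<le> ennreal ((norm (\<phi> r \<omega>))\<^sup>2)" for n r \<omega>
    by (simp add: truncate_def)
  have AEfin: "AE \<omega> in M. ?E \<omega> \<noteq> \<infinity>"
    using fin unfolding proc_energy_def by (intro nn_integral_noteq_infinite sq_integral_measurable[OF \<phi> tT order_refl]) auto
  have "(\<lambda>n. \<integral>\<^sup>+\<omega>. ?D n \<omega> \<partial>M) \<longlonglongrightarrow> (\<integral>\<^sup>+\<omega>. 0 \<partial>M)"
  proof (rule nn_integral_dominated_convergence[where w = ?E and u = ?D and u' = "\<lambda>_. 0"])
    show "?D n \<in> borel_measurable M" for n by (rule sq_integral_measurable[OF d tT order_refl])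
    show "?E \<in> borel_measurable M" by (rule sq_integral_measurable[OF \<phi> tT order_refl])
    show "AE \<omega> in M. ?D n \<omega> \<le> ?E \<omega>" for n
      by (rule AE_I2) (intro nn_integral_mono mult_right_mono dle, simp)
    show "(\<integral>\<^sup>+\<omega>. ?E \<omega> \<partial>M) < \<infinity>" using fin unfolding proc_energy_def .
    show "AE \<omega> in M. (\<lambda>n. ?D n \<omega>) \<longlonglongrightarrow> 0"
      using AEfin AE_space
    proof eventually_elim
      case (elim \<omega>)
      have "(\<lambda>n. ?D n \<omega>) \<longlonglongrightarrow> (\<integral>\<^sup>+(r::real). 0 \<partial>lborel)"
      proof (rule nn_integral_dominated_convergence[where w = "\<lambda>r. ennreal ((norm (\<phi> r \<omega>))\<^sup>2) * indicator {t..T} r"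
            and u = "\<lambda>n r. ennreal ((norm (?d n r \<omega>))\<^sup>2) * indicator {t..T} r" and u' = "\<lambda>_. 0"])
        show "(\<lambda>r. ennreal ((norm (?d n r \<omega>))\<^sup>2) * indicator {t..T} r) \<in> borel_measurable lborel" for n
          by (rule sq_path_measurable[OF d tT order_refl elim(2)])
        show "(\<lambda>r. ennreal ((norm (\<phi> r \<omega>))\<^sup>2) * indicator {t..T} r) \<in> borel_measurable lborel"
          by (rule sq_path_measurable[OF \<phi> tT order_refl elim(2)])
        show "AE r in lborel. ennreal ((norm (?d n r \<omega>))\<^sup>2) * indicator {t..T} r \<le> ennreal ((norm (\<phi> r \<omega>))\<^sup>2) * indicator {t..T} r" for n
          by (intro AE_I2 mult_right_mono dle) simp
        show "?E \<omega> < \<infinity>" using elim(1) by (simp add: less_top)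
        show "AE r in lborel. (\<lambda>n. ennreal ((norm (?d n r \<omega>))\<^sup>2) * indicator {t..T} r) \<longlonglongrightarrow> 0"
        proof (rule AE_I2)
          fix r
          obtain N :: nat where N: "norm (\<phi> r \<omega>) \<le> real N" using real_arch_simple by blast
          have "eventually (\<lambda>n. ennreal ((norm (?d n r \<omega>))\<^sup>2) * indicator {t..T} r = 0) sequentially"
            using eventually_ge_at_top[of N] by eventually_elim (use N in \<open>simp add: truncate_def\<close>)
          then show "(\<lambda>n. ennreal ((norm (?d n r \<omega>))\<^sup>2) * indicator {t..T} r) \<longlonglongrightarrow> 0"
            by (rule tendsto_eventually)
        qed
      qed simp
      then show ?case by simp
    qed
  qed simp
  then show ?thesis unfolding proc_energy_def by simp
qed

lemma elementary_dense:
  fixes \<phi> :: "real \<Rightarrow> 'a \<Rightarrow> 'b::euclidean_space"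
  assumes t: "0 \<le> t" "t \<le> T" and \<phi>: "progressive F t T \<phi>" and fin: "proc_energy M t T \<phi> < \<infinity>" and e: "0 < (e::real)"
  shows "\<exists>es. elementary M F t T es \<and> proc_energy M t T (\<lambda>r \<omega>. elementary_process es r \<omega> - \<phi> r \<omega>) \<le> ennreal e"
proof (cases "t = T")
  \<comment> \<open>A one-point interval carries no Lebesgue measure, so the empty list will do;
    grids require \<open>t < T\<close>.\<close>
  case True
  have "AE r in lborel. r \<noteq> T" by (rule AE_lborel_singleton)
  have "(\<integral>\<^sup>+r\<in>{t..T}. f r \<partial>lborel) = 0" for f :: "real \<Rightarrow> ennreal"
  proof -
    have "(\<integral>\<^sup>+r\<in>{t..T}. f r \<partial>lborel) = (\<integral>\<^sup>+(r::real). 0 \<partial>lborel)"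
      by (rule nn_integral_cong_AE) (use \<open>AE r in lborel. r \<noteq> T\<close> True in \<open>auto elim!: eventually_mono simp: indicator_def\<close>)
    then show ?thesis by simp
  qed
  then have "proc_energy M t T (\<lambda>r \<omega>. elementary_process [] r \<omega> - \<phi> r \<omega>) = 0" unfolding proc_energy_def by simp
  then show ?thesis by (intro exI[of _ "[]"]) (simp add: elementary_def)
next
  case False
  then have tT: "t < T" using t by simp
  have "0 < e / 4" using e by simp
  from ennreal_tendsto_0D[OF truncate_tendsto_energy[OF t(2) \<phi> fin] this]
  obtain n where n: "proc_energy M t T (\<lambda>r \<omega>. truncate (real n) (\<phi> r \<omega>) - \<phi> r \<omega>) < ennreal (e / 4)"
    unfolding eventually_sequentially by auto
  let ?\<psi> = "\<lambda>r \<omega>. truncate (real n) (\<phi> r \<omega>)"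
  have \<psi>: "progressive F t T ?\<psi>" by (rule progressive_comp[OF \<phi> truncate_measurable])
  have "norm (?\<psi> r \<omega>) \<le> real n" for r \<omega> by (rule truncate_norm) simp
  from elementary_dense_bounded[OF t(1) tT \<psi> this] obtain es where
    es: "\<And>n. elementary M F t T (es n)" and lim: "(\<lambda>m. proc_energy M t T (\<lambda>r \<omega>. elementary_process (es m) r \<omega> - ?\<psi> r \<omega>)) \<longlonglongrightarrow> 0"
    by blast
  from ennreal_tendsto_0D[OF lim \<open>0 < e / 4\<close>] obtain m where
    m: "proc_energy M t T (\<lambda>r \<omega>. elementary_process (es m) r \<omega> - ?\<psi> r \<omega>) < ennreal (e / 4)"
    unfolding eventually_sequentially by auto
  have "proc_energy M t T (\<lambda>r \<omega>. (elementary_process (es m) r \<omega> - ?\<psi> r \<omega>) + (?\<psi> r \<omega> - \<phi> r \<omega>))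
     \<le> 2 * proc_energy M t T (\<lambda>r \<omega>. elementary_process (es m) r \<omega> - ?\<psi> r \<omega>) + 2 * proc_energy M t T (\<lambda>r \<omega>. ?\<psi> r \<omega> - \<phi> r \<omega>)"
    by (rule proc_energy_add_le[OF progressive_diff[OF elementary_progressive[OF es] \<psi>] progressive_diff[OF \<psi> \<phi>] t(2) order_refl])
  also have "\<dots> \<le> 2 * ennreal (e / 4) + 2 * ennreal (e / 4)"
    using m n by (intro add_mono mult_left_mono) auto
  also have "\<dots> = ennreal (2 * (e / 4)) + ennreal (2 * (e / 4))" using e by (simp only: ennreal_mult' ennreal_numeral)
  also have "\<dots> = ennreal e" using e by (simp add: ennreal_plus[symmetric] del: ennreal_plus)
  finally show ?thesis using es by auto
qed

end

section \<open>Continuous processes and the Ito integral\<close>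

text \<open>Repeated use of |u + v|^2 \<le> 2|u|^2 + 2|v|^2, detaching one term at a time. The
  weights double while the squares will decay like 4^(-i), so no square roots are needed for
  summability.\<close>

lemma norm_telescope_sq_le:
  fixes x :: "nat \<Rightarrow> 'b::real_normed_vector"
  shows "(norm (x (k + n) - x k))\<^sup>2 \<le> (\<Sum>i<n. 2 ^ Suc i * (norm (x (Suc (k + i)) - x (k + i)))\<^sup>2)"
proof (induction n arbitrary: k)
  case (Suc n)
  let ?u = "norm (x (k + Suc n) - x (Suc k))" and ?v = "norm (x (Suc k) - x k)"
  have "norm (x (k + Suc n) - x k) \<le> ?u + ?v"
    using norm_triangle_ineq[of "x (k + Suc n) - x (Suc k)" "x (Suc k) - x k"] by simp
  then have "(norm (x (k + Suc n) - x k))\<^sup>2 \<le> (?u + ?v)\<^sup>2" by (intro power_mono) auto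
  also have "\<dots> \<le> 2 * ?v\<^sup>2 + 2 * ?u\<^sup>2"
    using zero_le_power2[of "?u - ?v"] by (simp add: power2_eq_square algebra_simps)
  also have "?u\<^sup>2 \<le> (\<Sum>i<n. 2 ^ Suc i * (norm (x (Suc (Suc k + i)) - x (Suc k + i)))\<^sup>2)"
    using Suc.IH[of "Suc k"] by simp
  also have "2 * ?v\<^sup>2 + 2 * (\<Sum>i<n. 2 ^ Suc i * (norm (x (Suc (Suc k + i)) - x (Suc k + i)))\<^sup>2)
     = (\<Sum>i<Suc n. 2 ^ Suc i * (norm (x (Suc (k + i)) - x (k + i)))\<^sup>2)"
    unfolding sum.lessThan_Suc_shift by (simp add: sum_distrib_left mult.assoc)
  finally show ?case by simp
qed simp

lemma suminf_offset_le_ennreal: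
  fixes f :: "nat \<Rightarrow> ennreal"
  shows "(\<Sum>i. f (i + k)) \<le> (\<Sum>i. f i)"
  unfolding suminf_eq_SUP
proof (rule SUP_least)
  fix n
  have "(\<Sum>i<n. f (i + k)) = sum f {k..<n + k}"
    using sum.shift_bounds_nat_ivl[of f 0 k n] by (simp add: lessThan_atLeast0)
  also have "\<dots> \<le> sum f {..<n + k}" by (intro sum_mono2) auto
  also have "\<dots> \<le> (SUP n. sum f {..<n})" by (rule SUP_upper) simp
  finally show "(\<Sum>i<n. f (i + k)) \<le> (SUP n. sum f {..<n})" .
qed

lemma ennreal_tendsto_0_unique:
  fixes a :: ennreal
  assumes "\<And>k::nat. a \<le> x k" "x \<longlonglongrightarrow> 0"
  shows "a = 0"
  using LIMSEQ_le_const[OF assms(2), of a] assms(1) by simp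

lemma ennreal_geometric_tendsto_0:
  assumes "0 \<le> C" shows "(\<lambda>k. ennreal (C / 4 ^ k)) \<longlonglongrightarrow> 0"
proof -
  have "(\<lambda>k. C * (1/4) ^ k) \<longlonglongrightarrow> C * 0" by (intro tendsto_mult tendsto_const LIMSEQ_realpow_zero) auto
  then have "(\<lambda>k. ennreal (C * (1/4) ^ k)) \<longlonglongrightarrow> ennreal 0" by (intro tendsto_ennrealI) simp
  then show ?thesis by (simp add: power_divide)
qed

lemma sup_sq_expectation_cong_AE:
  assumes "AE \<omega> in M. \<forall>r\<in>{t..s}. X r \<omega> = Y r \<omega>"
  shows "sup_sq_expectation M t s X = sup_sq_expectation M t s Y"
  unfolding sup_sq_expectation_def using assms
  by (intro nn_integral_cong_AE) (auto elim!: eventually_mono intro!: SUP_cong)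

lemma sup_sq_expectation_ge:
  assumes "r \<in> {t..s}"
  shows "(msq M (X r)) \<le> sup_sq_expectation M t s X"
  unfolding sup_sq_expectation_def by (intro nn_integral_mono SUP_upper assms)

lemma sup_sq_expectation_mono:
  assumes "s \<le> s'" shows "sup_sq_expectation M t s X \<le> sup_sq_expectation M t s' X"
  unfolding sup_sq_expectation_def by (intro nn_integral_mono SUP_subset_mono) (use assms in auto)

context brownian
begin

section \<open>Continuous progressive processes: suprema, versions, completeness\<close>

definition cont_proc :: "real \<Rightarrow> real \<Rightarrow> (real \<Rightarrow> 'a \<Rightarrow> 'b::euclidean_space) \<Rightarrow> bool" where
  "cont_proc t T X \<longleftrightarrow> progressive F t T X \<and> (AE \<omega> in M. continuous_on {t..T} (\<lambda>s. X s \<omega>))"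

lemma cont_proc_add: "cont_proc t T X \<Longrightarrow> cont_proc t T Y \<Longrightarrow> cont_proc t T (\<lambda>s \<omega>. X s \<omega> + Y s \<omega>)"
  unfolding cont_proc_def by (auto intro!: progressive_add elim!: eventually_elim2 intro: continuous_on_add)

lemma cont_proc_diff: "cont_proc t T X \<Longrightarrow> cont_proc t T Y \<Longrightarrow> cont_proc t T (\<lambda>s \<omega>. X s \<omega> - Y s \<omega>)"
  unfolding cont_proc_def by (auto intro!: progressive_diff elim!: eventually_elim2 intro: continuous_on_diff)

lemma cont_proc_subinterval: "cont_proc t T X \<Longrightarrow> s \<le> T \<Longrightarrow> cont_proc t s X"
  unfolding cont_proc_def by (auto intro: progressive_subinterval continuous_on_subset elim!: eventually_mono)

lemma cont_proc_measurable: "cont_proc t T X \<Longrightarrow> r \<in> {t..T} \<Longrightarrow> X r \<in> borel_measurable M"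
  unfolding cont_proc_def by (auto intro: measurable_F[OF progressive_section])

lemma cont_proc_sup_measurable:
  assumes "cont_proc t T X" "t \<le> T"
  shows "(\<lambda>\<omega>. SUP r\<in>{t..T}. ennreal ((norm (X r \<omega>))\<^sup>2)) \<in> borel_measurable M"
  by (rule sup_sq_measurable(1)[OF assms(2) cont_proc_measurable[OF assms(1)]]) (use assms in \<open>auto simp: cont_proc_def\<close>)

lemma sup_sq_expectation_add_le:
  assumes X: "cont_proc t T X" and Y: "cont_proc t T Y" and t: "t \<le> T"
  shows "sup_sq_expectation M t T (\<lambda>s \<omega>. X s \<omega> + Y s \<omega>) \<le> 2 * sup_sq_expectation M t T X + 2 * sup_sq_expectation M t T Y"
proof -
  have "sup_sq_expectation M t T (\<lambda>s \<omega>. X s \<omega> + Y s \<omega>)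
     \<le> (\<integral>\<^sup>+\<omega>. 2 * (SUP r\<in>{t..T}. ennreal ((norm (X r \<omega>))\<^sup>2)) + 2 * (SUP r\<in>{t..T}. ennreal ((norm (Y r \<omega>))\<^sup>2)) \<partial>M)"
    unfolding sup_sq_expectation_def
    by (intro nn_integral_mono SUP_least order_trans[OF ennreal_sq_add_le] add_mono mult_left_mono SUP_upper) auto
  also have "\<dots> = 2 * sup_sq_expectation M t T X + 2 * sup_sq_expectation M t T Y"
    unfolding sup_sq_expectation_def using cont_proc_sup_measurable[OF X t] cont_proc_sup_measurable[OF Y t]
    by (subst nn_integral_add) (auto simp: nn_integral_cmult)
  finally show ?thesis .
qed

lemma msq_add_le:
  fixes f g :: "'a \<Rightarrow> 'b::euclidean_space"
  assumes "f \<in> borel_measurable M" "g \<in> borel_measurable M"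
  shows "(msq M (\<lambda>\<omega>. f \<omega> + g \<omega>))
    \<le> 2 * (msq M f) + 2 * (msq M g)"
proof -
  have "(msq M (\<lambda>\<omega>. f \<omega> + g \<omega>))
    \<le> (\<integral>\<^sup>+\<omega>. 2 * ennreal ((norm (f \<omega>))\<^sup>2) + 2 * ennreal ((norm (g \<omega>))\<^sup>2) \<partial>M)"
    by (intro nn_integral_mono ennreal_sq_add_le)
  also have "\<dots> = 2 * (msq M f) + 2 * (msq M g)"
    using assms by (subst nn_integral_add) (auto simp: nn_integral_cmult)
  finally show ?thesis .
qed

lemma sup_sq_expectation_0_imp:
  assumes X: "cont_proc t T X" and t: "t \<le> T" and 0: "sup_sq_expectation M t T X = 0"
  shows "AE \<omega> in M. \<forall>s\<in>{t..T}. X s \<omega> = 0"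
proof -
  have "AE \<omega> in M. (SUP r\<in>{t..T}. ennreal ((norm (X r \<omega>))\<^sup>2)) = 0"
    using 0 nn_integral_0_iff_AE[OF cont_proc_sup_measurable[OF X t]] unfolding sup_sq_expectation_def by simp
  then show ?thesis
  proof eventually_elim
    case (elim \<omega>)
    have "ennreal ((norm (X s \<omega>))\<^sup>2) \<le> 0" if "s \<in> {t..T}" for s
      unfolding elim[symmetric] by (rule SUP_upper[OF that])
    then show ?case by (auto simp: ennreal_eq_0_iff)
  qed
qed

text \<open>Equality at each time gives equality at all dyadic times outside one null set, and
  continuity does the rest: versions of continuous processes are indistinguishable.\<close>

lemma cont_proc_AE_eq:
  assumes X: "cont_proc t T X" and Y: "cont_proc t T Y" and t: "t \<le> T"
    and eq: "\<And>s. s \<in> {t..T} \<Longrightarrow> AE \<omega> in M. X s \<omega> = Y s \<omega>"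
  shows "AE \<omega> in M. \<forall>s\<in>{t..T}. X s \<omega> = Y s \<omega>"
proof -
  let ?D = "\<lambda>s \<omega>. X s \<omega> - Y s \<omega>"
  have D: "cont_proc t T ?D" by (rule cont_proc_diff[OF X Y])
  have "(\<integral>\<^sup>+\<omega>. (SUP k\<in>{..2^n::nat}. ennreal ((norm (?D (t + (T - t) * real k / 2^n) \<omega>))\<^sup>2)) \<partial>M) = 0" for n
  proof -
    have in_grid: "t + (T - t) * real k / 2^n \<in> {t..T}" if "k \<in> {..2^n}" for k :: nat
      using dyadic_point_in[OF t] that by simp
    have "AE \<omega> in M. \<forall>k\<in>{..2^n::nat}. X (t + (T - t) * real k / 2^n) \<omega> = Y (t + (T - t) * real k / 2^n) \<omega>"
      using eq[OF in_grid] by (intro AE_finite_allI) auto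
    then have "AE \<omega> in M. (SUP k\<in>{..2^n::nat}. ennreal ((norm (?D (t + (T - t) * real k / 2^n) \<omega>))\<^sup>2)) = 0"
    proof eventually_elim
      case (elim \<omega>)
      have "(SUP k\<in>{..2^n::nat}. ennreal ((norm (?D (t + (T - t) * real k / 2^n) \<omega>))\<^sup>2)) \<le> 0"
        by (rule SUP_least) (use elim in simp)
      then show ?case by simp
    qed
    from nn_integral_cong_AE[OF this] show ?thesis by simp
  qed
  then have "sup_sq_expectation M t T ?D = 0"
    using sup_sq_measurable(2)[OF t cont_proc_measurable[OF D]] D unfolding cont_proc_def by simp
  from sup_sq_expectation_0_imp[OF D t this] show ?thesis by simp
qed

text \<open>With paths continuous only almost surely, an adapted process need not be progressive.
  Sampling at the last grid time not after \<open>s\<close> uses only the past; the limit of the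
  samples is progressive and agrees with \<open>X\<close> on every continuous path.\<close>

lemma continuous_adapted_version:
  fixes X :: "real \<Rightarrow> 'a \<Rightarrow> 'b::euclidean_space"
  assumes ad: "\<And>s. s \<in> {t..T} \<Longrightarrow> X s \<in> borel_measurable (F s)"
    and cont: "AE \<omega> in M. continuous_on {t..T} (\<lambda>s. X s \<omega>)"
  shows "\<exists>Y. cont_proc t T Y \<and> (AE \<omega> in M. \<forall>s\<in>{t..T}. Y s \<omega> = X s \<omega>)"
proof -
  define k where "k n s = nat \<lfloor>(s - t) * 2^n\<rfloor>" for n :: nat and s :: real
  define \<rho> where "\<rho> n s = t + real (k n s) / 2^n" for n s
  have \<rho>: "t \<le> \<rho> n s" "\<rho> n s \<le> s" "s - 1 / 2^n \<le> \<rho> n s" if "t \<le> s" for n s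
  proof -
    have r: "real (k n s) = of_int \<lfloor>(s - t) * 2^n\<rfloor>" using that by (simp add: k_def)
    have "real (k n s) \<le> (s - t) * 2^n" unfolding r by (rule of_int_floor_le)
    then have "real (k n s) / 2^n \<le> s - t" by (simp add: divide_le_eq)
    then show "\<rho> n s \<le> s" by (simp add: \<rho>_def)
    have "(s - t) * 2^n - 1 \<le> real (k n s)" unfolding r by linarith
    then have "((s - t) * 2^n - 1) / 2^n \<le> real (k n s) / 2^n" by (rule divide_right_mono) simp
    then show "s - 1 / 2^n \<le> \<rho> n s" by (simp add: \<rho>_def diff_divide_distrib)
  qed (simp add: \<rho>_def)
  have prog: "progressive F t T (\<lambda>s \<omega>. X (\<rho> n s) \<omega>)" for n
  proof (rule progressiveI_joint)
    fix r assume r: "r \<in> {t..T}"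
    \<comment> \<open>Capping the sampling time at \<open>r\<close> changes nothing for
      \<open>s \<le> r\<close> but makes each of the countably many candidates measurable for
      \<open>F r\<close>.\<close>
    have "(\<lambda>x. X (min r (t + real j / 2^n)) (snd x)) \<in> borel_measurable (borel \<Otimes>\<^sub>M F r)" for j :: nat
      by (rule measurable_compose[OF measurable_snd measurable_F_mono[OF ad]]) (use r in auto)
    moreover have "(\<lambda>x. k n (fst x)) \<in> measurable (borel \<Otimes>\<^sub>M F r) (count_space UNIV)"
      unfolding k_def by measurable
    ultimately have "(\<lambda>x. X (min r (t + real (k n (fst x)) / 2^n)) (snd x)) \<in> borel_measurable (borel \<Otimes>\<^sub>M F r)"
      by (rule measurable_compose_countable)
    then show "\<exists>\<psi>\<in>borel_measurable (borel \<Otimes>\<^sub>M F r). \<forall>s\<in>{t..r}. \<forall>\<omega>\<in>space (F r). X (\<rho> n s) \<omega> = \<psi> (s, \<omega>)"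
    proof (rule bexI[rotated], intro ballI)
      fix s \<omega> assume "s \<in> {t..r}"
      then have "\<rho> n s \<le> r" using \<rho>(2)[of s n] by auto
      then have "min r (t + real (k n s) / 2^n) = \<rho> n s" unfolding \<rho>_def by simp
      then show "X (\<rho> n s) \<omega> = X (min r (t + real (k n (fst (s, \<omega>))) / 2^n)) (snd (s, \<omega>))" by simp
    qed
  qed
  define Y where "Y s \<omega> = lim (\<lambda>n. X (\<rho> n s) \<omega>)" for s \<omega>
  have Y: "progressive F t T Y" unfolding Y_def by (rule progressive_lim[OF prog])
  have half: "(\<lambda>n. (1/2::real)^n) \<longlonglongrightarrow> 0" by (rule LIMSEQ_realpow_zero) auto
  have eq: "AE \<omega> in M. \<forall>s\<in>{t..T}. Y s \<omega> = X s \<omega>"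
    using cont
  proof eventually_elim
    case (elim \<omega>)
    show ?case
    proof
      fix s assume s: "s \<in> {t..T}"
      then have ts: "t \<le> s" by simp
      have l: "(\<lambda>n. s - 1 / 2^n) \<longlonglongrightarrow> s"
        using tendsto_diff[OF tendsto_const[of s] half] by (simp add: power_divide)
      have "(\<lambda>n. \<rho> n s) \<longlonglongrightarrow> s"
        by (rule tendsto_sandwich[OF _ _ l tendsto_const]) (simp_all add: \<rho>[OF ts])
      then have "(\<lambda>n. X (\<rho> n s) \<omega>) \<longlonglongrightarrow> X s \<omega>"
        by (rule continuous_on_tendsto_compose[OF elim])
           (use s in \<open>auto intro!: always_eventually \<rho>[OF ts] order_trans[OF \<rho>(2)[OF ts]]\<close>)
      then show "Y s \<omega> = X s \<omega>" unfolding Y_def by (rule limI)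
    qed
  qed
  moreover have "AE \<omega> in M. continuous_on {t..T} (\<lambda>s. Y s \<omega>)"
    using cont eq by eventually_elim (metis (no_types, lifting) continuous_on_cong)
  ultimately show ?thesis using Y unfolding cont_proc_def by blast
qed

text \<open>Squares decaying like 4^(-k) beat the weights of the telescoping estimate, so almost
  every path converges uniformly. The loss is the factor 4, since the weighted sum from
  \<open>k\<close> on is 2C / 4^k times a geometric series of sum 2.\<close>

lemma cont_proc_complete:
  fixes X :: "nat \<Rightarrow> real \<Rightarrow> 'a \<Rightarrow> 'b::euclidean_space"
  assumes tT: "t \<le> T" and X: "\<And>k. cont_proc t T (X k)" and C: "0 \<le> C"
    and S: "\<And>k. sup_sq_expectation M t T (\<lambda>s \<omega>. X (Suc k) s \<omega> - X k s \<omega>) \<le> ennreal (C / 4 ^ k)"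
  shows "\<exists>Y. cont_proc t T Y \<and> (\<forall>k. sup_sq_expectation M t T (\<lambda>s \<omega>. Y s \<omega> - X k s \<omega>) \<le> ennreal (4 * C / 4 ^ k))"
proof -
  define D where "D k \<omega> = (SUP s\<in>{t..T}. ennreal ((norm (X (Suc k) s \<omega> - X k s \<omega>))\<^sup>2))" for k \<omega>
  have Dm[measurable]: "D k \<in> borel_measurable M" for k
    unfolding D_def by (rule cont_proc_sup_measurable[OF cont_proc_diff[OF X X] tT])
  have DS: "(\<integral>\<^sup>+\<omega>. D k \<omega> \<partial>M) \<le> ennreal (C / 4 ^ k)" for k
    using S[of k] unfolding sup_sq_expectation_def D_def .
  \<comment> \<open>One random variable that dominates the squared distance of \<open>X k\<close>
    from all later members, uniformly in time.\<close>
  define B where "B k \<omega> = (\<Sum>i. ennreal (2 ^ Suc i) * D (k + i) \<omega>)" for k \<omega>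
  have Bm[measurable]: "B k \<in> borel_measurable M" for k unfolding B_def by measurable
  have intB: "(\<integral>\<^sup>+\<omega>. B k \<omega> \<partial>M) \<le> ennreal (4 * C / 4 ^ k)" for k
  proof -
    have "(\<integral>\<^sup>+\<omega>. B k \<omega> \<partial>M) = (\<Sum>i. ennreal (2 ^ Suc i) * (\<integral>\<^sup>+\<omega>. D (k + i) \<omega> \<partial>M))"
      unfolding B_def by (subst nn_integral_suminf) (auto simp: nn_integral_cmult)
    also have "\<dots> \<le> (\<Sum>i. ennreal (2 * C / 4 ^ k * (1/2) ^ i))"
    proof (intro suminf_le allI)
      fix i
      have "ennreal (2 ^ Suc i) * (\<integral>\<^sup>+\<omega>. D (k + i) \<omega> \<partial>M) \<le> ennreal (2 ^ Suc i) * ennreal (C / 4 ^ (k + i))"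
        by (intro mult_left_mono DS) simp
      also have "\<dots> = ennreal (2 ^ Suc i * (C / 4 ^ (k + i)))" using C by (simp only: ennreal_mult'' divide_nonneg_nonneg zero_le_power zero_le_numeral)
      also have "2 ^ Suc i * (C / 4 ^ (k + i)) = 2 * C / 4 ^ k * (1/2) ^ i"
      proof -
        have "(4::real) ^ i = 2 ^ i * 2 ^ i" by (simp add: power_mult_distrib[symmetric])
        then show ?thesis by (simp add: power_add power_divide)
      qed
      finally show "ennreal (2 ^ Suc i) * (\<integral>\<^sup>+\<omega>. D (k + i) \<omega> \<partial>M) \<le> ennreal (2 * C / 4 ^ k * (1/2) ^ i)" .
    qed auto
    also have "\<dots> = ennreal (2 * C / 4 ^ k * (1 / (1 - 1/2)))"
      using C by (intro suminf_ennreal_eq sums_mult geometric_sums) auto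
    finally show ?thesis by (simp add: mult.commute mult.left_commute)
  qed
  have AEB: "AE \<omega> in M. B 0 \<omega> \<noteq> \<infinity>"
    using intB[of 0] by (intro nn_integral_noteq_infinite) (auto simp: top_unique)
  \<comment> \<open>Shifting the index by \<open>k\<close> multiplies the weights by 2^k. Thus
    finiteness of \<open>B 0\<close> alone makes \<open>B k\<close> decay geometrically along the
    path.\<close>
  have Bscale: "ennreal (2 ^ k) * B k \<omega> \<le> B 0 \<omega>" for k \<omega>
  proof -
    have "ennreal (2 ^ k) * B k \<omega> = (\<Sum>i. ennreal (2 ^ k) * (ennreal (2 ^ Suc i) * D (k + i) \<omega>))"
      unfolding B_def by (rule ennreal_suminf_cmult[symmetric])
    also have "\<dots> = (\<Sum>i. ennreal (2 ^ Suc (i + k)) * D (i + k) \<omega>)"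
    proof (rule suminf_cong)
      fix i
      have "ennreal (2 ^ k) * ennreal (2 ^ Suc i) = ennreal (2 ^ Suc (i + k))"
        by (subst ennreal_mult[symmetric]) (simp_all add: power_add mult.commute)
      then show "ennreal (2 ^ k) * (ennreal (2 ^ Suc i) * D (k + i) \<omega>) = ennreal (2 ^ Suc (i + k)) * D (i + k) \<omega>"
        by (simp only: mult.assoc[symmetric] add.commute[of i k])
    qed
    also have "\<dots> \<le> (\<Sum>i. ennreal (2 ^ Suc i) * D i \<omega>)"
      by (rule suminf_offset_le_ennreal)
    finally show ?thesis by (simp add: B_def)
  qed
  have diffB: "ennreal ((norm (X (k + n) s \<omega> - X k s \<omega>))\<^sup>2) \<le> B k \<omega>" if s: "s \<in> {t..T}" for k n s \<omega>
  proof -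
    have "ennreal ((norm (X (k + n) s \<omega> - X k s \<omega>))\<^sup>2)
      \<le> ennreal (\<Sum>i<n. 2 ^ Suc i * (norm (X (Suc (k + i)) s \<omega> - X (k + i) s \<omega>))\<^sup>2)"
      by (intro ennreal_leI norm_telescope_sq_le[of "\<lambda>j. X j s \<omega>"])
    also have "\<dots> = (\<Sum>i<n. ennreal (2 ^ Suc i) * ennreal ((norm (X (Suc (k + i)) s \<omega> - X (k + i) s \<omega>))\<^sup>2))"
      by (subst sum_ennreal[symmetric]) (auto intro!: sum.cong simp: ennreal_mult)
    also have "\<dots> \<le> (\<Sum>i<n. ennreal (2 ^ Suc i) * D (k + i) \<omega>)"
      unfolding D_def by (intro sum_mono mult_left_mono SUP_upper s) simp
    also have "\<dots> \<le> B k \<omega>" unfolding B_def by (rule sum_le_suminf) auto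
    finally show ?thesis .
  qed
  define Y where "Y s \<omega> = lim (\<lambda>k. X k s \<omega>)" for s \<omega>
  have good: "AE \<omega> in M. continuous_on {t..T} (\<lambda>s. Y s \<omega>) \<and> (\<forall>k. \<forall>s\<in>{t..T}. ennreal ((norm (Y s \<omega> - X k s \<omega>))\<^sup>2) \<le> B k \<omega>)"
  proof -
    have "AE \<omega> in M. \<forall>k. continuous_on {t..T} (\<lambda>s. X k s \<omega>)"
      using X unfolding cont_proc_def by (subst AE_all_countable) auto
    with AEB show ?thesis
    proof eventually_elim
      case (elim \<omega>)
      then obtain R where R: "B 0 \<omega> = ennreal R" "0 \<le> R" by (cases "B 0 \<omega>") auto
      have Bk: "B k \<omega> \<le> ennreal (R / 2 ^ k)" for k
      proof -
        have "B k \<omega> \<noteq> \<infinity>" using Bscale[of k \<omega>] R by (auto simp: ennreal_mult_eq_top_iff top_unique)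
        then obtain b where b: "B k \<omega> = ennreal b" "0 \<le> b" by (cases "B k \<omega>") auto
        have "ennreal (2 ^ k * b) \<le> ennreal R" using Bscale[of k \<omega>] R b by (simp add: ennreal_mult)
        then have "2 ^ k * b \<le> R" using R by (simp add: ennreal_le_iff)
        then have "b \<le> R / 2 ^ k" by (simp add: field_simps)
        then show ?thesis unfolding b by (rule ennreal_leI)
      qed
      have nb: "(norm (X (k + n) s \<omega> - X k s \<omega>))\<^sup>2 \<le> R / 2 ^ k" if s: "s \<in> {t..T}" for k n s
        using order_trans[OF diffB[OF s] Bk] R by (subst (asm) ennreal_le_iff) auto
      have lim0: "(\<lambda>k. R / 2 ^ k) \<longlonglongrightarrow> 0"
      proof -
        have "(\<lambda>k. R * (1/2) ^ k) \<longlonglongrightarrow> R * 0" by (intro tendsto_mult tendsto_const LIMSEQ_realpow_zero) auto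
        then show ?thesis by (simp add: power_divide)
      qed
      have small: "\<exists>K. \<forall>k\<ge>K. R / 2 ^ k < e\<^sup>2" if "0 < e" for e
        using LIMSEQ_D[OF lim0, of "e\<^sup>2"] that R by auto
      have conv: "(\<lambda>k. X k s \<omega>) \<longlonglongrightarrow> Y s \<omega>" if s: "s \<in> {t..T}" for s
      proof -
        have "Cauchy (\<lambda>k. X k s \<omega>)"
        proof (rule CauchyI')
          fix e :: real assume e: "0 < e"
          from small[OF this] obtain K where K: "\<And>k. k \<ge> K \<Longrightarrow> R / 2 ^ k < e\<^sup>2" by blast
          show "\<exists>K. \<forall>m\<ge>K. \<forall>n>m. dist (X m s \<omega>) (X n s \<omega>) < e"
          proof (intro exI allI impI)
            fix m n assume mn: "K \<le> m" "m < n"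
            have "(norm (X n s \<omega> - X m s \<omega>))\<^sup>2 < e\<^sup>2"
              using nb[OF s, of m "n - m"] K[OF mn(1)] mn(2) by simp
            then have "norm (X n s \<omega> - X m s \<omega>) < e" by (rule power_less_imp_less_base) (use e in simp)
            then show "dist (X m s \<omega>) (X n s \<omega>) < e" by (simp add: dist_norm norm_minus_commute)
          qed
        qed
        then show ?thesis unfolding Y_def by (simp add: Cauchy_convergent_iff convergent_LIMSEQ_iff)
      qed
      have YB: "ennreal ((norm (Y s \<omega> - X k s \<omega>))\<^sup>2) \<le> B k \<omega>" if s: "s \<in> {t..T}" for k s
      proof -
        have "(\<lambda>n. X (n + k) s \<omega>) \<longlonglongrightarrow> Y s \<omega>" using conv[OF s] by (rule LIMSEQ_ignore_initial_segment)
        then have "(\<lambda>n. ennreal ((norm (X (n + k) s \<omega> - X k s \<omega>))\<^sup>2)) \<longlonglongrightarrow> ennreal ((norm (Y s \<omega> - X k s \<omega>))\<^sup>2)"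
          by (intro tendsto_intros)
        then show ?thesis
          by (rule LIMSEQ_le_const2) (use diffB[OF s, of k] in \<open>auto simp: add.commute\<close>)
      qed
      have "uniform_limit {t..T} (\<lambda>k s. X k s \<omega>) (\<lambda>s. Y s \<omega>) sequentially"
      proof (rule uniform_limitI)
        fix e :: real assume e: "0 < e"
        from small[OF this] obtain K where K: "\<And>k. k \<ge> K \<Longrightarrow> R / 2 ^ k < e\<^sup>2" by blast
        show "\<forall>\<^sub>F k in sequentially. \<forall>s\<in>{t..T}. dist (X k s \<omega>) (Y s \<omega>) < e"
          using eventually_ge_at_top[of K]
        proof eventually_elim
          case (elim k)
          show ?case
          proof
            fix s assume s: "s \<in> {t..T}"
            have "ennreal ((norm (Y s \<omega> - X k s \<omega>))\<^sup>2) \<le> ennreal (R / 2 ^ k)" using YB[OF s] Bk by (rule order_trans)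
            then have "(norm (Y s \<omega> - X k s \<omega>))\<^sup>2 \<le> R / 2 ^ k" using R by (subst (asm) ennreal_le_iff) auto
            also have "\<dots> < e\<^sup>2" using K[OF elim] .
            finally have "norm (Y s \<omega> - X k s \<omega>) < e" by (rule power_less_imp_less_base) (use e in simp)
            then show "dist (X k s \<omega>) (Y s \<omega>) < e" by (simp add: dist_norm norm_minus_commute)
          qed
        qed
      qed
      then have "continuous_on {t..T} (\<lambda>s. Y s \<omega>)"
        by (rule uniform_limit_theorem[rotated]) (use elim in auto)
      then show ?case using YB by blast
    qed
  qed
  have "cont_proc t T Y"
    unfolding cont_proc_def
  proof
    show "progressive F t T Y" unfolding Y_def using X unfolding cont_proc_def by (intro progressive_lim) auto
    show "AE \<omega> in M. continuous_on {t..T} (\<lambda>s. Y s \<omega>)" using good by eventually_elim blast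
  qed
  moreover have "sup_sq_expectation M t T (\<lambda>s \<omega>. Y s \<omega> - X k s \<omega>) \<le> ennreal (4 * C / 4 ^ k)" for k
  proof (rule order_trans[OF _ intB])
    show "sup_sq_expectation M t T (\<lambda>s \<omega>. Y s \<omega> - X k s \<omega>) \<le> (\<integral>\<^sup>+\<omega>. B k \<omega> \<partial>M)"
      unfolding sup_sq_expectation_def
    proof (rule nn_integral_mono_AE)
      show "AE \<omega> in M. (SUP s\<in>{t..T}. ennreal ((norm (Y s \<omega> - X k s \<omega>))\<^sup>2)) \<le> B k \<omega>"
        using good by eventually_elim (blast intro: SUP_least)
    qed
  qed
  ultimately show ?thesis by blast
qed

section \<open>Difference, uniqueness and existence of Ito integrals\<close>

lemma elementary_integral_eq_at:
  "elementary M F t s es \<Longrightarrow> elementary_integral W es \<omega> = elementary_integral_at W es s \<omega>"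
  by (induction es) (auto simp: elementary_integral_def elementary_integral_at_def elementary_def min_absorb1)

lemma elementary_integral_measurable:
  assumes "0 \<le> t" "t \<le> s" "elementary M F t s es"
  shows "elementary_integral W es \<in> borel_measurable M"
proof -
  have "elementary_integral W es = elementary_integral_at W es s"
    by (rule ext) (rule elementary_integral_eq_at[OF assms(3)])
  then show ?thesis using measurable_F[OF elementary_integral_at_adapted[OF assms]] by simp
qed

lemma has_ito_integral_diff:
  fixes \<phi> \<psi> :: "real \<Rightarrow> 'a \<Rightarrow> 'b::euclidean_space"
  assumes t: "0 \<le> t" "t \<le> s" and J: "has_ito_integral M F W t s \<phi> J" and K: "has_ito_integral M F W t s \<psi> K"
  shows "has_ito_integral M F W t s (\<lambda>r \<omega>. \<phi> r \<omega> - \<psi> r \<omega>) (\<lambda>\<omega>. J \<omega> - K \<omega>)"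
proof -
  obtain es where es: "\<And>k. elementary M F t s (es k)"
    and es1: "(\<lambda>k. proc_energy M t s (\<lambda>r \<omega>. elementary_process (es k) r \<omega> - \<phi> r \<omega>)) \<longlonglongrightarrow> 0"
    and es2: "(\<lambda>k. \<integral>\<^sup>+\<omega>. ennreal ((norm (elementary_integral W (es k) \<omega> - J \<omega>))\<^sup>2) \<partial>M) \<longlonglongrightarrow> 0"
    using J unfolding has_ito_integral_def proc_energy_def by blast
  obtain fs where fs: "\<And>k. elementary M F t s (fs k)"
    and fs1: "(\<lambda>k. proc_energy M t s (\<lambda>r \<omega>. elementary_process (fs k) r \<omega> - \<psi> r \<omega>)) \<longlonglongrightarrow> 0"
    and fs2: "(\<lambda>k. \<integral>\<^sup>+\<omega>. ennreal ((norm (elementary_integral W (fs k) \<omega> - K \<omega>))\<^sup>2) \<partial>M) \<longlonglongrightarrow> 0"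
    using K unfolding has_ito_integral_def proc_energy_def by blast
  have \<phi>: "progressive F t s \<phi>" "proc_energy M t s \<phi> < \<infinity>" and \<psi>: "progressive F t s \<psi>" "proc_energy M t s \<psi> < \<infinity>"
    using J K unfolding has_ito_integral_def L2_proc_def proc_energy_def by auto
  have m\<psi>: "progressive F t s (\<lambda>r \<omega>. - \<psi> r \<omega>)" by (rule progressive_comp[OF \<psi>(1)]) simp
  have Jm: "J \<in> borel_measurable (F s)" "integrable M (\<lambda>\<omega>. (norm (J \<omega>))\<^sup>2)" and Km: "K \<in> borel_measurable (F s)" "integrable M (\<lambda>\<omega>. (norm (K \<omega>))\<^sup>2)"
    using J K unfolding has_ito_integral_def L2_def by auto
  have two: "(\<lambda>k. 2 * a k + 2 * b k) \<longlonglongrightarrow> 0" if "a \<longlonglongrightarrow> 0" "b \<longlonglongrightarrow> 0" for a b :: "nat \<Rightarrow> ennreal"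
    using tendsto_add[OF ennreal_tendsto_cmult[OF _ that(1), of 2] ennreal_tendsto_cmult[OF _ that(2), of 2]] by simp
  have neg: "proc_energy M t s (\<lambda>r \<omega>. \<psi> r \<omega> - X r \<omega>) = proc_energy M t s (\<lambda>r \<omega>. X r \<omega> - \<psi> r \<omega>)" for X :: "real \<Rightarrow> 'a \<Rightarrow> 'b"
    unfolding proc_energy_def by (simp add: norm_minus_commute)
  have "proc_energy M t s (\<lambda>r \<omega>. \<phi> r \<omega> + (- \<psi> r \<omega>)) \<le> 2 * proc_energy M t s \<phi> + 2 * proc_energy M t s (\<lambda>r \<omega>. - \<psi> r \<omega>)"
    by (rule proc_energy_add_le[OF \<phi>(1) m\<psi> t(2) order_refl])
  also have "proc_energy M t s (\<lambda>r \<omega>. - \<psi> r \<omega>) = proc_energy M t s \<psi>" unfolding proc_energy_def by simp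
  also have "2 * proc_energy M t s \<phi> + 2 * proc_energy M t s \<psi> < \<infinity>" using \<phi>(2) \<psi>(2) by (simp add: ennreal_mult_less_top)
  finally have L: "(\<lambda>r \<omega>. \<phi> r \<omega> - \<psi> r \<omega>) \<in> L2_proc M F t s"
    unfolding L2_proc_def proc_energy_def using progressive_diff[OF \<phi>(1) \<psi>(1)] by simp
  have JK: "(\<lambda>\<omega>. J \<omega> - K \<omega>) \<in> L2 M (F s)"
  proof -
    have "integrable M (\<lambda>\<omega>. (norm (J \<omega> - K \<omega>))\<^sup>2)"
    proof (rule Bochner_Integration.integrable_bound)
      show "integrable M (\<lambda>\<omega>. 2 * (norm (J \<omega>))\<^sup>2 + 2 * (norm (K \<omega>))\<^sup>2)" using Jm Km by auto
      show "(\<lambda>\<omega>. (norm (J \<omega> - K \<omega>))\<^sup>2) \<in> borel_measurable M" using measurable_F[OF Jm(1)] measurable_F[OF Km(1)] by simp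
      have "(norm (x - y))\<^sup>2 \<le> 2 * (norm x)\<^sup>2 + 2 * (norm y)\<^sup>2" for x y :: 'b
      proof -
        have "(norm (x - y))\<^sup>2 \<le> (norm x + norm y)\<^sup>2" by (intro power_mono norm_triangle_ineq4) simp
        also have "\<dots> \<le> 2 * (norm x)\<^sup>2 + 2 * (norm y)\<^sup>2"
          using zero_le_power2[of "norm x - norm y"] by (simp add: power2_eq_square algebra_simps)
        finally show ?thesis .
      qed
      then show "AE \<omega> in M. norm ((norm (J \<omega> - K \<omega>))\<^sup>2) \<le> norm (2 * (norm (J \<omega>))\<^sup>2 + 2 * (norm (K \<omega>))\<^sup>2)" by simp
    qed
    then show ?thesis using Jm Km unfolding L2_def by simp
  qed
  define ds where "ds k = elementary_diff (es k) (fs k)" for k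
  have ds: "elementary M F t s (ds k)" for k unfolding ds_def by (rule elementary_elementary_diff[OF es fs])
  have "(\<lambda>k. proc_energy M t s (\<lambda>r \<omega>. elementary_process (ds k) r \<omega> - (\<phi> r \<omega> - \<psi> r \<omega>))) \<longlonglongrightarrow> 0"
  proof (rule tendsto_sandwich[OF _ _ tendsto_const two[OF es1 fs1]])
    show "\<forall>\<^sub>F k in sequentially. proc_energy M t s (\<lambda>r \<omega>. elementary_process (ds k) r \<omega> - (\<phi> r \<omega> - \<psi> r \<omega>))
      \<le> 2 * proc_energy M t s (\<lambda>r \<omega>. elementary_process (es k) r \<omega> - \<phi> r \<omega>) + 2 * proc_energy M t s (\<lambda>r \<omega>. elementary_process (fs k) r \<omega> - \<psi> r \<omega>)"
    proof (rule always_eventually, rule allI)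
      fix k
      have "proc_energy M t s (\<lambda>r \<omega>. (elementary_process (es k) r \<omega> - \<phi> r \<omega>) + (\<psi> r \<omega> - elementary_process (fs k) r \<omega>))
        \<le> 2 * proc_energy M t s (\<lambda>r \<omega>. elementary_process (es k) r \<omega> - \<phi> r \<omega>) + 2 * proc_energy M t s (\<lambda>r \<omega>. \<psi> r \<omega> - elementary_process (fs k) r \<omega>)"
        by (rule proc_energy_add_le[OF progressive_diff[OF elementary_progressive[OF es] \<phi>(1)] progressive_diff[OF \<psi>(1) elementary_progressive[OF fs]] t(2) order_refl])
      then show "proc_energy M t s (\<lambda>r \<omega>. elementary_process (ds k) r \<omega> - (\<phi> r \<omega> - \<psi> r \<omega>))
      \<le> 2 * proc_energy M t s (\<lambda>r \<omega>. elementary_process (es k) r \<omega> - \<phi> r \<omega>) + 2 * proc_energy M t s (\<lambda>r \<omega>. elementary_process (fs k) r \<omega> - \<psi> r \<omega>)"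
        unfolding neg ds_def elementary_process_diff by (simp add: algebra_simps)
    qed
  qed simp
  moreover have "(\<lambda>k. \<integral>\<^sup>+\<omega>. ennreal ((norm (elementary_integral W (ds k) \<omega> - (J \<omega> - K \<omega>)))\<^sup>2) \<partial>M) \<longlonglongrightarrow> 0"
  proof (rule tendsto_sandwich[OF _ _ tendsto_const two[OF es2 fs2]])
    show "\<forall>\<^sub>F k in sequentially. (msq M (\<lambda>\<omega>. elementary_integral W (ds k) \<omega> - (J \<omega> - K \<omega>)))
      \<le> 2 * (msq M (\<lambda>\<omega>. elementary_integral W (es k) \<omega> - J \<omega>)) + 2 * (msq M (\<lambda>\<omega>. elementary_integral W (fs k) \<omega> - K \<omega>))"
    proof (rule always_eventually, rule allI)
      fix k
      have "(msq M (\<lambda>\<omega>. (elementary_integral W (es k) \<omega> - J \<omega>) + (K \<omega> - elementary_integral W (fs k) \<omega>)))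
        \<le> 2 * (msq M (\<lambda>\<omega>. elementary_integral W (es k) \<omega> - J \<omega>)) + 2 * (msq M (\<lambda>\<omega>. K \<omega> - elementary_integral W (fs k) \<omega>))"
        by (intro msq_add_le borel_measurable_diff elementary_integral_measurable[OF t es] elementary_integral_measurable[OF t fs]
            measurable_F[OF Jm(1)] measurable_F[OF Km(1)])
      then show "(msq M (\<lambda>\<omega>. elementary_integral W (ds k) \<omega> - (J \<omega> - K \<omega>)))
      \<le> 2 * (msq M (\<lambda>\<omega>. elementary_integral W (es k) \<omega> - J \<omega>)) + 2 * (msq M (\<lambda>\<omega>. elementary_integral W (fs k) \<omega> - K \<omega>))"
        unfolding ds_def elementary_integral_diff norm_minus_commute[of "K _"] by (simp add: algebra_simps)
    qed
  qed simp
  ultimately show ?thesis using L JK ds unfolding has_ito_integral_def proc_energy_def by blast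
qed

text \<open>The difference is an Ito integral of the zero process. Its approximating integrands tend
  to 0 in energy, so by the isometry their integrals tend to 0 as well.\<close>

lemma has_ito_integral_unique:
  fixes \<phi> :: "real \<Rightarrow> 'a \<Rightarrow> 'b::euclidean_space"
  assumes t: "0 \<le> t" "t \<le> s" and J: "has_ito_integral M F W t s \<phi> J" and K: "has_ito_integral M F W t s \<phi> K"
  shows "AE \<omega> in M. J \<omega> = K \<omega>"
proof -
  let ?D = "\<lambda>\<omega>. J \<omega> - K \<omega>"
  from has_ito_integral_diff[OF t J K]
  obtain es where es: "\<And>k. elementary M F t s (es k)"
    and es1: "(\<lambda>k. \<integral>\<^sup>+\<omega>. (\<integral>\<^sup>+r\<in>{t..s}. ennreal ((norm (elementary_process (es k) r \<omega>))\<^sup>2) \<partial>lborel) \<partial>M) \<longlonglongrightarrow> 0"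
    and es2: "(\<lambda>k. \<integral>\<^sup>+\<omega>. ennreal ((norm (elementary_integral W (es k) \<omega> - ?D \<omega>))\<^sup>2) \<partial>M) \<longlonglongrightarrow> 0"
    unfolding has_ito_integral_def by auto
  have Dm: "?D \<in> borel_measurable M"
    using J K measurable_F unfolding has_ito_integral_def L2_def by (intro borel_measurable_diff) blast+
  note es1' = es1[folded elementary_isometry(1)[OF t(1) es]]
  have "(msq M ?D)
     \<le> 2 * (msq M (\<lambda>\<omega>. elementary_integral W (es k) \<omega> - ?D \<omega>))
       + 2 * (msq M (elementary_integral W (es k)))" for k
  proof -
    have "(msq M (\<lambda>\<omega>. (?D \<omega> - elementary_integral W (es k) \<omega>) + elementary_integral W (es k) \<omega>))
     \<le> 2 * (msq M (\<lambda>\<omega>. ?D \<omega> - elementary_integral W (es k) \<omega>))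
       + 2 * (msq M (elementary_integral W (es k)))"
      by (intro msq_add_le borel_measurable_diff[OF Dm] elementary_integral_measurable[OF t es])
    then show ?thesis by (simp add: norm_minus_commute[of "?D _"])
  qed
  moreover have "(\<lambda>k. 2 * (msq M (\<lambda>\<omega>. elementary_integral W (es k) \<omega> - ?D \<omega>))
       + 2 * (msq M (elementary_integral W (es k)))) \<longlonglongrightarrow> 0"
    using tendsto_add[OF ennreal_tendsto_cmult[OF _ es2, of 2] ennreal_tendsto_cmult[OF _ es1', of 2]] by simp
  ultimately have "(msq M ?D) = 0" by (rule ennreal_tendsto_0_unique)
  then have "AE \<omega> in M. ennreal ((norm (?D \<omega>))\<^sup>2) = 0" using Dm by (subst (asm) nn_integral_0_iff_AE) auto
  then show ?thesis by eventually_elim (simp add: ennreal_eq_0_iff)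
qed

lemma ito_integral_process_diff:
  assumes "0 \<le> t" "ito_integral_process M F W t T \<phi> I" "ito_integral_process M F W t T \<psi> J"
  shows "ito_integral_process M F W t T (\<lambda>r \<omega>. \<phi> r \<omega> - \<psi> r \<omega>) (\<lambda>r \<omega>. I r \<omega> - J r \<omega>)"
  using assms cont_proc_diff[of t T I J] unfolding ito_integral_process_def cont_proc_def
  by (auto intro: has_ito_integral_diff)

lemma ito_integral_process_cont_proc: "ito_integral_process M F W t T \<phi> I \<Longrightarrow> cont_proc t T I"
  unfolding ito_integral_process_def cont_proc_def by simp

text \<open>Approximants with energy error 4^(-k) have integrals that are Cauchy in the supremum
  norm by Doob's inequality. The constant 16 is Doob's 4 times a 2 for splitting the energy and a 2
  for splitting the supremum.\<close>

lemma ito_integral_process_exists_bounded: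
  fixes \<phi> :: "real \<Rightarrow> 'a \<Rightarrow> 'b::euclidean_space"
  assumes t: "0 \<le> t" "t \<le> T" and \<phi>: "\<phi> \<in> L2_proc M F t T"
  shows "\<exists>I. ito_integral_process M F W t T \<phi> I \<and> sup_sq_expectation M t T I \<le> 16 * proc_energy M t T \<phi>"
proof -
  have \<phi>p: "progressive F t T \<phi>" and \<phi>e: "proc_energy M t T \<phi> < \<infinity>" using \<phi> unfolding L2_proc_def proc_energy_def by auto
  have "\<exists>es. elementary M F t T es \<and> proc_energy M t T (\<lambda>r \<omega>. elementary_process es r \<omega> - \<phi> r \<omega>) \<le> ennreal (1 / 4 ^ k)" for k :: nat
    by (rule elementary_dense[OF t \<phi>p \<phi>e]) simp
  then have "\<forall>k::nat. \<exists>es. elementary M F t T es \<and> proc_energy M t T (\<lambda>r \<omega>. elementary_process es r \<omega> - \<phi> r \<omega>) \<le> ennreal (1 / 4 ^ k)" by blast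
  from choice[OF this] obtain es where es: "\<And>k::nat. elementary M F t T (es k)"
    and ese: "\<And>k. proc_energy M t T (\<lambda>r \<omega>. elementary_process (es k) r \<omega> - \<phi> r \<omega>) \<le> ennreal (1 / 4 ^ k)" by blast
  have ep: "progressive F t T (\<lambda>r \<omega>. elementary_process (es k) r \<omega> - \<phi> r \<omega>)" for k
    by (rule progressive_diff[OF elementary_progressive[OF es] \<phi>p])
  \<comment> \<open>Brownian paths are continuous only almost surely, so the elementary integrals
    are replaced by progressive versions before limits are taken.\<close>
  have "\<forall>k. \<exists>Y. cont_proc t T Y \<and> (AE \<omega> in M. \<forall>s\<in>{t..T}. Y s \<omega> = elementary_integral_at W (es k) s \<omega>)"
  proof (rule allI, rule continuous_adapted_version)
    fix k
    show "elementary_integral_at W (es k) s \<in> borel_measurable (F s)" if "s \<in> {t..T}" for s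
      by (rule elementary_integral_at_adapted[OF t(1) _ es]) (use that in simp)
    show "AE \<omega> in M. continuous_on {t..T} (\<lambda>s. elementary_integral_at W (es k) s \<omega>)"
      using elementary_integral_at_continuous[OF t(1) es] by eventually_elim (auto intro: continuous_on_subset)
  qed
  from choice[OF this] obtain N where N: "\<And>k. cont_proc t T (N k)"
    and Ne: "\<And>k. AE \<omega> in M. \<forall>s\<in>{t..T}. N k s \<omega> = elementary_integral_at W (es k) s \<omega>" by blast
  have "sup_sq_expectation M t T (\<lambda>s \<omega>. N (Suc k) s \<omega> - N k s \<omega>) \<le> ennreal (16 / 4 ^ k)" for k
  proof -
    have "AE \<omega> in M. \<forall>s\<in>{t..T}. N (Suc k) s \<omega> - N k s \<omega> = elementary_integral_at W (elementary_diff (es (Suc k)) (es k)) s \<omega>"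
      using Ne[of k] Ne[of "Suc k"] by eventually_elim (simp add: elementary_integral_at_diff)
    from sup_sq_expectation_cong_AE[OF this]
    have "sup_sq_expectation M t T (\<lambda>s \<omega>. N (Suc k) s \<omega> - N k s \<omega>)
      \<le> 4 * proc_energy M t T (elementary_process (elementary_diff (es (Suc k)) (es k)))"
      using elementary_integral_doob[OF t elementary_elementary_diff[OF es es]] unfolding proc_energy_def by simp
    also have "proc_energy M t T (elementary_process (elementary_diff (es (Suc k)) (es k)))
      = proc_energy M t T (\<lambda>r \<omega>. (elementary_process (es (Suc k)) r \<omega> - \<phi> r \<omega>) + (\<phi> r \<omega> - elementary_process (es k) r \<omega>))"
      unfolding proc_energy_def elementary_process_diff by simp
    also have "\<dots> \<le> 2 * proc_energy M t T (\<lambda>r \<omega>. elementary_process (es (Suc k)) r \<omega> - \<phi> r \<omega>)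
       + 2 * proc_energy M t T (\<lambda>r \<omega>. \<phi> r \<omega> - elementary_process (es k) r \<omega>)"
      by (rule proc_energy_add_le[OF ep progressive_diff[OF \<phi>p elementary_progressive[OF es]] t(2) order_refl])
    also have "proc_energy M t T (\<lambda>r \<omega>. \<phi> r \<omega> - elementary_process (es k) r \<omega>) = proc_energy M t T (\<lambda>r \<omega>. elementary_process (es k) r \<omega> - \<phi> r \<omega>)"
      unfolding proc_energy_def by (simp add: norm_minus_commute)
    also have "2 * proc_energy M t T (\<lambda>r \<omega>. elementary_process (es (Suc k)) r \<omega> - \<phi> r \<omega>)
       + 2 * proc_energy M t T (\<lambda>r \<omega>. elementary_process (es k) r \<omega> - \<phi> r \<omega>) \<le> 2 * ennreal (1 / 4 ^ k) + 2 * ennreal (1 / 4 ^ k)"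
      by (intro add_mono mult_left_mono ese order_trans[OF ese[of "Suc k"]] ennreal_leI) (auto simp: field_simps)
    also have "4 * (2 * ennreal (1 / 4 ^ k) + 2 * ennreal (1 / 4 ^ k)) = ennreal (16 / 4 ^ k)"
      by (simp add: ennreal_mult''[symmetric] ennreal_plus[symmetric] ennreal_numeral[symmetric] del: ennreal_plus ennreal_numeral)
    finally show ?thesis by (simp add: mult_left_mono)
  qed
  from cont_proc_complete[OF t(2) N _ this] obtain I where I: "cont_proc t T I"
    and IN: "\<And>k. sup_sq_expectation M t T (\<lambda>s \<omega>. I s \<omega> - N k s \<omega>) \<le> ennreal (64 / 4 ^ k)" by auto
  have has: "has_ito_integral M F W t s \<phi> (I s)" if s: "s \<in> {t..T}" for s
  proof -
    have s': "t \<le> s" "s \<le> T" using s by auto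
    have en_mono: "proc_energy M t s X \<le> proc_energy M t T X" for X :: "real \<Rightarrow> 'a \<Rightarrow> 'b"
      unfolding proc_energy_def using s' by (intro nn_integral_mono mult_left_mono) (auto simp: indicator_def)
    have L: "\<phi> \<in> L2_proc M F t s"
      using progressive_subinterval[OF \<phi>p order_refl s'(2)] le_less_trans[OF en_mono \<phi>e]
      unfolding L2_proc_def proc_energy_def by simp
    have Im: "I s \<in> borel_measurable (F s)" using I s unfolding cont_proc_def by (auto intro: progressive_section)
    have dist: "(msq M (\<lambda>\<omega>. elementary_integral_at W (es k) s \<omega> - I s \<omega>)) \<le> ennreal (64 / 4 ^ k)" for k
    proof -
      have "(msq M (\<lambda>\<omega>. elementary_integral_at W (es k) s \<omega> - I s \<omega>)) = (msq M (\<lambda>\<omega>. I s \<omega> - N k s \<omega>))"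
        using Ne[of k] s by (intro nn_integral_cong_AE) (auto elim!: eventually_mono simp: norm_minus_commute)
      also have "\<dots> \<le> ennreal (64 / 4 ^ k)" by (rule order_trans[OF sup_sq_expectation_ge[OF s] IN])
      finally show ?thesis .
    qed
    have atm: "elementary_integral_at W (es k) s \<in> borel_measurable M" for k
      by (rule measurable_F[OF elementary_integral_at_adapted[OF t(1) s'(1) es]])
    have "(msq M (\<lambda>\<omega>. (I s \<omega> - elementary_integral_at W (es 0) s \<omega>) + elementary_integral_at W (es 0) s \<omega>))
      \<le> 2 * (msq M (\<lambda>\<omega>. I s \<omega> - elementary_integral_at W (es 0) s \<omega>))
        + 2 * (msq M (elementary_integral_at W (es 0) s))"
      by (intro msq_add_le borel_measurable_diff measurable_F[OF Im] atm)
    also have "\<dots> < \<infinity>"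
    proof -
      have "(msq M (\<lambda>\<omega>. I s \<omega> - elementary_integral_at W (es 0) s \<omega>)) < \<infinity>"
        using dist[of 0] by (simp add: norm_minus_commute le_less_trans)
      moreover have "(msq M (elementary_integral_at W (es 0) s)) < \<infinity>"
        using elementary_integral_at_L2[OF t(1) s'(1) es, of 0] unfolding L2_def by (simp add: nn_integral_eq_integral)
      ultimately show ?thesis by (simp add: ennreal_mult_less_top)
    qed
    finally have "integrable M (\<lambda>\<omega>. (norm (I s \<omega>))\<^sup>2)"
      using measurable_F[OF Im] by (intro integrableI_bounded) auto
    then have IL: "I s \<in> L2 M (F s)" using Im unfolding L2_def by simp
    \<comment> \<open>The integral up to \<open>s\<close> needs its own approximating sequence on
      \<open>{t..s}\<close>: the same integrands, cut at \<open>s\<close>.\<close>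
    define rs where "rs k = elementary_restrict s (es k)" for k
    have rs: "elementary M F t s (rs k)" for k unfolding rs_def by (rule elementary_elementary_restrict[OF es])
    have "(\<lambda>k. proc_energy M t s (\<lambda>r \<omega>. elementary_process (rs k) r \<omega> - \<phi> r \<omega>)) \<longlonglongrightarrow> 0"
    proof (rule tendsto_sandwich[OF _ _ tendsto_const ennreal_geometric_tendsto_0[of 1]])
      show "\<forall>\<^sub>F k in sequentially. proc_energy M t s (\<lambda>r \<omega>. elementary_process (rs k) r \<omega> - \<phi> r \<omega>) \<le> ennreal (1 / 4 ^ k)"
      proof (rule always_eventually, rule allI)
        fix k
        have "proc_energy M t s (\<lambda>r \<omega>. elementary_process (rs k) r \<omega> - \<phi> r \<omega>) = proc_energy M t s (\<lambda>r \<omega>. elementary_process (es k) r \<omega> - \<phi> r \<omega>)"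
          unfolding proc_energy_def rs_def by (intro nn_integral_cong) (auto simp: elementary_process_restrict indicator_def)
        also have "\<dots> \<le> ennreal (1 / 4 ^ k)" by (rule order_trans[OF en_mono ese])
        finally show "proc_energy M t s (\<lambda>r \<omega>. elementary_process (rs k) r \<omega> - \<phi> r \<omega>) \<le> ennreal (1 / 4 ^ k)" .
      qed
    qed simp_all
    moreover have "(\<lambda>k. \<integral>\<^sup>+\<omega>. ennreal ((norm (elementary_integral W (rs k) \<omega> - I s \<omega>))\<^sup>2) \<partial>M) \<longlonglongrightarrow> 0"
      unfolding rs_def elementary_integral_restrict[OF es]
      by (rule tendsto_sandwich[OF _ _ tendsto_const ennreal_geometric_tendsto_0[of 64]]) (simp_all add: dist)
    ultimately show ?thesis using L IL rs unfolding has_ito_integral_def proc_energy_def by blast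
  qed
  then have ito: "ito_integral_process M F W t T \<phi> I" using I unfolding ito_integral_process_def cont_proc_def by blast
  \<comment> \<open>The remainder 144 consists of 2 * 64 from the distance to \<open>N k\<close> and
    16 from the energy error of \<open>es k\<close>; it vanishes as \<open>k\<close> grows.\<close>
  have bound: "sup_sq_expectation M t T I \<le> 16 * proc_energy M t T \<phi> + ennreal (144 / 4 ^ k)" for k
  proof -
    have "sup_sq_expectation M t T I = sup_sq_expectation M t T (\<lambda>s \<omega>. (I s \<omega> - N k s \<omega>) + N k s \<omega>)" by simp
    also have "\<dots> \<le> 2 * sup_sq_expectation M t T (\<lambda>s \<omega>. I s \<omega> - N k s \<omega>) + 2 * sup_sq_expectation M t T (N k)"
      by (rule sup_sq_expectation_add_le[OF cont_proc_diff[OF I N] N t(2)])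
    also have "sup_sq_expectation M t T (N k) \<le> 4 * proc_energy M t T (elementary_process (es k))"
      using elementary_integral_doob[OF t es, of k] unfolding proc_energy_def sup_sq_expectation_cong_AE[OF Ne[of k]] .
    also have "proc_energy M t T (elementary_process (es k)) = proc_energy M t T (\<lambda>r \<omega>. (elementary_process (es k) r \<omega> - \<phi> r \<omega>) + \<phi> r \<omega>)"
      by simp
    also have "\<dots> \<le> 2 * proc_energy M t T (\<lambda>r \<omega>. elementary_process (es k) r \<omega> - \<phi> r \<omega>) + 2 * proc_energy M t T \<phi>"
      by (rule proc_energy_add_le[OF ep \<phi>p t(2) order_refl])
    also have "2 * sup_sq_expectation M t T (\<lambda>s \<omega>. I s \<omega> - N k s \<omega>)
        + 2 * (4 * (2 * proc_energy M t T (\<lambda>r \<omega>. elementary_process (es k) r \<omega> - \<phi> r \<omega>) + 2 * proc_energy M t T \<phi>))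
      \<le> 2 * ennreal (64 / 4 ^ k) + 2 * (4 * (2 * ennreal (1 / 4 ^ k) + 2 * proc_energy M t T \<phi>))"
      by (intro add_mono mult_left_mono IN ese order_refl) auto
    also have "\<dots> = 16 * proc_energy M t T \<phi> + (2 * ennreal (64 / 4 ^ k) + 16 * ennreal (1 / 4 ^ k))"
      by (simp add: algebra_simps)
    also have "2 * ennreal (64 / 4 ^ k) + 16 * ennreal (1 / 4 ^ k) = ennreal (144 / 4 ^ k)"
      by (simp add: ennreal_mult''[symmetric] ennreal_plus[symmetric] ennreal_numeral[symmetric] del: ennreal_plus ennreal_numeral)
    finally show ?thesis by (simp add: add_left_mono mult_left_mono)
  qed
  have "(\<lambda>k. 16 * proc_energy M t T \<phi> + ennreal (144 / 4 ^ k)) \<longlonglongrightarrow> 16 * proc_energy M t T \<phi> + 0"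
    by (intro tendsto_add tendsto_const ennreal_geometric_tendsto_0) simp
  then have "sup_sq_expectation M t T I \<le> 16 * proc_energy M t T \<phi> + 0"
    by (rule LIMSEQ_le_const) (use bound in blast)
  then show ?thesis using ito by auto
qed

text \<open>The bound is known for one constructed version on \<open>{t..s}\<close>. Uniqueness at
  each time and continuity of paths transfer it to any integral process restricted to that
  interval.\<close>

lemma ito_integral_process_bound:
  fixes \<phi> :: "real \<Rightarrow> 'a \<Rightarrow> 'b::euclidean_space"
  assumes t: "0 \<le> t" and s: "s \<in> {t..T}" and I: "ito_integral_process M F W t T \<phi> I"
  shows "sup_sq_expectation M t s I \<le> 16 * proc_energy M t s \<phi>"
proof -
  have s': "t \<le> s" "s \<le> T" using s by auto
  have hI: "has_ito_integral M F W t r \<phi> (I r)" if "r \<in> {t..s}" for r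
    using I that s unfolding ito_integral_process_def by auto
  have \<phi>: "\<phi> \<in> L2_proc M F t s" using hI[of s] s' unfolding has_ito_integral_def by auto
  from ito_integral_process_exists_bounded[OF t s'(1) \<phi>] obtain J where
    J: "ito_integral_process M F W t s \<phi> J" "sup_sq_expectation M t s J \<le> 16 * proc_energy M t s \<phi>" by blast
  have "AE \<omega> in M. \<forall>r\<in>{t..s}. I r \<omega> = J r \<omega>"
  proof (rule cont_proc_AE_eq)
    show "cont_proc t s I" by (rule cont_proc_subinterval[OF ito_integral_process_cont_proc[OF I] s'(2)])
    show "cont_proc t s J" by (rule ito_integral_process_cont_proc[OF J(1)])
    show "AE \<omega> in M. I r \<omega> = J r \<omega>" if "r \<in> {t..s}" for r
      using has_ito_integral_unique[OF t _ hI[OF that]] J(1) that unfolding ito_integral_process_def by auto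
  qed (rule s')
  from sup_sq_expectation_cong_AE[OF this] J(2) show ?thesis by simp
qed

end

section \<open>Operator-valued coefficients\<close>

lemma ennreal_add_sq_le:
  fixes x y :: ennreal
  shows "(x + y)\<^sup>2 \<le> 2 * x\<^sup>2 + 2 * y\<^sup>2"
proof (cases "x = \<infinity> \<or> y = \<infinity>")
  case True
  then show ?thesis by (auto simp: power2_eq_square ennreal_mult_eq_top_iff)
next
  case False
  then obtain a b where ab: "x = ennreal a" "0 \<le> a" "y = ennreal b" "0 \<le> b" by (cases x; cases y) auto
  have "(a + b)\<^sup>2 \<le> 2 * a\<^sup>2 + 2 * b\<^sup>2"
    using zero_le_power2[of "a - b"] by (simp add: power2_eq_square algebra_simps)
  then have "ennreal ((a + b)\<^sup>2) \<le> ennreal (2 * a\<^sup>2 + 2 * b\<^sup>2)" by (rule ennreal_leI)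
  also have "\<dots> = 2 * ennreal (a\<^sup>2) + 2 * ennreal (b\<^sup>2)" by (simp add: ennreal_plus ennreal_mult)
  also have "ennreal ((a + b)\<^sup>2) = (x + y)\<^sup>2"
    using ab by (simp add: ennreal_plus[symmetric] ennreal_power del: ennreal_plus)
  finally show ?thesis using ab by (simp add: ennreal_power)
qed

context brownian
begin

section \<open>Square integrable random vectors and operator norms\<close>

lemma L2_msq:
  assumes "\<xi> \<in> L2 M (F s)"
  shows "(msq M \<xi>) = ennreal ((norm2 M \<xi>)\<^sup>2)"
  using assms unfolding L2_def norm2_def by (simp add: nn_integral_eq_integral)

lemma L2I:
  assumes "\<xi> \<in> borel_measurable (F s)" "(msq M \<xi>) < \<infinity>"
  shows "\<xi> \<in> L2 M (F s)"
  using assms measurable_F[OF assms(1)] unfolding L2_def by (auto intro!: integrableI_bounded)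

lemma L2_scale: "\<xi> \<in> L2 M (F s) \<Longrightarrow> (\<lambda>\<omega>. c *\<^sub>R \<xi> \<omega>) \<in> L2 M (F s)"
  unfolding L2_def by (auto simp: power_mult_distrib intro!: borel_measurable_scaleR)

lemma norm2_nonneg: "0 \<le> norm2 M \<xi>"
  unfolding norm2_def by simp

lemma norm2_scale: "norm2 M (\<lambda>\<omega>. c *\<^sub>R \<xi> \<omega>) = \<bar>c\<bar> * norm2 M \<xi>"
  unfolding norm2_def by (simp add: power_mult_distrib real_sqrt_mult)

lemma norm2_cong_AE:
  assumes "\<xi> \<in> borel_measurable M" "\<eta> \<in> borel_measurable M" "AE \<omega> in M. \<xi> \<omega> = \<eta> \<omega>"
  shows "norm2 M \<xi> = norm2 M \<eta>"
  unfolding norm2_def using assms by (intro arg_cong[where f = sqrt] integral_cong_AE) auto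

lemma L2_M: "\<xi> \<in> L2 M (F s) \<Longrightarrow> \<xi> \<in> borel_measurable M"
  unfolding L2_def using measurable_F by auto

lemma zero_L2: "(\<lambda>_. 0) \<in> L2 M (F s)"
  unfolding L2_def by simp

text \<open>A supremum of reals is meaningful only for a bounded set; the existential constant in
  \<open>L2_operator\<close> supplies the bound.\<close>

lemma L2_onorm_bdd:
  fixes L :: "('a \<Rightarrow> 'b::euclidean_space) \<Rightarrow> 'a \<Rightarrow> 'c::euclidean_space"
  assumes "L2_operator M (F s) L"
  shows "bdd_above ((\<lambda>\<xi>. norm2 M (L \<xi>)) ` {\<xi> \<in> L2 M (F s). norm2 M \<xi> \<le> 1})"
proof -
  obtain K where K: "\<And>\<xi>. \<xi> \<in> L2 M (F s) \<Longrightarrow> norm2 M (L \<xi>) \<le> K * norm2 M \<xi>"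
    using assms unfolding L2_operator_def by blast
  show ?thesis
  proof (rule bdd_aboveI2)
    fix \<xi> :: "'a \<Rightarrow> 'b" assume "\<xi> \<in> {\<xi> \<in> L2 M (F s). norm2 M \<xi> \<le> 1}"
    then have \<xi>: "\<xi> \<in> L2 M (F s)" "norm2 M \<xi> \<le> 1" by auto
    have "norm2 M (L \<xi>) \<le> \<bar>K\<bar> * norm2 M \<xi>"
      using K[OF \<xi>(1)] norm2_nonneg[of \<xi>] by (meson abs_ge_self mult_right_mono order_trans)
    also have "\<dots> \<le> \<bar>K\<bar> * 1" using \<xi>(2) by (intro mult_left_mono) auto
    finally show "norm2 M (L \<xi>) \<le> \<bar>K\<bar>" by simp
  qed
qed

lemma L2_onorm_nonneg:
  fixes L :: "('a \<Rightarrow> 'b::euclidean_space) \<Rightarrow> 'a \<Rightarrow> 'c::euclidean_space"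
  assumes "L2_operator M (F s) L"
  shows "0 \<le> L2_onorm M (F s) L"
proof -
  have "norm2 M (L (\<lambda>_. 0)) \<le> L2_onorm M (F s) L"
    unfolding L2_onorm_def by (rule cSUP_upper[OF _ L2_onorm_bdd[OF assms]]) (simp add: zero_L2, simp add: norm2_def)
  then show ?thesis using norm2_nonneg order_trans by blast
qed

text \<open>Normalise \<open>\<xi>\<close>. Homogeneity holds only almost surely, which
  \<open>norm2\<close> does not see. For norm 0 the constant from \<open>L2_operator\<close> shows
  that the image also has norm 0.\<close>

lemma L2_operator_bound:
  fixes L :: "('a \<Rightarrow> 'b::euclidean_space) \<Rightarrow> 'a \<Rightarrow> 'c::euclidean_space"
  assumes L: "L2_operator M (F s) L" and \<xi>: "\<xi> \<in> L2 M (F s)"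
  shows "norm2 M (L \<xi>) \<le> L2_onorm M (F s) L * norm2 M \<xi>"
proof (cases "norm2 M \<xi> = 0")
  case True
  obtain K where "norm2 M (L \<xi>) \<le> K * norm2 M \<xi>" using L \<xi> unfolding L2_operator_def by blast
  then show ?thesis using True by simp
next
  case False
  then have n: "0 < norm2 M \<xi>" using norm2_nonneg[of \<xi>] by simp
  let ?c = "1 / norm2 M \<xi>"
  have L': "L \<eta> \<in> L2 M (F s)" if "\<eta> \<in> L2 M (F s)" for \<eta> using L that unfolding L2_operator_def by blast
  have "AE \<omega> in M. L (\<lambda>\<omega>. ?c *\<^sub>R \<xi> \<omega>) \<omega> = ?c *\<^sub>R L \<xi> \<omega>" using L \<xi> unfolding L2_operator_def by blast
  then have "norm2 M (L (\<lambda>\<omega>. ?c *\<^sub>R \<xi> \<omega>)) = norm2 M (\<lambda>\<omega>. ?c *\<^sub>R L \<xi> \<omega>)"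
    by (rule norm2_cong_AE[OF L2_M[OF L'[OF L2_scale[OF \<xi>]]] L2_M[OF L2_scale[OF L'[OF \<xi>]]]])
  also have "\<dots> = ?c * norm2 M (L \<xi>)" unfolding norm2_scale using n by simp
  finally have "?c * norm2 M (L \<xi>) = norm2 M (L (\<lambda>\<omega>. ?c *\<^sub>R \<xi> \<omega>))" by simp
  also have "\<dots> \<le> L2_onorm M (F s) L"
    unfolding L2_onorm_def
    by (rule cSUP_upper[OF _ L2_onorm_bdd[OF L]]) (use n in \<open>simp add: L2_scale[OF \<xi>] norm2_scale\<close>)
  finally show ?thesis using n by (simp add: field_simps)
qed

text \<open>The operator norm is at best known to be Lebesgue measurable in time. A Borel majorant,
  valid for almost every time and nonnegative everywhere, fits the integrals over
  \<open>lborel\<close>.\<close>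

definition op_bound :: "real \<Rightarrow> (real \<Rightarrow> ('a \<Rightarrow> 'b::euclidean_space) \<Rightarrow> 'a \<Rightarrow> 'c::euclidean_space) \<Rightarrow> (real \<Rightarrow> real) \<Rightarrow> bool" where
  "op_bound T L a \<longleftrightarrow> strongly_progressive M F T L \<and> a \<in> borel_measurable borel \<and> (\<forall>s. 0 \<le> a s) \<and>
     (AE s in lborel. s \<in> {0..T} \<longrightarrow> L2_onorm M (F s) (L s) \<le> a s)"

lemma op_Lp_bound:
  fixes L :: "real \<Rightarrow> ('a \<Rightarrow> 'b::euclidean_space) \<Rightarrow> 'a \<Rightarrow> 'c::euclidean_space"
  assumes L: "L \<in> op_Lp M F T p" and p: "1 \<le> p"
  shows "\<exists>a. op_bound T L a \<and> (\<integral>\<^sup>+s\<in>{0..T}. ennreal (a s powr p) \<partial>lborel) = ennreal (op_norm_p M F T p L powr p)"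
proof -
  define g where "g s = L2_onorm M (F s) (L s) powr p" for s
  have sp: "strongly_progressive M F T L" and ig: "integrable (lebesgue_on {0..T}) g"
    using L unfolding op_Lp_def g_def by auto
  have on: "0 \<le> L2_onorm M (F s) (L s)" if "s \<in> {0..T}" for s
    using sp that unfolding strongly_progressive_def by (intro L2_onorm_nonneg) blast
  have g0: "0 \<le> g s" for s by (simp add: g_def)
  have "(\<lambda>s. indicator {0..T} s *\<^sub>R g s) \<in> borel_measurable lebesgue"
    using ig by (subst borel_measurable_restrict_space_iff[symmetric]) (auto simp: borel_measurable_integrable)
  from completion_ex_borel_measurable_real[OF this]
  obtain a1 where a1: "a1 \<in> borel_measurable lborel" "AE s in lborel. indicator {0..T} s *\<^sub>R g s = a1 s" by blast
  \<comment> \<open>Outside the interval and on a null set \<open>a1\<close> is arbitrary;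
    \<open>max 0\<close> keeps the majorant nonnegative there.\<close>
  define a where "a s = max 0 (a1 s) powr (1 / p)" for s
  have eq: "AE s in lborel. s \<in> {0..T} \<longrightarrow> a s = L2_onorm M (F s) (L s) \<and> a s powr p = g s"
    using a1(2)
  proof eventually_elim
    case (elim s)
    show ?case
    proof
      assume s: "s \<in> {0..T}"
      then have "a1 s = g s" using elim by simp
      then have "a s = L2_onorm M (F s) (L s) powr (p * (1 / p))" unfolding a_def g_def by (simp add: max_def powr_powr)
      then have "a s = L2_onorm M (F s) (L s)" using p on[OF s] by simp
      then show "a s = L2_onorm M (F s) (L s) \<and> a s powr p = g s" unfolding g_def by simp
    qed
  qed
  have am: "a \<in> borel_measurable borel" using a1(1) unfolding a_def[abs_def] by measurable
  have "(\<integral>\<^sup>+s\<in>{0..T}. ennreal (a s powr p) \<partial>lborel) = (\<integral>\<^sup>+s. ennreal (g s) * indicator {0..T} s \<partial>lborel)"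
    using eq by (intro nn_integral_cong_AE) (auto elim!: eventually_mono simp: indicator_def)
  also have "\<dots> = (\<integral>\<^sup>+s. ennreal (g s) * indicator {0..T} s \<partial>lebesgue)" by (rule nn_integral_completion[symmetric])
  also have "\<dots> = (\<integral>\<^sup>+s. ennreal (g s) \<partial>lebesgue_on {0..T})" by (subst nn_integral_restrict_space) auto
  also have "\<dots> = ennreal (\<integral>s. g s \<partial>lebesgue_on {0..T})" by (rule nn_integral_eq_integral[OF ig]) (simp add: g0)
  also have "(\<integral>s. g s \<partial>lebesgue_on {0..T}) = op_norm_p M F T p L powr p"
  proof -
    have "0 \<le> (\<integral>s. g s \<partial>lebesgue_on {0..T})" by (intro integral_nonneg_AE) (simp add: g0)
    then show ?thesis using p unfolding op_norm_p_def g_def by (simp add: powr_powr)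
  qed
  finally have "(\<integral>\<^sup>+s\<in>{0..T}. ennreal (a s powr p) \<partial>lborel) = ennreal (op_norm_p M F T p L powr p)" .
  moreover have "op_bound T L a"
    unfolding op_bound_def using sp am eq by (auto elim!: eventually_mono simp: a_def)
  ultimately show ?thesis by blast
qed

text \<open>With \<open>0 < T\<close> the interval has positive measure, so nonnegative norms force
  a nonnegative essential supremum. Being finite as well, it survives the conversion to a
  real.\<close>

lemma op_Linf_bound:
  fixes L :: "real \<Rightarrow> ('a \<Rightarrow> 'b::euclidean_space) \<Rightarrow> 'a \<Rightarrow> 'c::euclidean_space"
  assumes L: "L \<in> op_Linf M F T" and T: "0 < T"
  shows "op_bound T L (\<lambda>_. op_norm_inf M F T L)"
proof -
  let ?E = "op_esssup M F T L"
  have sp: "strongly_progressive M F T L" and fin: "?E < \<infinity>" using L unfolding op_Linf_def by auto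
  have on: "0 \<le> L2_onorm M (F s) (L s)" if "s \<in> {0..T}" for s
    using sp that unfolding strongly_progressive_def by (intro L2_onorm_nonneg) blast
  have "AE s in lebesgue_on {0..T}. ereal (L2_onorm M (F s) (L s)) \<le> ?E"
    unfolding op_esssup_def by (rule esssup_AE)
  then have "AE s in lebesgue. s \<in> {0..T} \<longrightarrow> ereal (L2_onorm M (F s) (L s)) \<le> ?E"
    by (subst (asm) AE_restrict_space_iff) auto
  then have ae: "AE s in lborel. s \<in> {0..T} \<longrightarrow> ereal (L2_onorm M (F s) (L s)) \<le> ?E" by (simp add: AE_completion_iff)
  have E0: "0 \<le> ?E"
  proof (rule ccontr)
    assume neg: "\<not> 0 \<le> ?E"
    from ae have "AE s in lborel. s \<notin> {0..T}"
    proof eventually_elim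
      case (elim s)
      show ?case
      proof
        assume s: "s \<in> {0..T}"
        have "0 \<le> ereal (L2_onorm M (F s) (L s))" using on[OF s] by simp
        also have "\<dots> \<le> ?E" using elim s by blast
        finally show False using neg by simp
      qed
    qed
    then have "{0..T} \<in> null_sets lborel" using Measure_Space.AE_iff_null_sets[of "{0..T}" "lborel :: real measure"] by simp
    then show False using T by (simp add: null_sets_def)
  qed
  then have E: "?E = ereal (op_norm_inf M F T L)" using fin unfolding op_norm_inf_def by (cases ?E) auto
  then have "0 \<le> op_norm_inf M F T L" using E0 by simp
  then show ?thesis using ae sp unfolding E op_bound_def by simp
qed

lemma op_bound_msq:
  fixes L :: "real \<Rightarrow> ('a \<Rightarrow> 'b::euclidean_space) \<Rightarrow> 'a \<Rightarrow> 'c::euclidean_space"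
  assumes "op_bound T L a"
  shows "AE s in lborel. s \<in> {0..T} \<longrightarrow> L2_operator M (F s) (L s) \<and> (\<forall>\<xi>\<in>L2 M (F s).
      (msq M (L s \<xi>)) \<le> ennreal ((a s)\<^sup>2) * (msq M \<xi>))"
proof -
  have "AE s in lborel. s \<in> {0..T} \<longrightarrow> L2_onorm M (F s) (L s) \<le> a s" using assms unfolding op_bound_def by blast
  then show ?thesis
  proof eventually_elim
    case (elim s)
    show ?case
    proof (intro impI conjI ballI)
      assume s: "s \<in> {0..T}"
      show op: "L2_operator M (F s) (L s)" using assms s unfolding op_bound_def strongly_progressive_def by blast
      fix \<xi> :: "'a \<Rightarrow> 'b" assume \<xi>: "\<xi> \<in> L2 M (F s)"
      have L\<xi>: "L s \<xi> \<in> L2 M (F s)" using op \<xi> unfolding L2_operator_def by blast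
      have "norm2 M (L s \<xi>) \<le> a s * norm2 M \<xi>"
        using L2_operator_bound[OF op \<xi>] elim s mult_right_mono[OF _ norm2_nonneg] order_trans by blast
      then have "(norm2 M (L s \<xi>))\<^sup>2 \<le> (a s * norm2 M \<xi>)\<^sup>2" by (rule power_mono) (rule norm2_nonneg)
      then show "(msq M (L s \<xi>)) \<le> ennreal ((a s)\<^sup>2) * (msq M \<xi>)"
        unfolding L2_msq[OF \<xi>] L2_msq[OF L\<xi>] by (simp add: ennreal_mult[symmetric] power_mult_distrib ennreal_leI)
    qed
  qed
qed

lemma L2_proc_section:
  fixes \<eta> :: "real \<Rightarrow> 'a \<Rightarrow> 'b::euclidean_space"
  assumes tT: "t \<le> T" and \<eta>: "\<eta> \<in> L2_proc M F t T"
  shows "AE s in lborel. s \<in> {t..T} \<longrightarrow> \<eta> s \<in> L2 M (F s)"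
proof -
  have p: "progressive F t T \<eta>" and e: "proc_energy M t T \<eta> < \<infinity>" using \<eta> unfolding L2_proc_def proc_energy_def by auto
  have m: "(\<lambda>s. (\<integral>\<^sup>+\<omega>. ennreal ((norm (\<eta> s \<omega>))\<^sup>2) * indicator {t..T} s \<partial>M)) \<in> borel_measurable lborel"
    using borel_measurable_nn_integral[OF progressive_nn_joint[OF p tT order_refl, of "\<lambda>x. ennreal ((norm x)\<^sup>2)" "\<lambda>_. 1"]] by simp
  have "(\<integral>\<^sup>+s. (\<integral>\<^sup>+\<omega>. ennreal ((norm (\<eta> s \<omega>))\<^sup>2) * indicator {t..T} s \<partial>M) \<partial>lborel) = proc_energy M t T \<eta>"
    unfolding proc_energy_def
    using pair_sigma_finite.Fubini'[OF sigma_finite_lborel_M progressive_nn_joint[OF p tT order_refl, of "\<lambda>x. ennreal ((norm x)\<^sup>2)" "\<lambda>_. 1"]]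
    by simp
  then have "(\<integral>\<^sup>+s. (\<integral>\<^sup>+\<omega>. ennreal ((norm (\<eta> s \<omega>))\<^sup>2) * indicator {t..T} s \<partial>M) \<partial>lborel) \<noteq> \<infinity>" using e by simp
  from nn_integral_noteq_infinite[OF m this] show ?thesis
  proof eventually_elim
    case (elim s)
    show ?case
    proof
      assume s: "s \<in> {t..T}"
      then show "\<eta> s \<in> L2 M (F s)" using elim by (intro L2I progressive_section[OF p s]) (simp add: less_top)
    qed
  qed
qed

text \<open>Strong progressive measurability is tested with processes on \<open>{0..T}\<close>.
  Extending \<open>\<eta>\<close> by zero before \<open>t\<close> costs no energy, and at times in
  \<open>{t..T}\<close> the argument of the operator is unchanged.\<close>

lemma strongly_progressive_apply:
  fixes L :: "real \<Rightarrow> ('a \<Rightarrow> 'b::euclidean_space) \<Rightarrow> 'a \<Rightarrow> 'c::euclidean_space"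
  assumes L: "strongly_progressive M F T L" and t: "0 \<le> t" "t \<le> T" and \<eta>: "\<eta> \<in> L2_proc M F t T"
  shows "\<exists>\<zeta>. progressive F t T \<zeta> \<and> (AE s in lborel. s \<in> {t..T} \<longrightarrow> (AE \<omega> in M. \<zeta> s \<omega> = L s (\<eta> s) \<omega>))"
proof -
  define \<eta>' where "\<eta>' s \<omega> = indicator {t..} s *\<^sub>R \<eta> s \<omega>" for s \<omega>
  have p: "progressive F t T \<eta>" and e: "proc_energy M t T \<eta> < \<infinity>" using \<eta> unfolding L2_proc_def proc_energy_def by auto
  have "(\<integral>\<^sup>+\<omega>. (\<integral>\<^sup>+s\<in>{0..T}. ennreal ((norm (\<eta>' s \<omega>))\<^sup>2) \<partial>lborel) \<partial>M) = proc_energy M t T \<eta>"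
    unfolding proc_energy_def \<eta>'_def using t by (intro nn_integral_cong) (auto simp: indicator_def)
  then have "\<eta>' \<in> L2_proc M F 0 T" using progressive_extend[OF p] e unfolding L2_proc_def \<eta>'_def by simp
  then obtain \<zeta> where \<zeta>: "progressive F 0 T \<zeta>" "AE s in lborel. s \<in> {0..T} \<longrightarrow> (AE \<omega> in M. \<zeta> s \<omega> = L s (\<eta>' s) \<omega>)"
    using L unfolding strongly_progressive_def by blast
  have "\<eta>' s = \<eta> s" if "s \<in> {t..T}" for s using that by (auto simp: \<eta>'_def fun_eq_iff)
  then have "AE s in lborel. s \<in> {t..T} \<longrightarrow> (AE \<omega> in M. \<zeta> s \<omega> = L s (\<eta> s) \<omega>)"
    using \<zeta>(2) t by (auto elim!: eventually_mono)
  then show ?thesis using progressive_subinterval[OF \<zeta>(1) t(1) order_refl] by blast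
qed

text \<open>The weight \<open>a + \<epsilon>\<close> is positive, so that one can divide by it; \<open>\<epsilon>\<close> then tends to 0.\<close>

lemma weighted_Cauchy_Schwarz:
  fixes \<zeta> :: "real \<Rightarrow> 'a \<Rightarrow> 'b::euclidean_space"
  assumes \<zeta>: "progressive F t T \<zeta>" and s: "t \<le> s" "s \<le> T"
    and a: "a \<in> borel_measurable borel" "\<And>r. 0 \<le> a r"
    and k: "(\<integral>\<^sup>+r\<in>{t..s}. k r \<partial>lborel) < \<infinity>"
    and bound: "AE r in lborel. r \<in> {t..s} \<longrightarrow> (msq M (\<zeta> r)) \<le> ennreal (a r) * k r"
  shows "(\<integral>\<^sup>+\<omega>. (\<integral>\<^sup>+r\<in>{t..s}. ennreal (norm (\<zeta> r \<omega>)) \<partial>lborel)\<^sup>2 \<partial>M)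
    \<le> (\<integral>\<^sup>+r\<in>{t..s}. ennreal (a r) \<partial>lborel) * (\<integral>\<^sup>+r\<in>{t..s}. k r \<partial>lborel)"
proof -
  let ?K = "\<integral>\<^sup>+r\<in>{t..s}. k r \<partial>lborel" and ?A = "\<integral>\<^sup>+r\<in>{t..s}. ennreal (a r) \<partial>lborel"
  let ?L = "\<integral>\<^sup>+\<omega>. (\<integral>\<^sup>+r\<in>{t..s}. ennreal (norm (\<zeta> r \<omega>)) \<partial>lborel)\<^sup>2 \<partial>M"
  have main: "?L \<le> (?A + ennreal (e * (s - t))) * ?K" if e: "0 < e" for e
  proof -
    define \<theta> where "\<theta> r = a r + e" for r
    have \<theta>: "0 < \<theta> r" for r using a(2)[of r] e by (simp add: \<theta>_def)
    have \<theta>m[measurable]: "\<theta> \<in> borel_measurable borel" using a(1) unfolding \<theta>_def[abs_def] by measurable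
    have \<Theta>: "(\<integral>\<^sup>+r\<in>{t..s}. ennreal (\<theta> r) \<partial>lborel) = ?A + ennreal (e * (s - t))"
    proof -
      have "(\<integral>\<^sup>+r\<in>{t..s}. ennreal (\<theta> r) \<partial>lborel) = (\<integral>\<^sup>+r. ennreal (a r) * indicator {t..s} r + ennreal e * indicator {t..s} r \<partial>lborel)"
        using a(2) e by (intro nn_integral_cong) (auto simp: \<theta>_def indicator_def ennreal_plus)
      also have "\<dots> = ?A + (\<integral>\<^sup>+r. ennreal e * indicator {t..s} r \<partial>lborel)"
        using a(1) by (subst nn_integral_add) auto
      also have "(\<integral>\<^sup>+r. ennreal e * indicator {t..s} r \<partial>lborel) = ennreal e * emeasure lborel {t..s}"
        by (rule nn_integral_cmult_indicator) simp
      also have "\<dots> = ennreal (e * (s - t))" using s e by (simp add: ennreal_mult)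
      finally show ?thesis .
    qed
    have "?L \<le> (\<integral>\<^sup>+\<omega>. (\<integral>\<^sup>+r\<in>{t..s}. ennreal (\<theta> r) \<partial>lborel) * (\<integral>\<^sup>+r. ennreal (1 / \<theta> r) * ennreal ((norm (\<zeta> r \<omega>))\<^sup>2) * indicator {t..s} r \<partial>lborel) \<partial>M)"
    proof (rule nn_integral_mono)
      fix \<omega> assume \<omega>: "\<omega> \<in> space M"
      \<comment> \<open>The norm is factored as sqrt(\<theta>) times norm / sqrt(\<theta>);
        positivity of \<open>\<theta>\<close> makes this exact.\<close>
      let ?f = "\<lambda>r. ennreal (sqrt (\<theta> r)) * indicator {t..s} r"
      let ?g = "\<lambda>r. ennreal (1 / sqrt (\<theta> r)) * ennreal (norm (\<zeta> r \<omega>)) * indicator {t..s} r"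
      have gm: "?g \<in> borel_measurable lborel"
        by (rule progressive_nn_path[OF \<zeta> s _ _ \<omega>]) simp_all
      have fm: "?f \<in> borel_measurable lborel" by simp
      have "(\<integral>\<^sup>+r\<in>{t..s}. ennreal (norm (\<zeta> r \<omega>)) \<partial>lborel) = (\<integral>\<^sup>+r. ?f r * ?g r \<partial>lborel)"
      proof (rule nn_integral_cong)
        fix r
        have "ennreal (sqrt (\<theta> r)) * (ennreal (1 / sqrt (\<theta> r)) * ennreal (norm (\<zeta> r \<omega>))) = ennreal (norm (\<zeta> r \<omega>))"
          using \<theta>[of r] by (simp add: ennreal_mult[symmetric])
        then show "ennreal (norm (\<zeta> r \<omega>)) * indicator {t..s} r = ?f r * ?g r" by (cases "r \<in> {t..s}") auto
      qed
      then have "(\<integral>\<^sup>+r\<in>{t..s}. ennreal (norm (\<zeta> r \<omega>)) \<partial>lborel)\<^sup>2 \<le> (\<integral>\<^sup>+r. (?f r)\<^sup>2 \<partial>lborel) * (\<integral>\<^sup>+r. (?g r)\<^sup>2 \<partial>lborel)"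
        using Cauchy_Schwarz_nn_integral[OF fm gm] by simp
      also have "(\<integral>\<^sup>+r. (?f r)\<^sup>2 \<partial>lborel) = (\<integral>\<^sup>+r\<in>{t..s}. ennreal (\<theta> r) \<partial>lborel)"
        using \<theta>[THEN less_imp_le] by (intro nn_integral_cong) (auto simp: indicator_def ennreal_power)
      also have "(\<integral>\<^sup>+r. (?g r)\<^sup>2 \<partial>lborel) = (\<integral>\<^sup>+r. ennreal (1 / \<theta> r) * ennreal ((norm (\<zeta> r \<omega>))\<^sup>2) * indicator {t..s} r \<partial>lborel)"
        using \<theta>[THEN less_imp_le] by (intro nn_integral_cong) (auto simp: indicator_def ennreal_power power_mult_distrib power_divide)
      finally show "(\<integral>\<^sup>+r\<in>{t..s}. ennreal (norm (\<zeta> r \<omega>)) \<partial>lborel)\<^sup>2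
        \<le> (\<integral>\<^sup>+r\<in>{t..s}. ennreal (\<theta> r) \<partial>lborel) * (\<integral>\<^sup>+r. ennreal (1 / \<theta> r) * ennreal ((norm (\<zeta> r \<omega>))\<^sup>2) * indicator {t..s} r \<partial>lborel)" .
    qed
    also have "\<dots> = (\<integral>\<^sup>+r\<in>{t..s}. ennreal (\<theta> r) \<partial>lborel) * (\<integral>\<^sup>+\<omega>. (\<integral>\<^sup>+r. ennreal (1 / \<theta> r) * ennreal ((norm (\<zeta> r \<omega>))\<^sup>2) * indicator {t..s} r \<partial>lborel) \<partial>M)"
      by (rule nn_integral_cmult[OF progressive_nn_integral_measurable[OF \<zeta> s]]) simp_all
    also have "(\<integral>\<^sup>+\<omega>. (\<integral>\<^sup>+r. ennreal (1 / \<theta> r) * ennreal ((norm (\<zeta> r \<omega>))\<^sup>2) * indicator {t..s} r \<partial>lborel) \<partial>M)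
      = (\<integral>\<^sup>+r. ennreal (1 / \<theta> r) * (msq M (\<zeta> r)) * indicator {t..s} r \<partial>lborel)"
      by (rule progressive_Fubini[OF \<zeta> s]) simp_all
    also have "\<dots> \<le> ?K"
    proof (rule nn_integral_mono_AE)
      show "AE r in lborel. ennreal (1 / \<theta> r) * (msq M (\<zeta> r)) * indicator {t..s} r \<le> k r * indicator {t..s} r"
        using bound
      proof eventually_elim
        case (elim r)
        show ?case
        proof (cases "r \<in> {t..s}")
          case True
          have "ennreal (1 / \<theta> r) * (msq M (\<zeta> r)) \<le> ennreal (1 / \<theta> r) * (ennreal (a r) * k r)"
            using elim True by (intro mult_left_mono) auto
          also have "\<dots> = ennreal (a r / \<theta> r) * k r"
            using \<theta>[of r] a(2)[of r] by (simp add: mult.assoc[symmetric] ennreal_mult[symmetric])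
          also have "\<dots> \<le> ennreal 1 * k r"
            using \<theta>[of r] e by (intro mult_right_mono ennreal_leI) (auto simp: \<theta>_def)
          finally show ?thesis using True by simp
        qed simp
      qed
    qed
    finally show ?thesis unfolding \<Theta> by (simp add: mult_left_mono)
  qed
  have "(\<lambda>n. ennreal (1 / real (Suc n) * (s - t))) \<longlonglongrightarrow> ennreal 0"
  proof (rule tendsto_ennrealI)
    have "(\<lambda>n. 1 / real (Suc n) * (s - t)) \<longlonglongrightarrow> 0 * (s - t)"
      by (intro tendsto_mult tendsto_const) (rule LIMSEQ_Suc[OF lim_1_over_n])
    then show "(\<lambda>n. 1 / real (Suc n) * (s - t)) \<longlonglongrightarrow> 0" by simp
  qed
  \<comment> \<open>Multiplication by \<open>?K\<close> is continuous in \<open>ennreal\<close>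
    because \<open>?K\<close> is finite.\<close>
  then have "(\<lambda>n. ?K * (?A + ennreal (1 / real (Suc n) * (s - t)))) \<longlonglongrightarrow> ?K * (?A + ennreal 0)"
    using k by (intro ennreal_tendsto_cmult tendsto_add tendsto_const) simp
  then have "?L \<le> ?K * (?A + ennreal 0)"
  proof (rule LIMSEQ_le_const)
    show "\<exists>N. \<forall>n\<ge>N. ?L \<le> ?K * (?A + ennreal (1 / real (Suc n) * (s - t)))"
    proof (intro exI allI impI)
      fix n :: nat
      have "0 < 1 / real (Suc n)" by simp
      from main[OF this] show "?L \<le> ?K * (?A + ennreal (1 / real (Suc n) * (s - t)))"
        by (simp only: mult.commute[of ?K])
    qed
  qed
  then show ?thesis by (simp add: mult.commute)
qed

section \<open>Paths of the drift integral\<close>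

lemma L2_L1_proc_integrable:
  fixes f :: "real \<Rightarrow> 'a \<Rightarrow> 'b::euclidean_space"
  assumes tT: "t \<le> T" and f: "f \<in> L2_L1_proc M F t T"
  shows "AE \<omega> in M. set_integrable lborel {t..T} (\<lambda>r. f r \<omega>)"
proof -
  have p: "progressive F t T f" and e: "(\<integral>\<^sup>+\<omega>. (\<integral>\<^sup>+r\<in>{t..T}. ennreal (norm (f r \<omega>)) \<partial>lborel)\<^sup>2 \<partial>M) < \<infinity>"
    using f unfolding L2_L1_proc_def by auto
  have "(\<lambda>\<omega>. \<integral>\<^sup>+r\<in>{t..T}. ennreal (norm (f r \<omega>)) \<partial>lborel) \<in> borel_measurable M"
    using progressive_nn_integral_measurable[OF p tT order_refl, of "\<lambda>x. ennreal (norm x)" "\<lambda>_. 1"] by simp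
  then have m: "(\<lambda>\<omega>. (\<integral>\<^sup>+r\<in>{t..T}. ennreal (norm (f r \<omega>)) \<partial>lborel)\<^sup>2) \<in> borel_measurable M" by simp
  have "AE \<omega> in M. (\<integral>\<^sup>+r\<in>{t..T}. ennreal (norm (f r \<omega>)) \<partial>lborel)\<^sup>2 \<noteq> \<infinity>"
    by (rule nn_integral_noteq_infinite[OF m]) (use e in simp)
  then show ?thesis using AE_space
  proof eventually_elim
    case (elim \<omega>)
    have "(\<lambda>r. indicator {t..T} r *\<^sub>R f r \<omega>) \<in> borel_measurable lborel"
      using measurable_compose[OF measurable_Pair2'[OF elim(2)] progressive_joint_M[OF p tT]] by simp
    moreover have "(\<integral>\<^sup>+r. ennreal (norm (indicat_real {t..T} r *\<^sub>R f r \<omega>)) \<partial>lborel) = (\<integral>\<^sup>+r\<in>{t..T}. ennreal (norm (f r \<omega>)) \<partial>lborel)"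
      by (intro nn_integral_cong) (auto simp: indicator_def)
    ultimately show ?case unfolding set_integrable_def using elim(1)
      by (intro integrableI_bounded) (auto simp: less_top power2_eq_square ennreal_mult_eq_top_iff)
  qed
qed

lemma norm_LINT_le:
  fixes f :: "real \<Rightarrow> 'b::euclidean_space"
  assumes "set_integrable lborel {t..T} f" "s \<le> s'" "s' \<le> T"
  shows "ennreal (norm (LINT r:{t..s}|lborel. f r)) \<le> (\<integral>\<^sup>+r\<in>{t..s'}. ennreal (norm (f r)) \<partial>lborel)"
proof -
  have "set_integrable lborel {t..s} f" by (rule set_integrable_subset[OF assms(1)]) (use assms in auto)
  then have "ennreal (norm (LINT r:{t..s}|lborel. f r)) \<le> (\<integral>\<^sup>+r. norm (indicat_real {t..s} r *\<^sub>R f r) \<partial>lborel)"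
    unfolding set_integrable_def set_lebesgue_integral_def by (rule integral_norm_bound_ennreal)
  also have "\<dots> \<le> (\<integral>\<^sup>+r\<in>{t..s'}. ennreal (norm (f r)) \<partial>lborel)"
    using assms by (intro nn_integral_mono) (auto simp: indicator_def)
  finally show ?thesis .
qed

lemma drift_cont_proc:
  fixes f :: "real \<Rightarrow> 'a \<Rightarrow> 'b::euclidean_space"
  assumes tT: "t \<le> T" and f: "f \<in> L2_L1_proc M F t T"
  shows "cont_proc t T (\<lambda>s \<omega>. LINT r:{t..s}|lborel. f r \<omega>)"
  unfolding cont_proc_def
proof
  show "progressive F t T (\<lambda>s \<omega>. LINT r:{t..s}|lborel. f r \<omega>)"
    using f unfolding L2_L1_proc_def by (auto intro: progressive_integral)
  show "AE \<omega> in M. continuous_on {t..T} (\<lambda>s. LINT r:{t..s}|lborel. f r \<omega>)"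
    using L2_L1_proc_integrable[OF tT f]
  proof eventually_elim
    case (elim \<omega>)
    have "continuous_on {t..T} (\<lambda>s. integral {t..s} (\<lambda>r. f r \<omega>))"
      using set_borel_integral_eq_integral(1)[OF elim] by (rule indefinite_integral_continuous_1)
    moreover have "integral {t..s} (\<lambda>r. f r \<omega>) = (LINT r:{t..s}|lborel. f r \<omega>)" if "s \<in> {t..T}" for s
      using set_borel_integral_eq_integral(2)[OF set_integrable_subset[OF elim, of "{t..s}"]] that by auto
    ultimately show ?case by (rule continuous_on_eq)
  qed
qed

end

section \<open>The Picard map\<close>

definition L1_energy :: "'a measure \<Rightarrow> real \<Rightarrow> real \<Rightarrow> (real \<Rightarrow> 'a \<Rightarrow> 'b::euclidean_space) \<Rightarrow> ennreal" where
  "L1_energy M t s \<phi> = (\<integral>\<^sup>+\<omega>. (\<integral>\<^sup>+r\<in>{t..s}. ennreal (norm (\<phi> r \<omega>)) \<partial>lborel)\<^sup>2 \<partial>M)"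

lemma L1_energy_subset:
  assumes "t0 \<le> t" "s \<le> s'" shows "L1_energy M t s \<phi> \<le> L1_energy M t0 s' \<phi>"
  unfolding L1_energy_def using assms
  by (intro nn_integral_mono power_mono mult_left_mono) (auto simp: indicator_def)

lemma proc_energy_subset:
  assumes "t0 \<le> t" "s \<le> s'" shows "proc_energy M t s \<phi> \<le> proc_energy M t0 s' \<phi>"
  unfolding proc_energy_def using assms
  by (intro nn_integral_mono mult_left_mono) (auto simp: indicator_def)

context brownian
begin

lemma L1_integral_measurable:
  fixes \<phi> :: "real \<Rightarrow> 'a \<Rightarrow> 'b::euclidean_space"
  assumes "progressive F t T \<phi>" "t \<le> s" "s \<le> T"
  shows "(\<lambda>\<omega>. \<integral>\<^sup>+r\<in>{t..s}. ennreal (norm (\<phi> r \<omega>)) \<partial>lborel) \<in> borel_measurable M"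
  using progressive_nn_integral_measurable[OF assms, of "\<lambda>x. ennreal (norm x)" "\<lambda>_. 1"] by simp

lemma L1_path_measurable:
  fixes \<phi> :: "real \<Rightarrow> 'a \<Rightarrow> 'b::euclidean_space"
  assumes "progressive F t T \<phi>" "t \<le> s" "s \<le> T" "\<omega> \<in> space M"
  shows "(\<lambda>r. ennreal (norm (\<phi> r \<omega>)) * indicator {t..s} r) \<in> borel_measurable lborel"
  using progressive_nn_path[OF assms(1-3) _ _ assms(4), of "\<lambda>x. ennreal (norm x)" "\<lambda>_. 1"] by simp

lemma L1_energy_add_le:
  fixes \<phi> \<psi> :: "real \<Rightarrow> 'a \<Rightarrow> 'b::euclidean_space"
  assumes \<phi>: "progressive F t T \<phi>" and \<psi>: "progressive F t T \<psi>" and s: "t \<le> s" "s \<le> T"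
  shows "L1_energy M t s (\<lambda>r \<omega>. \<phi> r \<omega> + \<psi> r \<omega>) \<le> 2 * L1_energy M t s \<phi> + 2 * L1_energy M t s \<psi>"
proof -
  let ?f = "\<lambda>\<omega>. \<integral>\<^sup>+r\<in>{t..s}. ennreal (norm (\<phi> r \<omega>)) \<partial>lborel" and ?g = "\<lambda>\<omega>. \<integral>\<^sup>+r\<in>{t..s}. ennreal (norm (\<psi> r \<omega>)) \<partial>lborel"
  have "L1_energy M t s (\<lambda>r \<omega>. \<phi> r \<omega> + \<psi> r \<omega>) \<le> (\<integral>\<^sup>+\<omega>. 2 * (?f \<omega>)\<^sup>2 + 2 * (?g \<omega>)\<^sup>2 \<partial>M)"
    unfolding L1_energy_def
  proof (rule nn_integral_mono)
    fix \<omega> assume \<omega>: "\<omega> \<in> space M"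
    have "(\<integral>\<^sup>+r\<in>{t..s}. ennreal (norm (\<phi> r \<omega> + \<psi> r \<omega>)) \<partial>lborel)
      \<le> (\<integral>\<^sup>+r. ennreal (norm (\<phi> r \<omega>)) * indicator {t..s} r + ennreal (norm (\<psi> r \<omega>)) * indicator {t..s} r \<partial>lborel)"
    proof (rule nn_integral_mono)
      fix r
      have "ennreal (norm (\<phi> r \<omega> + \<psi> r \<omega>)) \<le> ennreal (norm (\<phi> r \<omega>)) + ennreal (norm (\<psi> r \<omega>))"
        by (simp add: ennreal_plus[symmetric] ennreal_leI norm_triangle_ineq del: ennreal_plus)
      then show "ennreal (norm (\<phi> r \<omega> + \<psi> r \<omega>)) * indicator {t..s} r
        \<le> ennreal (norm (\<phi> r \<omega>)) * indicator {t..s} r + ennreal (norm (\<psi> r \<omega>)) * indicator {t..s} r"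
        by (cases "r \<in> {t..s}") auto
    qed
    also have "\<dots> = ?f \<omega> + ?g \<omega>"
      by (rule nn_integral_add[OF L1_path_measurable[OF \<phi> s \<omega>] L1_path_measurable[OF \<psi> s \<omega>]])
    finally have "(\<integral>\<^sup>+r\<in>{t..s}. ennreal (norm (\<phi> r \<omega> + \<psi> r \<omega>)) \<partial>lborel)\<^sup>2 \<le> (?f \<omega> + ?g \<omega>)\<^sup>2"
      by (rule power_mono) simp
    also have "\<dots> \<le> 2 * (?f \<omega>)\<^sup>2 + 2 * (?g \<omega>)\<^sup>2" by (rule ennreal_add_sq_le)
    finally show "(\<integral>\<^sup>+r\<in>{t..s}. ennreal (norm (\<phi> r \<omega> + \<psi> r \<omega>)) \<partial>lborel)\<^sup>2 \<le> 2 * (?f \<omega>)\<^sup>2 + 2 * (?g \<omega>)\<^sup>2" .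
  qed
  also have "\<dots> = 2 * L1_energy M t s \<phi> + 2 * L1_energy M t s \<psi>"
    unfolding L1_energy_def using L1_integral_measurable[OF \<phi> s] L1_integral_measurable[OF \<psi> s]
    by (subst nn_integral_add) (auto simp: nn_integral_cmult)
  finally show ?thesis .
qed

lemma proc_energy_le:
  assumes \<zeta>: "progressive F t T \<zeta>" and s: "t \<le> s" "s \<le> T"
    and bound: "AE r in lborel. r \<in> {t..s} \<longrightarrow> (msq M (\<zeta> r)) \<le> k r"
  shows "proc_energy M t s \<zeta> \<le> (\<integral>\<^sup>+r\<in>{t..s}. k r \<partial>lborel)"
  unfolding proc_energy_Fubini[OF \<zeta> s]
proof (rule nn_integral_mono_AE)
  show "AE r in lborel. (msq M (\<zeta> r)) * indicator {t..s} r \<le> k r * indicator {t..s} r"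
    using bound by eventually_elim (simp add: indicator_def)
qed

lemma drift_sup_le:
  fixes f :: "real \<Rightarrow> 'a \<Rightarrow> 'b::euclidean_space"
  assumes s: "t \<le> s" "s \<le> T" and f: "f \<in> L2_L1_proc M F t T"
  shows "sup_sq_expectation M t s (\<lambda>r \<omega>. LINT v:{t..r}|lborel. f v \<omega>) \<le> L1_energy M t s f"
  unfolding sup_sq_expectation_def L1_energy_def
proof (rule nn_integral_mono_AE)
  have "AE \<omega> in M. set_integrable lborel {t..T} (\<lambda>r. f r \<omega>)"
    by (rule L2_L1_proc_integrable[OF _ f]) (use s in simp)
  then show "AE \<omega> in M. (SUP r\<in>{t..s}. ennreal ((norm (LINT v:{t..r}|lborel. f v \<omega>))\<^sup>2))
     \<le> (\<integral>\<^sup>+r\<in>{t..s}. ennreal (norm (f r \<omega>)) \<partial>lborel)\<^sup>2"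
  proof eventually_elim
    case (elim \<omega>)
    show ?case
    proof (rule SUP_least)
      fix r assume "r \<in> {t..s}"
      then have "ennreal (norm (LINT v:{t..r}|lborel. f v \<omega>)) \<le> (\<integral>\<^sup>+r\<in>{t..s}. ennreal (norm (f r \<omega>)) \<partial>lborel)"
        by (intro norm_LINT_le[OF elim]) (use s in auto)
      then have "(ennreal (norm (LINT v:{t..r}|lborel. f v \<omega>)))\<^sup>2 \<le> (\<integral>\<^sup>+r\<in>{t..s}. ennreal (norm (f r \<omega>)) \<partial>lborel)\<^sup>2"
        by (rule power_mono) simp
      then show "ennreal ((norm (LINT v:{t..r}|lborel. f v \<omega>))\<^sup>2) \<le> (\<integral>\<^sup>+r\<in>{t..s}. ennreal (norm (f r \<omega>)) \<partial>lborel)\<^sup>2"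
        by (simp add: ennreal_power)
    qed
  qed
qed

lemma apply_msq_le:
  fixes L :: "real \<Rightarrow> ('a \<Rightarrow> 'b::euclidean_space) \<Rightarrow> 'a \<Rightarrow> 'c::euclidean_space"
  assumes L: "op_bound T L a" and t: "0 \<le> t" "t \<le> T" and \<eta>: "\<eta> \<in> L2_proc M F t T"
    and \<zeta>: "AE s in lborel. s \<in> {t..T} \<longrightarrow> (AE \<omega> in M. \<zeta> s \<omega> = L s (\<eta> s) \<omega>)"
  shows "AE s in lborel. s \<in> {t..T} \<longrightarrow>
    (msq M (\<zeta> s)) \<le> ennreal ((a s)\<^sup>2) * (msq M (\<eta> s))"
  using \<zeta> op_bound_msq[OF L] L2_proc_section[OF t(2) \<eta>]
proof eventually_elim
  case (elim s)
  show ?case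
  proof
    assume s: "s \<in> {t..T}"
    then have "(msq M (\<zeta> s)) = (msq M (L s (\<eta> s)))"
      using elim by (intro nn_integral_cong_AE) (auto elim!: eventually_mono)
    then show "(msq M (\<zeta> s)) \<le> ennreal ((a s)\<^sup>2) * (msq M (\<eta> s))"
      using elim s t by auto
  qed
qed

text \<open>Additivity alone gives this: write \<open>\<xi>\<close> as the sum of
  \<open>\<xi> - \<eta>\<close> and \<open>\<eta>\<close>.\<close>

lemma L2_operator_diff:
  fixes L :: "('a \<Rightarrow> 'b::euclidean_space) \<Rightarrow> 'a \<Rightarrow> 'c::euclidean_space"
  assumes L: "L2_operator M (F s) L" and \<xi>: "\<xi> \<in> L2 M (F s)" and \<eta>: "\<eta> \<in> L2 M (F s)" and d: "(\<lambda>\<omega>. \<xi> \<omega> - \<eta> \<omega>) \<in> L2 M (F s)"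
  shows "AE \<omega> in M. L \<xi> \<omega> - L \<eta> \<omega> = L (\<lambda>\<omega>. \<xi> \<omega> - \<eta> \<omega>) \<omega>"
proof -
  have "AE \<omega> in M. L (\<lambda>\<omega>. (\<xi> \<omega> - \<eta> \<omega>) + \<eta> \<omega>) \<omega> = L (\<lambda>\<omega>. \<xi> \<omega> - \<eta> \<omega>) \<omega> + L \<eta> \<omega>"
  proof -
    have "\<forall>\<xi>\<in>L2 M (F s). \<forall>\<eta>\<in>L2 M (F s). AE \<omega> in M. L (\<lambda>\<omega>. \<xi> \<omega> + \<eta> \<omega>) \<omega> = L \<xi> \<omega> + L \<eta> \<omega>"
      using L unfolding L2_operator_def by simp
    from bspec[OF bspec[OF this d] \<eta>] show ?thesis .
  qed
  then show ?thesis by eventually_elim simp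
qed

lemma sup_sq_L2:
  assumes X: "cont_proc t T X" and S: "sup_sq_expectation M t T X < \<infinity>" and s: "s \<in> {t..T}"
  shows "X s \<in> L2 M (F s)"
  using X s le_less_trans[OF sup_sq_expectation_ge[OF s] S] unfolding cont_proc_def
  by (intro L2I) (auto intro: progressive_section)

lemma sup_sq_L2_proc:
  assumes tT: "t \<le> T" and X: "cont_proc t T X" and S: "sup_sq_expectation M t T X < \<infinity>"
  shows "X \<in> L2_proc M F t T"
proof -
  have p: "progressive F t T X" using X unfolding cont_proc_def by simp
  have "proc_energy M t T X \<le> (\<integral>\<^sup>+r\<in>{t..T}. sup_sq_expectation M t T X \<partial>(lborel::real measure))"
    by (rule proc_energy_le[OF p tT order_refl]) (intro AE_I2 impI sup_sq_expectation_ge)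
  also have "\<dots> = sup_sq_expectation M t T X * emeasure lborel {t..T}"
    by (rule nn_integral_cmult_indicator) simp
  also have "\<dots> < \<infinity>" using S tT by (simp add: ennreal_mult_less_top)
  finally show ?thesis using p unfolding L2_proc_def proc_energy_def by simp
qed

end

text \<open>The coefficients enter through majorants and through numbers that bound integrals over
  all of \<open>{0..T}\<close>. This keeps later constants independent of \<open>t\<close> and of
  the shape of the majorants. The numbers for \<open>B\<close> and \<open>C\<close> bound integrals
  of squares.\<close>

locale linear_sde = brownian M W F for M :: "'a measure" and W F +
  fixes t T :: real
    and A C :: "real \<Rightarrow> ('a \<Rightarrow> 'b::euclidean_space) \<Rightarrow> 'a \<Rightarrow> 'b"
    and B D :: "real \<Rightarrow> ('a \<Rightarrow> 'c::euclidean_space) \<Rightarrow> 'a \<Rightarrow> 'b"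
    and b \<sigma> :: "real \<Rightarrow> 'a \<Rightarrow> 'b" and x :: "'a \<Rightarrow> 'b" and u :: "real \<Rightarrow> 'a \<Rightarrow> 'c"
    and a \<beta> c :: "real \<Rightarrow> real" and \<alpha>\<^sub>A \<beta>\<^sub>B \<gamma>\<^sub>C \<delta> :: real
  assumes t: "0 \<le> t" "t \<le> T"
    and A: "op_bound T A a" and a_int: "(\<integral>\<^sup>+s\<in>{0..T}. ennreal (a s) \<partial>lborel) \<le> ennreal \<alpha>\<^sub>A" and \<alpha>\<^sub>A: "0 \<le> \<alpha>\<^sub>A"
    and B: "op_bound T B \<beta>" and \<beta>_int: "(\<integral>\<^sup>+s\<in>{0..T}. ennreal ((\<beta> s)\<^sup>2) \<partial>lborel) \<le> ennreal \<beta>\<^sub>B"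
    and C: "op_bound T C c" and c_int: "(\<integral>\<^sup>+s\<in>{0..T}. ennreal ((c s)\<^sup>2) \<partial>lborel) \<le> ennreal \<gamma>\<^sub>C" and \<gamma>\<^sub>C: "0 \<le> \<gamma>\<^sub>C"
    and D: "op_bound T D (\<lambda>_. \<delta>)"
    and b: "b \<in> L2_L1_proc M F 0 T" and \<sigma>: "\<sigma> \<in> L2_proc M F 0 T"
    and x: "x \<in> L2 M (F t)" and u: "u \<in> L2_proc M F t T"
begin

definition coefficients :: "(real \<Rightarrow> 'a \<Rightarrow> 'b) \<Rightarrow> (real \<Rightarrow> 'a \<Rightarrow> 'b) \<Rightarrow> (real \<Rightarrow> 'a \<Rightarrow> 'b) \<Rightarrow> bool" where
  "coefficients X f g \<longleftrightarrow> f \<in> L2_L1_proc M F t T \<and> g \<in> L2_proc M F t T \<and>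
     (AE s in lborel. s \<in> {t..T} \<longrightarrow> (AE \<omega> in M. f s \<omega> = A s (X s) \<omega> + B s (u s) \<omega> + b s \<omega>)) \<and>
     (AE s in lborel. s \<in> {t..T} \<longrightarrow> (AE \<omega> in M. g s \<omega> = C s (X s) \<omega> + D s (u s) \<omega> + \<sigma> s \<omega>))"

text \<open>A relation and not a map, since drift, diffusion and stochastic integral are fixed only
  up to null sets. \<open>picard_step X X\<close> is the state equation.\<close>

definition picard_step :: "(real \<Rightarrow> 'a \<Rightarrow> 'b) \<Rightarrow> (real \<Rightarrow> 'a \<Rightarrow> 'b) \<Rightarrow> bool" where
  "picard_step X Y \<longleftrightarrow> (\<exists>f g I. coefficients X f g \<and> ito_integral_process M F W t T g I \<and>
     (AE \<omega> in M. \<forall>s\<in>{t..T}. Y s \<omega> = x \<omega> + (LINT r:{t..s}|lborel. f r \<omega>) + I s \<omega>))"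

definition S2_proc :: "(real \<Rightarrow> 'a \<Rightarrow> 'b) \<Rightarrow> bool" where
  "S2_proc X \<longleftrightarrow> cont_proc t T X \<and> sup_sq_expectation M t T X < \<infinity>"

text \<open>The bracket on the right of the asserted estimate, with energies in place of
  norms.\<close>

definition data :: ennreal where
  "data = (msq M x) + (ennreal \<beta>\<^sub>B + ennreal (\<delta>\<^sup>2)) * proc_energy M t T u
     + L1_energy M t T b + proc_energy M t T \<sigma>"

text \<open>A factor 2 comes from separating drift and noise; \<open>\<alpha>\<^sub>A\<close> is the
  mass of the Cauchy-Schwarz weight; 32 is 2 times the constant 16 of the stochastic
  integral.\<close>

definition rate :: "real \<Rightarrow> real" where
  "rate r = 2 * \<alpha>\<^sub>A * a r + 32 * (c r)\<^sup>2"

lemma a_nonneg: "0 \<le> a r" and a_meas[measurable]: "a \<in> borel_measurable borel" and c_meas[measurable]: "c \<in> borel_measurable borel"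
  and \<beta>_meas[measurable]: "\<beta> \<in> borel_measurable borel"
  using A B C unfolding op_bound_def by auto

lemma rate_nonneg: "0 \<le> rate r" unfolding rate_def using a_nonneg \<alpha>\<^sub>A by simp

lemma rate_meas[measurable]: "rate \<in> borel_measurable borel" unfolding rate_def[abs_def] by measurable

lemma sub_int: "t \<le> s \<Longrightarrow> s \<le> T \<Longrightarrow> (\<integral>\<^sup>+r\<in>{t..s}. g r \<partial>lborel) \<le> (\<integral>\<^sup>+r\<in>{0..T}. g r \<partial>lborel)"
  using t by (intro nn_integral_mono mult_left_mono) (auto simp: indicator_def)

text \<open>Weighted Cauchy-Schwarz with weight \<open>a\<close> and remaining factor
  \<open>a r * q r\<close>. Splitting \<open>(a r)^2 * q r\<close> in this way asks only for
  integrability of \<open>a\<close>; the bound \<open>Q\<close> makes the remaining integral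
  finite.\<close>

lemma A_estimate:
  fixes \<zeta> :: "real \<Rightarrow> 'a \<Rightarrow> 'b"
  assumes \<zeta>: "progressive F t T \<zeta>" and s: "t \<le> s" "s \<le> T" and q: "\<And>r. r \<in> {t..s} \<Longrightarrow> q r \<le> ennreal Q"
    and bound: "AE r in lborel. r \<in> {t..s} \<longrightarrow> (msq M (\<zeta> r)) \<le> ennreal ((a r)\<^sup>2) * q r"
  shows "L1_energy M t s \<zeta> \<le> ennreal \<alpha>\<^sub>A * (\<integral>\<^sup>+r\<in>{t..s}. ennreal (a r) * q r \<partial>lborel)"
    and "(\<integral>\<^sup>+r\<in>{t..s}. ennreal (a r) * q r \<partial>lborel) < \<infinity>"
proof -
  have "(\<integral>\<^sup>+r\<in>{t..s}. ennreal (a r) * q r \<partial>lborel) \<le> (\<integral>\<^sup>+r. ennreal Q * (ennreal (a r) * indicator {t..s} r) \<partial>lborel)"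
  proof (rule nn_integral_mono)
    fix r show "ennreal (a r) * q r * indicator {t..s} r \<le> ennreal Q * (ennreal (a r) * indicator {t..s} r)"
      using mult_left_mono[OF q, of r "ennreal (a r)"] by (cases "r \<in> {t..s}") (auto simp: mult.commute)
  qed
  also have "\<dots> = ennreal Q * (\<integral>\<^sup>+r\<in>{t..s}. ennreal (a r) \<partial>lborel)" by (rule nn_integral_cmult) simp
  also have "\<dots> \<le> ennreal Q * ennreal \<alpha>\<^sub>A" by (intro mult_left_mono order_trans[OF sub_int[OF s] a_int]) simp
  also have "\<dots> < \<infinity>" by (simp add: ennreal_mult_less_top)
  finally show fin: "(\<integral>\<^sup>+r\<in>{t..s}. ennreal (a r) * q r \<partial>lborel) < \<infinity>" .
  have "AE r in lborel. r \<in> {t..s} \<longrightarrow> (msq M (\<zeta> r)) \<le> ennreal (a r) * (ennreal (a r) * q r)"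
    using bound by eventually_elim (simp add: power2_eq_square ennreal_mult' a_nonneg mult.assoc)
  from weighted_Cauchy_Schwarz[OF \<zeta> s a_meas a_nonneg fin this]
  have "L1_energy M t s \<zeta> \<le> (\<integral>\<^sup>+r\<in>{t..s}. ennreal (a r) \<partial>lborel) * (\<integral>\<^sup>+r\<in>{t..s}. ennreal (a r) * q r \<partial>lborel)"
    unfolding L1_energy_def .
  also have "\<dots> \<le> ennreal \<alpha>\<^sub>A * (\<integral>\<^sup>+r\<in>{t..s}. ennreal (a r) * q r \<partial>lborel)"
    by (intro mult_right_mono order_trans[OF sub_int[OF s] a_int]) simp
  finally show "L1_energy M t s \<zeta> \<le> ennreal \<alpha>\<^sub>A * (\<integral>\<^sup>+r\<in>{t..s}. ennreal (a r) * q r \<partial>lborel)" .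
qed

text \<open>The terms with \<open>x\<close>, \<open>u\<close>, \<open>b\<close> and
  \<open>\<sigma>\<close> cancel, and linearity leaves operators applied to
  \<open>X r - X' r\<close>. The measurable majorant \<open>q\<close> of the mean square is kept
  free so that multiples of the weight can be inserted.\<close>

lemma picard_step_diff:
  assumes X: "S2_proc X" and X': "S2_proc X'" and Y: "picard_step X Y" and Y': "picard_step X' Y'"
    and s: "t \<le> s" "s \<le> T" and qm: "q \<in> borel_measurable borel" and qQ: "\<And>r. r \<in> {t..s} \<Longrightarrow> q r \<le> ennreal Q"
    and q: "\<And>r. r \<in> {t..s} \<Longrightarrow> (msq M (\<lambda>\<omega>. X r \<omega> - X' r \<omega>)) \<le> q r"
  shows "sup_sq_expectation M t s (\<lambda>r \<omega>. Y r \<omega> - Y' r \<omega>) \<le> (\<integral>\<^sup>+r\<in>{t..s}. ennreal (rate r) * q r \<partial>lborel)"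
proof -
  obtain f g I where fg: "coefficients X f g" and I: "ito_integral_process M F W t T g I"
    and Yeq: "AE \<omega> in M. \<forall>s\<in>{t..T}. Y s \<omega> = x \<omega> + (LINT r:{t..s}|lborel. f r \<omega>) + I s \<omega>"
    using Y unfolding picard_step_def by blast
  obtain f' g' I' where fg': "coefficients X' f' g'" and I': "ito_integral_process M F W t T g' I'"
    and Yeq': "AE \<omega> in M. \<forall>s\<in>{t..T}. Y' s \<omega> = x \<omega> + (LINT r:{t..s}|lborel. f' r \<omega>) + I' s \<omega>"
    using Y' unfolding picard_step_def by blast
  have f: "f \<in> L2_L1_proc M F t T" and f': "f' \<in> L2_L1_proc M F t T" and g: "g \<in> L2_proc M F t T" and g': "g' \<in> L2_proc M F t T"
    using fg fg' unfolding coefficients_def by auto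
  have fp: "progressive F t T f" "progressive F t T f'" and gp: "progressive F t T g" "progressive F t T g'"
    using f f' g g' unfolding L2_L1_proc_def L2_proc_def by auto
  let ?df = "\<lambda>r \<omega>. f r \<omega> - f' r \<omega>" and ?dg = "\<lambda>r \<omega>. g r \<omega> - g' r \<omega>"
  have dfp: "progressive F t T ?df" and dgp: "progressive F t T ?dg" by (intro progressive_diff fp gp)+
  have XL: "X r \<in> L2 M (F r)" "X' r \<in> L2 M (F r)" if "r \<in> {t..T}" for r
    using X X' sup_sq_L2[OF _ _ that] unfolding S2_proc_def by blast+
  have dXL: "(\<lambda>\<omega>. X r \<omega> - X' r \<omega>) \<in> L2 M (F r)" if r: "r \<in> {t..s}" for r
  proof (rule L2I)
    have r': "r \<in> {t..T}" using r s by auto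
    show "(\<lambda>\<omega>. X r \<omega> - X' r \<omega>) \<in> borel_measurable (F r)" using XL[OF r'] unfolding L2_def by auto
    show "(msq M (\<lambda>\<omega>. X r \<omega> - X' r \<omega>)) < \<infinity>"
      using order_trans[OF q[OF r] qQ[OF r]] by (simp add: le_less_trans)
  qed
  \<comment> \<open>Stated for a general operator so that it serves the drift with \<open>A\<close>,
    \<open>B\<close> and the diffusion with \<open>C\<close>, \<open>D\<close>.\<close>
  have msq: "AE r in lborel. r \<in> {t..s} \<longrightarrow> (msq M (\<lambda>\<omega>. h r \<omega> - h' r \<omega>)) \<le> ennreal ((l r)\<^sup>2) * q r"
    if L: "op_bound T L l" and h: "AE s in lborel. s \<in> {t..T} \<longrightarrow> (AE \<omega> in M. h s \<omega> = L s (X s) \<omega> + R s (u s) \<omega> + w s \<omega>)"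
      and h': "AE s in lborel. s \<in> {t..T} \<longrightarrow> (AE \<omega> in M. h' s \<omega> = L s (X' s) \<omega> + R s (u s) \<omega> + w s \<omega>)"
    for L :: "real \<Rightarrow> ('a \<Rightarrow> 'b) \<Rightarrow> 'a \<Rightarrow> 'b" and R :: "real \<Rightarrow> ('a \<Rightarrow> 'c) \<Rightarrow> 'a \<Rightarrow> 'b" and h h' w l
    using h h' op_bound_msq[OF L]
  proof eventually_elim
    case (elim r)
    show ?case
    proof
      assume r: "r \<in> {t..s}"
      then have r': "r \<in> {t..T}" "r \<in> {0..T}" using s t by auto
      have op: "L2_operator M (F r) (L r)" using elim r' by blast
      have "AE \<omega> in M. L r (X r) \<omega> - L r (X' r) \<omega> = L r (\<lambda>\<omega>. X r \<omega> - X' r \<omega>) \<omega>"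
        by (rule L2_operator_diff[OF op XL[OF r'(1)] dXL[OF r]])
      moreover have "AE \<omega> in M. h r \<omega> = L r (X r) \<omega> + R r (u r) \<omega> + w r \<omega>" using elim(1) r' by blast
      moreover have "AE \<omega> in M. h' r \<omega> = L r (X' r) \<omega> + R r (u r) \<omega> + w r \<omega>" using elim(2) r' by blast
      ultimately have "AE \<omega> in M. h r \<omega> - h' r \<omega> = L r (\<lambda>\<omega>. X r \<omega> - X' r \<omega>) \<omega>"
        by eventually_elim (simp add: algebra_simps)
      then have "(msq M (\<lambda>\<omega>. h r \<omega> - h' r \<omega>)) = (msq M (\<lambda>\<omega>. L r (\<lambda>\<omega>. X r \<omega> - X' r \<omega>) \<omega>))"
        by (intro nn_integral_cong_AE) (auto elim!: eventually_mono)
      also have "\<dots> \<le> ennreal ((l r)\<^sup>2) * (msq M (\<lambda>\<omega>. X r \<omega> - X' r \<omega>))"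
        using elim(3) r' dXL[OF r] by blast
      also have "\<dots> \<le> ennreal ((l r)\<^sup>2) * q r" by (intro mult_left_mono q[OF r]) simp
      finally show "(msq M (\<lambda>\<omega>. h r \<omega> - h' r \<omega>)) \<le> ennreal ((l r)\<^sup>2) * q r" .
    qed
  qed
  have df: "L1_energy M t s ?df \<le> ennreal \<alpha>\<^sub>A * (\<integral>\<^sup>+r\<in>{t..s}. ennreal (a r) * q r \<partial>lborel)"
    by (rule A_estimate(1)[OF dfp s qQ msq[OF A]]) (use fg fg' in \<open>auto simp: coefficients_def\<close>)
  have dg: "proc_energy M t s ?dg \<le> (\<integral>\<^sup>+r\<in>{t..s}. ennreal ((c r)\<^sup>2) * q r \<partial>lborel)"
    by (rule proc_energy_le[OF dgp s msq[OF C]]) (use fg fg' in \<open>auto simp: coefficients_def\<close>)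
  have "L1_energy M t T (\<lambda>r \<omega>. f r \<omega> + - f' r \<omega>) \<le> 2 * L1_energy M t T f + 2 * L1_energy M t T (\<lambda>r \<omega>. - f' r \<omega>)"
    by (rule L1_energy_add_le[OF fp(1) progressive_comp[OF fp(2)] t(2) order_refl]) simp
  also have "\<dots> < \<infinity>" using f f' unfolding L2_L1_proc_def L1_energy_def by (simp add: ennreal_mult_less_top)
  finally have dfL: "?df \<in> L2_L1_proc M F t T" using dfp unfolding L2_L1_proc_def L1_energy_def by simp
  have sT: "s \<in> {t..T}" using s by simp
  have dI: "ito_integral_process M F W t T ?dg (\<lambda>r \<omega>. I r \<omega> - I' r \<omega>)" by (rule ito_integral_process_diff[OF t(1) I I'])
  have "AE \<omega> in M. \<forall>r\<in>{t..s}. Y r \<omega> - Y' r \<omega> = (LINT v:{t..r}|lborel. ?df v \<omega>) + (I r \<omega> - I' r \<omega>)"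
    using Yeq Yeq' L2_L1_proc_integrable[OF t(2) f] L2_L1_proc_integrable[OF t(2) f']
  proof eventually_elim
    case (elim \<omega>)
    show ?case
    proof
      fix r assume r: "r \<in> {t..s}"
      have "(LINT v:{t..r}|lborel. ?df v \<omega>) = (LINT v:{t..r}|lborel. f v \<omega>) - (LINT v:{t..r}|lborel. f' v \<omega>)"
        by (rule set_integral_diff(2); rule set_integrable_subset[OF elim(3)] set_integrable_subset[OF elim(4)]) (use r s in auto)
      then show "Y r \<omega> - Y' r \<omega> = (LINT v:{t..r}|lborel. ?df v \<omega>) + (I r \<omega> - I' r \<omega>)" using elim(1,2) r s by auto
    qed
  qed
  from sup_sq_expectation_cong_AE[OF this]
  have "sup_sq_expectation M t s (\<lambda>r \<omega>. Y r \<omega> - Y' r \<omega>) = sup_sq_expectation M t s (\<lambda>r \<omega>. (LINT v:{t..r}|lborel. ?df v \<omega>) + (I r \<omega> - I' r \<omega>))" .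
  also have "\<dots> \<le> 2 * sup_sq_expectation M t s (\<lambda>r \<omega>. LINT v:{t..r}|lborel. ?df v \<omega>) + 2 * sup_sq_expectation M t s (\<lambda>r \<omega>. I r \<omega> - I' r \<omega>)"
    by (rule sup_sq_expectation_add_le[OF cont_proc_subinterval[OF drift_cont_proc[OF t(2) dfL] s(2)]
          cont_proc_subinterval[OF ito_integral_process_cont_proc[OF dI] s(2)] s(1)])
  also have "\<dots> \<le> 2 * (ennreal \<alpha>\<^sub>A * (\<integral>\<^sup>+r\<in>{t..s}. ennreal (a r) * q r \<partial>lborel)) + 2 * (16 * (\<integral>\<^sup>+r\<in>{t..s}. ennreal ((c r)\<^sup>2) * q r \<partial>lborel))"
    by (intro add_mono mult_left_mono order_trans[OF drift_sup_le[OF s dfL] df]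
          order_trans[OF ito_integral_process_bound[OF t(1) sT dI] mult_left_mono[OF dg]]) auto
  also have "\<dots> = (\<integral>\<^sup>+r. ennreal (2 * \<alpha>\<^sub>A) * (ennreal (a r) * q r * indicator {t..s} r) + ennreal 32 * (ennreal ((c r)\<^sup>2) * q r * indicator {t..s} r) \<partial>lborel)"
    using qm \<alpha>\<^sub>A by (subst nn_integral_add) (auto simp: nn_integral_cmult ennreal_mult mult.assoc)
  also have "\<dots> = (\<integral>\<^sup>+r\<in>{t..s}. ennreal (rate r) * q r \<partial>lborel)"
  proof (rule nn_integral_cong)
    fix r
    have "ennreal (rate r) = ennreal (2 * \<alpha>\<^sub>A) * ennreal (a r) + ennreal 32 * ennreal ((c r)\<^sup>2)"
      unfolding rate_def using \<alpha>\<^sub>A a_nonneg[of r] by (simp add: ennreal_plus ennreal_mult)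
    then show "ennreal (2 * \<alpha>\<^sub>A) * (ennreal (a r) * q r * indicator {t..s} r) + ennreal 32 * (ennreal ((c r)\<^sup>2) * q r * indicator {t..s} r)
      = ennreal (rate r) * q r * indicator {t..s} r" by (simp only: mult.assoc distrib_right)
  qed
  finally show ?thesis .
qed

text \<open>With the zero process as \<open>X\<close> one may take \<open>q = 0\<close>, and then
  only the data remain: this is where the final bound starts. For general \<open>X\<close> the
  estimate serves to show that the step stays in the space.\<close>

lemma picard_step_exists:
  assumes X: "S2_proc X" and qQ: "\<And>r. r \<in> {t..T} \<Longrightarrow> q r \<le> ennreal Q"
    and q: "\<And>r. r \<in> {t..T} \<Longrightarrow> (msq M (X r)) \<le> q r"
  shows "\<exists>Y. cont_proc t T Y \<and> picard_step X Y \<and> sup_sq_expectation M t T Y \<le>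
    128 * data + 8 * (ennreal \<alpha>\<^sub>A * (\<integral>\<^sup>+r\<in>{t..T}. ennreal (a r) * q r \<partial>lborel)) + 64 * (\<integral>\<^sup>+r\<in>{t..T}. ennreal ((c r)\<^sup>2) * q r \<partial>lborel)"
    and "(\<integral>\<^sup>+r\<in>{t..T}. ennreal (a r) * q r \<partial>lborel) < \<infinity>" "(\<integral>\<^sup>+r\<in>{t..T}. ennreal ((c r)\<^sup>2) * q r \<partial>lborel) < \<infinity>"
proof -
  \<comment> \<open>The largest coefficient of a data term, 128, belongs to the diffusion: 2 for the
    supremum, 16 for the Ito bound, and twice 2 for splitting the energy.\<close>
  have collect: "2 * (2 * x0 + 2 * (2 * p + 2 * (2 * q + 2 * r))) + 2 * (16 * (2 * v + 2 * (2 * w + 2 * z)))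
    = 4 * x0 + 16 * q + 16 * r + 128 * w + 128 * z + 8 * p + 64 * v" for x0 p q r v w z :: ennreal
    by (simp add: distrib_left mult.assoc[symmetric] add.assoc add.commute add.left_commute)
  let ?QA = "\<integral>\<^sup>+r\<in>{t..T}. ennreal (a r) * q r \<partial>lborel" and ?QC = "\<integral>\<^sup>+r\<in>{t..T}. ennreal ((c r)\<^sup>2) * q r \<partial>lborel"
  have XL: "X \<in> L2_proc M F t T" using X sup_sq_L2_proc[OF t(2)] unfolding S2_proc_def by blast
  have sp: "strongly_progressive M F T A" "strongly_progressive M F T C" "strongly_progressive M F T B" "strongly_progressive M F T D"
    using A B C D unfolding op_bound_def by auto
  obtain zA where zA: "progressive F t T zA" "AE s in lborel. s \<in> {t..T} \<longrightarrow> (AE \<omega> in M. zA s \<omega> = A s (X s) \<omega>)"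
    using strongly_progressive_apply[OF sp(1) t XL] by blast
  obtain zC where zC: "progressive F t T zC" "AE s in lborel. s \<in> {t..T} \<longrightarrow> (AE \<omega> in M. zC s \<omega> = C s (X s) \<omega>)"
    using strongly_progressive_apply[OF sp(2) t XL] by blast
  obtain zB where zB: "progressive F t T zB" "AE s in lborel. s \<in> {t..T} \<longrightarrow> (AE \<omega> in M. zB s \<omega> = B s (u s) \<omega>)"
    using strongly_progressive_apply[OF sp(3) t u] by blast
  obtain zD where zD: "progressive F t T zD" "AE s in lborel. s \<in> {t..T} \<longrightarrow> (AE \<omega> in M. zD s \<omega> = D s (u s) \<omega>)"
    using strongly_progressive_apply[OF sp(4) t u] by blast
  have up: "progressive F t T u" and ue: "proc_energy M t T u < \<infinity>" using u unfolding L2_proc_def proc_energy_def by auto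
  have bp: "progressive F t T b"
    using b unfolding L2_L1_proc_def by (auto intro: progressive_subinterval[OF _ t(1) order_refl])
  have be: "L1_energy M t T b < \<infinity>"
    using le_less_trans[OF L1_energy_subset[OF t(1) order_refl, of M T b]] b unfolding L2_L1_proc_def L1_energy_def by auto
  have \<sigma>p: "progressive F t T \<sigma>"
    using \<sigma> unfolding L2_proc_def by (auto intro: progressive_subinterval[OF _ t(1) order_refl])
  have \<sigma>e: "proc_energy M t T \<sigma> < \<infinity>"
    using le_less_trans[OF proc_energy_subset[OF t(1) order_refl, of M T \<sigma>]] \<sigma> unfolding L2_proc_def proc_energy_def by auto
  have xe: "(msq M x) < \<infinity>" unfolding L2_msq[OF x] by simp
  have bA: "AE r in lborel. r \<in> {t..T} \<longrightarrow> (msq M (zA r)) \<le> ennreal ((a r)\<^sup>2) * q r"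
    using apply_msq_le[OF A t XL zA(2)] by eventually_elim (use q in \<open>meson mult_left_mono order_trans zero_le\<close>)
  have bC: "AE r in lborel. r \<in> {t..T} \<longrightarrow> (msq M (zC r)) \<le> ennreal ((c r)\<^sup>2) * q r"
    using apply_msq_le[OF C t XL zC(2)] by eventually_elim (use q in \<open>meson mult_left_mono order_trans zero_le\<close>)
  have eA: "L1_energy M t T zA \<le> ennreal \<alpha>\<^sub>A * ?QA" by (rule A_estimate(1)[OF zA(1) t(2) order_refl qQ bA])
  show QA: "?QA < \<infinity>" by (rule A_estimate(2)[OF zA(1) t(2) order_refl qQ bA])
  have eC: "proc_energy M t T zC \<le> ?QC" by (rule proc_energy_le[OF zC(1) t(2) order_refl bC])
  show QC: "?QC < \<infinity>"
  proof -
    have "?QC \<le> (\<integral>\<^sup>+r. ennreal Q * (ennreal ((c r)\<^sup>2) * indicator {t..T} r) \<partial>lborel)"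
    proof (rule nn_integral_mono)
      fix r show "ennreal ((c r)\<^sup>2) * q r * indicator {t..T} r \<le> ennreal Q * (ennreal ((c r)\<^sup>2) * indicator {t..T} r)"
        using mult_left_mono[OF qQ, of r "ennreal ((c r)\<^sup>2)"] by (cases "r \<in> {t..T}") (auto simp: mult.commute)
    qed
    also have "\<dots> = ennreal Q * (\<integral>\<^sup>+r\<in>{t..T}. ennreal ((c r)\<^sup>2) \<partial>lborel)" by (rule nn_integral_cmult) simp
    also have "\<dots> \<le> ennreal Q * ennreal \<gamma>\<^sub>C" by (intro mult_left_mono order_trans[OF sub_int[OF t(2) order_refl] c_int]) simp
    also have "\<dots> < \<infinity>" by (simp add: ennreal_mult_less_top)
    finally show ?thesis .
  qed
  \<comment> \<open>Here the Cauchy-Schwarz weight is the square of \<open>\<beta>\<close>, and the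
    remaining factor is the mean square of \<open>u\<close>.\<close>
  have eB: "L1_energy M t T zB \<le> ennreal \<beta>\<^sub>B * proc_energy M t T u"
  proof -
    let ?k = "\<lambda>r. \<integral>\<^sup>+\<omega>. ennreal ((norm (u r \<omega>))\<^sup>2) \<partial>M"
    have k: "(\<integral>\<^sup>+r\<in>{t..T}. ?k r \<partial>lborel) = proc_energy M t T u" by (rule proc_energy_Fubini[OF up t(2) order_refl, symmetric])
    have "L1_energy M t T zB \<le> (\<integral>\<^sup>+r\<in>{t..T}. ennreal ((\<beta> r)\<^sup>2) \<partial>lborel) * (\<integral>\<^sup>+r\<in>{t..T}. ?k r \<partial>lborel)"
      unfolding L1_energy_def
      by (rule weighted_Cauchy_Schwarz[OF zB(1) t(2) order_refl _ _ _ apply_msq_le[OF B t u zB(2)]]) (use k ue in auto)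
    also have "\<dots> \<le> ennreal \<beta>\<^sub>B * proc_energy M t T u"
      unfolding k by (intro mult_right_mono order_trans[OF sub_int[OF t(2) order_refl] \<beta>_int]) simp
    finally show ?thesis .
  qed
  have eD: "proc_energy M t T zD \<le> ennreal (\<delta>\<^sup>2) * proc_energy M t T u"
  proof -
    have "proc_energy M t T zD \<le> (\<integral>\<^sup>+r\<in>{t..T}. ennreal (\<delta>\<^sup>2) * (msq M (u r)) \<partial>lborel)"
      by (rule proc_energy_le[OF zD(1) t(2) order_refl apply_msq_le[OF D t u zD(2)]])
    also have "\<dots> = (\<integral>\<^sup>+\<omega>. (\<integral>\<^sup>+r. ennreal (\<delta>\<^sup>2) * ennreal ((norm (u r \<omega>))\<^sup>2) * indicator {t..T} r \<partial>lborel) \<partial>M)"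
      by (rule progressive_Fubini[OF up t(2) order_refl, symmetric]) simp_all
    also have "\<dots> = (\<integral>\<^sup>+\<omega>. ennreal (\<delta>\<^sup>2) * (\<integral>\<^sup>+r\<in>{t..T}. ennreal ((norm (u r \<omega>))\<^sup>2) \<partial>lborel) \<partial>M)"
      unfolding mult.assoc by (intro nn_integral_cong nn_integral_cmult sq_path_measurable[OF up t(2) order_refl])
    also have "\<dots> = ennreal (\<delta>\<^sup>2) * proc_energy M t T u"
      unfolding proc_energy_def by (rule nn_integral_cmult[OF sq_integral_measurable[OF up t(2) order_refl]])
    finally show ?thesis .
  qed
  define f where "f r \<omega> = zA r \<omega> + (zB r \<omega> + b r \<omega>)" for r \<omega>
  define g where "g r \<omega> = zC r \<omega> + (zD r \<omega> + \<sigma> r \<omega>)" for r \<omega>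
  have fp: "progressive F t T f" unfolding f_def by (intro progressive_add zA zB bp)
  have gp: "progressive F t T g" unfolding g_def by (intro progressive_add zC zD \<sigma>p)
  have fe: "L1_energy M t T f \<le> 2 * (ennreal \<alpha>\<^sub>A * ?QA) + 2 * (2 * (ennreal \<beta>\<^sub>B * proc_energy M t T u) + 2 * L1_energy M t T b)"
    unfolding f_def
    by (intro order_trans[OF L1_energy_add_le[OF zA(1) progressive_add[OF zB(1) bp] t(2) order_refl]] add_mono mult_left_mono eA
        order_trans[OF L1_energy_add_le[OF zB(1) bp t(2) order_refl]] eB order_refl) auto
  have ge: "proc_energy M t T g \<le> 2 * ?QC + 2 * (2 * (ennreal (\<delta>\<^sup>2) * proc_energy M t T u) + 2 * proc_energy M t T \<sigma>)"
    unfolding g_def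
    by (intro order_trans[OF proc_energy_add_le[OF zC(1) progressive_add[OF zD(1) \<sigma>p] t(2) order_refl]] add_mono mult_left_mono eC
        order_trans[OF proc_energy_add_le[OF zD(1) \<sigma>p t(2) order_refl]] eD order_refl) auto
  have fL: "f \<in> L2_L1_proc M F t T"
    using fp le_less_trans[OF fe] QA be ue unfolding L2_L1_proc_def L1_energy_def[symmetric] by (simp add: ennreal_mult_less_top)
  have gL: "g \<in> L2_proc M F t T"
    using gp le_less_trans[OF ge] QC \<sigma>e ue unfolding L2_proc_def proc_energy_def[symmetric] by (simp add: ennreal_mult_less_top)
  have co: "coefficients X f g"
    unfolding coefficients_def
  proof (intro conjI fL gL)
    show "AE s in lborel. s \<in> {t..T} \<longrightarrow> (AE \<omega> in M. f s \<omega> = A s (X s) \<omega> + B s (u s) \<omega> + b s \<omega>)"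
      using zA(2) zB(2)
    proof eventually_elim
      case (elim s)
      show ?case
      proof
        assume s: "s \<in> {t..T}"
        have "AE \<omega> in M. zA s \<omega> = A s (X s) \<omega>" "AE \<omega> in M. zB s \<omega> = B s (u s) \<omega>" using elim s by auto
        then show "AE \<omega> in M. f s \<omega> = A s (X s) \<omega> + B s (u s) \<omega> + b s \<omega>" by eventually_elim (simp add: f_def)
      qed
    qed
    show "AE s in lborel. s \<in> {t..T} \<longrightarrow> (AE \<omega> in M. g s \<omega> = C s (X s) \<omega> + D s (u s) \<omega> + \<sigma> s \<omega>)"
      using zC(2) zD(2)
    proof eventually_elim
      case (elim s)
      show ?case
      proof
        assume s: "s \<in> {t..T}"
        have "AE \<omega> in M. zC s \<omega> = C s (X s) \<omega>" "AE \<omega> in M. zD s \<omega> = D s (u s) \<omega>" using elim s by auto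
        then show "AE \<omega> in M. g s \<omega> = C s (X s) \<omega> + D s (u s) \<omega> + \<sigma> s \<omega>" by eventually_elim (simp add: g_def)
      qed
    qed
  qed
  obtain I where I: "ito_integral_process M F W t T g I" "sup_sq_expectation M t T I \<le> 16 * proc_energy M t T g"
    using ito_integral_process_exists_bounded[OF t gL] by blast
  have xc: "cont_proc t T (\<lambda>s. x)"
    unfolding cont_proc_def
  proof
    show "progressive F t T (\<lambda>s. x)"
    proof (rule progressiveI_joint)
      fix r assume "r \<in> {t..T}"
      then have "(\<lambda>y. x (snd y)) \<in> borel_measurable (borel \<Otimes>\<^sub>M F r)"
        using x unfolding L2_def by (intro measurable_compose[OF measurable_snd measurable_F_mono]) auto
      then show "\<exists>\<psi>\<in>borel_measurable (borel \<Otimes>\<^sub>M F r). \<forall>s\<in>{t..r}. \<forall>\<omega>\<in>space (F r). x \<omega> = \<psi> (s, \<omega>)"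
        by (rule bexI[rotated]) simp
    qed
  qed simp
  let ?Z = "\<lambda>s \<omega>. LINT r:{t..s}|lborel. f r \<omega>"
  have Z: "cont_proc t T ?Z" by (rule drift_cont_proc[OF t(2) fL])
  have Ic: "cont_proc t T I" by (rule ito_integral_process_cont_proc[OF I(1)])
  let ?Y = "\<lambda>s \<omega>. (x \<omega> + ?Z s \<omega>) + I s \<omega>"
  have Y: "cont_proc t T ?Y" by (intro cont_proc_add xc Z Ic)
  have Sx: "sup_sq_expectation M t T (\<lambda>s. x) = (msq M x)"
    unfolding sup_sq_expectation_def using t by simp
  have "sup_sq_expectation M t T ?Y \<le> 2 * (2 * sup_sq_expectation M t T (\<lambda>s. x) + 2 * sup_sq_expectation M t T ?Z) + 2 * sup_sq_expectation M t T I"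
    by (intro order_trans[OF sup_sq_expectation_add_le[OF cont_proc_add[OF xc Z] Ic t(2)]] add_mono mult_left_mono
        sup_sq_expectation_add_le[OF xc Z t(2)] order_refl) simp
  also have "\<dots> \<le> 2 * (2 * (msq M x)
       + 2 * (2 * (ennreal \<alpha>\<^sub>A * ?QA) + 2 * (2 * (ennreal \<beta>\<^sub>B * proc_energy M t T u) + 2 * L1_energy M t T b)))
       + 2 * (16 * (2 * ?QC + 2 * (2 * (ennreal (\<delta>\<^sup>2) * proc_energy M t T u) + 2 * proc_energy M t T \<sigma>)))"
    unfolding Sx
    by (intro add_mono mult_left_mono order_refl order_trans[OF drift_sup_le[OF t(2) order_refl fL] fe]
        order_trans[OF I(2) mult_left_mono[OF ge]]) auto
  also have "\<dots> = 4 * (msq M x) + 16 * (ennreal \<beta>\<^sub>B * proc_energy M t T u) + 16 * L1_energy M t T b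
      + 128 * (ennreal (\<delta>\<^sup>2) * proc_energy M t T u) + 128 * proc_energy M t T \<sigma> + 8 * (ennreal \<alpha>\<^sub>A * ?QA) + 64 * ?QC"
    by (rule collect)
  \<comment> \<open>All data coefficients are raised to the largest one, so that they can be
    collected in \<open>data\<close>.\<close>
  also have "\<dots> \<le> 128 * (msq M x) + 128 * (ennreal \<beta>\<^sub>B * proc_energy M t T u) + 128 * L1_energy M t T b
      + 128 * (ennreal (\<delta>\<^sup>2) * proc_energy M t T u) + 128 * proc_energy M t T \<sigma> + 8 * (ennreal \<alpha>\<^sub>A * ?QA) + 64 * ?QC"
    by (intro add_mono mult_right_mono order_refl) auto
  also have "\<dots> = 128 * data + 8 * (ennreal \<alpha>\<^sub>A * ?QA) + 64 * ?QC"
    unfolding data_def by (simp add: algebra_simps)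
  finally have SY: "sup_sq_expectation M t T ?Y \<le> 128 * data + 8 * (ennreal \<alpha>\<^sub>A * ?QA) + 64 * ?QC" .
  have "picard_step X ?Y" unfolding picard_step_def using co I(1) by blast
  then show "\<exists>Y. cont_proc t T Y \<and> picard_step X Y \<and> sup_sq_expectation M t T Y \<le> 128 * data + 8 * (ennreal \<alpha>\<^sub>A * ?QA) + 64 * ?QC"
    using Y SY by blast
qed

lemma data_finite: "data < \<infinity>"
proof -
  have "L1_energy M t T b < \<infinity>"
    using le_less_trans[OF L1_energy_subset[OF t(1) order_refl, of M T b]] b unfolding L2_L1_proc_def L1_energy_def by auto
  moreover have "proc_energy M t T \<sigma> < \<infinity>"
    using le_less_trans[OF proc_energy_subset[OF t(1) order_refl, of M T \<sigma>]] \<sigma> unfolding L2_proc_def proc_energy_def by auto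
  moreover have "proc_energy M t T u < \<infinity>" using u unfolding L2_proc_def proc_energy_def by auto
  ultimately show ?thesis unfolding data_def L2_msq[OF x] by (simp add: ennreal_mult_less_top)
qed

end

section \<open>Fixed point\<close>

text \<open>A step-function substitute for \<open>exp (4 H)\<close> with \<open>H\<close> the primitive of \<open>h\<close>, which avoids the
  chain rule for absolutely continuous functions: each level set of \<open>\<lfloor>8 H\<rfloor>\<close> carries
  \<open>h\<close>-mass at most \<open>1/8\<close>.\<close>

lemma exists_weight:
  fixes h :: "real \<Rightarrow> real"
  assumes tT: "t \<le> T" and h[measurable]: "h \<in> borel_measurable borel" and h0: "\<And>r. 0 \<le> h r"
    and H: "(\<integral>\<^sup>+r\<in>{t..T}. ennreal (h r) \<partial>lborel) \<le> ennreal H" "0 \<le> H"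
  shows "\<exists>\<Phi>. \<Phi> \<in> borel_measurable borel \<and> (\<forall>r. 1 \<le> \<Phi> r \<and> \<Phi> r \<le> 2 powr (8 * H)) \<and>
    (\<forall>s\<in>{t..T}. (\<integral>\<^sup>+r\<in>{t..s}. ennreal (h r) * ennreal (\<Phi> r) \<partial>lborel) \<le> ennreal (\<Phi> s / 4))"
proof -
  have eq_nn: "(\<integral>\<^sup>+r. ennreal (norm (indicat_real S r *\<^sub>R h r)) \<partial>lborel) = (\<integral>\<^sup>+r\<in>S. ennreal (h r) \<partial>lborel)" for S
    using h0 by (intro nn_integral_cong) (auto simp: indicator_def)
  have int: "set_integrable lborel {t..T} h"
    unfolding set_integrable_def
  proof (rule integrableI_bounded)
    show "(\<integral>\<^sup>+r. ennreal (norm (indicat_real {t..T} r *\<^sub>R h r)) \<partial>lborel) < \<infinity>"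
      unfolding eq_nn using H by (simp add: le_less_trans)
  qed simp
  define G where "G r = integral {t..r} h" for r
  have hk: "h integrable_on {t..T}" by (rule set_borel_integral_eq_integral(1)[OF int])
  have Gc: "continuous_on {t..T} G" unfolding G_def by (rule indefinite_integral_continuous_1[OF hk])
  \<comment> \<open>The primitive measures the mass of \<open>h\<close> on subintervals and is
    monotone.\<close>
  have seg: "G p \<le> G q \<and> (\<integral>\<^sup>+r\<in>{p..q}. ennreal (h r) \<partial>lborel) = ennreal (G q - G p)" if pq: "t \<le> p" "p \<le> q" "q \<le> T" for p q
  proof -
    have ipq: "set_integrable lborel {p..q} h" by (rule set_integrable_subset[OF int]) (use pq in auto)
    have hkq: "h integrable_on {t..q}" by (rule integrable_on_subinterval[OF hk]) (use pq in auto)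
    have "integral {t..p} h + integral {p..q} h = integral {t..q} h"
      by (rule Henstock_Kurzweil_Integration.integral_combine[OF pq(1,2) hkq])
    then have d: "integral {p..q} h = G q - G p" by (simp add: G_def)
    have L: "(LINT r:{p..q}|lborel. h r) = G q - G p" using set_borel_integral_eq_integral(2)[OF ipq] d by simp
    have "(\<integral>\<^sup>+r\<in>{p..q}. ennreal (h r) \<partial>lborel) = (\<integral>\<^sup>+r. ennreal (indicat_real {p..q} r *\<^sub>R h r) \<partial>lborel)"
      by (intro nn_integral_cong) (auto simp: indicator_def)
    also have "\<dots> = ennreal (LINT r:{p..q}|lborel. h r)"
      using ipq h0 unfolding set_integrable_def set_lebesgue_integral_def by (intro nn_integral_eq_integral) auto
    finally have "(\<integral>\<^sup>+r\<in>{p..q}. ennreal (h r) \<partial>lborel) = ennreal (G q - G p)" unfolding L .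
    moreover have "0 \<le> (LINT r:{p..q}|lborel. h r)"
      unfolding set_lebesgue_integral_def using h0 by (intro integral_nonneg_AE) auto
    ultimately show ?thesis unfolding L by simp
  qed
  have Gt: "G t = 0" unfolding G_def by simp
  have GT: "G T \<le> H"
    using seg[of t T] tT H Gt by (simp add: ennreal_le_iff)
  \<comment> \<open>Clamping the argument to \<open>{t..T}\<close> makes the primitive continuous on
    the whole line, with values between 0 and \<open>H\<close>.\<close>
  define G' where "G' r = G (max t (min r T))" for r
  have G'c: "continuous_on UNIV G'"
    unfolding G'_def by (rule continuous_on_compose2[OF Gc]) (use tT in \<open>auto intro!: continuous_intros\<close>)
  have G'm[measurable]: "G' \<in> borel_measurable borel" by (rule borel_measurable_continuous_onI[OF G'c])
  have G'0: "0 \<le> G' r" for r unfolding G'_def using seg[of t "max t (min r T)"] tT Gt by auto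
  have G'H: "G' r \<le> H" for r unfolding G'_def using seg[of "max t (min r T)" T] tT GT by auto
  have G'eq: "G' r = G r" if "r \<in> {t..T}" for r using that unfolding G'_def by (auto simp: min_absorb1 max_absorb2)
  define n where "n r = nat \<lfloor>8 * G' r\<rfloor>" for r
  have n: "real (n r) \<le> 8 * G' r" "8 * G' r \<le> real (n r) + 1" for r
    using G'0[of r] unfolding n_def by (simp_all add: of_nat_nat)
  define \<Phi> where "\<Phi> r = (2::real) ^ n r" for r
  have nm: "n \<in> measurable borel (count_space UNIV)" unfolding n_def[abs_def] by measurable
  have "\<Phi> \<in> borel_measurable borel"
    using measurable_compose[OF nm, of "\<lambda>k. (2::real) ^ k" borel] unfolding \<Phi>_def[abs_def] by simp
  moreover have "1 \<le> \<Phi> r \<and> \<Phi> r \<le> 2 powr (8 * H)" for r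
  proof
    have "\<Phi> r = 2 powr real (n r)" unfolding \<Phi>_def by (simp add: powr_realpow)
    also have "\<dots> \<le> 2 powr (8 * H)" using n(1)[of r] G'H[of r] by (intro powr_mono) auto
    finally show "\<Phi> r \<le> 2 powr (8 * H)" .
  qed (simp add: \<Phi>_def)
  moreover have "(\<integral>\<^sup>+r\<in>{t..s}. ennreal (h r) * ennreal (\<Phi> r) \<partial>lborel) \<le> ennreal (\<Phi> s / 4)" if s: "s \<in> {t..T}" for s
  proof -
    \<comment> \<open>Closed bands of the primitive. Neighbouring bands may share points, which is
      harmless for an upper bound; closedness puts the infimum and supremum of a band into it, so
      its mass is at most the height 1/8.\<close>
    define K where "K j = {t..T} \<inter> G -` {real j / 8..(real j + 1) / 8}" for j :: nat
    have Kc: "closed (K j)" for j unfolding K_def by (intro continuous_closed_preimage Gc) auto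
    then have Km[measurable]: "K j \<in> sets borel" for j by (rule borel_closed)
    have K8: "(\<integral>\<^sup>+r\<in>K j. ennreal (h r) \<partial>lborel) \<le> ennreal (1 / 8)" for j
    proof (cases "K j = {}")
      case False
      have bdd: "bdd_below (K j)" "bdd_above (K j)" unfolding K_def by (auto intro: bdd_belowI[of _ t] bdd_aboveI[of _ T])
      define p where "p = Inf (K j)"
      define q where "q = Sup (K j)"
      have p: "p \<in> K j" and q: "q \<in> K j"
        unfolding p_def q_def using closed_contains_Inf[OF False bdd(1) Kc] closed_contains_Sup[OF False bdd(2) Kc] by auto
      have sub: "K j \<subseteq> {p..q}" unfolding p_def q_def using cInf_lower[OF _ bdd(1)] cSup_upper[OF _ bdd(2)] by auto
      then have pq: "p \<le> q" using p by auto
      have "(\<integral>\<^sup>+r\<in>K j. ennreal (h r) \<partial>lborel) \<le> (\<integral>\<^sup>+r\<in>{p..q}. ennreal (h r) \<partial>lborel)"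
        using sub by (intro nn_integral_mono mult_left_mono) (auto simp: indicator_def)
      also have "\<dots> = ennreal (G q - G p)" using seg[of p q] p q pq unfolding K_def by auto
      also have "\<dots> \<le> ennreal (1 / 8)"
        using p q unfolding K_def by (intro ennreal_leI) (auto simp: field_simps)
      finally show ?thesis .
    qed simp
    have "(\<integral>\<^sup>+r\<in>{t..s}. ennreal (h r) * ennreal (\<Phi> r) \<partial>lborel)
      \<le> (\<integral>\<^sup>+r. (\<Sum>j\<le>n s. ennreal (2 ^ j) * (ennreal (h r) * indicator (K j) r)) \<partial>lborel)"
    proof (rule nn_integral_mono)
      fix r
      show "ennreal (h r) * ennreal (\<Phi> r) * indicator {t..s} r \<le> (\<Sum>j\<le>n s. ennreal (2 ^ j) * (ennreal (h r) * indicator (K j) r))"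
      proof (cases "r \<in> {t..s}")
        case True
        then have r: "r \<in> {t..T}" using s by auto
        have "G r \<le> G s" using seg[of r s] True s by auto
        then have ns: "n r \<le> n s" unfolding n_def G'eq[OF r] G'eq[OF s] by (intro nat_mono floor_mono) simp
        have "r \<in> K (n r)" unfolding K_def using r n[of r] G'eq[OF r] by auto
        then have "ennreal (h r) * ennreal (\<Phi> r) * indicator {t..s} r = ennreal (2 ^ n r) * (ennreal (h r) * indicator (K (n r)) r)"
          using True unfolding \<Phi>_def by (simp add: mult.commute)
        also have "\<dots> \<le> (\<Sum>j\<le>n s. ennreal (2 ^ j) * (ennreal (h r) * indicator (K j) r))"
          using ns by (intro member_le_sum[of "n r"]) auto
        finally show ?thesis .
      qed simp
    qed
    also have "\<dots> = (\<Sum>j\<le>n s. ennreal (2 ^ j) * (\<integral>\<^sup>+r\<in>K j. ennreal (h r) \<partial>lborel))"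
      by (subst nn_integral_sum) (auto simp: nn_integral_cmult)
    also have "\<dots> \<le> (\<Sum>j\<le>n s. ennreal (2 ^ j) * ennreal (1 / 8))"
      by (intro sum_mono mult_left_mono K8) simp
    also have "\<dots> = ennreal (\<Sum>j\<le>n s. 2 ^ j * (1 / 8))"
      by (subst sum_ennreal[symmetric]) (auto simp: ennreal_mult[symmetric] simp del: ennreal_power)
    also have "\<dots> \<le> ennreal (\<Phi> s / 4)"
    proof (rule ennreal_leI)
      \<comment> \<open>The geometric sum is at most twice its last term, and 2 * 1/8 is the factor
        1/4 of the contraction.\<close>
      have "(\<Sum>j\<le>m. (2::real) ^ j) \<le> 2 * 2 ^ m" for m :: nat by (induction m) auto
      from this[of "n s"] show "(\<Sum>j\<le>n s. 2 ^ j * (1 / 8)) \<le> \<Phi> s / 4"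
        unfolding sum_distrib_right[symmetric] \<Phi>_def by simp
    qed
    finally show ?thesis .
  qed
  ultimately show ?thesis by blast
qed

context linear_sde
begin

section \<open>The Picard iteration in the weighted norm\<close>

lemma rate_integral: "(\<integral>\<^sup>+r\<in>{t..T}. ennreal (rate r) \<partial>lborel) \<le> ennreal (2 * \<alpha>\<^sub>A\<^sup>2 + 32 * \<gamma>\<^sub>C)"
proof -
  have "(\<integral>\<^sup>+r\<in>{t..T}. ennreal (rate r) \<partial>lborel)
    = (\<integral>\<^sup>+r. ennreal (2 * \<alpha>\<^sub>A) * (ennreal (a r) * indicator {t..T} r) + ennreal 32 * (ennreal ((c r)\<^sup>2) * indicator {t..T} r) \<partial>lborel)"
  proof (rule nn_integral_cong)
    fix r
    have "ennreal (rate r) = ennreal (2 * \<alpha>\<^sub>A) * ennreal (a r) + ennreal 32 * ennreal ((c r)\<^sup>2)"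
      unfolding rate_def using \<alpha>\<^sub>A a_nonneg[of r] by (simp add: ennreal_plus ennreal_mult)
    then show "ennreal (rate r) * indicator {t..T} r
      = ennreal (2 * \<alpha>\<^sub>A) * (ennreal (a r) * indicator {t..T} r) + ennreal 32 * (ennreal ((c r)\<^sup>2) * indicator {t..T} r)"
      by (simp only: mult.assoc distrib_right)
  qed
  also have "\<dots> = ennreal (2 * \<alpha>\<^sub>A) * (\<integral>\<^sup>+r\<in>{t..T}. ennreal (a r) \<partial>lborel) + ennreal 32 * (\<integral>\<^sup>+r\<in>{t..T}. ennreal ((c r)\<^sup>2) \<partial>lborel)"
    by (subst nn_integral_add) (auto simp: nn_integral_cmult)
  also have "\<dots> \<le> ennreal (2 * \<alpha>\<^sub>A) * ennreal \<alpha>\<^sub>A + ennreal 32 * ennreal \<gamma>\<^sub>C"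
    by (intro add_mono mult_left_mono order_trans[OF sub_int[OF t(2) order_refl] a_int] order_trans[OF sub_int[OF t(2) order_refl] c_int]) auto
  also have "ennreal (2 * \<alpha>\<^sub>A) * ennreal \<alpha>\<^sub>A = ennreal (2 * \<alpha>\<^sub>A\<^sup>2)"
    using \<alpha>\<^sub>A by (subst ennreal_mult[symmetric]) (auto simp: power2_eq_square mult.assoc)
  also have "ennreal 32 * ennreal \<gamma>\<^sub>C = ennreal (32 * \<gamma>\<^sub>C)"
    using \<gamma>\<^sub>C by (subst ennreal_mult[symmetric]) auto
  also have "ennreal (2 * \<alpha>\<^sub>A\<^sup>2) + ennreal (32 * \<gamma>\<^sub>C) = ennreal (2 * \<alpha>\<^sub>A\<^sup>2 + 32 * \<gamma>\<^sub>C)"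
    using \<gamma>\<^sub>C by (subst ennreal_plus) auto
  finally show ?thesis .
qed

definition weight_bound :: real where "weight_bound = 2 powr (8 * (2 * \<alpha>\<^sub>A\<^sup>2 + 32 * \<gamma>\<^sub>C))"

lemma S2_diff: "S2_proc X \<Longrightarrow> S2_proc Y \<Longrightarrow> sup_sq_expectation M t T (\<lambda>s \<omega>. X s \<omega> - Y s \<omega>) < \<infinity>"
proof -
  assume X: "S2_proc X" and Y: "S2_proc Y"
  have m: "cont_proc t T (\<lambda>s \<omega>. - Y s \<omega>)"
    using Y unfolding S2_proc_def cont_proc_def by (auto intro: progressive_comp continuous_on_minus elim!: eventually_mono)
  have "sup_sq_expectation M t T (\<lambda>s \<omega>. X s \<omega> + - Y s \<omega>) \<le> 2 * sup_sq_expectation M t T X + 2 * sup_sq_expectation M t T (\<lambda>s \<omega>. - Y s \<omega>)"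
    by (rule sup_sq_expectation_add_le[OF _ m t(2)]) (use X in \<open>simp add: S2_proc_def\<close>)
  also have "sup_sq_expectation M t T (\<lambda>s \<omega>. - Y s \<omega>) = sup_sq_expectation M t T Y" unfolding sup_sq_expectation_def by simp
  also have "2 * sup_sq_expectation M t T X + 2 * sup_sq_expectation M t T Y < \<infinity>"
    using X Y unfolding S2_proc_def by (simp add: ennreal_mult_less_top)
  finally show ?thesis by simp
qed

text \<open>Measured by E sup over \<open>{t..s}\<close> divided by \<open>\<Phi> s\<close>,
  uniformly in \<open>s\<close>, squared distances shrink by 1/4 in each step. Since the weight lies
  between 1 and \<open>weight_bound\<close>, convergence in the plain supremum norm follows at the
  cost of that factor.\<close>

lemma solution:
  shows "\<exists>X. S2_proc X \<and> picard_step X X \<and>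
    (\<forall>Y. S2_proc Y \<and> picard_step Y Y \<longrightarrow> (AE \<omega> in M. \<forall>s\<in>{t..T}. X s \<omega> = Y s \<omega>)) \<and>
    sup_sq_expectation M t T X \<le> ennreal (512 * weight_bound) * data"
proof -
  obtain \<Phi> where \<Phi>m[measurable]: "\<Phi> \<in> borel_measurable borel" and \<Phi>1: "\<And>r. 1 \<le> \<Phi> r" and \<Phi>W: "\<And>r. \<Phi> r \<le> weight_bound"
    and \<Phi>: "\<And>s. s \<in> {t..T} \<Longrightarrow> (\<integral>\<^sup>+r\<in>{t..s}. ennreal (rate r) * ennreal (\<Phi> r) \<partial>lborel) \<le> ennreal (\<Phi> s / 4)"
    using exists_weight[OF t(2) rate_meas rate_nonneg rate_integral] \<gamma>\<^sub>C unfolding weight_bound_def by auto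
  have W0: "0 \<le> weight_bound" unfolding weight_bound_def by simp
  have contraction: "sup_sq_expectation M t s (\<lambda>r \<omega>. Y r \<omega> - Y' r \<omega>) \<le> ennreal (d / 4 * \<Phi> s)"
    if X: "S2_proc X" "S2_proc X'" and Y: "picard_step X Y" "picard_step X' Y'" and d: "0 \<le> d"
      and IH: "\<And>r. r \<in> {t..T} \<Longrightarrow> sup_sq_expectation M t r (\<lambda>r \<omega>. X r \<omega> - X' r \<omega>) \<le> ennreal (d * \<Phi> r)"
      and s: "s \<in> {t..T}" for X X' Y Y' d s
  proof -
    have s': "t \<le> s" "s \<le> T" using s by auto
    have "sup_sq_expectation M t s (\<lambda>r \<omega>. Y r \<omega> - Y' r \<omega>) \<le> (\<integral>\<^sup>+r\<in>{t..s}. ennreal (rate r) * ennreal (d * \<Phi> r) \<partial>lborel)"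
    proof (rule picard_step_diff[OF X Y s', where Q = "d * weight_bound"])
      show "(\<lambda>r. ennreal (d * \<Phi> r)) \<in> borel_measurable borel" by simp
      show "ennreal (d * \<Phi> r) \<le> ennreal (d * weight_bound)" for r by (intro ennreal_leI mult_left_mono \<Phi>W d)
      fix r assume r: "r \<in> {t..s}"
      then have "r \<in> {t..r}" "r \<in> {t..T}" using s' by auto
      from order_trans[OF sup_sq_expectation_ge[OF this(1)] IH[OF this(2)]]
      show "(msq M (\<lambda>\<omega>. X r \<omega> - X' r \<omega>)) \<le> ennreal (d * \<Phi> r)" .
    qed
    also have "\<dots> = (\<integral>\<^sup>+r. ennreal d * (ennreal (rate r) * ennreal (\<Phi> r) * indicator {t..s} r) \<partial>lborel)"
      by (intro nn_integral_cong) (simp add: ennreal_mult'[OF d] mult_ac)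
    also have "\<dots> = ennreal d * (\<integral>\<^sup>+r\<in>{t..s}. ennreal (rate r) * ennreal (\<Phi> r) \<partial>lborel)" by (rule nn_integral_cmult) simp
    also have "\<dots> \<le> ennreal d * ennreal (\<Phi> s / 4)" by (intro mult_left_mono \<Phi>[OF s]) simp
    also have "\<dots> = ennreal (d / 4 * \<Phi> s)" using d by (simp add: ennreal_mult'[symmetric])
    finally show ?thesis .
  qed
  \<comment> \<open>The implication for the zero process survives the choice below, so that the
    chosen first iterate obeys the bound by the data.\<close>
  have step: "\<exists>Y. S2_proc Y \<and> picard_step X Y \<and> (X = (\<lambda>s \<omega>. 0) \<longrightarrow> sup_sq_expectation M t T Y \<le> 128 * data)"
    if X: "S2_proc X" for X
  proof (cases "X = (\<lambda>s \<omega>. 0)")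
    case True
    have "\<exists>Y. cont_proc t T Y \<and> picard_step X Y \<and> sup_sq_expectation M t T Y \<le>
       128 * data + 8 * (ennreal \<alpha>\<^sub>A * (\<integral>\<^sup>+r\<in>{t..T}. ennreal (a r) * 0 \<partial>lborel)) + 64 * (\<integral>\<^sup>+r\<in>{t..T}. ennreal ((c r)\<^sup>2) * 0 \<partial>lborel)"
      by (rule picard_step_exists(1)[OF X, where Q = 0]) (simp_all add: True)
    then obtain Y where Y: "cont_proc t T Y" "picard_step X Y" "sup_sq_expectation M t T Y \<le> 128 * data" by auto
    moreover have "128 * data < \<infinity>" using data_finite by (simp add: ennreal_mult_less_top)
    ultimately show ?thesis unfolding S2_proc_def by (blast intro: le_less_trans)
  next
    case False
    obtain Q where Q: "sup_sq_expectation M t T X = ennreal Q" using X unfolding S2_proc_def by (cases "sup_sq_expectation M t T X") auto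
    have qQ: "(\<lambda>_::real. ennreal Q) r \<le> ennreal Q" for r by simp
    have q: "(msq M (X r)) \<le> (\<lambda>_::real. ennreal Q) r" if "r \<in> {t..T}" for r
      using sup_sq_expectation_ge[OF that] Q by metis
    obtain Y where Y: "cont_proc t T Y" "picard_step X Y" and SY: "sup_sq_expectation M t T Y \<le>
       128 * data + 8 * (ennreal \<alpha>\<^sub>A * (\<integral>\<^sup>+r\<in>{t..T}. ennreal (a r) * ennreal Q \<partial>lborel)) + 64 * (\<integral>\<^sup>+r\<in>{t..T}. ennreal ((c r)\<^sup>2) * ennreal Q \<partial>lborel)"
      using picard_step_exists(1)[OF X qQ q] by blast
    have "\<dots> < \<infinity>"
      using picard_step_exists(2)[OF X qQ q] picard_step_exists(3)[OF X qQ q] data_finite by (simp add: ennreal_mult_less_top)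
    then show ?thesis using Y le_less_trans[OF SY] False unfolding S2_proc_def by blast
  qed
  have "\<forall>X. \<exists>Y. S2_proc X \<longrightarrow> S2_proc Y \<and> picard_step X Y \<and> (X = (\<lambda>s \<omega>. 0) \<longrightarrow> sup_sq_expectation M t T Y \<le> 128 * data)"
    using step by blast
  from choice[OF this] obtain P where P: "\<And>X. S2_proc X \<Longrightarrow> S2_proc (P X)" "\<And>X. S2_proc X \<Longrightarrow> picard_step X (P X)"
    and P0: "S2_proc (\<lambda>s \<omega>. 0) \<Longrightarrow> sup_sq_expectation M t T (P (\<lambda>s \<omega>. 0)) \<le> 128 * data" by blast
  have zero: "S2_proc (\<lambda>s \<omega>. 0)"
    unfolding S2_proc_def cont_proc_def progressive_def sup_sq_expectation_def using t by (simp add: split_beta)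
  define X where "X k = (P ^^ k) (\<lambda>s \<omega>. 0)" for k
  have X: "S2_proc (X k)" for k unfolding X_def by (induction k) (auto intro: zero P(1))
  have XS: "X (Suc k) = P (X k)" for k by (simp add: X_def)
  have XP: "picard_step (X k) (X (Suc k))" for k unfolding XS by (rule P(2)[OF X])
  obtain R where R: "data = ennreal R" "0 \<le> R" using data_finite by (cases data) auto
  have IH: "\<forall>s\<in>{t..T}. sup_sq_expectation M t s (\<lambda>r \<omega>. X (Suc k) r \<omega> - X k r \<omega>) \<le> ennreal (128 * R / 4 ^ k * \<Phi> s)" for k
  proof (induction k)
    case 0
    show ?case
    proof
      fix s assume s: "s \<in> {t..T}"
      have "sup_sq_expectation M t s (\<lambda>r \<omega>. X (Suc 0) r \<omega> - X 0 r \<omega>) \<le> sup_sq_expectation M t T (P (\<lambda>s \<omega>. 0))"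
        using sup_sq_expectation_mono[of s T M t "P (\<lambda>s \<omega>. 0)"] s by (simp add: X_def)
      also have "\<dots> \<le> 128 * data" by (rule P0[OF zero])
      also have "\<dots> = ennreal (128 * R * 1)" using R by (simp add: ennreal_mult)
      also have "\<dots> \<le> ennreal (128 * R * \<Phi> s)" using R \<Phi>1[of s] by (intro ennreal_leI mult_left_mono) auto
      finally show "sup_sq_expectation M t s (\<lambda>r \<omega>. X (Suc 0) r \<omega> - X 0 r \<omega>) \<le> ennreal (128 * R / 4 ^ 0 * \<Phi> s)" by simp
    qed
  next
    case (Suc k)
    show ?case
    proof
      fix s assume s: "s \<in> {t..T}"
      have "sup_sq_expectation M t s (\<lambda>r \<omega>. X (Suc (Suc k)) r \<omega> - X (Suc k) r \<omega>) \<le> ennreal (128 * R / 4 ^ k / 4 * \<Phi> s)"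
        by (rule contraction[OF X X XP XP _ _ s]) (use Suc R in auto)
      then show "sup_sq_expectation M t s (\<lambda>r \<omega>. X (Suc (Suc k)) r \<omega> - X (Suc k) r \<omega>) \<le> ennreal (128 * R / 4 ^ Suc k * \<Phi> s)"
        by (simp add: divide_divide_eq_left mult.commute)
    qed
  qed
  \<comment> \<open>128 times the data times the largest weight. The iteration starts at the zero
    process, so the limit itself is bounded by \<open>4 * c0\<close>.\<close>
  define c0 where "c0 = 128 * R * weight_bound"
  have c0: "0 \<le> c0" unfolding c0_def using R W0 by simp
  have TT: "T \<in> {t..T}" using t by simp
  have "sup_sq_expectation M t T (\<lambda>r \<omega>. X (Suc k) r \<omega> - X k r \<omega>) \<le> ennreal (c0 / 4 ^ k)" for k
  proof -
    have "128 * R / 4 ^ k * \<Phi> T \<le> 128 * R / 4 ^ k * weight_bound" using R by (intro mult_left_mono \<Phi>W) auto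
    then have "ennreal (128 * R / 4 ^ k * \<Phi> T) \<le> ennreal (c0 / 4 ^ k)" unfolding c0_def by (intro ennreal_leI) simp
    with IH[of k] TT show ?thesis by (meson order_trans)
  qed
  from cont_proc_complete[OF t(2) _ c0 this] X obtain Z where Zc: "cont_proc t T Z"
    and ZX: "\<And>k. sup_sq_expectation M t T (\<lambda>s \<omega>. Z s \<omega> - X k s \<omega>) \<le> ennreal (4 * c0 / 4 ^ k)" unfolding S2_proc_def by blast
  have ZS: "sup_sq_expectation M t T Z \<le> ennreal (4 * c0)" using ZX[of 0] by (simp add: X_def)
  then have Z: "S2_proc Z" using Zc unfolding S2_proc_def by (auto intro: le_less_trans)
  have bound: "sup_sq_expectation M t T Z \<le> ennreal (512 * weight_bound) * data"
    using ZS W0 R unfolding c0_def R(1) by (simp add: ennreal_mult[symmetric] mult_ac)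
  have PZ: "S2_proc (P Z)" "picard_step Z (P Z)" using P Z by auto
  \<comment> \<open>The limit is fixed up to indistinguishability: \<open>P Z\<close> and
    \<open>Z\<close> are both compared with iterate \<open>Suc k\<close>. The constant 10 is 2 * 1 +
    2 * 4, from one contraction and from the rate of convergence.\<close>
  have "sup_sq_expectation M t T (\<lambda>s \<omega>. P Z s \<omega> - Z s \<omega>) \<le> ennreal (10 * c0 * weight_bound / 4 ^ k)" for k
  proof -
    have XPc: "cont_proc t T (\<lambda>s \<omega>. P Z s \<omega> - X (Suc k) s \<omega>)" and XZc: "cont_proc t T (\<lambda>s \<omega>. X (Suc k) s \<omega> - Z s \<omega>)"
      using PZ(1) X[of "Suc k"] Zc unfolding S2_proc_def by (auto intro: cont_proc_diff)
    have W1: "1 \<le> weight_bound" using \<Phi>1[of t] \<Phi>W[of t] by simp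
    have "sup_sq_expectation M t T (\<lambda>s \<omega>. P Z s \<omega> - X (Suc k) s \<omega>) \<le> ennreal (4 * c0 / 4 ^ k / 4 * \<Phi> T)"
    proof (rule contraction[OF Z X PZ(2) XP _ _ TT])
      fix r assume r: "r \<in> {t..T}"
      have "sup_sq_expectation M t r (\<lambda>r \<omega>. Z r \<omega> - X k r \<omega>) \<le> ennreal (4 * c0 / 4 ^ k * 1)"
        using order_trans[OF sup_sq_expectation_mono ZX[of k]] r by auto
      also have "\<dots> \<le> ennreal (4 * c0 / 4 ^ k * \<Phi> r)" using c0 \<Phi>1 by (intro ennreal_leI mult_left_mono) auto
      finally show "sup_sq_expectation M t r (\<lambda>r \<omega>. Z r \<omega> - X k r \<omega>) \<le> ennreal (4 * c0 / 4 ^ k * \<Phi> r)" .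
    qed (use c0 in simp)
    also have "\<dots> \<le> ennreal (c0 * weight_bound / 4 ^ k)"
    proof (rule ennreal_leI)
      have "c0 / 4 ^ k * \<Phi> T \<le> c0 / 4 ^ k * weight_bound" using c0 by (intro mult_left_mono \<Phi>W) auto
      then show "4 * c0 / 4 ^ k / 4 * \<Phi> T \<le> c0 * weight_bound / 4 ^ k" by simp
    qed
    finally have 1: "sup_sq_expectation M t T (\<lambda>s \<omega>. P Z s \<omega> - X (Suc k) s \<omega>) \<le> ennreal (c0 * weight_bound / 4 ^ k)" .
    have "sup_sq_expectation M t T (\<lambda>s \<omega>. X (Suc k) s \<omega> - Z s \<omega>) = sup_sq_expectation M t T (\<lambda>s \<omega>. Z s \<omega> - X (Suc k) s \<omega>)"
      unfolding sup_sq_expectation_def by (simp add: norm_minus_commute)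
    also have "\<dots> \<le> ennreal (4 * c0 / 4 ^ Suc k)" by (rule ZX)
    also have "\<dots> \<le> ennreal (4 * c0 * weight_bound / 4 ^ k)"
    proof (rule ennreal_leI)
      have "4 * c0 / 4 ^ Suc k \<le> 4 * c0 / 4 ^ k * 1" using c0 by (simp add: field_simps)
      also have "\<dots> \<le> 4 * c0 / 4 ^ k * weight_bound" using c0 W1 by (intro mult_left_mono) auto
      finally show "4 * c0 / 4 ^ Suc k \<le> 4 * c0 * weight_bound / 4 ^ k" by simp
    qed
    finally have 2: "sup_sq_expectation M t T (\<lambda>s \<omega>. X (Suc k) s \<omega> - Z s \<omega>) \<le> ennreal (4 * c0 * weight_bound / 4 ^ k)" .
    have "sup_sq_expectation M t T (\<lambda>s \<omega>. (P Z s \<omega> - X (Suc k) s \<omega>) + (X (Suc k) s \<omega> - Z s \<omega>))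
      \<le> 2 * ennreal (c0 * weight_bound / 4 ^ k) + 2 * ennreal (4 * c0 * weight_bound / 4 ^ k)"
      by (intro order_trans[OF sup_sq_expectation_add_le[OF XPc XZc t(2)]] add_mono mult_left_mono 1 2) auto
    also have "\<dots> = ennreal (2 * (c0 * weight_bound / 4 ^ k) + 2 * (4 * c0 * weight_bound / 4 ^ k))"
    proof -
      have "2 * ennreal v = ennreal (2 * v)" for v by (simp add: ennreal_mult')
      then show ?thesis using c0 W0 by (subst ennreal_plus) auto
    qed
    also have "2 * (c0 * weight_bound / 4 ^ k) + 2 * (4 * c0 * weight_bound / 4 ^ k) = 10 * c0 * weight_bound / 4 ^ k" by simp
    finally show ?thesis by simp
  qed
  then have "sup_sq_expectation M t T (\<lambda>s \<omega>. P Z s \<omega> - Z s \<omega>) = 0"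
    by (rule ennreal_tendsto_0_unique) (use c0 W0 in \<open>auto intro!: ennreal_geometric_tendsto_0\<close>)
  from sup_sq_expectation_0_imp[OF cont_proc_diff t(2) this] PZ(1) Zc
  have eq: "AE \<omega> in M. \<forall>s\<in>{t..T}. P Z s \<omega> - Z s \<omega> = 0" unfolding S2_proc_def by blast
  have ZZ: "picard_step Z Z"
  proof -
    obtain f g I where co: "coefficients Z f g" and I: "ito_integral_process M F W t T g I"
      and Y: "AE \<omega> in M. \<forall>s\<in>{t..T}. P Z s \<omega> = x \<omega> + (LINT r:{t..s}|lborel. f r \<omega>) + I s \<omega>"
      using PZ(2) unfolding picard_step_def by blast
    have "AE \<omega> in M. \<forall>s\<in>{t..T}. Z s \<omega> = x \<omega> + (LINT r:{t..s}|lborel. f r \<omega>) + I s \<omega>"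
      using Y eq by eventually_elim simp
    then show ?thesis using co I unfolding picard_step_def by blast
  qed
  have uniq: "AE \<omega> in M. \<forall>s\<in>{t..T}. Z s \<omega> = Y s \<omega>" if Y: "S2_proc Y" "picard_step Y Y" for Y
  proof -
    obtain d where d: "sup_sq_expectation M t T (\<lambda>s \<omega>. Z s \<omega> - Y s \<omega>) = ennreal d" "0 \<le> d"
      using S2_diff[OF Z Y(1)] by (cases "sup_sq_expectation M t T (\<lambda>s \<omega>. Z s \<omega> - Y s \<omega>)") auto
    \<comment> \<open>Both processes are fixed points, so the contraction can be applied to their
      difference any number of times.\<close>
    have "\<forall>s\<in>{t..T}. sup_sq_expectation M t s (\<lambda>s \<omega>. Z s \<omega> - Y s \<omega>) \<le> ennreal (d / 4 ^ k * \<Phi> s)" for k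
    proof (induction k)
      case 0
      show ?case
      proof
        fix s assume s: "s \<in> {t..T}"
        have "sup_sq_expectation M t s (\<lambda>s \<omega>. Z s \<omega> - Y s \<omega>) \<le> ennreal (d * 1)"
          using sup_sq_expectation_mono[of s T M t "\<lambda>s \<omega>. Z s \<omega> - Y s \<omega>"] s d by simp
        also have "\<dots> \<le> ennreal (d * \<Phi> s)" using d \<Phi>1 by (intro ennreal_leI mult_left_mono) auto
        finally show "sup_sq_expectation M t s (\<lambda>s \<omega>. Z s \<omega> - Y s \<omega>) \<le> ennreal (d / 4 ^ 0 * \<Phi> s)" by simp
      qed
    next
      case (Suc k)
      show ?case
      proof
        fix s assume s: "s \<in> {t..T}"
        have "sup_sq_expectation M t s (\<lambda>s \<omega>. Z s \<omega> - Y s \<omega>) \<le> ennreal (d / 4 ^ k / 4 * \<Phi> s)"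
          by (rule contraction[OF Z Y(1) ZZ Y(2) _ _ s]) (use Suc d in auto)
        then show "sup_sq_expectation M t s (\<lambda>s \<omega>. Z s \<omega> - Y s \<omega>) \<le> ennreal (d / 4 ^ Suc k * \<Phi> s)"
          by (simp add: divide_divide_eq_left mult.commute)
      qed
    qed
    then have "sup_sq_expectation M t T (\<lambda>s \<omega>. Z s \<omega> - Y s \<omega>) \<le> ennreal (d / 4 ^ k * \<Phi> T)" for k using TT by blast
    then have "sup_sq_expectation M t T (\<lambda>s \<omega>. Z s \<omega> - Y s \<omega>) \<le> ennreal (d * \<Phi> T / 4 ^ k)" for k by simp
    then have "sup_sq_expectation M t T (\<lambda>s \<omega>. Z s \<omega> - Y s \<omega>) = 0"
      by (rule ennreal_tendsto_0_unique) (use d \<Phi>1[of T] in \<open>auto intro!: ennreal_geometric_tendsto_0\<close>)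
    from sup_sq_expectation_0_imp[OF cont_proc_diff t(2) this] Zc Y(1)
    have "AE \<omega> in M. \<forall>s\<in>{t..T}. Z s \<omega> - Y s \<omega> = 0" unfolding S2_proc_def by blast
    then show ?thesis by simp
  qed
  show ?thesis using Z ZZ uniq bound by blast
qed

end

section \<open>Energies expressed by the norms of the theorem\<close>

context brownian
begin

text \<open>Where the mean square is infinite, \<open>norm2\<close> and \<open>enn2real\<close> both
  return 0, so the integrands agree at every \<open>r\<close>. Finite energy makes such times
  negligible, and nothing is lost in passing from \<open>ennreal\<close> to real integrals.\<close>

lemma proc_energy_eq_LINT:
  fixes \<phi> :: "real \<Rightarrow> 'a \<Rightarrow> 'b::euclidean_space"
  assumes tT: "t \<le> T" and p: "progressive F t T \<phi>" and e: "proc_energy M t T \<phi> < \<infinity>"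
  shows "proc_energy M t T \<phi> = ennreal (LINT r:{t..T}|lborel. (norm2 M (\<phi> r))\<^sup>2)"
proof -
  define N where "N r = (\<integral>\<^sup>+\<omega>. ennreal ((norm (\<phi> r \<omega>))\<^sup>2) * indicator {t..T} r \<partial>M)" for r
  have Nm: "N \<in> borel_measurable lborel"
    using borel_measurable_nn_integral[OF progressive_nn_joint[OF p tT order_refl, of "\<lambda>x. ennreal ((norm x)\<^sup>2)" "\<lambda>_. 1"]]
    unfolding N_def by simp
  have Nint: "(\<integral>\<^sup>+r. N r \<partial>lborel) = proc_energy M t T \<phi>"
    unfolding proc_energy_def N_def
    using pair_sigma_finite.Fubini'[OF sigma_finite_lborel_M progressive_nn_joint[OF p tT order_refl, of "\<lambda>x. ennreal ((norm x)\<^sup>2)" "\<lambda>_. 1"]]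
    by simp
  have eq: "indicat_real {t..T} r *\<^sub>R (norm2 M (\<phi> r))\<^sup>2 = enn2real (N r)" for r
  proof (cases "r \<in> {t..T}")
    case True
    have "(\<lambda>\<omega>. (norm (\<phi> r \<omega>))\<^sup>2) \<in> borel_measurable M" using measurable_F[OF progressive_section[OF p True]] by simp
    then have "(\<integral>\<omega>. (norm (\<phi> r \<omega>))\<^sup>2 \<partial>M) = enn2real (msq M (\<phi> r))"
      by (rule integral_eq_nn_integral) simp
    then show ?thesis using True unfolding norm2_def N_def by simp
  qed (simp add: N_def)
  have AEfin: "AE r in lborel. N r \<noteq> \<infinity>" by (rule nn_integral_noteq_infinite[OF Nm]) (use Nint e in simp)
  have "(LINT r:{t..T}|lborel. (norm2 M (\<phi> r))\<^sup>2) = (\<integral>r. enn2real (N r) \<partial>lborel)"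
    unfolding set_lebesgue_integral_def eq ..
  also have "\<dots> = enn2real (\<integral>\<^sup>+r. ennreal (enn2real (N r)) \<partial>lborel)"
    using Nm by (intro integral_eq_nn_integral) auto
  also have "(\<integral>\<^sup>+r. ennreal (enn2real (N r)) \<partial>lborel) = (\<integral>\<^sup>+r. N r \<partial>lborel)"
    using AEfin by (intro nn_integral_cong_AE) (auto elim!: eventually_mono simp: less_top)
  finally have "(LINT r:{t..T}|lborel. (norm2 M (\<phi> r))\<^sup>2) = enn2real (proc_energy M t T \<phi>)" unfolding Nint .
  then show ?thesis using e by (simp add: less_top)
qed

text \<open>A path with infinite integral has Bochner integral 0, the value of
  \<open>enn2real\<close> at infinity. Such outcomes form a null set when the energy is finite, so
  both conversions to reals are faithful.\<close>

lemma L1_energy_eq_norm2: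
  fixes \<phi> :: "real \<Rightarrow> 'a \<Rightarrow> 'b::euclidean_space"
  assumes tT: "t \<le> T" and p: "progressive F t T \<phi>" and e: "L1_energy M t T \<phi> < \<infinity>"
  shows "L1_energy M t T \<phi> = ennreal ((norm2 M (\<lambda>\<omega>. LINT r:{t..T}|lborel. norm (\<phi> r \<omega>)))\<^sup>2)"
proof -
  define V where "V \<omega> = (\<integral>\<^sup>+r\<in>{t..T}. ennreal (norm (\<phi> r \<omega>)) \<partial>lborel)" for \<omega>
  have Vm[measurable]: "V \<in> borel_measurable M" unfolding V_def by (rule L1_integral_measurable[OF p tT order_refl])
  have VL: "(LINT r:{t..T}|lborel. norm (\<phi> r \<omega>)) = enn2real (V \<omega>)" if \<omega>: "\<omega> \<in> space M" for \<omega>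
  proof -
    have "(\<lambda>r. indicator {t..T} r *\<^sub>R \<phi> r \<omega>) \<in> borel_measurable lborel"
      using measurable_compose[OF measurable_Pair2'[OF \<omega>] progressive_joint_M[OF p tT]] by simp
    then have "(\<lambda>r. norm (indicat_real {t..T} r *\<^sub>R \<phi> r \<omega>)) \<in> borel_measurable lborel" by measurable
    then have "(\<lambda>r. indicat_real {t..T} r *\<^sub>R norm (\<phi> r \<omega>)) \<in> borel_measurable lborel" by simp
    then have "(LINT r:{t..T}|lborel. norm (\<phi> r \<omega>)) = enn2real (\<integral>\<^sup>+r. ennreal (indicat_real {t..T} r *\<^sub>R norm (\<phi> r \<omega>)) \<partial>lborel)"
      unfolding set_lebesgue_integral_def by (rule integral_eq_nn_integral) simp
    also have "(\<integral>\<^sup>+r. ennreal (indicat_real {t..T} r *\<^sub>R norm (\<phi> r \<omega>)) \<partial>lborel) = V \<omega>"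
      unfolding V_def by (intro nn_integral_cong) (auto simp: indicator_def)
    finally show ?thesis .
  qed
  have VE: "(\<integral>\<^sup>+\<omega>. (V \<omega>)\<^sup>2 \<partial>M) = L1_energy M t T \<phi>" unfolding V_def L1_energy_def ..
  have AEfin: "AE \<omega> in M. (V \<omega>)\<^sup>2 \<noteq> \<infinity>" by (rule nn_integral_noteq_infinite) (use VE e in auto)
  have "(norm2 M (\<lambda>\<omega>. LINT r:{t..T}|lborel. norm (\<phi> r \<omega>)))\<^sup>2 = (\<integral>\<omega>. (enn2real (V \<omega>))\<^sup>2 \<partial>M)"
    unfolding norm2_def by (simp add: VL cong: Bochner_Integration.integral_cong)
  also have "\<dots> = enn2real (\<integral>\<^sup>+\<omega>. ennreal ((enn2real (V \<omega>))\<^sup>2) \<partial>M)"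
    by (intro integral_eq_nn_integral) auto
  also have "(\<integral>\<^sup>+\<omega>. ennreal ((enn2real (V \<omega>))\<^sup>2) \<partial>M) = (\<integral>\<^sup>+\<omega>. (V \<omega>)\<^sup>2 \<partial>M)"
  proof (rule nn_integral_cong_AE)
    show "AE \<omega> in M. ennreal ((enn2real (V \<omega>))\<^sup>2) = (V \<omega>)\<^sup>2"
      using AEfin
    proof eventually_elim
      case (elim \<omega>)
      then obtain v where "V \<omega> = ennreal v" "0 \<le> v" by (cases "V \<omega>") (auto simp: power2_eq_square)
      then show ?case by (simp add: ennreal_power)
    qed
  qed
  finally show ?thesis unfolding VE using e by (simp add: less_top)
qed

end

theorem proposition2p2:
  shows "\<exists>K :: real \<Rightarrow> real \<Rightarrow> real. (\<forall>\<alpha> \<gamma>. 0 < K \<alpha> \<gamma>) \<and>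
    (\<forall>(M :: 'a measure) F W (T :: real)
      (\<A> :: real \<Rightarrow> ('a \<Rightarrow> real^'n) \<Rightarrow> 'a \<Rightarrow> real^'n)
      (\<B> :: real \<Rightarrow> ('a \<Rightarrow> real^'m) \<Rightarrow> 'a \<Rightarrow> real^'n)
      (\<C> :: real \<Rightarrow> ('a \<Rightarrow> real^'n) \<Rightarrow> 'a \<Rightarrow> real^'n)
      (\<D> :: real \<Rightarrow> ('a \<Rightarrow> real^'m) \<Rightarrow> 'a \<Rightarrow> real^'n)
      (b :: real \<Rightarrow> 'a \<Rightarrow> real^'n) (\<sigma> :: real \<Rightarrow> 'a \<Rightarrow> real^'n).
      brownian_setting M F W \<and> 0 < T \<and>
      \<A> \<in> op_Lp M F T 1 \<and> \<B> \<in> op_Lp M F T 2 \<and> \<C> \<in> op_Lp M F T 2 \<and> \<D> \<in> op_Linf M F T \<and>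
      b \<in> L2_L1_proc M F 0 T \<and> \<sigma> \<in> L2_proc M F 0 T \<longrightarrow>
      (\<forall>t\<in>{0..T}. \<forall>x\<in>L2 M (F t). \<forall>u\<in>L2_proc M F t T.
        \<exists>X. sde_solution M F W T \<A> \<B> \<C> \<D> b \<sigma> t x u X \<and>
          (\<forall>Y. sde_solution M F W T \<A> \<B> \<C> \<D> b \<sigma> t x u Y \<longrightarrow> indistinguishable_on M {t..T} X Y) \<and>
          sup_sq_expectation M t T X
            \<le> ennreal (K (op_norm_p M F T 1 \<A>) (op_norm_p M F T 2 \<C>) *
                ((norm2 M x)\<^sup>2
                 + ((op_norm_p M F T 2 \<B>)\<^sup>2 + (op_norm_inf M F T \<D>)\<^sup>2)
                     * (LINT r:{t..T}|lborel. (norm2 M (u r))\<^sup>2)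
                 + (norm2 M (\<lambda>\<omega>. LINT r:{t..T}|lborel. norm (b r \<omega>)))\<^sup>2
                 + (LINT r:{t..T}|lborel. (norm2 M (\<sigma> r))\<^sup>2)))))"
proof (intro exI[of _ "\<lambda>\<alpha> \<gamma>. 512 * 2 powr (8 * (2 * \<alpha>\<^sup>2 + 32 * \<gamma>\<^sup>2))"] conjI allI impI ballI)
  fix \<alpha> \<gamma> :: real show "0 < 512 * 2 powr (8 * (2 * \<alpha>\<^sup>2 + 32 * \<gamma>\<^sup>2))" by simp
next
  fix M :: "'a measure" and F W and T :: real
    and \<A> \<C> :: "real \<Rightarrow> ('a \<Rightarrow> real^'n) \<Rightarrow> 'a \<Rightarrow> real^'n" and \<B> \<D> :: "real \<Rightarrow> ('a \<Rightarrow> real^'m) \<Rightarrow> 'a \<Rightarrow> real^'n"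
    and b \<sigma> :: "real \<Rightarrow> 'a \<Rightarrow> real^'n" and t :: real and x :: "'a \<Rightarrow> real^'n" and u :: "real \<Rightarrow> 'a \<Rightarrow> real^'m"
  assume asm: "brownian_setting M F W \<and> 0 < T \<and>
      \<A> \<in> op_Lp M F T 1 \<and> \<B> \<in> op_Lp M F T 2 \<and> \<C> \<in> op_Lp M F T 2 \<and> \<D> \<in> op_Linf M F T \<and>
      b \<in> L2_L1_proc M F 0 T \<and> \<sigma> \<in> L2_proc M F 0 T"
    and t: "t \<in> {0..T}" and x: "x \<in> L2 M (F t)" and u: "u \<in> L2_proc M F t T"
  interpret brownian M W F
    using asm unfolding brownian_setting_def by (intro brownian.intro brownian_axioms.intro) auto
  have T0: "0 < T" and b: "b \<in> L2_L1_proc M F 0 T" and \<sigma>: "\<sigma> \<in> L2_proc M F 0 T" using asm by auto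
  have sq: "(a::real) powr 2 = a\<^sup>2" if "0 \<le> a" for a using that by simp
  have np: "0 \<le> op_norm_p M F T p L" for p and L :: "real \<Rightarrow> ('a \<Rightarrow> 'p::euclidean_space) \<Rightarrow> 'a \<Rightarrow> 'q::euclidean_space"
    unfolding op_norm_p_def by simp
  obtain a where a: "op_bound T \<A> a" "(\<integral>\<^sup>+s\<in>{0..T}. ennreal (a s powr 1) \<partial>lborel) = ennreal (op_norm_p M F T 1 \<A> powr 1)"
    using op_Lp_bound[of \<A> T 1] asm by auto
  obtain \<beta> where \<beta>: "op_bound T \<B> \<beta>" "(\<integral>\<^sup>+s\<in>{0..T}. ennreal (\<beta> s powr 2) \<partial>lborel) = ennreal (op_norm_p M F T 2 \<B> powr 2)"
    using op_Lp_bound[of \<B> T 2] asm by auto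
  obtain c where c: "op_bound T \<C> c" "(\<integral>\<^sup>+s\<in>{0..T}. ennreal (c s powr 2) \<partial>lborel) = ennreal (op_norm_p M F T 2 \<C> powr 2)"
    using op_Lp_bound[of \<C> T 2] asm by auto
  have D: "op_bound T \<D> (\<lambda>_. op_norm_inf M F T \<D>)" using op_Linf_bound[of \<D> T] asm by auto
  have nonneg: "0 \<le> a s" "0 \<le> \<beta> s" "0 \<le> c s" for s using a(1) \<beta>(1) c(1) unfolding op_bound_def by auto
  \<comment> \<open>For exponent 2 the integrals of the squared majorants equal the squares of the
    norms; for exponent 1 the integral is the norm itself. This is why the choice of
    \<open>K\<close> has squares on both arguments.\<close>
  interpret L: linear_sde M W F t T \<A> \<C> \<B> \<D> b \<sigma> x u a \<beta> c "op_norm_p M F T 1 \<A>" "(op_norm_p M F T 2 \<B>)\<^sup>2"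
    "(op_norm_p M F T 2 \<C>)\<^sup>2" "op_norm_inf M F T \<D>"
  proof unfold_locales
    show "(\<integral>\<^sup>+s\<in>{0..T}. ennreal (a s) \<partial>lborel) \<le> ennreal (op_norm_p M F T 1 \<A>)"
      using a(2) by (simp add: nonneg np)
    show "(\<integral>\<^sup>+s\<in>{0..T}. ennreal ((\<beta> s)\<^sup>2) \<partial>lborel) \<le> ennreal ((op_norm_p M F T 2 \<B>)\<^sup>2)"
      using \<beta>(2) by (simp add: sq nonneg np)
    show "(\<integral>\<^sup>+s\<in>{0..T}. ennreal ((c s)\<^sup>2) \<partial>lborel) \<le> ennreal ((op_norm_p M F T 2 \<C>)\<^sup>2)"
      using c(2) by (simp add: sq nonneg np)
  qed (use t a(1) \<beta>(1) c(1) D b \<sigma> x u np in auto)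
  \<comment> \<open>Solutions are the fixed points of the Picard relation in the given space, so
    existence, uniqueness and the bound all come from \<open>L.solution\<close>.\<close>
  have sol: "sde_solution M F W T \<A> \<B> \<C> \<D> b \<sigma> t x u X \<longleftrightarrow> L.S2_proc X \<and> L.picard_step X X" for X
    unfolding sde_solution_def L.picard_step_def L.coefficients_def L.S2_proc_def L2_C_proc_def cont_proc_def by blast
  have tT: "t \<le> T" "0 \<le> t" using t by auto
  have up: "progressive F t T u" "proc_energy M t T u < \<infinity>" using u unfolding L2_proc_def proc_energy_def by auto
  have bp: "progressive F t T b" "L1_energy M t T b < \<infinity>"
    using b progressive_subinterval[OF _ tT(2) order_refl] le_less_trans[OF L1_energy_subset[OF tT(2) order_refl, of M T b]]
    unfolding L2_L1_proc_def L1_energy_def by auto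
  have \<sigma>p: "progressive F t T \<sigma>" "proc_energy M t T \<sigma> < \<infinity>"
    using \<sigma> progressive_subinterval[OF _ tT(2) order_refl] le_less_trans[OF proc_energy_subset[OF tT(2) order_refl, of M T \<sigma>]]
    unfolding L2_proc_def proc_energy_def by auto
  have LINT0: "0 \<le> (LINT r:{t..T}|lborel. (norm2 M (v r))\<^sup>2)" for v :: "real \<Rightarrow> 'a \<Rightarrow> 'q::euclidean_space"
    unfolding set_lebesgue_integral_def by (intro integral_nonneg_AE) auto
  \<comment> \<open>Nonnegativity of the real integrals allows sums and products to move out of
    \<open>ennreal\<close>.\<close>
  have data: "L.data = ennreal ((norm2 M x)\<^sup>2
                 + ((op_norm_p M F T 2 \<B>)\<^sup>2 + (op_norm_inf M F T \<D>)\<^sup>2)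
                     * (LINT r:{t..T}|lborel. (norm2 M (u r))\<^sup>2)
                 + (norm2 M (\<lambda>\<omega>. LINT r:{t..T}|lborel. norm (b r \<omega>)))\<^sup>2
                 + (LINT r:{t..T}|lborel. (norm2 M (\<sigma> r))\<^sup>2))"
    unfolding L.data_def L2_msq[OF x] proc_energy_eq_LINT[OF tT(1) up] proc_energy_eq_LINT[OF tT(1) \<sigma>p] L1_energy_eq_norm2[OF tT(1) bp]
    using LINT0[of u] LINT0[of \<sigma>] by (simp add: ennreal_plus ennreal_mult)
  obtain X where X: "L.S2_proc X" "L.picard_step X X"
    and uniq: "\<And>Y. L.S2_proc Y \<Longrightarrow> L.picard_step Y Y \<Longrightarrow> AE \<omega> in M. \<forall>s\<in>{t..T}. X s \<omega> = Y s \<omega>"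
    and bound: "sup_sq_expectation M t T X \<le> ennreal (512 * L.weight_bound) * L.data"
    using L.solution by blast
  let ?K = "512 * 2 powr (8 * (2 * (op_norm_p M F T 1 \<A>)\<^sup>2 + 32 * (op_norm_p M F T 2 \<C>)\<^sup>2))"
  show "\<exists>X. sde_solution M F W T \<A> \<B> \<C> \<D> b \<sigma> t x u X \<and>
          (\<forall>Y. sde_solution M F W T \<A> \<B> \<C> \<D> b \<sigma> t x u Y \<longrightarrow> indistinguishable_on M {t..T} X Y) \<and>
          sup_sq_expectation M t T X
            \<le> ennreal (?K *
                ((norm2 M x)\<^sup>2
                 + ((op_norm_p M F T 2 \<B>)\<^sup>2 + (op_norm_inf M F T \<D>)\<^sup>2)
                     * (LINT r:{t..T}|lborel. (norm2 M (u r))\<^sup>2)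
                 + (norm2 M (\<lambda>\<omega>. LINT r:{t..T}|lborel. norm (b r \<omega>)))\<^sup>2
                 + (LINT r:{t..T}|lborel. (norm2 M (\<sigma> r))\<^sup>2)))"
  proof (intro exI[of _ X] conjI allI impI)
    show "sde_solution M F W T \<A> \<B> \<C> \<D> b \<sigma> t x u X" using X sol by blast
    show "indistinguishable_on M {t..T} X Y" if "sde_solution M F W T \<A> \<B> \<C> \<D> b \<sigma> t x u Y" for Y
      using uniq[of Y] that sol unfolding indistinguishable_on_def by blast
    show "sup_sq_expectation M t T X
            \<le> ennreal (?K *
                ((norm2 M x)\<^sup>2
                 + ((op_norm_p M F T 2 \<B>)\<^sup>2 + (op_norm_inf M F T \<D>)\<^sup>2)
                     * (LINT r:{t..T}|lborel. (norm2 M (u r))\<^sup>2)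
                 + (norm2 M (\<lambda>\<omega>. LINT r:{t..T}|lborel. norm (b r \<omega>)))\<^sup>2
                 + (LINT r:{t..T}|lborel. (norm2 M (\<sigma> r))\<^sup>2)))"
      using bound unfolding data L.weight_bound_def by (simp only: ennreal_mult'[symmetric] zero_le_mult_iff powr_ge_zero zero_le_numeral simp_thms)
  qed
qed

end
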